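(* Let $\rho=\rho_{AC_A}$ and $\tilde\rho=\tilde\rho_{C_BB}$ be PPT states (density operators with positive partial transpose). Then $$K_{A\leftrightarrow C\leftrightarrow B}(\rho\otimes\tilde\rho)\le\min\{K_D(\rho^\Gamma),K_D(\tilde\rho^\Gamma)\}\le\min\{E_R^\infty(\rho^\Gamma),E_R^\infty(\tilde\rho^\Gamma),E_{sq}(\rho^\Gamma),E_{sq}(\tilde\rho^\Gamma)\},$$ where $\Gamma$ denotes the partial transpose with respect to Charlie's subsystem ($C_A$, respectively $C_B$).
   Context: All systems are finite-dimensional; $\log$ is base 2. Charlie holds $C=C_AC_B$. $\alpha\approx_\epsilon\beta$ means $\|\alpha-\beta\|_1\le\epsilon$. Private states: an $m$-bit private state $\gamma_m$ is a bipartite state (cut $AA':BB'$), with key systems $A,B$ of dimension $2^m$ and shield systems $A',B'$ of arbitrary finite dimension, of the form $\gamma_m=2^{-m}\sum_{i,j=0}^{2^m-1}|ii\rangle\langle jj|_{AB}\otimes U_i\,\sigma_{A'B'}\,U_j^\dagger$ with $\sigma_{A'B'}$ a state and $U_i$ unitaries on $A'B'$. Quantum key repeater rate: $$K_{A\leftrightarrow C\leftrightarrow B}(\rho\otimes\tilde\rho)=\inf_{\epsilon>0}\limsup_{n\to\infty}\sup_{\Lambda_n,\gamma_m}\Big\{\tfrac mn:\ \mathrm{Tr}_C\Lambda_n\big((\rho_{AC_A}\otimes\tilde\rho_{C_BB})^{\otimes n}\big)\approx_\epsilon\gamma_m\Big\},$$ with $\Lambda_n$ ranging over tripartite LOCC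 protocols among Alice, Bob, Charlie and $\gamma_m$ over $m$-bit private states between Alice and Bob. Distillable key of a bipartite state: $K_D(\rho)=\inf_{\epsilon>0}\limsup_{n\to\infty}\sup_{\Lambda_n\,\mathrm{LOCC},\,\gamma_m}\{\frac mn:\Lambda_n(\rho^{\otimes n})\approx_\epsilon\gamma_m\}$. Relative entropy of entanglement: $E_R(\rho)=\inf_{\sigma\text{ separable}}D(\rho\|\sigma)$, with regularisation $E_R^\infty(\rho)=\lim_n\frac1nE_R(\rho^{\otimes n})$. Squashed entanglement: $E_{sq}(\rho_{AB})=\inf_{\rho_{ABE}}\frac12I(A:B|E)_{\rho_{ABE}}$, the infimum over all extensions $\rho_{ABE}$ of $\rho_{AB}$, where $I(A:B|E)$ is the quantum conditional mutual information. *)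

theory Defs
  imports Complex_Main "HOL-Library.Extended_Real" "Jordan_Normal_Form.Schur_Decomposition"
begin

section \<open>Matrices\<close>

definition mat_trace :: "complex mat \<Rightarrow> complex" where
  "mat_trace A = (\<Sum>i<dim_row A. A $$ (i, i))"

text \<open>Jordan_Normal_Form matrices of a common size do not form a type, so \<open>sum\<close> does not
  apply to them; \<open>mat_sum n f I\<close> is the sum of a family of \<open>n \<times> n\<close> matrices.\<close>

definition mat_sum :: "nat \<Rightarrow> ('i \<Rightarrow> complex mat) \<Rightarrow> 'i set \<Rightarrow> complex mat" where
  "mat_sum n f I = mat n n (\<lambda>ij. \<Sum>k\<in>I. f k $$ ij)"

definition kron :: "complex mat \<Rightarrow> complex mat \<Rightarrow> complex mat" where
  "kron A B = mat (dim_row A * dim_row B) (dim_col A * dim_col B)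
     (\<lambda>(i, j). A $$ (i div dim_row B, j div dim_col B) * B $$ (i mod dim_row B, j mod dim_col B))"

definition matrix_unit :: "nat \<Rightarrow> nat \<Rightarrow> nat \<Rightarrow> complex mat" where
  "matrix_unit n k l = mat n n (\<lambda>(i, j). if i = k \<and> j = l then 1 else 0)"

definition unitary :: "nat \<Rightarrow> complex mat \<Rightarrow> bool" where
  "unitary n U \<longleftrightarrow> U \<in> carrier_mat n n \<and> mat_adjoint U * U = 1\<^sub>m n \<and> U * mat_adjoint U = 1\<^sub>m n"

text \<open>The order on complex numbers makes \<open>0 \<le> z\<close> include that \<open>z\<close> is real; hence a
  positive semidefinite matrix is Hermitian.\<close>

definition psd :: "nat \<Rightarrow> complex mat \<Rightarrow> bool" where
  "psd n A \<longleftrightarrow> A \<in> carrier_mat n n \<and> (\<forall>v\<in>carrier_vec n. 0 \<le> (A *\<^sub>v v) \<bullet>c v)"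

definition density :: "nat \<Rightarrow> complex mat \<Rightarrow> bool" where
  "density n \<rho> \<longleftrightarrow> psd n \<rho> \<and> mat_trace \<rho> = 1"

text \<open>Functional calculus for Hermitian matrices. By the spectral theorem such a \<open>B\<close> exists,
  and it does not depend on the diagonalisation.\<close>

definition mat_fun :: "(real \<Rightarrow> real) \<Rightarrow> complex mat \<Rightarrow> complex mat" where
  "mat_fun f A = (THE B. \<exists>U d. unitary (dim_row A) U \<and>
     A = U * mat_diag (dim_row A) (\<lambda>i. complex_of_real (d i)) * mat_adjoint U \<and>
     B = U * mat_diag (dim_row A) (\<lambda>i. complex_of_real (f (d i))) * mat_adjoint U)"

definition trace_norm :: "complex mat \<Rightarrow> real" where
  "trace_norm X = Re (mat_trace (mat_fun sqrt (mat_adjoint X * X)))"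


section \<open>Composite systems\<close>

text \<open>A composite system is described by the list \<open>ds\<close> of the dimensions of its parties. Its
  operators are matrices of size \<open>prod_list ds\<close>, whose indices are mixed-radix numbers with the
  most significant digit first. This is the convention of \<open>kron\<close>, so merging adjacent parties
  (replacing \<open>[a, b, c]\<close> by \<open>[a, b * c]\<close>, say) leaves the matrix unchanged.\<close>

fun encode :: "nat list \<Rightarrow> nat list \<Rightarrow> nat" where
  "encode (d # ds) (x # xs) = x * prod_list ds + encode ds xs"
| "encode _ _ = 0"

fun decode :: "nat list \<Rightarrow> nat \<Rightarrow> nat list" where
  "decode [] i = []"
| "decode (d # ds) i = (i div prod_list ds) # decode ds (i mod prod_list ds)"

text \<open>Trace over party \<open>p\<close> (counted from 0).\<close>

definition ptrace :: "nat list \<Rightarrow> nat \<Rightarrow> complex mat \<Rightarrow> complex mat" where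
  "ptrace ds p X =
     (let es = take p ds @ drop (Suc p) ds;
          ins = (\<lambda>i k. encode ds (take p (decode es i) @ k # drop p (decode es i)))
      in mat (prod_list es) (prod_list es) (\<lambda>(i, j). \<Sum>k<ds ! p. X $$ (ins i k, ins j k)))"

text \<open>Transposition of party \<open>p\<close>.\<close>

definition ptranspose :: "nat list \<Rightarrow> nat \<Rightarrow> complex mat \<Rightarrow> complex mat" where
  "ptranspose ds p X = mat (prod_list ds) (prod_list ds)
     (\<lambda>(i, j). X $$ (encode ds ((decode ds i)[p := decode ds j ! p]),
                     encode ds ((decode ds j)[p := decode ds i ! p])))"

text \<open>Tensor product of \<open>X\<close> on \<open>ds\<close> and \<open>Y\<close> on \<open>es\<close> (the same parties), regrouped so that
  party \<open>p\<close> holds \<open>ds ! p\<close> followed by \<open>es ! p\<close>.\<close>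

definition party_tensor ::
    "nat list \<Rightarrow> nat list \<Rightarrow> complex mat \<Rightarrow> complex mat \<Rightarrow> complex mat" where
  "party_tensor ds es X Y =
     (let fs = map2 (*) ds es;
          l = (\<lambda>i. encode ds (map2 (div) (decode fs i) es));
          r = (\<lambda>i. encode es (map2 (mod) (decode fs i) es))
      in mat (prod_list fs) (prod_list fs) (\<lambda>(i, j). X $$ (l i, l j) * Y $$ (r i, r j)))"

fun party_power :: "nat list \<Rightarrow> complex mat \<Rightarrow> nat \<Rightarrow> complex mat" where
  "party_power ds X 0 = 1\<^sub>m 1"
| "party_power ds X (Suc n) = party_tensor ds (map (\<lambda>d. d ^ n) ds) X (party_power ds X n)"

definition local_op :: "nat list \<Rightarrow> nat \<Rightarrow> complex mat \<Rightarrow> complex mat" where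
  "local_op ds p K =
     kron (1\<^sub>m (prod_list (take p ds))) (kron K (1\<^sub>m (prod_list (drop (Suc p) ds))))"

definition ppt_state :: "nat list \<Rightarrow> nat \<Rightarrow> complex mat \<Rightarrow> bool" where
  "ppt_state ds p \<rho> \<longleftrightarrow>
     density (prod_list ds) \<rho> \<and> psd (prod_list ds) (ptranspose ds p \<rho>)"

definition separable :: "nat \<Rightarrow> nat \<Rightarrow> complex mat \<Rightarrow> bool" where
  "separable a b \<sigma> \<longleftrightarrow> (\<exists>(r::nat) w \<alpha> \<beta>.
     (\<forall>k<r. 0 \<le> w k \<and> density a (\<alpha> k) \<and> density b (\<beta> k)) \<and> (\<Sum>k<r. w k) = (1::real) \<and>
     \<sigma> = mat_sum (a * b) (\<lambda>k. complex_of_real (w k) \<cdot>\<^sub>m kron (\<alpha> k) (\<beta> k)) {..<r})"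


section \<open>LOCC and key rates\<close>

text \<open>\<open>locc ds ds' \<Lambda>\<close>: the map \<open>\<Lambda>\<close>, from operators on \<open>ds\<close> to operators on \<open>ds'\<close>, is
  implemented by finitely many rounds. In each round one party \<open>p\<close> performs a measurement with
  Kraus operators \<open>K k\<close> and announces \<open>k\<close>, on which the remaining protocol may depend; the output
  dimension \<open>e k\<close> may depend on \<open>k\<close> too. Instruments whose outcomes comprise several Kraus operators
  arise when the continuations ignore part of \<open>k\<close>; adding and discarding local
  systems are also measurements of this kind.\<close>

inductive locc :: "nat list \<Rightarrow> nat list \<Rightarrow> (complex mat \<Rightarrow> complex mat) \<Rightarrow> bool" where
  locc_done: "locc ds ds (\<lambda>X. X)"
| locc_round: "\<lbrakk> p < length ds;
     \<forall>k<r. 0 < e k \<and> K k \<in> carrier_mat (e k) (ds ! p);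
     mat_sum (ds ! p) (\<lambda>k. mat_adjoint (K k) * K k) {..<r} = 1\<^sub>m (ds ! p);
     \<forall>k<r. locc (ds[p := e k]) ds' (\<Lambda> k) \<rbrakk>
   \<Longrightarrow> locc ds ds' (\<lambda>X. mat_sum (prod_list ds')
         (\<lambda>k. \<Lambda> k (local_op ds p (K k) * X * mat_adjoint (local_op ds p (K k)))) {..<r::nat})"

text \<open>An \<open>m\<close>-bit private state with shield dimensions \<open>a\<close> and \<open>b\<close>, as an operator on
  \<open>[2 ^ m * a, 2 ^ m * b]\<close>, that is, with the systems in the order \<open>A A' B B'\<close>.\<close>

definition private_state :: "nat \<Rightarrow> nat \<Rightarrow> nat \<Rightarrow> complex mat \<Rightarrow> bool" where
  "private_state m a b \<gamma> \<longleftrightarrow> (\<exists>\<sigma> U. density (a * b) \<sigma> \<and> (\<forall>i<2 ^ m. unitary (a * b) (U i)) \<and>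
     \<gamma> = complex_of_real (1 / 2 ^ m) \<cdot>\<^sub>m mat_sum (2 ^ m * a * (2 ^ m * b))
           (\<lambda>(i, j). party_tensor [2 ^ m, 2 ^ m] [a, b]
              (matrix_unit (2 ^ m * 2 ^ m) (encode [2 ^ m, 2 ^ m] [i, i])
                (encode [2 ^ m, 2 ^ m] [j, j]))
              (U i * \<sigma> * mat_adjoint (U j)))
           ({..<2 ^ m} \<times> {..<2 ^ m}))"

text \<open>\<open>achievable \<epsilon> n m\<close> is to mean that \<open>m\<close> bits of key are obtained from \<open>n\<close> copies with error
  at most \<open>\<epsilon>\<close>. The rate is extended-real valued so that no boundedness has to be presupposed.\<close>

definition asymptotic_rate :: "(real \<Rightarrow> nat \<Rightarrow> nat \<Rightarrow> bool) \<Rightarrow> ereal" where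
  "asymptotic_rate achievable =
     (INF \<epsilon>\<in>{0<..}. limsup (\<lambda>n. SUP m\<in>{m. achievable \<epsilon> n m}. ereal (real m / real n)))"

definition distillable_key :: "nat \<Rightarrow> nat \<Rightarrow> complex mat \<Rightarrow> ereal" where
  "distillable_key a b \<rho> = asymptotic_rate (\<lambda>\<epsilon> n m. \<exists>\<Lambda> a' b' \<gamma>.
     locc [a ^ n, b ^ n] [2 ^ m * a', 2 ^ m * b'] \<Lambda> \<and> private_state m a' b' \<gamma> \<and>
     trace_norm (\<Lambda> (party_power [a, b] \<rho> n) - \<gamma>) \<le> \<epsilon>)"

text \<open>Here \<open>\<omega>\<close> is a state of Alice, Charlie and Bob, in this order.\<close>

definition key_repeater_rate :: "nat \<Rightarrow> nat \<Rightarrow> nat \<Rightarrow> complex mat \<Rightarrow> ereal" where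
  "key_repeater_rate a c b \<omega> = asymptotic_rate (\<lambda>\<epsilon> n m. \<exists>\<Lambda> a' c' b' \<gamma>.
     locc [a ^ n, c ^ n, b ^ n] [2 ^ m * a', c', 2 ^ m * b'] \<Lambda> \<and> private_state m a' b' \<gamma> \<and>
     trace_norm (ptrace [2 ^ m * a', c', 2 ^ m * b'] 1 (\<Lambda> (party_power [a, c, b] \<omega> n)) - \<gamma>) \<le> \<epsilon>)"


section \<open>Entanglement measures\<close>

text \<open>Since \<open>log 2 0 = 0\<close>, \<open>mat_fun (log 2)\<close> takes the logarithm on the support.\<close>

definition relative_entropy :: "nat \<Rightarrow> complex mat \<Rightarrow> complex mat \<Rightarrow> ereal" where
  "relative_entropy n \<rho> \<sigma> =
     (if \<forall>v\<in>carrier_vec n. \<sigma> *\<^sub>v v = 0\<^sub>v n \<longrightarrow> \<rho> *\<^sub>v v = 0\<^sub>v n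
      then ereal (Re (mat_trace (\<rho> * (mat_fun (log 2) \<rho> - mat_fun (log 2) \<sigma>))))
      else \<infinity>)"

definition rel_ent_entanglement :: "nat \<Rightarrow> nat \<Rightarrow> complex mat \<Rightarrow> ereal" where
  "rel_ent_entanglement a b \<rho> = (INF \<sigma>\<in>{\<sigma>. separable a b \<sigma>}. relative_entropy (a * b) \<rho> \<sigma>)"

definition reg_rel_ent_entanglement :: "nat \<Rightarrow> nat \<Rightarrow> complex mat \<Rightarrow> ereal" where
  "reg_rel_ent_entanglement a b \<rho> =
     lim (\<lambda>n. ereal (1 / real n) * rel_ent_entanglement (a ^ n) (b ^ n) (party_power [a, b] \<rho> n))"

definition vn_entropy :: "complex mat \<Rightarrow> real" where
  "vn_entropy \<rho> = - Re (mat_trace (\<rho> * mat_fun (log 2) \<rho>))"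

text \<open>\<open>I(A:B|E)\<close> for a state on \<open>[a, b, e]\<close>.\<close>

definition cond_mutual_info :: "nat \<Rightarrow> nat \<Rightarrow> nat \<Rightarrow> complex mat \<Rightarrow> real" where
  "cond_mutual_info a b e \<tau> =
     vn_entropy (ptrace [a, b, e] 1 \<tau>) + vn_entropy (ptrace [a, b, e] 0 \<tau>)
     - vn_entropy \<tau> - vn_entropy (ptrace [b, e] 0 (ptrace [a, b, e] 0 \<tau>))"

definition squashed_entanglement :: "nat \<Rightarrow> nat \<Rightarrow> complex mat \<Rightarrow> ereal" where
  "squashed_entanglement a b \<rho> =
     (INF (e, \<tau>)\<in>{(e, \<tau>). density (a * b * e) \<tau> \<and> ptrace [a, b, e] 2 \<tau> = \<rho>}.
        ereal (1 / 2 * cond_mutual_info a b e \<tau>))"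

end

theory Submission
  imports Defs
begin

text \<open>Let Charlie be merged with Bob, say, and let him use the complex conjugates of his Kraus
  operators. The resulting bipartite LOCC protocol turns the partial transpose of the input into the
  partial transpose of the output, and since Charlie is traced out, the key of Alice and Bob is the same.
  The partial transpose of the second input is a state by the PPT condition, and Bob can prepare it
  locally. Hence every repeater protocol yields a protocol that distils key from the partial transpose
  of the first input.

  The relative entropy of entanglement and the squashed entanglement are LOCC monotones and, at a state
  close to an \<open>m\<close>-bit private state, are at least about \<open>m\<close>. Such a state nearly always passes a test
  that a separable state passes with probability at most \<open>2\<close> to the power \<open>-m\<close>. For squashed entanglement,
  passing the test means that Alice's key is almost known to Bob and that dephasing it creates almost
  \<open>m\<close> bits of entropy, so that it is almost independent of the extension. The entropy inequalities
  behind this rest on writing the relative entropy as an integral of suprema of functions that are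
  linear in the pair of states.\<close>

section \<open>Operators on finite index sets\<close>

text \<open>The shields have no bounded dimension, so a continuity estimate that contains the
  logarithm of the total dimension says nothing about the output of a protocol. The tests take its
  place: their error terms involve only the number of key bits. Operators are not normalised. A
  branch of a protocol carries its probability as its trace; relative entropy and conditional mutual
  information are homogeneous of degree one, so sums over branches need no division by
  probabilities, and a lower bound that is linear in the operator can be added up over the branches.
  For \<open>s > 0\<close> the maximum \<open>Qs\<close> is \<open><A, (s R + L)^-1 A>\<close> with
  \<open>R\<close> the right multiplication by \<open>A\<close> and \<open>L\<close> the left
  multiplication by \<open>B\<close>. Relative entropy is the integral of
  \<open>Qs - Tr A / (s + 1)\<close> over all positive \<open>s\<close>, so the convexity and
  monotonicity that are needed follow from inequalities between quadratic polynomials, without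
  operator convexity of the logarithm. Charlie conjugates his operators because exchanging the row
  and column indices of his system exchanges \<open>K\<close> with its entrywise conjugate in
  \<open>K X K^*\<close>. The trace over him does not notice the transposition.\<close>

text \<open>An operator is given by its matrix entries; those outside the index set \<open>I\<close> are irrelevant.
  Entropies are in nats up to the comparison with the rates.\<close>

type_synonym 'i op = "'i \<Rightarrow> 'i \<Rightarrow> complex"

abbreviation sqmat :: "nat \<Rightarrow> complex mat set" where
  "sqmat n \<equiv> carrier_mat n n"

definition inn :: "'i set \<Rightarrow> ('i \<Rightarrow> complex) \<Rightarrow> ('i \<Rightarrow> complex) \<Rightarrow> complex" where
  "inn I f g = (\<Sum>x\<in>I. cnj (f x) * g x)"

definition app :: "'j set \<Rightarrow> ('i \<Rightarrow> 'j \<Rightarrow> complex) \<Rightarrow> ('j \<Rightarrow> complex) \<Rightarrow> 'i \<Rightarrow> complex" where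
  "app J A f x = (\<Sum>y\<in>J. A x y * f y)"

definition quad :: "'i set \<Rightarrow> 'i op \<Rightarrow> ('i \<Rightarrow> complex) \<Rightarrow> complex" where
  "quad I A f = (\<Sum>x\<in>I. \<Sum>y\<in>I. cnj (f x) * A x y * f y)"

definition pos :: "'i set \<Rightarrow> 'i op \<Rightarrow> bool" where
  "pos I A \<longleftrightarrow> (\<forall>f. 0 \<le> quad I A f)"

definition herm :: "'i set \<Rightarrow> 'i op \<Rightarrow> bool" where
  "herm I A \<longleftrightarrow> (\<forall>x\<in>I. \<forall>y\<in>I. A x y = cnj (A y x))"

definition tr :: "'i set \<Rightarrow> 'i op \<Rightarrow> complex" where
  "tr I A = (\<Sum>x\<in>I. A x x)"

text \<open>Orthonormality and completeness are both demanded, so no dimension count is needed to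
  pass from one to the other. The vectors are labelled by \<open>I\<close> itself, the label being
  the first argument.\<close>

definition onb :: "'i set \<Rightarrow> 'i op \<Rightarrow> bool" where
  "onb I u \<longleftrightarrow> (\<forall>k\<in>I. \<forall>l\<in>I. inn I (u k) (u l) = (if k = l then 1 else 0)) \<and>
     (\<forall>x\<in>I. \<forall>y\<in>I. (\<Sum>k\<in>I. u k x * cnj (u k y)) = (if x = y then 1 else 0))"

definition spec :: "'i set \<Rightarrow> ('i \<Rightarrow> real) \<Rightarrow> 'i op \<Rightarrow> 'i op \<Rightarrow> bool" where
  "spec I p u A \<longleftrightarrow> onb I u \<and>
     (\<forall>x\<in>I. \<forall>y\<in>I. A x y = (\<Sum>k\<in>I. of_real (p k) * u k x * cnj (u k y)))"

lemma quad_inn_app: "quad I A f = inn I f (app I A f)"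
  by (simp add: quad_def inn_def app_def sum_distrib_left mult.assoc)

lemma inn_cnj: "cnj (inn I f g) = inn I g f"
  by (simp add: inn_def mult.commute)

lemma inn_adj_app:
  assumes "herm I A"
  shows "inn I f (app I A g) = cnj (inn I g (app I A f))"
proof -
  have "inn I f (app I A g) = (\<Sum>x\<in>I. \<Sum>y\<in>I. cnj (f x) * A x y * g y)"
    by (simp add: inn_def app_def sum_distrib_left mult.assoc)
  also have "... = (\<Sum>y\<in>I. \<Sum>x\<in>I. cnj (f x) * A x y * g y)" by (rule sum.swap)
  also have "... = (\<Sum>y\<in>I. \<Sum>x\<in>I. cnj (cnj (g y) * (A y x * f x)))"
  proof (intro sum.cong refl)
    fix x y assume "x \<in> I" "y \<in> I"
    then have "A x y = cnj (A y x)" using assms unfolding herm_def by blast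
    then show "cnj (f x) * A x y * g y = cnj (cnj (g y) * (A y x * f x))" by (metis complex_cnj_cnj complex_cnj_mult mult.assoc mult.commute)
  qed
  finally show ?thesis by (simp add: inn_def app_def sum_distrib_left)
qed

lemma inn_self: "inn I f f = of_real (\<Sum>x\<in>I. (cmod (f x))\<^sup>2)"
  by (simp add: inn_def mult.commute flip: complex_norm_square)

lemma quad_unit:
  assumes "finite I" "a \<in> I"
  shows "quad I A (\<lambda>x. if x = a then c else 0) = cnj c * A a a * c"
proof -
  have "quad I A (\<lambda>x. if x = a then c else 0) =
    (\<Sum>x\<in>I. if x = a then \<Sum>y\<in>I. if y = a then cnj c * A a a * c else 0 else 0)"
    unfolding quad_def by (intro sum.cong refl) (auto intro!: sum.cong)
  then show ?thesis using assms by simp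
qed

text \<open>Polarisation: the form is real at each unit vector, at the sum of two unit vectors, and
  at the same sum with one of them multiplied by \<i>. The last two conditions give the imaginary
  and the real part of the claim.\<close>

lemma nonneg_quad_herm:
  assumes "finite I" "pos I A" shows "herm I A"
  unfolding herm_def
proof (intro ballI)
  fix a b assume ab: "a \<in> I" "b \<in> I"
  show "A a b = cnj (A b a)"
  proof (cases "a = b")
    case True
    have "0 \<le> quad I A (\<lambda>x. if x = a then 1 else 0)" using assms(2) by (auto simp: pos_def)
    then have "0 \<le> A a a" using quad_unit[OF assms(1) ab(1), of A 1] by simp
    with True show ?thesis by (simp add: less_eq_complex_def complex_eq_iff)
  next
    case False
    have q: "quad I A (\<lambda>x. if x = a then 1 else if x = b then c else 0) =
      A a a + A a b * c + cnj c * A b a + cnj c * A b b * c" for c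
    proof -
      have *: "(\<Sum>x\<in>I. h x * (if x = a then 1 else if x = b then d else 0)) = h a + h b * d" for h and d :: complex
      proof -
        have "(\<Sum>x\<in>I. h x * (if x = a then 1 else if x = b then d else 0))
          = (\<Sum>x\<in>I. (if x = a then h a else 0) + (if x = b then h b * d else 0))"
          using False by (intro sum.cong) auto
        then show ?thesis using assms(1) ab by (simp add: sum.distrib)
      qed
      have **: "cnj (if x = a then 1 else if x = b then c else 0) = (if x = a then 1 else if x = b then cnj c else 0)" for x
        by simp
      have "quad I A (\<lambda>x. if x = a then 1 else if x = b then c else 0) =
        (\<Sum>x\<in>I. (A x a + A x b * c) * (if x = a then 1 else if x = b then cnj c else 0))"
        unfolding quad_def ** mult.assoc sum_distrib_left[symmetric] by (simp only: * mult.commute)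
      then show ?thesis unfolding * by (simp add: algebra_simps)
    qed
    have p: "0 \<le> quad I A f" for f using assms(2) by (auto simp: pos_def)
    have aa: "0 \<le> A a a" using quad_unit[OF assms(1) ab(1), of A 1] p[of "\<lambda>x. if x = a then 1 else 0"] by simp
    have bb: "0 \<le> A b b" using quad_unit[OF assms(1) ab(2), of A 1] p[of "\<lambda>x. if x = b then 1 else 0"] by simp
    show ?thesis
      using p[of "\<lambda>x. if x = a then 1 else if x = b then 1 else 0"]
        p[of "\<lambda>x. if x = a then 1 else if x = b then \<i> else 0"] aa bb
      unfolding q by (simp add: less_eq_complex_def complex_eq_iff)
  qed
qed

subsection \<open>The spectral theorem\<close>

text \<open>The trace is the sum of the diagonal of a Schur form, which lists the roots of the
  characteristic polynomial, so one root is nonzero. A nonzero eigenvalue is wanted because its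
  eigenvectors lie in the range of \<open>T\<close>.\<close>

lemma trace_nonzero_eigenvector:
  fixes T :: "nat \<Rightarrow> nat \<Rightarrow> complex"
  assumes "(\<Sum>i<n. T i i) \<noteq> 0"
  shows "\<exists>c v. c \<noteq> 0 \<and> (\<exists>i<n. v i \<noteq> 0) \<and> (\<forall>i<n. app {..<n} T v i = c * v i)"
proof -
  define A where "A = mat n n (\<lambda>(i, j). T i j)"
  have A: "A \<in> sqmat n" by (simp add: A_def)
  from char_poly_factorized[OF A] obtain es where es: "char_poly A = (\<Prod>a\<leftarrow>es. [:- a, 1:])" by auto
  obtain B P Q where d: "schur_decomposition A es = (B, P, Q)" by (metis prod_cases3)
  from schur_decomposition[OF A es d] have sim: "similar_mat_wit A B P Q" and dB: "diag_mat B = es" by auto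
  have BPQ: "B \<in> sqmat n" "P \<in> sqmat n" "Q \<in> sqmat n"
    and AP: "A = P * B * Q" and QP: "Q * P = 1\<^sub>m n"
    using similar_mat_witD2[OF A sim] by auto
  have comm: "mat_trace (X * Y) = mat_trace (Y * X)" if "X \<in> sqmat n" "Y \<in> sqmat n" for X Y
  proof -
    have "mat_trace (X * Y) = (\<Sum>i<n. \<Sum>k<n. X $$ (i, k) * Y $$ (k, i))"
      using that by (auto simp: mat_trace_def scalar_prod_def atLeast0LessThan intro!: sum.cong)
    also have "... = (\<Sum>k<n. \<Sum>i<n. X $$ (i, k) * Y $$ (k, i))" by (rule sum.swap)
    also have "... = mat_trace (Y * X)"
      using that by (auto simp: mat_trace_def scalar_prod_def atLeast0LessThan mult.commute intro!: sum.cong)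
    finally show ?thesis .
  qed
  have "mat_trace A = mat_trace (Q * (P * B))"
    unfolding AP using BPQ by (intro comm) auto
  also have "Q * (P * B) = B" using BPQ QP by (simp flip: assoc_mult_mat)
  finally have "mat_trace A = sum_list es"
    using BPQ by (simp add: mat_trace_def diag_mat_def interv_sum_list_conv_sum_set_nat atLeast0LessThan flip: dB)
  moreover have "mat_trace A = (\<Sum>i<n. T i i)" by (simp add: mat_trace_def A_def)
  ultimately have "sum_list es \<noteq> 0" using assms by simp
  then obtain c where c: "c \<in> set es" "c \<noteq> 0" by (metis sum_list_neutral)
  have "poly (char_poly A) c = 0"
    unfolding es using c(1) by (simp add: poly_prod_list prod_list_zero_iff)
  then have "eigenvalue A c" using eigenvalue_root_char_poly[OF A] by simp
  then obtain v where v: "v \<in> carrier_vec n" "v \<noteq> 0\<^sub>v n" "A *\<^sub>v v = c \<cdot>\<^sub>v v"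
    using A by (auto simp: eigenvalue_def eigenvector_def)
  have "\<exists>i<n. v $ i \<noteq> 0" using v(1,2) by (metis carrier_vecD eq_vecI index_zero_vec)
  moreover have "app {..<n} T (($) v) i = c * v $ i" if "i < n" for i
  proof -
    have "(A *\<^sub>v v) $ i = app {..<n} T (($) v) i"
      using that v(1) A by (auto simp: A_def app_def scalar_prod_def atLeast0LessThan intro!: sum.cong)
    then show ?thesis using v that by simp
  qed
  ultimately show ?thesis using c(2) by blast
qed

lemma inn_sum_right: "inn I f (\<lambda>x. \<Sum>k\<in>K. g k x) = (\<Sum>k\<in>K. inn I f (g k))"
  unfolding inn_def sum_distrib_left by (rule sum.swap)

lemma inn_scale_right: "inn I f (\<lambda>x. c * g x) = c * inn I f g"
  by (simp add: inn_def sum_distrib_left mult_ac)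

lemma inn_scale_left: "inn I (\<lambda>x. c * f x) g = cnj c * inn I f g"
  by (simp add: inn_def sum_distrib_left mult_ac)

lemma inn_add_right: "inn I f (\<lambda>x. g x + h x) = inn I f g + inn I f h"
  by (simp add: inn_def sum.distrib algebra_simps)

lemma inn_diff_right: "inn I f (\<lambda>x. g x - h x) = inn I f g - inn I f h"
  by (simp add: inn_def sum_subtractf algebra_simps)

lemma inn_cong: "\<lbrakk>\<And>x. x \<in> I \<Longrightarrow> f x = f' x; \<And>x. x \<in> I \<Longrightarrow> g x = g' x\<rbrakk> \<Longrightarrow> inn I f g = inn I f' g'"
  by (simp add: inn_def)

text \<open>Deflation: \<open>T\<close> is a shift of \<open>A\<close> with the components already
  found removed, so its range is orthogonal to them. An eigenvector of \<open>T\<close> for a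
  nonzero eigenvalue is therefore orthogonal to the earlier ones, and on such a vector
  \<open>T\<close> is just \<open>A + c\<close>.\<close>

lemma orthonormal_eigenvectors:
  fixes A :: "nat \<Rightarrow> nat \<Rightarrow> complex"
  assumes h: "herm {..<n} A"
  shows "k \<le> n \<Longrightarrow> \<exists>p u. (\<forall>i<k. \<forall>j<k. inn {..<n} (u i) (u j) = (if i = j then 1 else 0)) \<and>
    (\<forall>l<k. \<forall>x<n. app {..<n} A (u l) x = of_real (p l) * u l x)"
proof (induction k)
  case 0
  then show ?case by simp
next
  case (Suc k)
  let ?I = "{..<n}"
  from Suc have "k \<le> n" by simp
  from Suc.IH[OF this] obtain p u where on: "\<And>i j. i < k \<Longrightarrow> j < k \<Longrightarrow> inn ?I (u i) (u j) = (if i = j then 1 else 0)"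
    and ev: "\<And>l x. l < k \<Longrightarrow> x < n \<Longrightarrow> app ?I A (u l) x = of_real (p l) * u l x" by blast
  define d where "d = tr ?I A - (\<Sum>l<k. of_real (p l))"
  \<comment> \<open>The trace of \<open>T\<close> is \<open>d + c (n - k)\<close> with
    \<open>n - k > 0\<close>. A shift by 1 makes it nonzero exactly when the unshifted trace
    \<open>d\<close> is 0.\<close>
  obtain c :: real where c: "d + of_real c * of_nat (n - k) \<noteq> 0"
  proof (cases "d = 0")
    case True
    then show ?thesis using that[of 1] Suc.prems by auto
  next
    case False
    then show ?thesis using that[of 0] by auto
  qed
  define T where "T x y = A x y + (if x = y then of_real c else 0) - (\<Sum>l<k. of_real (p l + c) * u l x * cnj (u l y))" for x y
  have "(\<Sum>i<n. T i i) = tr ?I A + of_real c * of_nat n - (\<Sum>l<k. of_real (p l + c) * inn ?I (u l) (u l))"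
    unfolding T_def sum_subtractf sum.distrib tr_def
    by (simp add: inn_def sum_distrib_left mult_ac, rule sum.swap)
  also have "... = d + of_real c * of_nat (n - k)"
    using Suc.prems by (simp add: on d_def of_nat_diff sum.distrib algebra_simps)
  finally have "(\<Sum>i<n. T i i) \<noteq> 0" using c by simp
  from trace_nonzero_eigenvector[where T = T, OF this] obtain e v where e: "e \<noteq> 0" and v0: "\<exists>i<n. v i \<noteq> 0"
    and v: "\<And>i. i < n \<Longrightarrow> app ?I T v i = e * v i" by auto
  have appT: "app ?I T f x = app ?I A f x + of_real c * f x - (\<Sum>l<k. of_real (p l + c) * inn ?I (u l) f * u l x)"
    if "x < n" for f x
  proof -
    have "app ?I T f x = (\<Sum>y<n. A x y * f y) + (\<Sum>y<n. (if x = y then of_real c * f y else 0))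
      - (\<Sum>y<n. \<Sum>l<k. of_real (p l + c) * u l x * cnj (u l y) * f y)"
      unfolding app_def T_def sum.distrib[symmetric] sum_subtractf[symmetric]
      by (intro sum.cong refl) (simp add: algebra_simps sum_distrib_left)
    also have "(\<Sum>y<n. \<Sum>l<k. of_real (p l + c) * u l x * cnj (u l y) * f y)
      = (\<Sum>l<k. of_real (p l + c) * inn ?I (u l) f * u l x)"
      by (subst sum.swap) (simp add: inn_def sum_distrib_left sum_distrib_right mult_ac)
    finally show ?thesis using that by (simp add: app_def)
  qed
  have orth: "inn ?I (u l) v = 0" if l: "l < k" for l
  proof -
    have "e * inn ?I (u l) v = inn ?I (u l) (\<lambda>x. e * v x)" by (simp add: inn_scale_right)
    also have "... = inn ?I (u l) (\<lambda>x. app ?I A v x + of_real c * v x - (\<Sum>j<k. of_real (p j + c) * inn ?I (u j) v * u j x))"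
      by (rule inn_cong) (simp_all only: lessThan_iff appT[symmetric] v[symmetric])
    also have "... = inn ?I (u l) (app ?I A v) + of_real c * inn ?I (u l) v
       - (\<Sum>j<k. of_real (p j + c) * inn ?I (u j) v * inn ?I (u l) (u j))"
      by (simp add: inn_diff_right inn_add_right inn_scale_right inn_sum_right)
    also have "inn ?I (u l) (app ?I A v) = of_real (p l) * inn ?I (u l) v"
    proof -
      have "inn ?I (u l) (app ?I A v) = cnj (inn ?I v (\<lambda>x. of_real (p l) * u l x))"
        unfolding inn_adj_app[OF h, of "u l"] by (intro arg_cong[of _ _ cnj] inn_cong) (simp_all add: ev l)
      then show ?thesis by (simp add: inn_scale_right inn_cnj)
    qed
    also have "(\<Sum>j<k. of_real (p j + c) * inn ?I (u j) v * inn ?I (u l) (u j)) = of_real (p l + c) * inn ?I (u l) v"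
    proof -
      have "(\<Sum>j<k. of_real (p j + c) * inn ?I (u j) v * inn ?I (u l) (u j))
        = (\<Sum>j<k. if j = l then of_real (p j + c) * inn ?I (u j) v else 0)"
        using l by (intro sum.cong) (auto simp: on)
      then show ?thesis using l by simp
    qed
    finally show ?thesis using e by (simp add: algebra_simps)
  qed
  have Av: "app ?I A v x = (e - of_real c) * v x" if "x < n" for x
    using appT[OF that, of v] v[OF that] by (simp add: orth algebra_simps)
  define N where "N = (\<Sum>x<n. (cmod (v x))\<^sup>2)"
  have N: "inn ?I v v = of_real N" by (simp add: inn_self N_def)
  have Npos: "N > 0"
  proof -
    obtain i where "i < n" "v i \<noteq> 0" using v0 by auto
    then show ?thesis unfolding N_def by (intro sum_pos2[of _ i]) auto
  qed
  have "inn ?I v (app ?I A v) = (e - of_real c) * of_real N"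
    unfolding N[symmetric] inn_scale_right[symmetric] by (rule inn_cong) (simp_all add: Av)
  moreover have "cnj (inn ?I v (app ?I A v)) = inn ?I v (app ?I A v)" using inn_adj_app[OF h, of v v] by simp
  ultimately have "cnj ((e - of_real c) * of_real N) = (e - of_real c) * of_real N" by simp
  then have "cnj e = e" using Npos by simp
  then have er: "e = of_real (Re e)" by (simp add: complex_eq_iff)
  define w where "w x = of_real (1 / sqrt N) * v x" for x
  have ww: "inn ?I w w = 1"
    using Npos unfolding w_def inn_scale_left inn_scale_right N by (simp flip: of_real_mult)
  have uw: "inn ?I (u l) w = 0" if "l < k" for l
    unfolding w_def inn_scale_right by (simp add: orth that)
  have wu: "inn ?I w (u l) = 0" if "l < k" for l
    using uw[OF that] inn_cnj[of ?I "u l" w] by simp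
  have Aw: "app ?I A w x = of_real (Re e - c) * w x" if "x < n" for x
  proof -
    have "app ?I A w x = of_real (1 / sqrt N) * app ?I A v x"
      by (simp add: app_def w_def sum_distrib_left mult_ac)
    then show ?thesis using Av[OF that] er by (simp add: w_def)
  qed
  show ?case
    by (rule exI[of _ "p(k := Re e - c)"], rule exI[of _ "u(k := w)"])
       (auto simp: less_Suc_eq on ww uw wu ev Aw)
qed

lemma spectral_nat:
  fixes A :: "nat \<Rightarrow> nat \<Rightarrow> complex"
  assumes h: "herm {..<n} A"
  shows "\<exists>p u. spec {..<n} p u A"
proof -
  let ?I = "{..<n}"
  from orthonormal_eigenvectors[OF h order_refl] obtain p u
    where on: "\<And>i j. i < n \<Longrightarrow> j < n \<Longrightarrow> inn ?I (u i) (u j) = (if i = j then 1 else 0)"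
    and ev: "\<And>l x. l < n \<Longrightarrow> x < n \<Longrightarrow> app ?I A (u l) x = of_real (p l) * u l x" by blast
  \<comment> \<open>\<open>Q\<close> projects onto the complement of the \<open>n\<close> vectors.
    Its trace is \<open>n - n = 0\<close>, and the trace of a projection is the sum of the squared
    moduli of its entries; hence \<open>Q = 0\<close>, which is completeness.\<close>
  define Q where "Q x y = (if x = y then 1 else 0) - (\<Sum>l<n. u l x * cnj (u l y))" for x y
  have Qapp: "app ?I Q f x = f x - (\<Sum>l<n. inn ?I (u l) f * u l x)" if "x < n" for f x
  proof -
    have "app ?I Q f x = (\<Sum>y<n. if x = y then f y else 0) - (\<Sum>y<n. \<Sum>l<n. u l x * cnj (u l y) * f y)"
      unfolding app_def Q_def sum_subtractf[symmetric]
      by (intro sum.cong refl) (simp add: algebra_simps sum_distrib_left)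
    also have "(\<Sum>y<n. \<Sum>l<n. u l x * cnj (u l y) * f y) = (\<Sum>l<n. inn ?I (u l) f * u l x)"
      by (subst sum.swap) (simp add: inn_def sum_distrib_left sum_distrib_right mult_ac)
    finally show ?thesis using that by simp
  qed
  have uQ: "inn ?I (u l) (\<lambda>x. Q x y) = 0" if "l < n" "y < n" for l y
  proof -
    have "inn ?I (u l) (\<lambda>x. Q x y) = (\<Sum>x<n. if x = y then cnj (u l x) else 0) - (\<Sum>x<n. \<Sum>j<n. cnj (u j y) * (cnj (u l x) * u j x))"
      unfolding inn_def Q_def sum_subtractf[symmetric]
      by (intro sum.cong refl) (simp add: algebra_simps sum_distrib_left)
    also have "(\<Sum>x<n. \<Sum>j<n. cnj (u j y) * (cnj (u l x) * u j x)) = (\<Sum>j<n. cnj (u j y) * inn ?I (u l) (u j))"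
      by (subst sum.swap) (simp add: inn_def sum_distrib_left)
    also have "... = (\<Sum>j<n. if j = l then cnj (u j y) else 0)"
      using that by (intro sum.cong) (auto simp: on)
    finally show ?thesis using that by simp
  qed
  have trQ: "(\<Sum>x<n. Q x x) = 0"
  proof -
    have "(\<Sum>x<n. Q x x) = of_nat n - (\<Sum>l<n. inn ?I (u l) (u l))"
      unfolding Q_def sum_subtractf inn_def by (simp add: mult.commute, rule sum.swap)
    then show ?thesis by (simp add: on)
  qed
  have QQ: "(\<Sum>y<n. Q x y * Q y x) = Q x x" if "x < n" for x
    using Qapp[OF that, of "\<lambda>y. Q y x"] uQ that by (simp add: app_def)
  have "(\<Sum>x<n. \<Sum>y<n. (cmod (Q x y))\<^sup>2) = 0"
  proof -
    have "complex_of_real (\<Sum>x<n. \<Sum>y<n. (cmod (Q x y))\<^sup>2) = (\<Sum>x<n. \<Sum>y<n. Q x y * Q y x)"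
      unfolding of_real_sum
    proof (intro sum.cong refl)
      fix x y
      have "Q y x = cnj (Q x y)" by (simp add: Q_def mult.commute)
      then show "complex_of_real ((cmod (Q x y))\<^sup>2) = Q x y * Q y x" by (simp only: complex_norm_square)
    qed
    also have "... = 0" using trQ by (simp add: QQ)
    finally show ?thesis using of_real_eq_0_iff by blast
  qed
  then have Q0: "Q x y = 0" if "x < n" "y < n" for x y
    using that by (subst (asm) sum_nonneg_eq_0_iff; simp add: sum_nonneg sum_nonneg_eq_0_iff)
  then have compl: "(\<Sum>k<n. u k x * cnj (u k y)) = (if x = y then 1 else 0)" if "x < n" "y < n" for x y
    using Q0[OF that] by (simp add: Q_def)
  have "A x y = (\<Sum>k<n. of_real (p k) * u k x * cnj (u k y))" if xy: "x < n" "y < n" for x y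
  proof -
    have "A x y = (\<Sum>z<n. A x z * (if z = y then 1 else 0))"
    proof -
      have "(\<Sum>z<n. A x z * (if z = y then 1 else 0)) = (\<Sum>z<n. if z = y then A x z else 0)" by (intro sum.cong) auto
      then show ?thesis using xy by simp
    qed
    also have "... = (\<Sum>z<n. A x z * (\<Sum>k<n. u k z * cnj (u k y)))" using xy by (simp add: compl)
    also have "... = (\<Sum>z<n. \<Sum>k<n. A x z * u k z * cnj (u k y))" by (simp add: sum_distrib_left mult.assoc)
    also have "... = (\<Sum>k<n. \<Sum>z<n. A x z * u k z * cnj (u k y))" by (rule sum.swap)
    also have "... = (\<Sum>k<n. app ?I A (u k) x * cnj (u k y))" by (simp add: app_def sum_distrib_right)
    finally show ?thesis using xy by (simp add: ev)
  qed
  then have "spec {..<n} p u A" unfolding spec_def onb_def using on compl by blast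
  then show ?thesis by blast
qed

lemma spec_reindex:
  assumes b: "bij_betw h J I" and s: "spec I p u A"
  shows "spec J (p \<circ> h) (\<lambda>k x. u (h k) (h x)) (\<lambda>x y. A (h x) (h y))"
proof -
  have hI: "h x \<in> I" if "x \<in> J" for x using b that by (auto simp: bij_betw_def)
  have eq: "h x = h y \<longleftrightarrow> x = y" if "x \<in> J" "y \<in> J" for x y
    using b that by (auto simp: bij_betw_def inj_on_def)
  have re: "(\<Sum>x\<in>J. g (h x)) = (\<Sum>x\<in>I. g x)" for g :: "'b \<Rightarrow> complex"
    using sum.reindex_bij_betw[OF b] .
  have "onb J (\<lambda>k x. u (h k) (h x))"
    using s hI unfolding spec_def onb_def inn_def
    by (simp add: re[of "\<lambda>k. u k _ * cnj (u k _)"] re[of "\<lambda>x. cnj (u _ x) * u _ x"] eq)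
  moreover have "A (h x) (h y) = (\<Sum>k\<in>J. of_real ((p \<circ> h) k) * u (h k) (h x) * cnj (u (h k) (h y)))"
    if "x \<in> J" "y \<in> J" for x y
    using s hI that unfolding spec_def comp_def
    by (simp add: re[of "\<lambda>k. of_real (p k) * u k _ * cnj (u k _)"])
  ultimately show ?thesis by (simp add: spec_def)
qed

theorem spectral:
  assumes fin: "finite I" and h: "herm I A"
  shows "\<exists>p u. spec I p u A"
proof -
  obtain h where b: "bij_betw h {..<card I} I" using ex_bij_betw_nat_finite[OF fin] by (auto simp: atLeast0LessThan)
  have "herm {..<card I} (\<lambda>x y. A (h x) (h y))" using h b unfolding herm_def bij_betw_def by blast
  from spectral_nat[OF this] obtain p u where s: "spec {..<card I} p u (\<lambda>x y. A (h x) (h y))" by blast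
  have b': "bij_betw (inv_into {..<card I} h) I {..<card I}" using b by (rule bij_betw_inv_into)
  from spec_reindex[OF b' s] have "spec I (p \<circ> inv_into {..<card I} h)
     (\<lambda>k x. u (inv_into {..<card I} h k) (inv_into {..<card I} h x))
     (\<lambda>x y. A (h (inv_into {..<card I} h x)) (h (inv_into {..<card I} h y)))" .
  moreover have "h (inv_into {..<card I} h x) = x" if "x \<in> I" for x using b that by (rule bij_betw_inv_into_right)
  ultimately have "spec I (p \<circ> inv_into {..<card I} h)
     (\<lambda>k x. u (inv_into {..<card I} h k) (inv_into {..<card I} h x)) A"
    by (auto simp: spec_def)
  then show ?thesis by blast
qed

lemma sum3_swap: "(\<Sum>x\<in>A. \<Sum>y\<in>B. \<Sum>k\<in>K. g x y k) = (\<Sum>k\<in>K. \<Sum>x\<in>A. \<Sum>y\<in>B. g x y k)"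
proof -
  have "(\<Sum>x\<in>A. \<Sum>y\<in>B. \<Sum>k\<in>K. g x y k) = (\<Sum>x\<in>A. \<Sum>k\<in>K. \<Sum>y\<in>B. g x y k)"
    by (intro sum.cong refl sum.swap)
  then show ?thesis by (simp only: sum.swap[of _ K A])
qed

lemma onb_inn: "\<lbrakk>onb I u; k \<in> I; l \<in> I\<rbrakk> \<Longrightarrow> inn I (u k) (u l) = (if k = l then 1 else 0)"
  by (simp add: onb_def)

lemma onb_expand:
  assumes "finite I" "onb I u" "x \<in> I"
  shows "(\<Sum>k\<in>I. inn I (u k) f * u k x) = f x"
proof -
  have "(\<Sum>k\<in>I. inn I (u k) f * u k x) = (\<Sum>k\<in>I. \<Sum>y\<in>I. u k x * cnj (u k y) * f y)"
    by (simp add: inn_def sum_distrib_left sum_distrib_right mult_ac)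
  also have "... = (\<Sum>y\<in>I. \<Sum>k\<in>I. u k x * cnj (u k y) * f y)" by (rule sum.swap)
  also have "... = (\<Sum>y\<in>I. if y = x then f y else 0)"
    using assms by (intro sum.cong refl) (auto simp: onb_def simp flip: sum_distrib_right)
  finally show ?thesis using assms by simp
qed

lemma parseval:
  assumes "finite I" "onb I u"
  shows "(\<Sum>k\<in>I. cnj (inn I (u k) f) * inn I (u k) g) = inn I f g"
proof -
  have "inn I f g = inn I f (\<lambda>x. \<Sum>k\<in>I. inn I (u k) g * u k x)"
    by (rule inn_cong) (simp_all add: onb_expand assms)
  then show ?thesis unfolding inn_sum_right inn_scale_right inn_cnj by (simp only: mult.commute)
qed

lemma parseval_norm:
  assumes "finite I" "onb I u"
  shows "(\<Sum>k\<in>I. (cmod (inn I (u k) f))\<^sup>2) = (\<Sum>x\<in>I. (cmod (f x))\<^sup>2)"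
proof -
  have "complex_of_real (\<Sum>k\<in>I. (cmod (inn I (u k) f))\<^sup>2) = (\<Sum>k\<in>I. cnj (inn I (u k) f) * inn I (u k) f)"
    unfolding of_real_sum complex_norm_square by (simp only: mult.commute)
  also have "... = complex_of_real (\<Sum>x\<in>I. (cmod (f x))\<^sup>2)"
    unfolding parseval[OF assms] inn_self ..
  finally have "complex_of_real (\<Sum>k\<in>I. (cmod (inn I (u k) f))\<^sup>2) = complex_of_real (\<Sum>x\<in>I. (cmod (f x))\<^sup>2)" .
  then show ?thesis by (simp only: of_real_eq_iff)
qed

lemma onb_cnj: "onb I u \<Longrightarrow> onb I (\<lambda>k x. cnj (u k x))"
proof -
  assume u: "onb I u"
  have "inn I (\<lambda>x. cnj (u k x)) (\<lambda>x. cnj (u l x)) = inn I (u l) (u k)" for k l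
    by (simp add: inn_def mult.commute)
  moreover have "(\<Sum>k\<in>I. cnj (u k x) * cnj (cnj (u k y))) = (\<Sum>k\<in>I. u k y * cnj (u k x))" for x y
    by (simp add: mult.commute)
  ultimately show ?thesis using u unfolding onb_def by simp
qed

lemma spec_app:
  assumes "finite I" "spec I p u A" "k \<in> I" "x \<in> I"
  shows "app I A (u k) x = of_real (p k) * u k x"
proof -
  have "app I A (u k) x = (\<Sum>y\<in>I. \<Sum>l\<in>I. of_real (p l) * u l x * cnj (u l y) * u k y)"
    unfolding app_def using assms by (intro sum.cong refl) (simp add: spec_def sum_distrib_right)
  also have "... = (\<Sum>l\<in>I. \<Sum>y\<in>I. of_real (p l) * u l x * cnj (u l y) * u k y)" by (rule sum.swap)
  also have "... = (\<Sum>l\<in>I. of_real (p l) * u l x * inn I (u l) (u k))"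
    by (simp add: inn_def sum_distrib_left mult.assoc)
  also have "... = (\<Sum>l\<in>I. if l = k then of_real (p l) * u l x else 0)"
    using assms by (intro sum.cong refl) (auto simp: spec_def onb_inn)
  finally show ?thesis using assms by simp
qed

lemma spec_quad:
  assumes "spec I p u A"
  shows "quad I A f = of_real (\<Sum>k\<in>I. p k * (cmod (inn I (u k) f))\<^sup>2)"
proof -
  have "quad I A f = (\<Sum>x\<in>I. \<Sum>y\<in>I. \<Sum>k\<in>I. of_real (p k) * (cnj (f x) * u k x) * (cnj (u k y) * f y))"
    unfolding quad_def using assms
    by (intro sum.cong refl) (simp add: spec_def sum_distrib_left sum_distrib_right mult_ac)
  also have "... = (\<Sum>k\<in>I. \<Sum>x\<in>I. \<Sum>y\<in>I. of_real (p k) * (cnj (f x) * u k x) * (cnj (u k y) * f y))"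
    by (rule sum3_swap)
  also have "... = (\<Sum>k\<in>I. of_real (p k) * (inn I f (u k) * inn I (u k) f))"
  proof (intro sum.cong refl)
    fix k
    have "inn I f (u k) * inn I (u k) f = (\<Sum>x\<in>I. \<Sum>y\<in>I. (cnj (f x) * u k x) * (cnj (u k y) * f y))"
      by (simp only: inn_def sum_product)
    then show "(\<Sum>x\<in>I. \<Sum>y\<in>I. of_real (p k) * (cnj (f x) * u k x) * (cnj (u k y) * f y)) = of_real (p k) * (inn I f (u k) * inn I (u k) f)"
      by (simp only: sum_distrib_left mult.assoc)
  qed
  also have "... = (\<Sum>k\<in>I. of_real (p k) * (inn I (u k) f * cnj (inn I (u k) f)))"
    by (simp add: inn_cnj mult.commute)
  finally show ?thesis by (simp only: complex_norm_square of_real_sum of_real_mult)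
qed

lemma spec_herm: "spec I p u A \<Longrightarrow> herm I A"
  unfolding spec_def herm_def by (auto simp: mult_ac)

lemma spec_trace:
  assumes "spec I p u A"
  shows "tr I A = of_real (\<Sum>k\<in>I. p k)"
proof -
  have "tr I A = (\<Sum>x\<in>I. \<Sum>k\<in>I. of_real (p k) * (cnj (u k x) * u k x))"
    unfolding tr_def using assms by (intro sum.cong refl) (simp add: spec_def mult_ac)
  also have "... = (\<Sum>k\<in>I. of_real (p k) * inn I (u k) (u k))"
    by (subst sum.swap) (simp add: inn_def sum_distrib_left)
  also have "... = (\<Sum>k\<in>I. of_real (p k))"
    using assms by (intro sum.cong refl) (simp add: spec_def onb_inn)
  finally show ?thesis by simp
qed

lemma spec_quad_self:
  assumes "finite I" "spec I p u A" "k \<in> I" shows "quad I A (u k) = of_real (p k)"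
proof -
  have "(\<Sum>l\<in>I. p l * (cmod (inn I (u l) (u k)))\<^sup>2) = (\<Sum>l\<in>I. if l = k then p l else 0)"
    using assms by (intro sum.cong refl) (auto simp: spec_def onb_inn)
  then show ?thesis using spec_quad[OF assms(2), of "u k"] assms by simp
qed

lemma spec_pos_nonneg:
  assumes "finite I" "spec I p u A" "pos I A" "k \<in> I"
  shows "0 \<le> p k"
  using assms(3) spec_quad_self[OF assms(1,2,4)] by (metis pos_def less_eq_complex_def Re_complex_of_real zero_complex.sel(1))

text \<open>Eigenvectors \<open>u j\<close> and \<open>v k\<close> of the same operator are
  orthogonal unless \<open>p j = q k\<close>, so \<open>g (p j)\<close> may be exchanged for
  \<open>g (q k)\<close> whenever one basis is expanded in the other. This makes \<open>mfun\<close>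
  computable from any decomposition, although its definition fixes one by choice.\<close>

lemma spec_function_unique:
  assumes fin: "finite I" and s: "spec I p u A" and t: "spec I q v A" and xy: "x \<in> I" "y \<in> I"
  shows "(\<Sum>k\<in>I. of_real (g (p k)) * u k x * cnj (u k y)) = (\<Sum>k\<in>I. of_real (g (q k)) * v k x * cnj (v k y))"
proof -
  have u: "onb I u" and v: "onb I v" using s t by (auto simp: spec_def)
  have eig: "of_real (g (p j)) * inn I (u j) (v k) = of_real (g (q k)) * inn I (u j) (v k)" if "j \<in> I" "k \<in> I" for j k
  proof -
    have "inn I (u j) (app I A (v k)) = of_real (q k) * inn I (u j) (v k)"
      unfolding inn_scale_right[symmetric] by (rule inn_cong) (simp_all add: spec_app[OF fin t] that)
    moreover have "inn I (u j) (app I A (v k)) = cnj (of_real (p j) * inn I (v k) (u j))"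
      unfolding inn_adj_app[OF spec_herm[OF s], of "u j"] inn_scale_right[symmetric]
      by (intro arg_cong[of _ _ cnj] inn_cong) (simp_all add: spec_app[OF fin s] that)
    ultimately have "of_real (q k) * inn I (u j) (v k) = of_real (p j) * inn I (u j) (v k)"
      by (simp only: complex_cnj_mult complex_cnj_complex_of_real inn_cnj)
    then have "q k = p j \<or> inn I (u j) (v k) = 0" by (metis mult_cancel_right of_real_eq_iff)
    then show ?thesis by auto
  qed
  have Bv: "(\<Sum>j\<in>I. of_real (g (p j)) * u j x * inn I (u j) (v k)) = of_real (g (q k)) * v k x" if "k \<in> I" for k
  proof -
    have "(\<Sum>j\<in>I. of_real (g (p j)) * u j x * inn I (u j) (v k)) = (\<Sum>j\<in>I. of_real (g (q k)) * (inn I (u j) (v k) * u j x))"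
      using eig that by (intro sum.cong refl) (simp add: mult_ac)
    then show ?thesis using onb_expand[OF fin u xy(1), of "v k"] by (simp flip: sum_distrib_left)
  qed
  have "(\<Sum>j\<in>I. of_real (g (p j)) * u j x * cnj (u j y))
      = (\<Sum>j\<in>I. of_real (g (p j)) * u j x * (\<Sum>k\<in>I. inn I (u j) (v k) * cnj (v k y)))"
  proof (intro sum.cong refl)
    fix j
    have "(\<Sum>k\<in>I. inn I (u j) (v k) * cnj (v k y)) = cnj (\<Sum>k\<in>I. inn I (v k) (u j) * v k y)"
      by (simp add: inn_cnj)
    then have "(\<Sum>k\<in>I. inn I (u j) (v k) * cnj (v k y)) = cnj (u j y)"
      unfolding onb_expand[OF fin v xy(2)] .
    then show "of_real (g (p j)) * u j x * cnj (u j y) = of_real (g (p j)) * u j x * (\<Sum>k\<in>I. inn I (u j) (v k) * cnj (v k y))"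
      by simp
  qed
  also have "... = (\<Sum>k\<in>I. \<Sum>j\<in>I. of_real (g (p j)) * u j x * inn I (u j) (v k) * cnj (v k y))"
    by (subst sum.swap) (simp add: sum_distrib_left mult.assoc)
  also have "... = (\<Sum>k\<in>I. of_real (g (q k)) * v k x * cnj (v k y))"
    by (simp add: Bv flip: sum_distrib_right)
  finally show ?thesis .
qed

section \<open>Functional calculus and relative entropy\<close>

definition evl :: "'i set \<Rightarrow> 'i op \<Rightarrow> 'i \<Rightarrow> real" where
  "evl I A = (SOME p. \<exists>u. spec I p u A)"

definition evc :: "'i set \<Rightarrow> 'i op \<Rightarrow> 'i \<Rightarrow> 'i \<Rightarrow> complex" where
  "evc I A = (SOME u. spec I (evl I A) u A)"

lemma spec_evl_evc: "\<lbrakk>finite I; herm I A\<rbrakk> \<Longrightarrow> spec I (evl I A) (evc I A) A"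
proof -
  assume "finite I" "herm I A"
  then have "\<exists>p u. spec I p u A" by (rule spectral)
  then have "\<exists>u. spec I (evl I A) u A" unfolding evl_def by (rule someI_ex)
  then show "spec I (evl I A) (evc I A) A" unfolding evc_def by (rule someI_ex)
qed

definition mfun :: "'i set \<Rightarrow> (real \<Rightarrow> real) \<Rightarrow> 'i op \<Rightarrow> 'i \<Rightarrow> 'i \<Rightarrow> complex" where
  "mfun I g A x y = (\<Sum>k\<in>I. of_real (g (evl I A k)) * evc I A k x * cnj (evc I A k y))"

lemma mfun_spec:
  assumes "finite I" "spec I p u A" "x \<in> I" "y \<in> I"
  shows "mfun I g A x y = (\<Sum>k\<in>I. of_real (g (p k)) * u k x * cnj (u k y))"
  unfolding mfun_def
  by (rule spec_function_unique[OF assms(1) spec_evl_evc[OF assms(1) spec_herm[OF assms(2)]] assms(2-4)])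

text \<open>\<open>trln I A B\<close> is \<open>Tr (A ln B)\<close>; eigenvalue \<open>0\<close> of \<open>B\<close> contributes nothing since \<open>ln 0 = 0\<close>.\<close>

definition trln :: "'i set \<Rightarrow> 'i op \<Rightarrow> 'i op \<Rightarrow> real" where
  "trln I A B = Re (\<Sum>x\<in>I. \<Sum>y\<in>I. A x y * mfun I ln B y x)"

lemma trln_spec:
  assumes "finite I" "spec I q v B"
  shows "trln I A B = (\<Sum>j\<in>I. ln (q j) * Re (quad I A (v j)))"
proof -
  have "(\<Sum>x\<in>I. \<Sum>y\<in>I. A x y * mfun I ln B y x) = (\<Sum>x\<in>I. \<Sum>y\<in>I. \<Sum>j\<in>I. of_real (ln (q j)) * (cnj (v j x) * A x y * v j y))"
    by (intro sum.cong refl) (simp add: mfun_spec[OF assms] sum_distrib_left mult_ac)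
  also have "... = (\<Sum>j\<in>I. \<Sum>x\<in>I. \<Sum>y\<in>I. of_real (ln (q j)) * (cnj (v j x) * A x y * v j y))"
    by (rule sum3_swap)
  also have "... = (\<Sum>j\<in>I. of_real (ln (q j)) * quad I A (v j))"
    by (simp add: quad_def sum_distrib_left)
  finally show ?thesis by (simp add: trln_def)
qed

lemma trln_self:
  assumes "finite I" "spec I p u A"
  shows "trln I A A = (\<Sum>k\<in>I. p k * ln (p k))"
  using spec_quad_self[OF assms] by (simp add: trln_spec[OF assms] mult.commute)

definition relent :: "'i set \<Rightarrow> 'i op \<Rightarrow> 'i op \<Rightarrow> real" where
  "relent I A B = trln I A A - trln I A B"

text \<open>For positive operators a zero of the form is a kernel vector, so this says that the
  kernel of \<open>B\<close> lies in that of \<open>A\<close>. In terms of forms the condition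
  passes directly through sums and through \<open>sand\<close>.\<close>

definition supp :: "'i set \<Rightarrow> 'i op \<Rightarrow> 'i op \<Rightarrow> bool" where
  "supp I A B \<longleftrightarrow> (\<forall>f. quad I B f = 0 \<longrightarrow> quad I A f = 0)"

subsection \<open>Variational formula\<close>

text \<open>\<open>Qs\<close> is the maximum over \<open>Y\<close> of \<open>vari\<close>, which is linear in \<open>(A, B)\<close>. Integrating \<open>Qs\<close> over
  \<open>s\<close> gives the relative entropy, which inherits joint convexity and monotonicity.\<close>

definition vari :: "'i set \<Rightarrow> 'i op \<Rightarrow> 'i op \<Rightarrow> real \<Rightarrow> 'i op \<Rightarrow> real" where
  "vari I A B s Y = 2 * Re (\<Sum>x\<in>I. \<Sum>y\<in>I. A x y * Y y x)
     - s * (\<Sum>z\<in>I. Re (quad I A (\<lambda>x. cnj (Y z x)))) - (\<Sum>z\<in>I. Re (quad I B (\<lambda>x. Y x z)))"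

definition Qs :: "'i set \<Rightarrow> 'i op \<Rightarrow> 'i op \<Rightarrow> real \<Rightarrow> real" where
  "Qs I A B s = (\<Sum>i\<in>I. \<Sum>j\<in>I. (cmod (inn I (evc I A i) (evc I B j)))\<^sup>2 *
     (evl I A i)\<^sup>2 / (s * evl I A i + evl I B j))"

text \<open>The terms of \<open>vari\<close> are the traces of \<open>A Y\<close>,
  \<open>Y A Y^*\<close> and \<open>Y^* B Y\<close>. In the coordinates
  \<open><v j, Y (u i)>\<close> of \<open>Y\<close> they decouple, and maximising over
  \<open>Y\<close> becomes one scalar problem for each pair \<open>(i, j)\<close>.\<close>

lemma vari_spec:
  assumes fin: "finite I" and A: "spec I p u A" and B: "spec I q v B"
  shows "vari I A B s Y = (\<Sum>i\<in>I. \<Sum>j\<in>I. 2 * p i * Re (inn I (u i) (v j) * inn I (v j) (app I Y (u i)))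
    - (s * p i + q j) * (cmod (inn I (v j) (app I Y (u i))))\<^sup>2)"
proof -
  have u: "onb I u" and v: "onb I v" using A B by (auto simp: spec_def)
  have 1: "(\<Sum>x\<in>I. \<Sum>y\<in>I. A x y * Y y x) = (\<Sum>i\<in>I. of_real (p i) * (\<Sum>j\<in>I. inn I (u i) (v j) * inn I (v j) (app I Y (u i))))"
  proof -
    have "(\<Sum>x\<in>I. \<Sum>y\<in>I. A x y * Y y x) = (\<Sum>x\<in>I. \<Sum>y\<in>I. \<Sum>i\<in>I. of_real (p i) * (cnj (u i y) * (Y y x * u i x)))"
      using A by (intro sum.cong refl) (simp add: spec_def sum_distrib_left sum_distrib_right mult_ac)
    also have "... = (\<Sum>i\<in>I. \<Sum>x\<in>I. \<Sum>y\<in>I. of_real (p i) * (cnj (u i y) * (Y y x * u i x)))"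
      by (rule sum3_swap)
    also have "... = (\<Sum>i\<in>I. of_real (p i) * inn I (u i) (app I Y (u i)))"
      by (subst sum.swap) (simp add: inn_def app_def sum_distrib_left mult_ac)
    also have "... = (\<Sum>i\<in>I. of_real (p i) * (\<Sum>j\<in>I. inn I (u i) (v j) * inn I (v j) (app I Y (u i))))"
    proof (intro sum.cong refl arg_cong2[where f = "(*)"])
      fix i
      show "inn I (u i) (app I Y (u i)) = (\<Sum>j\<in>I. inn I (u i) (v j) * inn I (v j) (app I Y (u i)))"
        using parseval[OF fin v, of "u i" "app I Y (u i)"] by (simp add: inn_cnj)
    qed
    finally show ?thesis .
  qed
  have 2: "(\<Sum>z\<in>I. Re (quad I A (\<lambda>x. cnj (Y z x)))) = (\<Sum>i\<in>I. \<Sum>j\<in>I. p i * (cmod (inn I (v j) (app I Y (u i))))\<^sup>2)"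
  proof -
    have *: "inn I (u i) (\<lambda>x. cnj (Y z x)) = cnj (app I Y (u i) z)" for i z
      by (simp add: inn_def app_def mult.commute)
    have "(\<Sum>z\<in>I. Re (quad I A (\<lambda>x. cnj (Y z x)))) = (\<Sum>z\<in>I. \<Sum>i\<in>I. p i * (cmod (app I Y (u i) z))\<^sup>2)"
      by (simp add: spec_quad[OF A] *)
    also have "... = (\<Sum>i\<in>I. p i * (\<Sum>z\<in>I. (cmod (app I Y (u i) z))\<^sup>2))"
      by (subst sum.swap) (simp add: sum_distrib_left)
    finally show ?thesis unfolding parseval_norm[OF fin v, of "app I Y (u _)", symmetric] by (simp only: sum_distrib_left)
  qed
  have 3: "(\<Sum>z\<in>I. Re (quad I B (\<lambda>x. Y x z))) = (\<Sum>i\<in>I. \<Sum>j\<in>I. q j * (cmod (inn I (v j) (app I Y (u i))))\<^sup>2)"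
  proof -
    have *: "inn I (\<lambda>x. cnj (u i x)) (\<lambda>z. inn I (v j) (\<lambda>x. Y x z)) = inn I (v j) (app I Y (u i))" for i j
      unfolding inn_def app_def sum_distrib_left by (subst sum.swap) (simp add: mult_ac)
    have "(\<Sum>z\<in>I. Re (quad I B (\<lambda>x. Y x z))) = (\<Sum>z\<in>I. \<Sum>j\<in>I. q j * (cmod (inn I (v j) (\<lambda>x. Y x z)))\<^sup>2)"
      by (simp add: spec_quad[OF B])
    also have "... = (\<Sum>j\<in>I. q j * (\<Sum>z\<in>I. (cmod (inn I (v j) (\<lambda>x. Y x z)))\<^sup>2))"
      by (subst sum.swap) (simp add: sum_distrib_left)
    also have "... = (\<Sum>j\<in>I. q j * (\<Sum>i\<in>I. (cmod (inn I (v j) (app I Y (u i))))\<^sup>2))"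
      by (simp only: parseval_norm[OF fin onb_cnj[OF u], of "\<lambda>z. inn I (v _) (\<lambda>x. Y x z)", symmetric] *)
    also have "... = (\<Sum>i\<in>I. \<Sum>j\<in>I. q j * (cmod (inn I (v j) (app I Y (u i))))\<^sup>2)"
      by (subst sum.swap) (simp add: sum_distrib_left)
    finally show ?thesis .
  qed
  show ?thesis
    unfolding vari_def 1 2 3
    by (simp add: sum_subtractf sum_distrib_left sum.distrib algebra_simps)
qed

lemma quadratic_max:
  fixes c y :: complex and p q s :: real
  assumes "0 \<le> p" "0 \<le> q" "0 < s"
  shows "2 * p * Re (c * y) - (s * p + q) * (cmod y)\<^sup>2 \<le> (cmod c)\<^sup>2 * p\<^sup>2 / (s * p + q)"
proof (cases "s * p + q = 0")
  case True
  \<comment> \<open>Here the quotient on the right is 0 by division by zero, and the left side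
    vanishes too.\<close>
  then have "p = 0" using assms by (metis add_nonneg_eq_0_iff mult_eq_0_iff mult_nonneg_nonneg less_eq_real_def less_irrefl)
  with True show ?thesis by simp
next
  case False
  then have d: "s * p + q > 0" using assms by (simp add: order_less_le)
  define d where "d = s * p + q"
  have "Re (c * y) \<le> cmod c * cmod y" by (metis complex_Re_le_cmod norm_mult)
  then have "2 * p * Re (c * y) \<le> 2 * p * (cmod c * cmod y)" using assms by (simp add: mult_left_mono)
  moreover have "2 * p * (cmod c * cmod y) - d * (cmod y)\<^sup>2 \<le> (cmod c)\<^sup>2 * p\<^sup>2 / d"
  proof -
    have "0 \<le> (d * cmod y - p * cmod c)\<^sup>2" by simp
    then have "(2 * p * (cmod c * cmod y) - d * (cmod y)\<^sup>2) * d \<le> (cmod c)\<^sup>2 * p\<^sup>2"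
      by (simp add: power2_eq_square algebra_simps)
    then show ?thesis using d by (simp add: d_def pos_le_divide_eq)
  qed
  ultimately show ?thesis by (simp add: d_def)
qed

lemma vari_le_Qs:
  assumes fin: "finite I" and A: "pos I A" and B: "pos I B" and s: "0 < s"
  shows "vari I A B s Y \<le> Qs I A B s"
proof -
  have sA: "spec I (evl I A) (evc I A) A" and sB: "spec I (evl I B) (evc I B) B"
    using assms by (auto intro!: spec_evl_evc nonneg_quad_herm)
  show ?thesis
    unfolding vari_spec[OF fin sA sB] Qs_def
    by (intro sum_mono quadratic_max spec_pos_nonneg[OF fin sA A] spec_pos_nonneg[OF fin sB B] s)
qed

lemma vari_attained:
  assumes fin: "finite I" and A: "pos I A" and B: "pos I B" and s: "0 < s"
  shows "\<exists>Y. vari I A B s Y = Qs I A B s"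
proof -
  define p u q v where "p = evl I A" and "u = evc I A" and "q = evl I B" and "v = evc I B"
  have sA: "spec I p u A" and sB: "spec I q v B"
    using assms by (auto simp: p_def u_def q_def v_def intro!: spec_evl_evc nonneg_quad_herm)
  have u: "onb I u" and v: "onb I v" using sA sB by (auto simp: spec_def)
  \<comment> \<open>The vertex of the parabola belonging to \<open>(i, j)\<close> in
    \<open>vari_spec\<close>. Where its leading coefficient vanishes, division by zero sets the
    coordinate to 0.\<close>
  define y where "y i j = cnj (inn I (u i) (v j)) * of_real (p i / (s * p i + q j))" for i j
  define Y where "Y x z = (\<Sum>i\<in>I. \<Sum>j\<in>I. y i j * v j x * cnj (u i z))" for x z
  have "app I Y (u k) x = (\<Sum>j\<in>I. y k j * v j x)" if "k \<in> I" for k x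
  proof -
    have "app I Y (u k) x = (\<Sum>i\<in>I. (\<Sum>j\<in>I. y i j * v j x) * inn I (u i) (u k))"
      unfolding app_def Y_def inn_def sum_distrib_left sum_distrib_right
      by (subst sum.swap) (simp add: mult_ac)
    also have "... = (\<Sum>i\<in>I. if i = k then (\<Sum>j\<in>I. y i j * v j x) else 0)"
      using that by (intro sum.cong refl) (simp add: onb_inn[OF u])
    finally show ?thesis using fin that by simp
  qed
  then have appY: "app I Y (u k) = (\<lambda>x. \<Sum>j\<in>I. y k j * v j x)" if "k \<in> I" for k
    using that by blast
  have *: "inn I (v l) (app I Y (u k)) = y k l" if "k \<in> I" "l \<in> I" for k l
  proof -
    have "inn I (v l) (app I Y (u k)) = (\<Sum>j\<in>I. y k j * inn I (v l) (v j))"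
      using that by (simp add: appY inn_sum_right inn_scale_right)
    also have "... = (\<Sum>j\<in>I. if j = l then y k j else 0)"
      using that by (intro sum.cong refl) (auto simp: onb_inn[OF v])
    finally show ?thesis using fin that by simp
  qed
  have "vari I A B s Y = (\<Sum>i\<in>I. \<Sum>j\<in>I. (cmod (inn I (u i) (v j)))\<^sup>2 * (p i)\<^sup>2 / (s * p i + q j))"
    unfolding vari_spec[OF fin sA sB]
  proof (intro sum.cong refl)
    fix i j assume ij: "i \<in> I" "j \<in> I"
    let ?c = "inn I (u i) (v j)" and ?r = "p i / (s * p i + q j)"
    have "?c * y i j = of_real ((cmod ?c)\<^sup>2 * ?r)"
      unfolding y_def of_real_mult complex_norm_square by (simp add: mult_ac)
    then have 1: "Re (?c * y i j) = (cmod ?c)\<^sup>2 * ?r" by (metis Re_complex_of_real)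
    have 2: "(cmod (y i j))\<^sup>2 = (cmod ?c)\<^sup>2 * ?r\<^sup>2"
      unfolding y_def norm_mult complex_mod_cnj norm_of_real power_mult_distrib power2_abs ..
    show "2 * p i * Re (?c * inn I (v j) (app I Y (u i))) - (s * p i + q j) * (cmod (inn I (v j) (app I Y (u i))))\<^sup>2
      = (cmod ?c)\<^sup>2 * (p i)\<^sup>2 / (s * p i + q j)"
      unfolding *[OF ij] 1 2
    proof (cases "s * p i + q j = 0")
      case False
      have "2 * a * (w * (a / d)) - d * (w * (a / d)\<^sup>2) = w * a\<^sup>2 / d" if "d \<noteq> 0" for a d w :: real
        using that by (simp add: power2_eq_square)
      from this[OF False] show "2 * p i * ((cmod ?c)\<^sup>2 * ?r) - (s * p i + q j) * ((cmod ?c)\<^sup>2 * ?r\<^sup>2) = (cmod ?c)\<^sup>2 * (p i)\<^sup>2 / (s * p i + q j)" .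
    qed simp
  qed
  then show ?thesis unfolding Qs_def p_def u_def q_def v_def by blast
qed

lemma pos_Re: "pos I A \<Longrightarrow> 0 \<le> Re (quad I A f)"
  by (simp add: pos_def less_eq_complex_def)

lemma pos_real: "pos I A \<Longrightarrow> quad I A f = of_real (Re (quad I A f))"
  by (simp add: pos_def less_eq_complex_def complex_eq_iff)

lemma pos_specI:
  assumes "spec I p u A" "\<And>k. k \<in> I \<Longrightarrow> 0 \<le> p k" shows "pos I A"
  unfolding pos_def spec_quad[OF assms(1)] using assms(2)
  by (auto simp: less_eq_complex_def intro!: sum_nonneg)

subsection \<open>Relative entropy as a difference of limits\<close>

text \<open>An antiderivative in \<open>s\<close> of \<open>Qs - Tr A / (s + 1)\<close>, as
  \<open>Hs_deriv\<close> shows. The term \<open>ln (s + 1)\<close> compensates the growth of the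
  other logarithm, so that the values at 0 and at infinity are the two terms of the relative
  entropy.\<close>

definition Hs :: "'i set \<Rightarrow> 'i op \<Rightarrow> 'i op \<Rightarrow> real \<Rightarrow> real" where
  "Hs I A B s = (\<Sum>i\<in>I. \<Sum>j\<in>I. (cmod (inn I (evc I A i) (evc I B j)))\<^sup>2 * evl I A i *
     (ln (s * evl I A i + evl I B j) - ln (s + 1)))"

locale supported_pair =
  fixes I :: "'i set" and A B :: "'i op"
  assumes fin: "finite I" and A: "pos I A" and B: "pos I B" and sup: "supp I A B"
begin

lemma sA: "spec I (evl I A) (evc I A) A" and sB: "spec I (evl I B) (evc I B) B"
  by (auto intro!: spec_evl_evc nonneg_quad_herm fin A B)

abbreviation "p \<equiv> evl I A"
abbreviation "q \<equiv> evl I B"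
abbreviation "w i j \<equiv> (cmod (inn I (evc I A i) (evc I B j)))\<^sup>2"

lemma p_nonneg: "i \<in> I \<Longrightarrow> 0 \<le> p i" and q_nonneg: "j \<in> I \<Longrightarrow> 0 \<le> q j"
  using spec_pos_nonneg[OF fin sA A] spec_pos_nonneg[OF fin sB B] by auto

lemma quad_evc: "quad I A (evc I B j) = of_real (\<Sum>i\<in>I. w i j * p i)"
  by (simp add: spec_quad[OF sA] mult.commute)

text \<open>The support condition annihilates every term with \<open>q j = 0\<close>. All logarithms
  and quotients that count then have positive arguments, down to and including
  \<open>s = 0\<close>.\<close>

lemma wp_cases:
  assumes "i \<in> I" "j \<in> I"
  shows "w i j * p i = 0 \<or> (p i > 0 \<and> q j > 0)"
proof (cases "q j = 0")
  case True
  then have "quad I B (evc I B j) = 0" using spec_quad_self[OF fin sB assms(2)] by simp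
  then have "quad I A (evc I B j) = 0" using sup by (simp add: supp_def)
  then have "(\<Sum>i\<in>I. w i j * p i) = 0" unfolding quad_evc by (simp only: of_real_eq_0_iff)
  then have "w i j * p i = 0"
    using assms fin p_nonneg by (subst (asm) sum_nonneg_eq_0_iff) auto
  then show ?thesis ..
next
  case False
  then show ?thesis using p_nonneg[OF assms(1)] q_nonneg[OF assms(2)] by auto
qed

lemma Hs_0: "Hs I A B 0 = trln I A B"
proof -
  have "trln I A B = (\<Sum>j\<in>I. \<Sum>i\<in>I. w i j * p i * ln (q j))"
    by (simp add: trln_spec[OF fin sB] quad_evc sum_distrib_left sum_distrib_right mult_ac)
  then show ?thesis unfolding Hs_def by (subst sum.swap) simp
qed

lemma sum_w: "i \<in> I \<Longrightarrow> (\<Sum>j\<in>I. w i j) = 1"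
proof -
  assume i: "i \<in> I"
  have "cmod (inn I (evc I A i) (evc I B j)) = cmod (inn I (evc I B j) (evc I A i))" for j
    by (metis inn_cnj complex_mod_cnj)
  then have "(\<Sum>j\<in>I. w i j) = (\<Sum>x\<in>I. (cmod (evc I A i x))\<^sup>2)"
    using parseval_norm[OF fin, of "evc I B"] sB by (simp add: spec_def)
  moreover have "complex_of_real (\<Sum>x\<in>I. (cmod (evc I A i x))\<^sup>2) = 1"
    unfolding inn_self[symmetric] using sA i by (simp add: spec_def onb_inn)
  ultimately show ?thesis by (metis of_real_eq_1_iff)
qed

lemma Hs_deriv:
  assumes "0 < s"
  shows "(Hs I A B has_real_derivative Qs I A B s - Re (tr I A) / (s + 1)) (at s)"
proof -
  have "((\<lambda>s. w i j * p i * (ln (s * p i + q j) - ln (s + 1))) has_real_derivative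
      (w i j * (p i)\<^sup>2 / (s * p i + q j) - w i j * p i / (s + 1))) (at s)" if "i \<in> I" "j \<in> I" for i j
    using wp_cases[OF that]
  proof
    assume "p i > 0 \<and> q j > 0"
    then have "s * p i + q j > 0" using assms by (simp add: add_pos_pos)
    then show ?thesis using assms
      by (auto intro!: derivative_eq_intros simp: power2_eq_square algebra_simps divide_inverse)
  next
    assume z: "w i j * p i = 0"
    then have "w i j * (p i)\<^sup>2 = 0" by auto
    with z show ?thesis by (simp only:) simp
  qed
  then have "(Hs I A B has_real_derivative (\<Sum>i\<in>I. \<Sum>j\<in>I. w i j * (p i)\<^sup>2 / (s * p i + q j) - w i j * p i / (s + 1))) (at s)"
    unfolding Hs_def by (intro DERIV_sum)
  also have "(\<Sum>i\<in>I. \<Sum>j\<in>I. w i j * (p i)\<^sup>2 / (s * p i + q j) - w i j * p i / (s + 1)) = Qs I A B s - (\<Sum>i\<in>I. p i * (\<Sum>j\<in>I. w i j)) / (s + 1)"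
    by (simp add: Qs_def sum_subtractf sum_divide_distrib sum_distrib_left mult_ac)
  finally show ?thesis by (simp add: sum_w spec_trace[OF sA])
qed

lemma Hs_cont: "continuous_on {0..} (Hs I A B)"
  unfolding Hs_def
proof (intro continuous_on_sum)
  fix i j assume ij: "i \<in> I" "j \<in> I"
  show "continuous_on {0..} (\<lambda>s. w i j * p i * (ln (s * p i + q j) - ln (s + 1)))"
    using wp_cases[OF ij]
  proof
    assume "p i > 0 \<and> q j > 0"
    then have "s * p i + q j > 0" if "s \<ge> 0" for s using that by (simp add: add_nonneg_pos)
    then show ?thesis by (force intro!: continuous_intros)
  next
    assume z: "w i j * p i = 0"
    show ?thesis unfolding z by simp
  qed
qed

lemma Hs_lim: "(Hs I A B \<longlongrightarrow> trln I A A) at_top"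
proof -
  have "((\<lambda>s. w i j * p i * (ln (s * p i + q j) - ln (s + 1))) \<longlongrightarrow> w i j * p i * ln (p i)) at_top"
    if "i \<in> I" "j \<in> I" for i j
    using wp_cases[OF that]
  proof
    assume pq: "p i > 0 \<and> q j > 0"
    have 1: "((\<lambda>s::real. inverse s) \<longlongrightarrow> 0) at_top" by (rule tendsto_inverse_0_at_top) (rule filterlim_ident)
    have "((\<lambda>s. w i j * p i * (ln (p i + q j * inverse s) - ln (1 + inverse s))) \<longlongrightarrow> w i j * p i * (ln (p i + q j * 0) - ln (1 + 0))) at_top"
      using pq by (intro tendsto_intros 1) auto
    moreover have "\<forall>\<^sub>F s in at_top. w i j * p i * (ln (p i + q j * inverse s) - ln (1 + inverse s)) = w i j * p i * (ln (s * p i + q j) - ln (s + 1))"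
      using eventually_gt_at_top[of 0]
    proof eventually_elim
      case (elim s)
      have "p i + q j * inverse s = (s * p i + q j) / s" "1 + inverse s = (s + 1) / s"
        using elim by (auto simp: field_simps)
      moreover have "s * p i + q j > 0" using pq elim by (simp add: add_pos_pos)
      ultimately have "ln (p i + q j * inverse s) - ln (1 + inverse s) = ln (s * p i + q j) - ln (s + 1)"
        using elim by (simp add: ln_div)
      then show ?case by (simp only:)
    qed
    ultimately show ?thesis using Lim_transform_eventually by force
  next
    assume z: "w i j * p i = 0"
    show ?thesis unfolding z by simp
  qed
  then have "(Hs I A B \<longlongrightarrow> (\<Sum>i\<in>I. \<Sum>j\<in>I. w i j * p i * ln (p i))) at_top"
    unfolding Hs_def by (intro tendsto_sum)
  also have "(\<Sum>i\<in>I. \<Sum>j\<in>I. w i j * p i * ln (p i)) = (\<Sum>i\<in>I. (\<Sum>j\<in>I. w i j) * (p i * ln (p i)))"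
    by (simp add: sum_distrib_left sum_distrib_right mult_ac)
  finally show ?thesis by (simp add: sum_w trln_self[OF fin sA])
qed

end

lemma relent_transfer:
  assumes X: "\<And>x. x \<in> X \<Longrightarrow> supported_pair (I x) (A x) (B x)"
    and K: "\<And>k. k \<in> K \<Longrightarrow> supported_pair (J k) (C k) (D k)"
    and t: "(\<Sum>k\<in>K. Re (tr (J k) (C k))) = (\<Sum>x\<in>X. Re (tr (I x) (A x)))"
    and Q: "\<And>s. 0 < s \<Longrightarrow> (\<Sum>k\<in>K. Qs (J k) (C k) (D k) s) \<le> (\<Sum>x\<in>X. Qs (I x) (A x) (B x) s)"
  shows "(\<Sum>k\<in>K. relent (J k) (C k) (D k)) \<le> (\<Sum>x\<in>X. relent (I x) (A x) (B x))"
proof -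
  define G where "G s = (\<Sum>x\<in>X. Hs (I x) (A x) (B x) s) - (\<Sum>k\<in>K. Hs (J k) (C k) (D k) s)" for s
  have dG: "(G has_real_derivative (\<Sum>x\<in>X. Qs (I x) (A x) (B x) s) - (\<Sum>k\<in>K. Qs (J k) (C k) (D k) s)) (at s)"
    if "0 < s" for s
  proof -
    have "(G has_real_derivative (\<Sum>x\<in>X. Qs (I x) (A x) (B x) s - Re (tr (I x) (A x)) / (s + 1))
       - (\<Sum>k\<in>K. Qs (J k) (C k) (D k) s - Re (tr (J k) (C k)) / (s + 1))) (at s)"
      unfolding G_def
      by (intro DERIV_diff DERIV_sum supported_pair.Hs_deriv X K that)
    then show ?thesis by (simp add: sum_subtractf t flip: sum_divide_distrib)
  qed
  have cG: "continuous_on {0..} G"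
    unfolding G_def by (intro continuous_intros supported_pair.Hs_cont X K)
  have mono: "G 0 \<le> G s" if "0 \<le> s" for s
  proof (rule DERIV_nonneg_imp_increasing_open[OF that])
    show "\<exists>y. (G has_real_derivative y) (at x) \<and> 0 \<le> y" if "0 < x" for x
      using dG[OF that] Q[OF that] by force
    show "continuous_on {0..s} G" by (rule continuous_on_subset[OF cG]) auto
  qed
  have lim: "(G \<longlongrightarrow> (\<Sum>x\<in>X. trln (I x) (A x) (A x)) - (\<Sum>k\<in>K. trln (J k) (C k) (C k))) at_top"
    unfolding G_def by (intro tendsto_intros supported_pair.Hs_lim X K)
  have "G 0 \<le> (\<Sum>x\<in>X. trln (I x) (A x) (A x)) - (\<Sum>k\<in>K. trln (J k) (C k) (C k))"
    by (rule tendsto_lowerbound[OF lim eventually_mono[OF eventually_ge_at_top[of 0]]]) (simp_all add: mono)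
  moreover have "G 0 = (\<Sum>x\<in>X. trln (I x) (A x) (B x)) - (\<Sum>k\<in>K. trln (J k) (C k) (D k))"
    unfolding G_def using supported_pair.Hs_0[OF X] supported_pair.Hs_0[OF K] by simp
  ultimately show ?thesis by (simp add: relent_def sum_subtractf)
qed

subsection \<open>Joint convexity\<close>

lemma quad_sum: "quad I (\<lambda>x y. \<Sum>k\<in>K. A k x y) f = (\<Sum>k\<in>K. quad I (A k) f)"
  unfolding quad_def sum_distrib_left sum_distrib_right by (rule sum3_swap)

lemma tr_sum: "tr I (\<lambda>x y. \<Sum>k\<in>K. A k x y) = (\<Sum>k\<in>K. tr I (A k))"
  unfolding tr_def by (rule sum.swap)

lemma pos_sum: "(\<And>k. k \<in> K \<Longrightarrow> pos I (A k)) \<Longrightarrow> pos I (\<lambda>x y. \<Sum>k\<in>K. A k x y)"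
  unfolding pos_def quad_sum by (auto simp: less_eq_complex_def intro!: sum_nonneg)

lemma supp_sum:
  assumes "finite K" "\<And>k. k \<in> K \<Longrightarrow> pos I (B k)" "\<And>k. k \<in> K \<Longrightarrow> supp I (A k) (B k)"
  shows "supp I (\<lambda>x y. \<Sum>k\<in>K. A k x y) (\<lambda>x y. \<Sum>k\<in>K. B k x y)"
  unfolding supp_def quad_sum
proof (intro allI impI sum.neutral ballI)
  fix f k assume z: "(\<Sum>k\<in>K. quad I (B k) f) = 0" and k: "k \<in> K"
  then have "(\<Sum>k\<in>K. Re (quad I (B k) f)) = 0" by (metis Re_sum zero_complex.sel(1))
  then have "Re (quad I (B k) f) = 0"
    using assms k by (subst (asm) sum_nonneg_eq_0_iff) (auto intro: pos_Re)
  then have "quad I (B k) f = 0" using pos_real[OF assms(2)[OF k], of f] by simp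
  then show "quad I (A k) f = 0" using assms(3)[OF k] by (simp add: supp_def)
qed

lemma vari_sum: "vari I (\<lambda>x y. \<Sum>k\<in>K. A k x y) (\<lambda>x y. \<Sum>k\<in>K. B k x y) s Y = (\<Sum>k\<in>K. vari I (A k) (B k) s Y)"
proof -
  have 1: "(\<Sum>x\<in>I. \<Sum>y\<in>I. (\<Sum>k\<in>K. A k x y) * Y y x) = (\<Sum>k\<in>K. \<Sum>x\<in>I. \<Sum>y\<in>I. A k x y * Y y x)"
    unfolding sum_distrib_right by (rule sum3_swap)
  show ?thesis
    unfolding vari_def quad_sum 1 sum_subtractf sum_distrib_left[symmetric] Re_sum[of _ K]
    by (simp only: sum.swap[of _ K I])
qed

text \<open>\<open>vari\<close> is linear in the pair, so the \<open>Y\<close> that is optimal for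
  the sum competes in every summand. Weights do not appear: by homogeneity they are absorbed into
  the operators.\<close>

lemma relent_convex:
  assumes "finite K" "\<And>k. k \<in> K \<Longrightarrow> supported_pair I (A k) (B k)" "finite I"
  shows "supported_pair I (\<lambda>x y. \<Sum>k\<in>K. A k x y) (\<lambda>x y. \<Sum>k\<in>K. B k x y)"
    and "relent I (\<lambda>x y. \<Sum>k\<in>K. A k x y) (\<lambda>x y. \<Sum>k\<in>K. B k x y) \<le> (\<Sum>k\<in>K. relent I (A k) (B k))"
proof -
  let ?A = "\<lambda>x y. \<Sum>k\<in>K. A k x y" and ?B = "\<lambda>x y. \<Sum>k\<in>K. B k x y"
  show sp: "supported_pair I ?A ?B"
    using assms by (auto simp: supported_pair_def intro!: pos_sum supp_sum)
  have Q: "Qs I ?A ?B s \<le> (\<Sum>k\<in>K. Qs I (A k) (B k) s)" if "0 < s" for s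
  proof -
    have "\<exists>Y. vari I ?A ?B s Y = Qs I ?A ?B s"
      using sp that unfolding supported_pair_def by (intro vari_attained) auto
    then obtain Y where "vari I ?A ?B s Y = Qs I ?A ?B s" ..
    then have "Qs I ?A ?B s = (\<Sum>k\<in>K. vari I (A k) (B k) s Y)" by (simp add: vari_sum)
    also have "... \<le> (\<Sum>k\<in>K. Qs I (A k) (B k) s)"
      using assms that by (intro sum_mono vari_le_Qs) (auto simp: supported_pair_def)
    finally show ?thesis .
  qed
  have "(\<Sum>k\<in>{()}. relent I ?A ?B) \<le> (\<Sum>k\<in>K. relent I (A k) (B k))"
    by (rule relent_transfer) (use assms sp Q in \<open>auto simp: tr_sum\<close>)
  then show "relent I ?A ?B \<le> (\<Sum>k\<in>K. relent I (A k) (B k))" by simp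
qed

subsection \<open>Monotonicity under measurements\<close>

definition sand :: "'i set \<Rightarrow> ('j \<Rightarrow> 'i \<Rightarrow> complex) \<Rightarrow> 'i op \<Rightarrow> 'j \<Rightarrow> 'j \<Rightarrow> complex" where
  "sand I K A x y = (\<Sum>a\<in>I. \<Sum>b\<in>I. K x a * A a b * cnj (K y b))"

definition adj :: "'j set \<Rightarrow> ('j \<Rightarrow> 'i \<Rightarrow> complex) \<Rightarrow> ('j \<Rightarrow> complex) \<Rightarrow> 'i \<Rightarrow> complex" where
  "adj J K f a = (\<Sum>x\<in>J. cnj (K x a) * f x)"

text \<open>The output set \<open>J k\<close> depends on the outcome just as the output dimension in
  \<open>locc\<close> does.\<close>

definition kraus :: "'i set \<Rightarrow> 'k set \<Rightarrow> ('k \<Rightarrow> 'j set) \<Rightarrow> ('k \<Rightarrow> 'j \<Rightarrow> 'i \<Rightarrow> complex) \<Rightarrow> bool" where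
  "kraus I R J K \<longleftrightarrow> (\<forall>a\<in>I. \<forall>b\<in>I. (\<Sum>k\<in>R. \<Sum>x\<in>J k. cnj (K k x a) * K k x b) = (if a = b then 1 else 0))"

lemma sum4_swap: "(\<Sum>x\<in>A. \<Sum>y\<in>B. \<Sum>k\<in>K. \<Sum>l\<in>L. g x y k l) = (\<Sum>k\<in>K. \<Sum>l\<in>L. \<Sum>x\<in>A. \<Sum>y\<in>B. g x y k l)"
proof -
  have "(\<Sum>x\<in>A. \<Sum>y\<in>B. \<Sum>k\<in>K. \<Sum>l\<in>L. g x y k l) = (\<Sum>k\<in>K. \<Sum>x\<in>A. \<Sum>y\<in>B. \<Sum>l\<in>L. g x y k l)"
    by (rule sum3_swap)
  also have "... = (\<Sum>k\<in>K. \<Sum>l\<in>L. \<Sum>x\<in>A. \<Sum>y\<in>B. g x y k l)" by (intro sum.cong refl sum3_swap)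
  finally show ?thesis .
qed

lemma quad_sand: "quad J (sand I K A) f = quad I A (adj J K f)"
proof -
  have "quad J (sand I K A) f = (\<Sum>x\<in>J. \<Sum>y\<in>J. \<Sum>a\<in>I. \<Sum>b\<in>I. (cnj (f x) * K x a) * A a b * (cnj (K y b) * f y))"
    by (simp add: quad_def sand_def sum_distrib_left sum_distrib_right mult_ac)
  also have "... = (\<Sum>a\<in>I. \<Sum>b\<in>I. \<Sum>x\<in>J. \<Sum>y\<in>J. (cnj (f x) * K x a) * A a b * (cnj (K y b) * f y))"
    by (rule sum4_swap)
  also have "... = quad I A (adj J K f)"
    unfolding quad_def
  proof (intro sum.cong refl)
    fix a b
    have "cnj (adj J K f a) = (\<Sum>x\<in>J. cnj (f x) * K x a)" by (simp add: adj_def mult.commute)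
    then show "(\<Sum>x\<in>J. \<Sum>y\<in>J. (cnj (f x) * K x a) * A a b * (cnj (K y b) * f y)) = cnj (adj J K f a) * A a b * adj J K f b"
      by (simp only: adj_def sum_distrib_left sum_distrib_right) (rule sum.swap)
  qed
  finally show ?thesis .
qed

lemma pos_sand: "pos I A \<Longrightarrow> pos J (sand I K A)"
  by (simp add: pos_def quad_sand)

lemma supp_sand: "supp I A B \<Longrightarrow> supp J (sand I K A) (sand I K B)"
  by (simp add: supp_def quad_sand)

lemma inn_adj: "inn I v (adj J K f) = inn J (app I K v) f"
  unfolding inn_def adj_def app_def by (simp add: sum_distrib_left sum_distrib_right mult_ac, rule sum.swap)

lemma tr_sand_sum:
  assumes fin: "finite I" and K: "kraus I R J K"
  shows "(\<Sum>k\<in>R. tr (J k) (sand I (K k) A)) = tr I A"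
proof -
  have "(\<Sum>k\<in>R. tr (J k) (sand I (K k) A)) = (\<Sum>k\<in>R. \<Sum>x\<in>J k. \<Sum>a\<in>I. \<Sum>b\<in>I. A a b * (cnj (K k x b) * K k x a))"
    by (simp add: tr_def sand_def mult_ac)
  also have "... = (\<Sum>k\<in>R. \<Sum>a\<in>I. \<Sum>b\<in>I. \<Sum>x\<in>J k. A a b * (cnj (K k x b) * K k x a))"
    by (intro sum.cong refl sum3_swap[symmetric])
  also have "... = (\<Sum>a\<in>I. \<Sum>b\<in>I. \<Sum>k\<in>R. \<Sum>x\<in>J k. A a b * (cnj (K k x b) * K k x a))"
    by (rule sum3_swap[symmetric])
  also have "... = (\<Sum>a\<in>I. \<Sum>b\<in>I. if b = a then A a b else 0)"
    using K unfolding kraus_def by (intro sum.cong refl) (auto simp flip: sum_distrib_left)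
  finally show ?thesis using fin by (simp add: tr_def)
qed

text \<open>Stacked over \<open>k\<close>, the operators form an isometry, whose adjoint is a
  contraction. With \<open>z\<close> the image of \<open>w\<close> under the adjoint,
  \<open>W - N\<close> is the squared distance of \<open>w\<close> from the isometric image of
  \<open>z\<close>.\<close>

lemma contraction:
  assumes fin: "finite I" and K: "kraus I R J K"
  shows "(\<Sum>a\<in>I. (cmod (\<Sum>k\<in>R. adj (J k) (K k) (w k) a))\<^sup>2) \<le> (\<Sum>k\<in>R. \<Sum>x\<in>J k. (cmod (w k x))\<^sup>2)"
proof -
  define z where "z a = (\<Sum>k\<in>R. adj (J k) (K k) (w k) a)" for a
  define N W where "N = (\<Sum>a\<in>I. (cmod (z a))\<^sup>2)" and "W = (\<Sum>k\<in>R. \<Sum>x\<in>J k. (cmod (w k x))\<^sup>2)"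
  have N: "inn I z z = of_real N" by (simp add: inn_self N_def)
  have 1: "(\<Sum>k\<in>R. inn (J k) (app I (K k) z) (w k)) = of_real N"
  proof -
    have "(\<Sum>k\<in>R. inn (J k) (app I (K k) z) (w k)) = inn I z (\<lambda>a. \<Sum>k\<in>R. adj (J k) (K k) (w k) a)"
      unfolding inn_sum_right inn_adj ..
    then show ?thesis by (simp add: N flip: z_def)
  qed
  have 2: "(\<Sum>k\<in>R. inn (J k) (app I (K k) z) (app I (K k) z)) = of_real N"
  proof -
    have "(\<Sum>k\<in>R. inn (J k) (app I (K k) z) (app I (K k) z)) = (\<Sum>k\<in>R. \<Sum>x\<in>J k. \<Sum>a\<in>I. \<Sum>b\<in>I. cnj (z a) * z b * (cnj (K k x a) * K k x b))"
      unfolding inn_def app_def cnj_sum sum_product by (simp add: mult_ac)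
    also have "... = (\<Sum>k\<in>R. \<Sum>a\<in>I. \<Sum>b\<in>I. \<Sum>x\<in>J k. cnj (z a) * z b * (cnj (K k x a) * K k x b))"
      by (intro sum.cong refl sum3_swap[symmetric])
    also have "... = (\<Sum>a\<in>I. \<Sum>b\<in>I. \<Sum>k\<in>R. \<Sum>x\<in>J k. cnj (z a) * z b * (cnj (K k x a) * K k x b))"
      by (rule sum3_swap[symmetric])
    also have "... = (\<Sum>a\<in>I. \<Sum>b\<in>I. if b = a then cnj (z a) * z b else 0)"
      using K unfolding kraus_def by (intro sum.cong refl) (auto simp flip: sum_distrib_left)
    also have "... = inn I z z" using fin by (simp add: inn_def)
    finally show ?thesis by (simp add: N)
  qed
  have 3: "(\<Sum>k\<in>R. inn (J k) (w k) (w k)) = of_real W" by (simp add: inn_self W_def)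
  have 4: "(\<Sum>k\<in>R. inn (J k) (w k) (app I (K k) z)) = of_real N"
  proof -
    have "(\<Sum>k\<in>R. inn (J k) (w k) (app I (K k) z)) = cnj (\<Sum>k\<in>R. inn (J k) (app I (K k) z) (w k))"
      by (simp add: inn_cnj)
    then show ?thesis by (simp add: 1)
  qed
  have "of_real (\<Sum>k\<in>R. \<Sum>x\<in>J k. (cmod (w k x - app I (K k) z x))\<^sup>2)
    = (\<Sum>k\<in>R. inn (J k) (\<lambda>x. w k x - app I (K k) z x) (\<lambda>x. w k x - app I (K k) z x))"
    by (simp add: inn_self)
  also have "... = (\<Sum>k\<in>R. inn (J k) (w k) (w k) - inn (J k) (w k) (app I (K k) z)
      - inn (J k) (app I (K k) z) (w k) + inn (J k) (app I (K k) z) (app I (K k) z))"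
    by (intro sum.cong refl) (simp add: inn_def sum_subtractf sum.distrib algebra_simps)
  also have "... = of_real (W - N)" unfolding sum.distrib sum_subtractf 1 2 3 4 by simp
  finally have "W - N = (\<Sum>k\<in>R. \<Sum>x\<in>J k. (cmod (w k x - app I (K k) z x))\<^sup>2)" by (simp only: of_real_eq_iff)
  then have "N \<le> W" by (smt (verit) sum_nonneg zero_le_power2)
  then show ?thesis by (simp add: N_def W_def z_def)
qed

text \<open>With \<open>Z = \<Sum>k. K_k^* Y_k K_k\<close>, this is
  \<open>Z Z^* \<le> \<Sum>k. K_k^* Y_k Y_k^* K_k\<close> integrated against \<open>A\<close>. It
  holds at each eigenvector \<open>v\<close> of \<open>A\<close> by \<open>contraction\<close> for
  the vectors \<open>Y_k^* K_k v\<close>.\<close>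

lemma kadison_schwarz:
  assumes fin: "finite I" and K: "kraus I R J K" and A: "pos I A"
  shows "(\<Sum>z\<in>I. Re (quad I A (\<lambda>a. \<Sum>k\<in>R. \<Sum>x\<in>J k. \<Sum>y\<in>J k. cnj (K k x a) * Y k x y * K k y z)))
    \<le> (\<Sum>k\<in>R. \<Sum>z\<in>J k. Re (quad (J k) (sand I (K k) A) (\<lambda>x. Y k x z)))"
proof -
  have sA: "spec I (evl I A) (evc I A) A" by (intro spec_evl_evc nonneg_quad_herm fin A)
  define p v where "p = evl I A" and "v = evc I A"
  define g where "g j k y = inn (J k) (app I (K k) (v j)) (\<lambda>x. Y k x y)" for j k y
  let ?Y = "\<lambda>z a. \<Sum>k\<in>R. \<Sum>x\<in>J k. \<Sum>y\<in>J k. cnj (K k x a) * Y k x y * K k y z"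
  have 1: "cmod (inn I (v j) (?Y z)) = cmod (\<Sum>k\<in>R. adj (J k) (K k) (\<lambda>y. cnj (g j k y)) z)" for j z
  proof -
    have Yz: "?Y z = (\<lambda>a. \<Sum>k\<in>R. \<Sum>y\<in>J k. K k y z * adj (J k) (K k) (\<lambda>x. Y k x y) a)"
    proof
      fix a
      have "?Y z a = (\<Sum>k\<in>R. \<Sum>y\<in>J k. \<Sum>x\<in>J k. cnj (K k x a) * Y k x y * K k y z)"
        by (intro sum.cong refl sum.swap)
      then show "?Y z a = (\<Sum>k\<in>R. \<Sum>y\<in>J k. K k y z * adj (J k) (K k) (\<lambda>x. Y k x y) a)"
        by (simp add: adj_def sum_distrib_left mult_ac)
    qed
    have "inn I (v j) (?Y z) = (\<Sum>k\<in>R. \<Sum>y\<in>J k. K k y z * g j k y)"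
      unfolding Yz inn_sum_right inn_scale_right inn_adj g_def ..
    also have "... = cnj (\<Sum>k\<in>R. adj (J k) (K k) (\<lambda>y. cnj (g j k y)) z)"
      by (simp add: adj_def)
    finally show ?thesis by (simp only: complex_mod_cnj)
  qed
  have "(\<Sum>z\<in>I. Re (quad I A (?Y z))) = (\<Sum>z\<in>I. \<Sum>j\<in>I. p j * (cmod (inn I (v j) (?Y z)))\<^sup>2)"
    by (simp add: spec_quad[OF sA] p_def v_def)
  also have "... = (\<Sum>j\<in>I. p j * (\<Sum>z\<in>I. (cmod (\<Sum>k\<in>R. adj (J k) (K k) (\<lambda>y. cnj (g j k y)) z))\<^sup>2))"
    unfolding 1 by (subst sum.swap) (simp add: sum_distrib_left)
  also have "... \<le> (\<Sum>j\<in>I. p j * (\<Sum>k\<in>R. \<Sum>y\<in>J k. (cmod (cnj (g j k y)))\<^sup>2))"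
    using spec_pos_nonneg[OF fin sA A] unfolding p_def
    by (intro sum_mono mult_left_mono contraction[OF fin K]) auto
  also have "... = (\<Sum>j\<in>I. \<Sum>k\<in>R. \<Sum>y\<in>J k. p j * (cmod (g j k y))\<^sup>2)"
    by (simp add: sum_distrib_left)
  also have "... = (\<Sum>k\<in>R. \<Sum>j\<in>I. \<Sum>y\<in>J k. p j * (cmod (g j k y))\<^sup>2)"
    by (rule sum.swap)
  also have "... = (\<Sum>k\<in>R. \<Sum>y\<in>J k. \<Sum>j\<in>I. p j * (cmod (g j k y))\<^sup>2)"
    by (intro sum.cong refl sum.swap)
  also have "... = (\<Sum>k\<in>R. \<Sum>z\<in>J k. Re (quad (J k) (sand I (K k) A) (\<lambda>x. Y k x z)))"
    by (simp add: quad_sand spec_quad[OF sA] p_def v_def inn_adj g_def)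
  finally show ?thesis .
qed

lemma supported_sand: "\<lbrakk>supported_pair I A B; finite J\<rbrakk> \<Longrightarrow> supported_pair J (sand I K A) (sand I K B)"
  by (simp add: supported_pair_def pos_sand supp_sand)

theorem relent_kraus:
  assumes sp: "supported_pair I A B" and K: "kraus I R J K" and finJ: "\<And>k. k \<in> R \<Longrightarrow> finite (J k)"
  shows "(\<Sum>k\<in>R. relent (J k) (sand I (K k) A) (sand I (K k) B)) \<le> relent I A B"
proof -
  interpret supported_pair I A B by fact
  note finI = fin
  have Q: "(\<Sum>k\<in>R. Qs (J k) (sand I (K k) A) (sand I (K k) B) s) \<le> Qs I A B s" if s: "0 < s" for s
  proof -
    have "\<exists>Y. vari (J k) (sand I (K k) A) (sand I (K k) B) s Y = Qs (J k) (sand I (K k) A) (sand I (K k) B) s"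
      if "k \<in> R" for k
      using A B s by (intro vari_attained finJ that pos_sand)
    then obtain Y where Y: "\<And>k. k \<in> R \<Longrightarrow> vari (J k) (sand I (K k) A) (sand I (K k) B) s (Y k) = Qs (J k) (sand I (K k) A) (sand I (K k) B) s"
      by metis
    \<comment> \<open>The optimal operators after the measurement, pulled back to the input. The
      linear term of \<open>vari\<close> is preserved exactly; the two quadratic terms can only
      shrink.\<close>
    define Z where "Z a b = (\<Sum>k\<in>R. \<Sum>x\<in>J k. \<Sum>y\<in>J k. cnj (K k x a) * Y k x y * K k y b)" for a b
    have 1: "(\<Sum>k\<in>R. \<Sum>x\<in>J k. \<Sum>y\<in>J k. sand I (K k) A x y * Y k y x) = (\<Sum>a\<in>I. \<Sum>b\<in>I. A a b * Z b a)"
    proof -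
      have "(\<Sum>k\<in>R. \<Sum>x\<in>J k. \<Sum>y\<in>J k. sand I (K k) A x y * Y k y x)
        = (\<Sum>k\<in>R. \<Sum>y\<in>J k. \<Sum>x\<in>J k. \<Sum>a\<in>I. \<Sum>b\<in>I. A a b * (cnj (K k y b) * Y k y x * K k x a))"
        by (subst sum.swap) (simp add: sand_def sum_distrib_left sum_distrib_right mult_ac)
      also have "... = (\<Sum>k\<in>R. \<Sum>a\<in>I. \<Sum>b\<in>I. \<Sum>y\<in>J k. \<Sum>x\<in>J k. A a b * (cnj (K k y b) * Y k y x * K k x a))"
        by (intro sum.cong refl sum4_swap)
      also have "... = (\<Sum>a\<in>I. \<Sum>b\<in>I. \<Sum>k\<in>R. \<Sum>y\<in>J k. \<Sum>x\<in>J k. A a b * (cnj (K k y b) * Y k y x * K k x a))"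
        by (rule sum3_swap[symmetric])
      finally show ?thesis by (simp add: Z_def sum_distrib_left)
    qed
    have 2: "(\<Sum>z\<in>I. Re (quad I B (\<lambda>x. Z x z))) \<le> (\<Sum>k\<in>R. \<Sum>z\<in>J k. Re (quad (J k) (sand I (K k) B) (\<lambda>x. Y k x z)))"
      unfolding Z_def by (rule kadison_schwarz[OF finI K B])
    \<comment> \<open>Here the factors stand in the other order. Pulling back commutes with
      adjoints, so the same inequality is applied to the adjoints of the \<open>Y k\<close>.\<close>
    have 3: "(\<Sum>z\<in>I. Re (quad I A (\<lambda>x. cnj (Z z x)))) \<le> (\<Sum>k\<in>R. \<Sum>z\<in>J k. Re (quad (J k) (sand I (K k) A) (\<lambda>x. cnj (Y k z x))))"
    proof -
      have "cnj (Z z a) = (\<Sum>k\<in>R. \<Sum>x\<in>J k. \<Sum>y\<in>J k. cnj (K k x a) * cnj (Y k y x) * K k y z)" for z a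
      proof -
        have "cnj (Z z a) = (\<Sum>k\<in>R. \<Sum>x\<in>J k. \<Sum>y\<in>J k. cnj (K k y a) * cnj (Y k x y) * K k x z)"
          by (simp add: Z_def mult_ac)
        also have "... = (\<Sum>k\<in>R. \<Sum>y\<in>J k. \<Sum>x\<in>J k. cnj (K k y a) * cnj (Y k x y) * K k x z)"
          by (intro sum.cong refl sum.swap)
        finally show ?thesis .
      qed
      then show ?thesis using kadison_schwarz[OF finI K A, of "\<lambda>k x y. cnj (Y k y x)"] by (simp only:)
    qed
    have "(\<Sum>k\<in>R. Qs (J k) (sand I (K k) A) (sand I (K k) B) s) = (\<Sum>k\<in>R. vari (J k) (sand I (K k) A) (sand I (K k) B) s (Y k))"
      by (simp add: Y)
    also have "... = 2 * Re (\<Sum>k\<in>R. \<Sum>x\<in>J k. \<Sum>y\<in>J k. sand I (K k) A x y * Y k y x)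
      - s * (\<Sum>k\<in>R. \<Sum>z\<in>J k. Re (quad (J k) (sand I (K k) A) (\<lambda>x. cnj (Y k z x))))
      - (\<Sum>k\<in>R. \<Sum>z\<in>J k. Re (quad (J k) (sand I (K k) B) (\<lambda>x. Y k x z)))"
      unfolding vari_def sum_subtractf sum_distrib_left[symmetric] Re_sum[of _ R] ..
    also have "... \<le> vari I A B s Z"
      unfolding vari_def 1 using 2 mult_left_mono[OF 3, of s] s by linarith
    also have "... \<le> Qs I A B s" by (rule vari_le_Qs[OF finI A B s])
    finally show ?thesis .
  qed
  have t: "(\<Sum>k\<in>R. Re (tr (J k) (sand I (K k) A))) = Re (tr I A)"
    unfolding Re_sum[symmetric] tr_sand_sum[OF finI K] ..
  show ?thesis
    using relent_transfer[of "{()}" "\<lambda>_. I" "\<lambda>_. A" "\<lambda>_. B" R J "\<lambda>k. sand I (K k) A" "\<lambda>k. sand I (K k) B"]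
      sp supported_sand[OF sp finJ] t Q by simp
qed

lemma relent_unit:
  assumes "pos {()} A" "pos {()} B"
  shows "relent {()} A B = Re (A () ()) * ln (Re (A () ())) - Re (A () ()) * ln (Re (B () ()))"
proof -
  have q: "quad {()} C (\<lambda>_. 1) = C () ()" for C by (simp add: quad_def)
  have "spec {()} (\<lambda>_. Re (C () ())) (\<lambda>_ _. 1) C" if "pos {()} C" for C
    using pos_real[OF that, of "\<lambda>_. 1"] by (auto simp: spec_def onb_def inn_def q)
  from trln_spec[OF _ this[OF assms(1)], of A] trln_spec[OF _ this[OF assms(2)], of A]
  show ?thesis by (simp add: relent_def q)
qed

text \<open>The rank-one measurement with rows \<open>r t\<close> leaves scalars \<open>a\<close>
  and \<open>b\<close>, for which \<open>a ln (a / b) \<ge> a ln z + a - z b\<close> by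
  \<open>ln x \<le> x - 1\<close> at \<open>x = z b / a\<close>. For fixed slopes \<open>z t\<close>
  the bound is linear in the pair, and each application chooses the slopes.\<close>

lemma relent_ge_test:
  assumes sp: "supported_pair I A B" and T: "finite T"
    and r: "\<And>a b. a \<in> I \<Longrightarrow> b \<in> I \<Longrightarrow> (\<Sum>t\<in>T. cnj (r t a) * r t b) = (if a = b then 1 else 0)"
    and z: "\<And>t. t \<in> T \<Longrightarrow> 0 < z t"
  defines "\<alpha> \<equiv> \<lambda>C t. Re (quad I C (\<lambda>a. cnj (r t a)))"
  shows "(\<Sum>t\<in>T. \<alpha> A t * ln (z t) + \<alpha> A t - z t * \<alpha> B t) \<le> relent I A B"
proof -
  interpret supported_pair I A B by fact
  let ?K = "\<lambda>t (u::unit) a. r t a"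
  have s: "sand I (?K t) C () () = quad I C (\<lambda>a. cnj (r t a))" for t C
    by (simp add: sand_def quad_def)
  have "kraus I T (\<lambda>_. {()}) ?K" using r by (simp add: kraus_def)
  from relent_kraus[OF sp this]
  have le: "(\<Sum>t\<in>T. relent {()} (sand I (?K t) A) (sand I (?K t) B)) \<le> relent I A B" by simp
  have *: "\<alpha> A t * ln (z t) + \<alpha> A t - z t * \<alpha> B t \<le> relent {()} (sand I (?K t) A) (sand I (?K t) B)"
    if "t \<in> T" for t
  proof -
    have nn: "0 \<le> \<alpha> A t" "0 \<le> \<alpha> B t" using A B by (auto simp: \<alpha>_def pos_Re)
    have zt: "z t > 0" using z that .
    have ab: "\<alpha> A t = 0" if "\<alpha> B t = 0"
    proof -
      have "quad I B (\<lambda>a. cnj (r t a)) = 0" using pos_real[OF B] that unfolding \<alpha>_def by (metis of_real_0)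
      then have "quad I A (\<lambda>a. cnj (r t a)) = 0" using sup by (simp add: supp_def)
      then show ?thesis by (simp add: \<alpha>_def)
    qed
    have "relent {()} (sand I (?K t) A) (sand I (?K t) B) = \<alpha> A t * ln (\<alpha> A t) - \<alpha> A t * ln (\<alpha> B t)"
      by (subst relent_unit) (simp_all add: pos_sand A B s \<alpha>_def)
    moreover have "\<alpha> A t * ln (z t) + \<alpha> A t - z t * \<alpha> B t \<le> \<alpha> A t * ln (\<alpha> A t) - \<alpha> A t * ln (\<alpha> B t)"
    proof (cases "\<alpha> A t = 0")
      case True
      then show ?thesis using nn zt by simp
    next
      case False
      then have p: "\<alpha> A t > 0" "\<alpha> B t > 0" using nn ab by (auto simp: less_le)
      have "ln (z t * \<alpha> B t / \<alpha> A t) \<le> z t * \<alpha> B t / \<alpha> A t - 1"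
        using p zt by (intro ln_le_minus_one) simp
      then have "\<alpha> A t * (ln (z t) + ln (\<alpha> B t) - ln (\<alpha> A t)) \<le> \<alpha> A t * (z t * \<alpha> B t / \<alpha> A t - 1)"
        using p zt by (intro mult_left_mono) (simp_all add: ln_mult ln_div)
      then show ?thesis using p by (simp add: algebra_simps)
    qed
    ultimately show ?thesis by simp
  qed
  have "(\<Sum>t\<in>T. \<alpha> A t * ln (z t) + \<alpha> A t - z t * \<alpha> B t)
      \<le> (\<Sum>t\<in>T. relent {()} (sand I (?K t) A) (sand I (?K t) B))"
    by (rule sum_mono) (rule *)
  with le show ?thesis by simp
qed

section \<open>Entropies of composite systems\<close>

definition ent :: "'i set \<Rightarrow> 'i op \<Rightarrow> real" where
  "ent I A = - trln I A A"

lemma ent_spec: "\<lbrakk>finite I; spec I p u A\<rbrakk> \<Longrightarrow> ent I A = - (\<Sum>k\<in>I. p k * ln (p k))"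
  by (simp add: ent_def trln_self)

lemma mfun_cong:
  assumes "\<And>x y. x \<in> I \<Longrightarrow> y \<in> I \<Longrightarrow> A x y = B x y" shows "mfun I g A = mfun I g B"
proof -
  have "spec I p u A = spec I p u B" for p u using assms by (auto simp: spec_def)
  then have *: "evl I A = evl I B" "evc I A = evc I B" by (simp_all add: evl_def evc_def)
  show ?thesis by (intro ext) (simp add: mfun_def *)
qed

lemma trln_cong:
  assumes "\<And>x y. x \<in> I \<Longrightarrow> y \<in> I \<Longrightarrow> A x y = A' x y" "\<And>x y. x \<in> I \<Longrightarrow> y \<in> I \<Longrightarrow> B x y = B' x y"
  shows "trln I A B = trln I A' B'"
  using assms mfun_cong[of I B B'] by (simp add: trln_def)

lemma ent_cong: "(\<And>x y. x \<in> I \<Longrightarrow> y \<in> I \<Longrightarrow> A x y = A' x y) \<Longrightarrow> ent I A = ent I A'"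
  unfolding ent_def by (intro arg_cong[where f = uminus] trln_cong) auto

lemma quad_cong: "\<lbrakk>\<And>x y. x \<in> I \<Longrightarrow> y \<in> I \<Longrightarrow> A x y = B x y; \<And>x. x \<in> I \<Longrightarrow> f x = g x\<rbrakk> \<Longrightarrow> quad I A f = quad I B g"
  by (simp add: quad_def)

lemma pos_cong: "(\<And>x y. x \<in> I \<Longrightarrow> y \<in> I \<Longrightarrow> A x y = B x y) \<Longrightarrow> pos I A = pos I B"
  using quad_cong[of I A B] by (auto simp: pos_def)

lemma quad_reindex:
  assumes "bij_betw h J I" shows "quad I A f = quad J (\<lambda>x y. A (h x) (h y)) (\<lambda>x. f (h x))"
proof -
  have "quad I A f = (\<Sum>x\<in>J. \<Sum>y\<in>I. cnj (f (h x)) * A (h x) y * f y)"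
    unfolding quad_def by (rule sum.reindex_bij_betw[OF assms, symmetric])
  also have "... = (\<Sum>x\<in>J. \<Sum>y\<in>J. cnj (f (h x)) * A (h x) (h y) * f (h y))"
    by (intro sum.cong refl sum.reindex_bij_betw[OF assms, symmetric])
  finally show ?thesis by (simp add: quad_def)
qed

lemma pos_reindex:
  assumes "bij_betw h J I" "pos I A" shows "pos J (\<lambda>x y. A (h x) (h y))"
proof -
  have "quad J (\<lambda>x y. A (h x) (h y)) f = quad I A (\<lambda>x. f (inv_into J h x))" for f
    unfolding quad_reindex[OF assms(1), of A]
    using assms(1) by (intro quad_cong) (auto simp: bij_betw_def inv_into_f_f)
  then show ?thesis using assms(2) by (simp add: pos_def)
qed

lemma trln_reindex:
  assumes fin: "finite I" and b: "bij_betw h J I" and B: "herm I B"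
  shows "trln J (\<lambda>x y. A (h x) (h y)) (\<lambda>x y. B (h x) (h y)) = trln I A B"
proof -
  have s: "spec I (evl I B) (evc I B) B" by (intro spec_evl_evc fin B)
  have finJ: "finite J" using b fin bij_betw_finite by blast
  show ?thesis
    unfolding trln_spec[OF fin s] trln_spec[OF finJ spec_reindex[OF b s]] comp_def
    using quad_reindex[OF b, of A "evc I B _"] sum.reindex_bij_betw[OF b, of "\<lambda>j. ln (evl I B j) * Re (quad I A (evc I B j))"]
    by simp
qed

lemma ent_reindex:
  assumes "finite I" "bij_betw h J I" "herm I A"
  shows "ent J (\<lambda>x y. A (h x) (h y)) = ent I A"
  using trln_reindex[OF assms] by (simp add: ent_def)

lemma trln_sum_left: "trln I (\<lambda>x y. \<Sum>k\<in>K. A k x y) B = (\<Sum>k\<in>K. trln I (A k) B)"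
proof -
  have "(\<Sum>x\<in>I. \<Sum>y\<in>I. (\<Sum>k\<in>K. A k x y) * mfun I ln B y x) = (\<Sum>k\<in>K. \<Sum>x\<in>I. \<Sum>y\<in>I. A k x y * mfun I ln B y x)"
    unfolding sum_distrib_right by (rule sum3_swap)
  then show ?thesis unfolding trln_def Re_sum[of _ K, symmetric] by (rule arg_cong)
qed

lemma pos_herm: "\<lbrakk>finite I; pos I A\<rbrakk> \<Longrightarrow> herm I A" by (rule nonneg_quad_herm)

subsection \<open>Block diagonal operators\<close>

definition bdiag :: "('k \<Rightarrow> 'j \<Rightarrow> 'j \<Rightarrow> complex) \<Rightarrow> 'k \<times> 'j \<Rightarrow> 'k \<times> 'j \<Rightarrow> complex" where
  "bdiag B x y = (if fst x = fst y then B (fst x) (snd x) (snd y) else 0)"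

definition block :: "('k \<times> 'j) op \<Rightarrow> 'k \<Rightarrow> 'j \<Rightarrow> 'j \<Rightarrow> complex" where
  "block A i x y = A (i, x) (i, y)"

lemma sum_Times: "(\<Sum>x\<in>A \<times> B. g x) = (\<Sum>a\<in>A. \<Sum>b\<in>B. g (a, b))"
  by (simp add: sum.cartesian_product)

lemma sum_delta2:
  assumes "finite A" "a \<in> A"
  shows "(\<Sum>i\<in>A. \<Sum>x\<in>B. if i = a then g x else 0) = (\<Sum>x\<in>B. g x :: complex)"
proof -
  have "(\<Sum>i\<in>A. \<Sum>x\<in>B. if i = a then g x else 0) = (\<Sum>i\<in>A. if i = a then (\<Sum>x\<in>B. g x) else 0)"
    by (intro sum.cong) auto
  then show ?thesis using assms by simp
qed

lemma spec_bdiag: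
  assumes K: "finite K" and J: "finite J" and s: "\<And>i. i \<in> K \<Longrightarrow> spec J (p i) (u i) (B i)"
  shows "spec (K \<times> J) (\<lambda>x. p (fst x) (snd x)) (\<lambda>k x. if fst k = fst x then u (fst k) (snd k) (snd x) else 0) (bdiag B)"
proof -
  let ?u = "\<lambda>k x. if fst k = fst x then u (fst k) (snd k) (snd x) else 0"
  have o: "onb J (u i)" if "i \<in> K" for i using s[OF that] by (simp add: spec_def)
  have f1: "inn (K \<times> J) (?u k) (?u l) = (if k = l then 1 else 0)" if k: "k \<in> K \<times> J" and l: "l \<in> K \<times> J" for k l
  proof -
    have "inn (K \<times> J) (?u k) (?u l) = (\<Sum>i\<in>K. \<Sum>x\<in>J. if i = fst k then (if fst k = fst l then cnj (u (fst k) (snd k) x) * u (fst l) (snd l) x else 0) else 0)"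
      unfolding inn_def sum_Times by (intro sum.cong refl) auto
    also have "... = (\<Sum>x\<in>J. if fst k = fst l then cnj (u (fst k) (snd k) x) * u (fst l) (snd l) x else 0)"
      using K k by (intro sum_delta2) auto
    also have "... = (if fst k = fst l then inn J (u (fst k) (snd k)) (u (fst k) (snd l)) else 0)"
      by (simp add: inn_def)
    finally show ?thesis using k l o[of "fst k"] by (auto simp: onb_inn prod_eq_iff)
  qed
  have *: "(\<Sum>k\<in>K \<times> J. g k * ?u k x * cnj (?u k y)) = (if fst x = fst y then (\<Sum>k\<in>J. g (fst x, k) * u (fst x) k (snd x) * cnj (u (fst x) k (snd y))) else 0)"
    if x: "x \<in> K \<times> J" for x y g
  proof -
    have "(\<Sum>k\<in>K \<times> J. g k * ?u k x * cnj (?u k y)) = (\<Sum>i\<in>K. \<Sum>k\<in>J. if i = fst x then (if fst x = fst y then g (fst x, k) * u (fst x) k (snd x) * cnj (u (fst x) k (snd y)) else 0) else 0)"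
      unfolding sum_Times by (intro sum.cong refl) auto
    also have "... = (\<Sum>k\<in>J. if fst x = fst y then g (fst x, k) * u (fst x) k (snd x) * cnj (u (fst x) k (snd y)) else 0)"
      using K x by (intro sum_delta2) auto
    finally show ?thesis by simp
  qed
  have f2: "(\<Sum>k\<in>K \<times> J. ?u k x * cnj (?u k y)) = (if x = y then 1 else 0)" if "x \<in> K \<times> J" "y \<in> K \<times> J" for x y
    using *[OF that(1), of "\<lambda>_. 1" y] that o[of "fst x"] by (auto simp: onb_def prod_eq_iff)
  have f3: "bdiag B x y = (\<Sum>k\<in>K \<times> J. of_real (p (fst k) (snd k)) * ?u k x * cnj (?u k y))"
    if "x \<in> K \<times> J" "y \<in> K \<times> J" for x y
    using *[OF that(1), of "\<lambda>k. of_real (p (fst k) (snd k))" y] that s[of "fst x"] by (auto simp: spec_def bdiag_def)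
  show ?thesis
    unfolding spec_def onb_def by (intro conjI ballI; (erule (1) f1 | erule (1) f2 | erule (1) f3))
qed

text \<open>The eigenvectors of a block diagonal operator can be taken inside the blocks, so only
  the diagonal blocks of \<open>A\<close> are seen.\<close>

lemma trln_bdiag:
  assumes K: "finite K" and J: "finite J" and B: "\<And>i. i \<in> K \<Longrightarrow> herm J (B i)"
  shows "trln (K \<times> J) A (bdiag B) = (\<Sum>i\<in>K. trln J (block A i) (B i))"
proof -
  have s: "spec J (evl J (B i)) (evc J (B i)) (B i)" if "i \<in> K" for i
    by (intro spec_evl_evc J B that)
  have q: "quad (K \<times> J) A (\<lambda>x. if i = fst x then f (snd x) else 0) = quad J (block A i) f" if "i \<in> K" for i f
  proof -
    have "quad (K \<times> J) A (\<lambda>x. if i = fst x then f (snd x) else 0)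
      = (\<Sum>j\<in>K. \<Sum>x\<in>J. if j = i then (\<Sum>k\<in>K. \<Sum>y\<in>J. if k = i then cnj (f x) * A (i, x) (i, y) * f y else 0) else 0)"
      unfolding quad_def sum_Times by (intro sum.cong refl) (auto intro!: sum.cong)
    also have "... = quad J (block A i) f"
      using K that by (simp add: sum_delta2 quad_def block_def)
    finally show ?thesis .
  qed
  have sb: "spec (K \<times> J) (\<lambda>x. evl J (B (fst x)) (snd x))
      (\<lambda>k x. if fst k = fst x then evc J (B (fst k)) (snd k) (snd x) else 0) (bdiag B)"
    by (rule spec_bdiag[OF K J s])
  show ?thesis
    unfolding trln_spec[OF finite_cartesian_product[OF K J] sb]
    by (simp add: sum_Times q trln_spec[OF J s])
qed

lemma quad_bdiag:
  assumes K: "finite K" shows "quad (K \<times> J) (bdiag B) f = (\<Sum>i\<in>K. quad J (B i) (\<lambda>x. f (i, x)))"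
proof -
  have "quad (K \<times> J) (bdiag B) f = (\<Sum>i\<in>K. \<Sum>x\<in>J. \<Sum>j\<in>K. \<Sum>y\<in>J. if j = i then cnj (f (i, x)) * B i x y * f (i, y) else 0)"
    unfolding quad_def sum_Times by (intro sum.cong refl) (auto simp: bdiag_def)
  also have "... = (\<Sum>i\<in>K. \<Sum>x\<in>J. \<Sum>y\<in>J. cnj (f (i, x)) * B i x y * f (i, y))"
    using K by (intro sum.cong refl sum_delta2)
  finally show ?thesis by (simp add: quad_def)
qed

lemma pos_bdiag: "\<lbrakk>finite K; \<And>i. i \<in> K \<Longrightarrow> pos J (B i)\<rbrakk> \<Longrightarrow> pos (K \<times> J) (bdiag B)"
  by (auto simp: pos_def quad_bdiag less_eq_complex_def intro!: sum_nonneg)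

lemma quad_block:
  assumes "finite K" "i \<in> K"
  shows "quad J (block A i) f = quad (K \<times> J) A (\<lambda>x. if fst x = i then f (snd x) else 0)"
proof -
  have "quad (K \<times> J) A (\<lambda>x. if fst x = i then f (snd x) else 0)
    = (\<Sum>j\<in>K. \<Sum>x\<in>J. if j = i then (\<Sum>k\<in>K. \<Sum>y\<in>J. if k = i then cnj (f x) * A (i, x) (i, y) * f y else 0) else 0)"
    unfolding quad_def sum_Times by (intro sum.cong refl) (auto intro!: sum.cong)
  also have "... = quad J (block A i) f"
    using assms by (simp add: sum_delta2 quad_def block_def)
  finally show ?thesis ..
qed

lemma pos_block: "\<lbrakk>finite K; i \<in> K; pos (K \<times> J) A\<rbrakk> \<Longrightarrow> pos J (block A i)"
  by (simp add: pos_def quad_block)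

lemma quad_zero_iff:
  assumes "finite I" "pos I A" "spec I p u A"
  shows "quad I A f = 0 \<longleftrightarrow> (\<forall>k\<in>I. p k = 0 \<or> inn I (u k) f = 0)"
  unfolding spec_quad[OF assms(3)] of_real_eq_0_iff
  using assms(1) spec_pos_nonneg[OF assms(1,3,2)] by (subst sum_nonneg_eq_0_iff) auto

text \<open>For a positive operator the zeros of the form are the vectors orthogonal to all
  eigenvectors with nonzero eigenvalue, hence a subspace.\<close>

lemma quad_zero_sum:
  assumes "finite I" "pos I A" "\<And>k. k \<in> K \<Longrightarrow> quad I A (f k) = 0"
  shows "quad I A (\<lambda>x. \<Sum>k\<in>K. f k x) = 0"
proof -
  have s: "spec I (evl I A) (evc I A) A" using assms by (intro spec_evl_evc nonneg_quad_herm)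
  show ?thesis using assms(3) unfolding quad_zero_iff[OF assms(1,2) s] inn_sum_right by (auto intro!: sum.neutral)
qed

lemma supp_bdiag_block:
  assumes K: "finite K" and J: "finite J" and A: "pos (K \<times> J) A"
    and B: "\<And>i. i \<in> K \<Longrightarrow> pos J (B i)" and s: "\<And>i. i \<in> K \<Longrightarrow> supp J (block A i) (B i)"
  shows "supported_pair (K \<times> J) A (bdiag B)"
proof
  show "finite (K \<times> J)" "pos (K \<times> J) A" "pos (K \<times> J) (bdiag B)" using assms by (auto intro: pos_bdiag)
  show "supp (K \<times> J) A (bdiag B)"
    unfolding supp_def quad_bdiag[OF K]
  proof (intro allI impI)
    fix f assume z: "(\<Sum>i\<in>K. quad J (B i) (\<lambda>x. f (i, x))) = 0"
    have "quad (K \<times> J) A (\<lambda>x. if fst x = i then f x else 0) = 0" if i: "i \<in> K" for i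
    proof -
      have "(\<Sum>i\<in>K. Re (quad J (B i) (\<lambda>x. f (i, x)))) = 0" using z by (metis Re_sum zero_complex.sel(1))
      then have "Re (quad J (B i) (\<lambda>x. f (i, x))) = 0"
        using B K i by (subst (asm) sum_nonneg_eq_0_iff) (auto intro: pos_Re)
      then have "quad J (B i) (\<lambda>x. f (i, x)) = 0" using pos_real[OF B[OF i]] by (metis of_real_0)
      then have "quad J (block A i) (\<lambda>x. f (i, x)) = 0" using s[OF i] by (simp add: supp_def)
      moreover have "(\<lambda>x. if fst x = i then f (i, snd x) else 0) = (\<lambda>x. if fst x = i then f x else 0)"
        by (auto simp: fun_eq_iff)
      ultimately show ?thesis unfolding quad_block[OF K i] by simp
    qed
    then have "quad (K \<times> J) A (\<lambda>x. \<Sum>i\<in>K. if fst x = i then f x else 0) = 0"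
      using K J A by (intro quad_zero_sum) auto
    then show "quad (K \<times> J) A f = 0"
      using K by (subst quad_cong[of _ A A f "\<lambda>x. \<Sum>i\<in>K. if fst x = i then f x else 0"]) auto
  qed
qed

lemma supp_refl: "supp I A A" by (simp add: supp_def)

text \<open>\<open>bdiag (block A)\<close> is \<open>A\<close> dephased in the first factor, and the
  relative entropy to it is the entropy gained by dephasing. Lower bounds on relative entropy thus
  become lower bounds on that gain.\<close>

lemma relent_bdiag_block:
  assumes "finite K" "finite J" "pos (K \<times> J) A"
  shows "supported_pair (K \<times> J) A (bdiag (block A))"
    and "relent (K \<times> J) A (bdiag (block A)) = (\<Sum>i\<in>K. ent J (block A i)) - ent (K \<times> J) A"
  using assms
  by (auto intro!: supp_bdiag_block pos_block supp_refl simp: relent_def ent_def trln_bdiag pos_herm pos_block sum_negf)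

subsection \<open>Conditional entropy\<close>

definition ptr1 :: "'m set \<Rightarrow> ('m \<times> 'n) op \<Rightarrow> 'n \<Rightarrow> 'n \<Rightarrow> complex" where
  "ptr1 M A x y = (\<Sum>m\<in>M. A (m, x) (m, y))"

definition condent :: "'m set \<Rightarrow> 'n set \<Rightarrow> ('m \<times> 'n) op \<Rightarrow> real" where
  "condent M N A = ent (M \<times> N) A - ent N (ptr1 M A)"

text \<open>\<open>rop K\<close> is \<open>1 \<otimes> K\<close>; its companion \<open>lop K\<close>
  is \<open>K \<otimes> 1\<close>.\<close>

definition rop :: "('y \<Rightarrow> 'n \<Rightarrow> complex) \<Rightarrow> 'm \<times> 'y \<Rightarrow> 'm \<times> 'n \<Rightarrow> complex" where
  "rop K x z = (if fst x = fst z then K (snd x) (snd z) else 0)"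

definition lop :: "('x \<Rightarrow> 'm \<Rightarrow> complex) \<Rightarrow> 'x \<times> 'n \<Rightarrow> 'm \<times> 'n \<Rightarrow> complex" where
  "lop K x z = (if snd x = snd z then K (fst x) (fst z) else 0)"

lemma ptr1_block: "ptr1 M A = (\<lambda>x y. \<Sum>m\<in>M. block A m x y)"
  by (simp add: ptr1_def block_def fun_eq_iff)

lemma pos_ptr1: "\<lbrakk>finite M; pos (M \<times> N) A\<rbrakk> \<Longrightarrow> pos N (ptr1 M A)"
  unfolding ptr1_block by (rule pos_sum) (rule pos_block)

lemma condent_cong:
  assumes "\<And>x y. x \<in> M \<times> N \<Longrightarrow> y \<in> M \<times> N \<Longrightarrow> A x y = A' x y"
  shows "condent M N A = condent M N A'"
proof -
  have "ent (M \<times> N) A = ent (M \<times> N) A'" by (rule ent_cong) (rule assms)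
  moreover have "ent N (ptr1 M A) = ent N (ptr1 M A')"
    by (rule ent_cong) (simp add: ptr1_def assms)
  ultimately show ?thesis by (simp add: condent_def)
qed

lemma relent_cong:
  assumes "\<And>x y. x \<in> I \<Longrightarrow> y \<in> I \<Longrightarrow> A x y = A' x y" "\<And>x y. x \<in> I \<Longrightarrow> y \<in> I \<Longrightarrow> B x y = B' x y"
  shows "relent I A B = relent I A' B'"
  unfolding relent_def using assms trln_cong[of I A A' A A'] trln_cong[of I A A' B B'] by simp

lemma supp_sum_member:
  assumes "finite K" "i \<in> K" "\<And>k. k \<in> K \<Longrightarrow> pos I (B k)"
  shows "supp I (B i) (\<lambda>x y. \<Sum>k\<in>K. B k x y)"
  unfolding supp_def quad_sum
proof (intro allI impI)
  fix f assume "(\<Sum>k\<in>K. quad I (B k) f) = 0"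
  then have "(\<Sum>k\<in>K. Re (quad I (B k) f)) = 0" by (metis Re_sum zero_complex.sel(1))
  then have "Re (quad I (B i) f) = 0"
    using assms by (subst (asm) sum_nonneg_eq_0_iff) (auto intro: pos_Re)
  then show "quad I (B i) f = 0" using pos_real[OF assms(3)[OF assms(2)], of f] by simp
qed

text \<open>The second operator is the identity on \<open>M\<close> tensor the reduction of
  \<open>A\<close> to \<open>N\<close>, written with equal diagonal blocks. Through this identity
  conditional entropy inherits data processing and concavity from the relative entropy.\<close>

lemma condent_relent:
  assumes M: "finite M" and N: "finite N" and A: "pos (M \<times> N) A"
  shows "supported_pair (M \<times> N) A (bdiag (\<lambda>_. ptr1 M A))"
    and "relent (M \<times> N) A (bdiag (\<lambda>_. ptr1 M A)) = - condent M N A"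
proof -
  have p: "pos N (ptr1 M A)" by (rule pos_ptr1[OF M A])
  show "supported_pair (M \<times> N) A (bdiag (\<lambda>_. ptr1 M A))"
  proof (rule supp_bdiag_block[OF M N A p])
    fix i assume "i \<in> M"
    then show "supp N (block A i) (ptr1 M A)"
      unfolding ptr1_block using M A by (intro supp_sum_member pos_block)
  qed
  have "trln (M \<times> N) A (bdiag (\<lambda>_. ptr1 M A)) = (\<Sum>i\<in>M. trln N (block A i) (ptr1 M A))"
    by (intro trln_bdiag M N pos_herm p)
  also have "... = trln N (ptr1 M A) (ptr1 M A)"
    unfolding trln_sum_left[symmetric] ptr1_block[symmetric] ..
  finally show "relent (M \<times> N) A (bdiag (\<lambda>_. ptr1 M A)) = - condent M N A"
    by (simp add: relent_def condent_def ent_def)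
qed

lemma sum_delta_fst: "\<lbrakk>finite M; m \<in> M\<rbrakk> \<Longrightarrow> (\<Sum>z\<in>M \<times> N. if m = fst z then g (snd z) else 0) = (\<Sum>n\<in>N. g n :: complex)"
  using sum_delta2[where A = M and a = m and B = N and g = g] by (simp add: sum_Times eq_commute[of m] cong: if_cong)

lemma sum_delta_snd:
  assumes "finite N" "n \<in> N"
  shows "(\<Sum>z\<in>M \<times> N. if n = snd z then g (fst z) else 0) = (\<Sum>m\<in>M. g m :: complex)"
  using assms by (simp add: sum_Times)

lemma sand_rop:
  assumes M: "finite M" and x: "fst x \<in> M" and y: "fst y \<in> M"
  shows "sand (M \<times> N) (rop K) A x y = (\<Sum>n\<in>N. \<Sum>n'\<in>N. K (snd x) n * A (fst x, n) (fst y, n') * cnj (K (snd y) n'))"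
proof -
  have "sand (M \<times> N) (rop K) A x y = (\<Sum>z\<in>M \<times> N. if fst x = fst z then
     (\<Sum>w\<in>M \<times> N. if fst y = fst w then K (snd x) (snd z) * A (fst x, snd z) (fst y, snd w) * cnj (K (snd y) (snd w)) else 0) else 0)"
    unfolding sand_def rop_def by (intro sum.cong refl) (auto intro!: sum.cong)
  also have "... = (\<Sum>z\<in>M \<times> N. if fst x = fst z then
     (\<Sum>n'\<in>N. K (snd x) (snd z) * A (fst x, snd z) (fst y, n') * cnj (K (snd y) n')) else 0)"
    by (intro sum.cong refl if_cong sum_delta_fst M y)
  also have "... = (\<Sum>n\<in>N. \<Sum>n'\<in>N. K (snd x) n * A (fst x, n) (fst y, n') * cnj (K (snd y) n'))"
    by (intro sum_delta_fst M x)
  finally show ?thesis .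
qed

lemma sand_lop:
  assumes N: "finite N" and x: "snd x \<in> N" and y: "snd y \<in> N"
  shows "sand (M \<times> N) (lop K) A x y = (\<Sum>m\<in>M. \<Sum>m'\<in>M. K (fst x) m * A (m, snd x) (m', snd y) * cnj (K (fst y) m'))"
proof -
  have "sand (M \<times> N) (lop K) A x y = (\<Sum>z\<in>M \<times> N. if snd x = snd z then
     (\<Sum>w\<in>M \<times> N. if snd y = snd w then K (fst x) (fst z) * A (fst z, snd x) (fst w, snd y) * cnj (K (fst y) (fst w)) else 0) else 0)"
    unfolding sand_def lop_def by (intro sum.cong refl) (auto intro!: sum.cong)
  also have "... = (\<Sum>z\<in>M \<times> N. if snd x = snd z then
     (\<Sum>m'\<in>M. K (fst x) (fst z) * A (fst z, snd x) (m', snd y) * cnj (K (fst y) m')) else 0)"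
    by (intro sum.cong refl if_cong sum_delta_snd N y)
  also have "... = (\<Sum>m\<in>M. \<Sum>m'\<in>M. K (fst x) m * A (m, snd x) (m', snd y) * cnj (K (fst y) m'))"
    by (intro sum_delta_snd N x)
  finally show ?thesis .
qed

lemma kraus_rop:
  assumes M: "finite M" and K: "kraus N R J K"
  shows "kraus (M \<times> N) R (\<lambda>k. M \<times> J k) (\<lambda>k. rop (K k))"
  unfolding kraus_def
proof (intro ballI)
  fix a b assume ab: "a \<in> M \<times> N" "b \<in> M \<times> N"
  have "(\<Sum>k\<in>R. \<Sum>x\<in>M \<times> J k. cnj (rop (K k) x a) * rop (K k) x b)
    = (\<Sum>k\<in>R. \<Sum>x\<in>M \<times> J k. if fst a = fst x then (if fst a = fst b then cnj (K k (snd x) (snd a)) * K k (snd x) (snd b) else 0) else 0)"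
    by (intro sum.cong refl) (auto simp: rop_def)
  also have "... = (\<Sum>k\<in>R. \<Sum>x\<in>J k. if fst a = fst b then cnj (K k x (snd a)) * K k x (snd b) else 0)"
    using ab by (intro sum.cong refl sum_delta_fst M) auto
  also have "... = (if a = b then 1 else 0)"
    using K ab by (cases "fst a = fst b") (auto simp: kraus_def prod_eq_iff mem_Times_iff)
  finally show "(\<Sum>k\<in>R. \<Sum>x\<in>M \<times> J k. cnj (rop (K k) x a) * rop (K k) x b) = (if a = b then 1 else 0)" .
qed

lemma kraus_lop:
  assumes N: "finite N" and K: "kraus M R J K"
  shows "kraus (M \<times> N) R (\<lambda>k. J k \<times> N) (\<lambda>k. lop (K k))"
  unfolding kraus_def
proof (intro ballI)
  fix a b assume ab: "a \<in> M \<times> N" "b \<in> M \<times> N"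
  have "(\<Sum>k\<in>R. \<Sum>x\<in>J k \<times> N. cnj (lop (K k) x a) * lop (K k) x b)
    = (\<Sum>k\<in>R. \<Sum>x\<in>J k \<times> N. if snd a = snd x then (if snd a = snd b then cnj (K k (fst x) (fst a)) * K k (fst x) (fst b) else 0) else 0)"
    by (intro sum.cong refl) (auto simp: lop_def)
  also have "... = (\<Sum>k\<in>R. \<Sum>x\<in>J k. if snd a = snd b then cnj (K k x (fst a)) * K k x (fst b) else 0)"
    using ab by (intro sum.cong refl sum_delta_snd N) auto
  also have "... = (if a = b then 1 else 0)"
    using K ab by (cases "snd a = snd b") (auto simp: kraus_def prod_eq_iff mem_Times_iff)
  finally show "(\<Sum>k\<in>R. \<Sum>x\<in>J k \<times> N. cnj (lop (K k) x a) * lop (K k) x b) = (if a = b then 1 else 0)" .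
qed

lemma sand_rop_bdiag:
  assumes M: "finite M" and x: "fst x \<in> M" and y: "fst y \<in> M"
  shows "sand (M \<times> N) (rop K) (bdiag B) x y = bdiag (\<lambda>m. sand N K (B m)) x y"
  unfolding sand_rop[OF assms] by (simp add: bdiag_def sand_def)

lemma ptr1_sand_rop:
  assumes M: "finite M" shows "ptr1 M (sand (M \<times> N) (rop K) A) = sand N K (ptr1 M A)"
proof (intro ext)
  fix x y
  have "ptr1 M (sand (M \<times> N) (rop K) A) x y = (\<Sum>m\<in>M. \<Sum>n\<in>N. \<Sum>n'\<in>N. K x n * A (m, n) (m, n') * cnj (K y n'))"
    unfolding ptr1_def using M by (intro sum.cong refl) (simp add: sand_rop)
  also have "... = (\<Sum>n\<in>N. \<Sum>n'\<in>N. \<Sum>m\<in>M. K x n * A (m, n) (m, n') * cnj (K y n'))"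
    by (rule sum3_swap[symmetric])
  finally show "ptr1 M (sand (M \<times> N) (rop K) A) x y = sand N K (ptr1 M A) x y"
    by (simp add: sand_def ptr1_def sum_distrib_left sum_distrib_right)
qed

text \<open>Operations on \<open>N\<close> commute with reducing to \<open>N\<close> and keep the
  reference operator in the form \<open>1 \<otimes> A_N\<close>, so \<open>relent_kraus\<close>
  compares conditional entropies on both sides.\<close>

theorem condent_kraus:
  assumes M: "finite M" and N: "finite N" and A: "pos (M \<times> N) A"
    and K: "kraus N R J K" and J: "\<And>k. k \<in> R \<Longrightarrow> finite (J k)"
  shows "condent M N A \<le> (\<Sum>k\<in>R. condent M (J k) (sand (M \<times> N) (rop (K k)) A))"
proof -
  note c = condent_relent[OF M N A]
  have "(\<Sum>k\<in>R. relent (M \<times> J k) (sand (M \<times> N) (rop (K k)) A) (sand (M \<times> N) (rop (K k)) (bdiag (\<lambda>_. ptr1 M A))))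
    \<le> relent (M \<times> N) A (bdiag (\<lambda>_. ptr1 M A))"
    using M J by (intro relent_kraus[OF c(1) kraus_rop[OF M K]]) auto
  also have "(\<Sum>k\<in>R. relent (M \<times> J k) (sand (M \<times> N) (rop (K k)) A) (sand (M \<times> N) (rop (K k)) (bdiag (\<lambda>_. ptr1 M A))))
    = (\<Sum>k\<in>R. - condent M (J k) (sand (M \<times> N) (rop (K k)) A))"
  proof (intro sum.cong refl)
    fix k assume k: "k \<in> R"
    have "relent (M \<times> J k) (sand (M \<times> N) (rop (K k)) A) (sand (M \<times> N) (rop (K k)) (bdiag (\<lambda>_. ptr1 M A)))
      = relent (M \<times> J k) (sand (M \<times> N) (rop (K k)) A) (bdiag (\<lambda>_. ptr1 M (sand (M \<times> N) (rop (K k)) A)))"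
      unfolding ptr1_sand_rop[OF M] by (intro relent_cong refl sand_rop_bdiag M) auto
    also have "... = - condent M (J k) (sand (M \<times> N) (rop (K k)) A)"
      by (intro condent_relent M J k pos_sand A)
    finally show "relent (M \<times> J k) (sand (M \<times> N) (rop (K k)) A) (sand (M \<times> N) (rop (K k)) (bdiag (\<lambda>_. ptr1 M A)))
      = - condent M (J k) (sand (M \<times> N) (rop (K k)) A)" .
  qed
  finally show ?thesis unfolding c(2) by (simp add: sum_negf)
qed

theorem condent_concave:
  assumes M: "finite M" and N: "finite N" and K: "finite K" and A: "\<And>k. k \<in> K \<Longrightarrow> pos (M \<times> N) (A k)"
  shows "(\<Sum>k\<in>K. condent M N (A k)) \<le> condent M N (\<lambda>x y. \<Sum>k\<in>K. A k x y)"
proof -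
  let ?S = "\<lambda>x y. \<Sum>k\<in>K. A k x y"
  have S: "pos (M \<times> N) ?S" by (rule pos_sum) (rule A)
  have "ptr1 M ?S = (\<lambda>x y. \<Sum>k\<in>K. ptr1 M (A k) x y)" unfolding ptr1_def by (intro ext) (rule sum.swap)
  then have b: "(bdiag (\<lambda>_. ptr1 M ?S) :: 'a \<times> 'b \<Rightarrow> _) = (\<lambda>x y. \<Sum>k\<in>K. bdiag (\<lambda>_. ptr1 M (A k)) x y)"
    by (auto simp: bdiag_def fun_eq_iff)
  have "relent (M \<times> N) ?S (bdiag (\<lambda>_. ptr1 M ?S)) \<le> (\<Sum>k\<in>K. relent (M \<times> N) (A k) (bdiag (\<lambda>_. ptr1 M (A k))))"
    unfolding b using M N by (intro relent_convex(2)[OF K] condent_relent(1) A) auto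
  then show ?thesis by (simp add: condent_relent(2)[OF M N] S A sum_negf)
qed

subsection \<open>Conditional mutual information\<close>

definition swap12 :: "('a \<times> 'b \<times> 'e) op \<Rightarrow> 'b \<times> 'a \<times> 'e \<Rightarrow> 'b \<times> 'a \<times> 'e \<Rightarrow> complex" where
  "swap12 \<tau> x y = \<tau> (fst (snd x), fst x, snd (snd x)) (fst (snd y), fst y, snd (snd y))"

definition cmi :: "'a set \<Rightarrow> 'b set \<Rightarrow> 'e set \<Rightarrow> ('a \<times> 'b \<times> 'e) op \<Rightarrow> real" where
  "cmi A B E \<tau> = ent (A \<times> E) (ptr1 B (swap12 \<tau>)) + ent (B \<times> E) (ptr1 A \<tau>)
     - ent (A \<times> B \<times> E) \<tau> - ent E (ptr1 B (ptr1 A \<tau>))"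

lemma bij_swap12: "bij_betw (\<lambda>x. (fst (snd x), fst x, snd (snd x))) (B \<times> A \<times> E) (A \<times> B \<times> E)"
  by (rule bij_betwI[where g = "\<lambda>x. (fst (snd x), fst x, snd (snd x))"]) auto

lemma pos_swap12: "pos (A \<times> B \<times> E) \<tau> \<Longrightarrow> pos (B \<times> A \<times> E) (swap12 \<tau>)"
  using pos_reindex[OF bij_swap12, of A B E \<tau>] by (simp add: swap12_def[abs_def])

lemma ent_swap12:
  assumes "finite A" "finite B" "finite E" "pos (A \<times> B \<times> E) \<tau>"
  shows "ent (B \<times> A \<times> E) (swap12 \<tau>) = ent (A \<times> B \<times> E) \<tau>"
  using ent_reindex[OF _ bij_swap12, of A B E \<tau>] assms pos_herm[of "A \<times> B \<times> E" \<tau>] by (simp add: swap12_def[abs_def])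

lemma swap12_swap12 [simp]: "swap12 (swap12 \<tau>) = \<tau>"
  by (simp add: swap12_def[abs_def])

lemma ptr1_ptr1_swap12: "ptr1 A (ptr1 B (swap12 \<tau>)) = ptr1 B (ptr1 A \<tau>)"
  unfolding ptr1_def swap12_def by (intro ext, simp, rule sum.swap)

lemma cmi_swap12:
  assumes "finite A" "finite B" "finite E" "pos (A \<times> B \<times> E) \<tau>"
  shows "cmi B A E (swap12 \<tau>) = cmi A B E \<tau>"
  by (simp add: cmi_def ent_swap12[OF assms] ptr1_ptr1_swap12)

lemma cmi_condent:
  assumes "finite A" "finite B" "finite E" "pos (A \<times> B \<times> E) \<tau>"
  shows "cmi A B E \<tau> = condent B E (ptr1 A \<tau>) - condent B (A \<times> E) (swap12 \<tau>)"
  by (simp add: cmi_def condent_def ent_swap12[OF assms])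

text \<open>Strong subadditivity as \<open>H(B|AE) \<le> H(B|E)\<close>. Discarding \<open>A\<close>
  amounts to measuring it in the standard basis, where data processing applies, and then forgetting
  the outcome, where concavity applies.\<close>

theorem cmi_nonneg:
  assumes A: "finite A" and B: "finite B" and E: "finite E" and \<tau>: "pos (A \<times> B \<times> E) \<tau>"
  shows "0 \<le> cmi A B E \<tau>"
proof -
  define K :: "'a \<Rightarrow> 'c \<Rightarrow> 'a \<times> 'c \<Rightarrow> complex" where "K a e z = (if z = (a, e) then 1 else 0)" for a e z
  have K: "kraus (A \<times> E) A (\<lambda>_. E) K"
    unfolding kraus_def
  proof (intro ballI)
    fix y z assume "y \<in> A \<times> E" "z \<in> A \<times> E"
    have "(\<Sum>k\<in>A. \<Sum>x\<in>E. cnj (K k x y) * K k x z) = (\<Sum>x\<in>A \<times> E. if x = y then (if y = z then 1 else 0) else 0)"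
      unfolding sum_Times by (intro sum.cong refl) (auto simp: K_def)
    then show "(\<Sum>k\<in>A. \<Sum>x\<in>E. cnj (K k x y) * K k x z) = (if y = z then 1 else 0)"
      using A E \<open>y \<in> A \<times> E\<close> by simp
  qed
  have s: "sand (B \<times> A \<times> E) (rop (K a)) (swap12 \<tau>) x y = block \<tau> a x y"
    if "a \<in> A" "x \<in> B \<times> E" "y \<in> B \<times> E" for a x y
  proof -
    have "sand (B \<times> A \<times> E) (rop (K a)) (swap12 \<tau>) x y
      = (\<Sum>n\<in>A \<times> E. if n = (a, snd x) then (\<Sum>n'\<in>A \<times> E. if n' = (a, snd y) then \<tau> (a, x) (a, y) else 0) else 0)"
      using that by (subst sand_rop) (auto simp: B K_def swap12_def intro!: sum.cong)
    then show ?thesis using that A E by (auto simp: block_def mem_Times_iff)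
  qed
  have "condent B (A \<times> E) (swap12 \<tau>) \<le> (\<Sum>a\<in>A. condent B E (sand (B \<times> A \<times> E) (rop (K a)) (swap12 \<tau>)))"
    using A B E by (intro condent_kraus pos_swap12 \<tau> K) auto
  also have "... = (\<Sum>a\<in>A. condent B E (block \<tau> a))"
    using s by (intro sum.cong refl condent_cong) auto
  also have "... \<le> condent B E (\<lambda>x y. \<Sum>a\<in>A. block \<tau> a x y)"
    by (intro condent_concave A B E pos_block[OF A _ \<tau>])
  finally show ?thesis
    unfolding cmi_condent[OF assms] ptr1_block[of A] by simp
qed

text \<open>In \<open>H(B|E) - H(B|AE)\<close> the subtracted term does not decrease, by data
  processing. The first term does not increase, because the reduced operators on \<open>B E\<close>
  add up to the original one and conditional entropy is concave.\<close>

theorem cmi_measure_left: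
  assumes A: "finite A" and B: "finite B" and E: "finite E" and \<tau>: "pos (A \<times> B \<times> E) \<tau>"
    and K: "kraus A R J K" and R: "finite R" and J: "\<And>k. k \<in> R \<Longrightarrow> finite (J k)"
  shows "(\<Sum>k\<in>R. cmi (J k) B E (sand (A \<times> B \<times> E) (lop (K k)) \<tau>)) \<le> cmi A B E \<tau>"
proof -
  let ?t = "\<lambda>k. sand (A \<times> B \<times> E) (lop (K k)) \<tau>"
  have fBE: "finite (B \<times> E)" using B E by simp
  have pt: "pos (J k \<times> B \<times> E) (?t k)" for k by (rule pos_sand[OF \<tau>])
  have 1: "sand (B \<times> A \<times> E) (rop (lop (K k))) (swap12 \<tau>) x y = swap12 (?t k) x y"
    if "x \<in> B \<times> J k \<times> E" "y \<in> B \<times> J k \<times> E" for k x y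
  proof -
    have "sand (B \<times> A \<times> E) (rop (lop (K k))) (swap12 \<tau>) x y
      = sand (A \<times> E) (lop (K k)) (\<lambda>n n'. swap12 \<tau> (fst x, n) (fst y, n')) (snd x) (snd y)"
      using that by (subst sand_rop) (auto simp: B sand_def)
    also have "... = (\<Sum>m\<in>A. \<Sum>m'\<in>A. K k (fst (snd x)) m * \<tau> (m, fst x, snd (snd x)) (m', fst y, snd (snd y)) * cnj (K k (fst (snd y)) m'))"
      using that by (subst sand_lop) (auto simp: E swap12_def)
    also have "... = swap12 (?t k) x y"
      using that unfolding swap12_def by (subst sand_lop) (auto simp: fBE)
    finally show ?thesis .
  qed
  have "condent B (A \<times> E) (swap12 \<tau>) \<le> (\<Sum>k\<in>R. condent B (J k \<times> E) (sand (B \<times> A \<times> E) (rop (lop (K k))) (swap12 \<tau>)))"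
    using A B E J by (intro condent_kraus pos_swap12 \<tau> kraus_lop K) auto
  also have "... = (\<Sum>k\<in>R. condent B (J k \<times> E) (swap12 (?t k)))"
    using 1 by (intro sum.cong refl condent_cong) auto
  finally have a: "condent B (A \<times> E) (swap12 \<tau>) \<le> (\<Sum>k\<in>R. condent B (J k \<times> E) (swap12 (?t k)))" .
  have 2: "(\<Sum>k\<in>R. ptr1 (J k) (?t k) x y) = ptr1 A \<tau> x y" if "x \<in> B \<times> E" "y \<in> B \<times> E" for x y
  proof -
    have "(\<Sum>k\<in>R. ptr1 (J k) (?t k) x y) = (\<Sum>k\<in>R. tr (J k) (sand A (K k) (\<lambda>m m'. \<tau> (m, x) (m', y))))"
      unfolding ptr1_def tr_def using that by (intro sum.cong refl) (simp add: sand_lop[OF fBE], simp add: sand_def)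
    then show ?thesis unfolding tr_sand_sum[OF A K] by (simp add: tr_def ptr1_def)
  qed
  have "(\<Sum>k\<in>R. condent B E (ptr1 (J k) (?t k))) \<le> condent B E (\<lambda>x y. \<Sum>k\<in>R. ptr1 (J k) (?t k) x y)"
    by (intro condent_concave B E R pos_ptr1 J pt)
  also have "... = condent B E (ptr1 A \<tau>)"
    using 2 by (intro condent_cong) auto
  finally have b: "(\<Sum>k\<in>R. condent B E (ptr1 (J k) (?t k))) \<le> condent B E (ptr1 A \<tau>)" .
  have "(\<Sum>k\<in>R. cmi (J k) B E (?t k)) = (\<Sum>k\<in>R. condent B E (ptr1 (J k) (?t k)) - condent B (J k \<times> E) (swap12 (?t k)))"
    by (intro sum.cong refl cmi_condent J B E pt)
  then show ?thesis using a b unfolding cmi_condent[OF A B E \<tau>] by (simp add: sum_subtractf)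
qed

subsection \<open>Duality\<close>

definition gramL :: "'z set \<Rightarrow> ('m \<Rightarrow> 'z \<Rightarrow> complex) \<Rightarrow> 'm \<Rightarrow> 'm \<Rightarrow> complex" where
  "gramL Z X m m' = (\<Sum>z\<in>Z. X m z * cnj (X m' z))"

definition gramR :: "'m set \<Rightarrow> ('m \<Rightarrow> 'z \<Rightarrow> complex) \<Rightarrow> 'z \<Rightarrow> 'z \<Rightarrow> complex" where
  "gramR M X z z' = (\<Sum>m\<in>M. X m z * cnj (X m z'))"

lemma gramR_gramL: "gramR M X = gramL M (\<lambda>z m. X m z)"
  by (simp add: gramR_def gramL_def fun_eq_iff)

lemma quad_gramL: "quad M (gramL Z X) f = of_real (\<Sum>z\<in>Z. (cmod (inn M f (\<lambda>m. X m z)))\<^sup>2)"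
proof -
  have "quad M (gramL Z X) f = (\<Sum>x\<in>M. \<Sum>y\<in>M. \<Sum>z\<in>Z. (cnj (f x) * X x z) * cnj (cnj (f y) * X y z))"
    by (simp add: quad_def gramL_def sum_distrib_left sum_distrib_right mult_ac)
  also have "... = (\<Sum>z\<in>Z. \<Sum>x\<in>M. \<Sum>y\<in>M. (cnj (f x) * X x z) * cnj (cnj (f y) * X y z))" by (rule sum3_swap)
  also have "... = (\<Sum>z\<in>Z. inn M f (\<lambda>m. X m z) * cnj (inn M f (\<lambda>m. X m z)))"
    unfolding inn_def cnj_sum sum_product ..
  finally show ?thesis by (simp only: complex_norm_square of_real_sum)
qed

lemma pos_gramL: "pos M (gramL Z X)"
  by (auto simp: pos_def quad_gramL less_eq_complex_def intro!: sum_nonneg)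

lemma pos_gramR: "pos Z (gramR M X)"
  unfolding gramR_gramL by (rule pos_gramL)

text \<open>The two reduced states of a bipartite pure state have the same spectrum.\<close>

lemma ent_gram:
  assumes M: "finite M" and Z: "finite Z"
  shows "ent M (gramL Z X) = ent Z (gramR M X)"
proof -
  define p u q v where "p = evl M (gramL Z X)" and "u = evc M (gramL Z X)"
    and "q = evl Z (gramR M X)" and "v = evc Z (gramR M X)"
  have s: "spec M p u (gramL Z X)" unfolding p_def u_def by (intro spec_evl_evc M pos_herm pos_gramL)
  have t: "spec Z q v (gramR M X)" unfolding q_def v_def by (intro spec_evl_evc Z pos_herm pos_gramR)
  have u: "onb M u" and v: "onb Z v" using s t by (auto simp: spec_def)
  define w where "w k j = inn M (u k) (\<lambda>m. inn Z (v j) (X m))" for k j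
  have w': "w k j = inn Z (v j) (\<lambda>z. inn M (u k) (\<lambda>m. X m z))" for k j
    unfolding w_def inn_def sum_distrib_left by (subst sum.swap) (simp add: mult_ac)
  have p: "p k = (\<Sum>j\<in>Z. (cmod (w k j))\<^sup>2)" if "k \<in> M" for k
    using spec_quad_self[OF M s that] unfolding quad_gramL of_real_eq_iff w' parseval_norm[OF Z v] by simp
  have q: "q j = (\<Sum>k\<in>M. (cmod (w k j))\<^sup>2)" if "j \<in> Z" for j
    using spec_quad_self[OF Z t that] unfolding gramR_gramL quad_gramL of_real_eq_iff w_def parseval_norm[OF M u] by simp
  \<comment> \<open>Both Gram operators, moved onto \<open>X\<close>, give the same expression in
    three factors of \<open>X\<close>, so \<open>w k j\<close> can be nonzero only between equal
    eigenvalues. As \<open>p\<close> and \<open>q\<close> are the row and column sums of its squared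
    moduli, the entropies agree without a Schmidt decomposition.\<close>
  have pq: "p k = q j \<or> w k j = 0" if k: "k \<in> M" and j: "j \<in> Z" for k j
  proof -
    let ?g = "\<lambda>z'. inn M (u k) (\<lambda>m. X m z')"
    have 1: "inn M (app M (gramL Z X) (u k)) (\<lambda>m. inn Z (v j) (X m)) = of_real (p k) * w k j"
    proof -
      have "inn M (app M (gramL Z X) (u k)) (\<lambda>m. inn Z (v j) (X m)) = inn M (\<lambda>m. of_real (p k) * u k m) (\<lambda>m. inn Z (v j) (X m))"
        by (rule inn_cong) (simp_all add: spec_app[OF M s k])
      then show ?thesis by (simp add: inn_scale_left w_def)
    qed
    have 2: "inn Z (app Z (gramR M X) (v j)) ?g = of_real (q j) * w k j"
    proof -
      have "inn Z (app Z (gramR M X) (v j)) ?g = inn Z (\<lambda>z. of_real (q j) * v j z) ?g"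
        by (rule inn_cong) (simp_all add: spec_app[OF Z t j])
      then show ?thesis by (simp add: inn_scale_left w')
    qed
    have "inn M (app M (gramL Z X) (u k)) (\<lambda>m. inn Z (v j) (X m))
      = (\<Sum>m\<in>M. \<Sum>m'\<in>M. \<Sum>z\<in>Z. \<Sum>z'\<in>Z. cnj (X m z) * X m' z * cnj (u k m') * (cnj (v j z') * X m z'))"
      unfolding inn_def app_def gramL_def by (simp add: sum_distrib_left sum_distrib_right mult_ac)
    also have "... = (\<Sum>z\<in>Z. \<Sum>z'\<in>Z. \<Sum>m\<in>M. \<Sum>m'\<in>M. cnj (X m z) * X m' z * cnj (u k m') * (cnj (v j z') * X m z'))"
      by (rule sum4_swap)
    also have "... = inn Z (app Z (gramR M X) (v j)) ?g"
      unfolding inn_def[of Z]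
    proof (intro sum.cong refl)
      fix z
      have "cnj (app Z (gramR M X) (v j) z) = (\<Sum>z'\<in>Z. \<Sum>m\<in>M. cnj (X m z) * X m z' * cnj (v j z'))"
        by (simp add: app_def gramR_def sum_distrib_right)
      then show "(\<Sum>z'\<in>Z. \<Sum>m\<in>M. \<Sum>m'\<in>M. cnj (X m z) * X m' z * cnj (u k m') * (cnj (v j z') * X m z'))
        = cnj (app Z (gramR M X) (v j) z) * ?g z"
        by (simp add: inn_def sum_distrib_left sum_distrib_right mult_ac)
    qed
    finally have "of_real (p k) * w k j = of_real (q j) * w k j" using 1 2 by simp
    then show ?thesis by (metis mult_cancel_right of_real_eq_iff)
  qed
  have "(\<Sum>k\<in>M. p k * ln (p k)) = (\<Sum>k\<in>M. \<Sum>j\<in>Z. (cmod (w k j))\<^sup>2 * ln (p k))"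
    by (intro sum.cong refl) (simp only: p[symmetric] sum_distrib_right[symmetric])
  also have "... = (\<Sum>k\<in>M. \<Sum>j\<in>Z. (cmod (w k j))\<^sup>2 * ln (q j))"
    using pq by (intro sum.cong refl) force
  also have "... = (\<Sum>j\<in>Z. \<Sum>k\<in>M. (cmod (w k j))\<^sup>2 * ln (q j))" by (rule sum.swap)
  also have "... = (\<Sum>j\<in>Z. q j * ln (q j))"
    by (intro sum.cong refl) (simp only: q[symmetric] sum_distrib_right[symmetric])
  finally show ?thesis by (simp add: ent_spec[OF M s] ent_spec[OF Z t])
qed

text \<open>The conditional entropy of a classical label \<open>i\<close> given the operator
  \<open>\<nu> i\<close> on \<open>J\<close>, as \<open>condent_bdiag\<close> shows. For total trace
  one it is the entropy of the label minus the Holevo quantity.\<close>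

definition chi :: "'k set \<Rightarrow> 'j set \<Rightarrow> ('k \<Rightarrow> 'j \<Rightarrow> 'j \<Rightarrow> complex) \<Rightarrow> real" where
  "chi K J \<nu> = (\<Sum>i\<in>K. ent J (\<nu> i)) - ent J (\<lambda>x y. \<Sum>i\<in>K. \<nu> i x y)"

lemma chi_cong:
  assumes "\<And>i x y. i \<in> K \<Longrightarrow> x \<in> J \<Longrightarrow> y \<in> J \<Longrightarrow> \<nu> i x y = \<nu>' i x y"
  shows "chi K J \<nu> = chi K J \<nu>'"
  unfolding chi_def using assms by (intro arg_cong2[where f = "(-)"] sum.cong refl ent_cong) auto

lemma condent_bdiag:
  assumes "finite K" "finite J" "\<And>i. i \<in> K \<Longrightarrow> pos J (\<nu> i)"
  shows "condent K J (bdiag \<nu>) = chi K J \<nu>"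
proof -
  have "ent (K \<times> J) (bdiag \<nu>) = (\<Sum>i\<in>K. ent J (\<nu> i))"
  proof -
    have "trln (K \<times> J) (bdiag \<nu>) (bdiag \<nu>) = (\<Sum>i\<in>K. trln J (block (bdiag \<nu>) i) (\<nu> i))"
      using assms by (intro trln_bdiag pos_herm)
    moreover have "block (bdiag \<nu>) i = \<nu> i" for i by (simp add: block_def bdiag_def fun_eq_iff)
    ultimately show ?thesis by (simp add: ent_def sum_negf)
  qed
  moreover have "ptr1 K (bdiag \<nu>) = (\<lambda>x y. \<Sum>i\<in>K. \<nu> i x y)" by (simp add: ptr1_def bdiag_def fun_eq_iff)
  ultimately show ?thesis by (simp add: condent_def chi_def)
qed

text \<open>Discarding \<open>R\<close> can only raise the uncertainty about the label: the
  difference is the conditional mutual information of \<open>R\<close> and \<open>K\<close> given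
  \<open>E\<close>.\<close>

lemma chi_trace:
  assumes K: "finite K" and R: "finite R" and E: "finite E" and \<nu>: "\<And>i. i \<in> K \<Longrightarrow> pos (R \<times> E) (\<nu> i)"
  shows "chi K (R \<times> E) \<nu> \<le> chi K E (\<lambda>i. ptr1 R (\<nu> i))"
proof -
  have b: "pos (K \<times> R \<times> E) (bdiag \<nu>)" using K \<nu> by (rule pos_bdiag)
  have p: "ptr1 R (swap12 (bdiag \<nu>)) = bdiag (\<lambda>i. ptr1 R (\<nu> i))"
    by (simp add: ptr1_def swap12_def bdiag_def fun_eq_iff)
  have "0 \<le> cmi R K E (swap12 (bdiag \<nu>))" by (intro cmi_nonneg K R E pos_swap12 b)
  also have "... = condent K E (bdiag (\<lambda>i. ptr1 R (\<nu> i))) - condent K (R \<times> E) (bdiag \<nu>)"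
    unfolding cmi_condent[OF R K E pos_swap12[OF b]] p swap12_swap12 ..
  finally show ?thesis
    using K R E \<nu> by (simp add: condent_bdiag pos_ptr1)
qed

text \<open>Purifying \<open>\<tau>\<close> turns the entropy increase of the dephased first system into the information
  about the dephasing basis that is left in the complement.\<close>

lemma dephasing_le_chi:
  assumes K: "finite K" and N: "finite N" and Z: "finite Z" and \<tau>: "pos ((K \<times> N) \<times> Z) \<tau>"
  defines "\<omega> \<equiv> \<lambda>x y. \<Sum>z\<in>Z. \<tau> (x, z) (y, z)"
  shows "(\<Sum>i\<in>K. ent N (block \<omega> i)) - ent (K \<times> N) \<omega> \<le> chi K Z (\<lambda>i z z'. \<Sum>n\<in>N. \<tau> ((i, n), z) ((i, n), z'))"
proof -
  define R where "R = (K \<times> N) \<times> Z"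
  have R: "finite R" using K N Z by (simp add: R_def)
  define p u where "p = evl R \<tau>" and "u = evc R \<tau>"
  have s: "spec R p u \<tau>" unfolding p_def u_def using \<tau> R by (intro spec_evl_evc pos_herm) (simp_all add: R_def)
  have p0: "0 \<le> p r" if "r \<in> R" for r using spec_pos_nonneg[OF R s _ that] \<tau> by (simp add: R_def)
  \<comment> \<open>The vector of a purification with purifying system \<open>R\<close>. Relative to
    \<open>K \<times> N\<close> its complement is \<open>R \<times> Z\<close>, and a fixed key
    \<open>i\<close> leaves a pure vector on \<open>N\<close> and the same complement.\<close>
  define X where "X x r = of_real (sqrt (p (fst r))) * u (fst r) (x, snd r)" for x r
  have XX: "X x (r, z) * cnj (X y (r, z')) = of_real (p r) * u r (x, z) * cnj (u r (y, z'))" if "r \<in> R" for x y r z z'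
  proof -
    have "complex_of_real (sqrt (p r)) * of_real (sqrt (p r)) = of_real (p r)"
      using p0[OF that] by (simp flip: of_real_mult)
    then show ?thesis by (simp add: X_def algebra_simps)
  qed
  have tau: "(\<Sum>r\<in>R. X x (r, z) * cnj (X y (r, z'))) = \<tau> (x, z) (y, z')"
    if "x \<in> K \<times> N" "y \<in> K \<times> N" "z \<in> Z" "z' \<in> Z" for x y z z'
  proof -
    have "\<tau> (x, z) (y, z') = (\<Sum>r\<in>R. of_real (p r) * u r (x, z) * cnj (u r (y, z')))"
      using that by (intro bspec[OF bspec[OF conjunct2[OF s[unfolded spec_def]]]]) (auto simp: R_def)
    then show ?thesis by (simp add: XX)
  qed
  have L: "gramL (R \<times> Z) X x y = \<omega> x y" if "x \<in> K \<times> N" "y \<in> K \<times> N" for x y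
    unfolding gramL_def sum_Times \<omega>_def using that by (subst sum.swap) (simp add: tau)
  have 1: "ent (K \<times> N) \<omega> = ent (R \<times> Z) (gramR (K \<times> N) X)"
    using ent_gram[of "K \<times> N" "R \<times> Z" X] K N R Z ent_cong[of "K \<times> N" "gramL (R \<times> Z) X" \<omega>] L by simp
  have 2: "ent N (block \<omega> i) = ent (R \<times> Z) (gramR N (\<lambda>n. X (i, n)))" if "i \<in> K" for i
  proof -
    have "ent N (block \<omega> i) = ent N (gramL (R \<times> Z) (\<lambda>n. X (i, n)))"
      using that L by (intro ent_cong) (simp add: block_def gramL_def)
    then show ?thesis using ent_gram[of N "R \<times> Z" "\<lambda>n. X (i, n)"] N R Z by simp
  qed
  have 3: "gramR (K \<times> N) X = (\<lambda>x y. \<Sum>i\<in>K. gramR N (\<lambda>n. X (i, n)) x y)"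
    by (simp add: gramR_def sum_Times fun_eq_iff)
  have "(\<Sum>i\<in>K. ent N (block \<omega> i)) - ent (K \<times> N) \<omega> = chi K (R \<times> Z) (\<lambda>i. gramR N (\<lambda>n. X (i, n)))"
    by (simp add: chi_def 1 2 3)
  also have "... \<le> chi K Z (\<lambda>i. ptr1 R (gramR N (\<lambda>n. X (i, n))))"
    by (intro chi_trace K R Z pos_gramR)
  also have "... = chi K Z (\<lambda>i z z'. \<Sum>n\<in>N. \<tau> ((i, n), z) ((i, n), z'))"
    unfolding ptr1_def gramR_def by (intro chi_cong, subst sum.swap) (simp add: tau)
  finally show ?thesis .
qed

subsection \<open>Tests\<close>

definition proj :: "'i set \<Rightarrow> 'i op \<Rightarrow> bool" where
  "proj I P \<longleftrightarrow> herm I P \<and> (\<forall>x\<in>I. \<forall>y\<in>I. (\<Sum>z\<in>I. P x z * P z y) = P x y)"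

definition trp :: "'i set \<Rightarrow> 'i op \<Rightarrow> 'i op \<Rightarrow> real" where
  "trp I P A = Re (\<Sum>x\<in>I. \<Sum>y\<in>I. P x y * A y x)"

lemma proj_compl:
  assumes I: "finite I" and P: "proj I P"
  shows "proj I (\<lambda>x y. (if x = y then 1 else 0) - P x y)"
proof -
  have h: "P x y = cnj (P y x)" if "x \<in> I" "y \<in> I" for x y using P that unfolding proj_def herm_def by blast
  have "(\<Sum>z\<in>I. ((if x = z then 1 else 0) - P x z) * ((if z = y then 1 else 0) - P z y)) = (if x = y then 1 else 0) - P x y"
    if "x \<in> I" "y \<in> I" for x y
  proof -
    have "(\<Sum>z\<in>I. ((if x = z then 1 else 0) - P x z) * ((if z = y then 1 else 0) - P z y))
      = (\<Sum>z\<in>I. if x = z then (if x = y then 1 else 0) - P x y else 0) - (\<Sum>z\<in>I. if z = y then P x y else 0) + (\<Sum>z\<in>I. P x z * P z y)"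
      unfolding sum_subtractf[symmetric] sum.distrib[symmetric] by (intro sum.cong refl) (auto simp: algebra_simps)
    then show ?thesis using that I P by (simp add: proj_def)
  qed
  moreover have "herm I (\<lambda>x y. (if x = y then 1 else 0) - P x y)"
    unfolding herm_def by (auto simp flip: h)
  ultimately show ?thesis by (simp add: proj_def)
qed

text \<open>Since \<open>P = P^* P\<close>, the rows of a projection refine it into rank-one parts,
  the form in which \<open>relent_ge_test\<close> takes its measurement.\<close>

lemma proj_rows:
  assumes "proj I P"
  shows "(\<Sum>a\<in>I. Re (quad I A (\<lambda>b. cnj (P a b)))) = trp I P A"
proof -
  have "(\<Sum>a\<in>I. quad I A (\<lambda>b. cnj (P a b))) = (\<Sum>a\<in>I. \<Sum>x\<in>I. \<Sum>y\<in>I. A x y * (P y a * P a x))"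
  proof -
    have "cnj (P a y) = P y a" if "a \<in> I" "y \<in> I" for a y using assms that unfolding proj_def herm_def by metis
    then show ?thesis by (simp add: quad_def mult_ac)
  qed
  also have "... = (\<Sum>x\<in>I. \<Sum>y\<in>I. \<Sum>a\<in>I. A x y * (P y a * P a x))" by (rule sum3_swap[symmetric])
  also have "... = (\<Sum>x\<in>I. \<Sum>y\<in>I. P y x * A x y)"
    using assms by (intro sum.cong refl) (simp add: proj_def mult.commute flip: sum_distrib_left)
  also have "... = (\<Sum>y\<in>I. \<Sum>x\<in>I. P y x * A x y)" by (rule sum.swap)
  finally show ?thesis by (simp add: trp_def flip: Re_sum)
qed

lemma trp_compl:
  assumes "finite I" shows "trp I (\<lambda>x y. (if x = y then 1 else 0) - P x y) A = Re (tr I A) - trp I P A"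
proof -
  have "(\<Sum>x\<in>I. \<Sum>y\<in>I. ((if x = y then 1 else 0) - P x y) * A y x)
    = (\<Sum>x\<in>I. \<Sum>y\<in>I. if x = y then A y x else 0) - (\<Sum>x\<in>I. \<Sum>y\<in>I. P x y * A y x)"
    unfolding sum_subtractf[symmetric] by (intro sum.cong refl) (auto simp: algebra_simps)
  then show ?thesis using assms by (simp add: trp_def tr_def)
qed

text \<open>The rank-one measurement consists of the rows of \<open>P\<close> and those of
  \<open>1 - P\<close>, with a common slope in each group.\<close>

lemma relent_ge_proj:
  assumes sp: "supported_pair I A B" and P: "proj I P" and z: "0 < z1" "0 < z2"
  shows "trp I P A * ln z1 + (Re (tr I A) - trp I P A) * ln z2 + Re (tr I A) - z1 * trp I P B - z2 * (Re (tr I B) - trp I P B)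
    \<le> relent I A B"
proof -
  interpret supported_pair I A B by fact
  let ?Q = "\<lambda>x y. (if x = y then 1 else 0) - P x y"
  note Q = proj_compl[OF fin P]
  define r where "r t = (if fst t then P (snd t) else ?Q (snd t))" for t :: "bool \<times> 'a"
  have sumT: "(\<Sum>t\<in>UNIV \<times> I. g t) = (\<Sum>a\<in>I. g (True, a)) + (\<Sum>a\<in>I. g (False, a))" for g :: "bool \<times> 'a \<Rightarrow> 'b::comm_monoid_add"
    by (simp add: sum_Times UNIV_bool add.commute)
  have cn: "(\<Sum>x\<in>I. cnj (R x a) * R x b) = R a b" if "proj I R" "a \<in> I" "b \<in> I" for R a b
  proof -
    have "cnj (R x a) = R a x" if "x \<in> I" for x using \<open>proj I R\<close> \<open>a \<in> I\<close> that unfolding proj_def herm_def by metis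
    then show ?thesis using that by (simp add: proj_def)
  qed
  have c: "(\<Sum>t\<in>UNIV \<times> I. cnj (r t a) * r t b) = (if a = b then 1 else 0)" if "a \<in> I" "b \<in> I" for a b
    unfolding sumT using cn[OF P that] cn[OF Q that] by (simp add: r_def)
  have a: "(\<Sum>a\<in>I. Re (quad I C (\<lambda>b. cnj (r (True, a) b)))) = trp I P C"
    "(\<Sum>a\<in>I. Re (quad I C (\<lambda>b. cnj (r (False, a) b)))) = Re (tr I C) - trp I P C" for C
    using proj_rows[OF P, of C] proj_rows[OF Q, of C] trp_compl[OF fin, of P C] by (simp_all add: r_def)
  have "(\<Sum>t\<in>UNIV \<times> I. Re (quad I A (\<lambda>b. cnj (r t b))) * ln (if fst t then z1 else z2) + Re (quad I A (\<lambda>b. cnj (r t b)))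
      - (if fst t then z1 else z2) * Re (quad I B (\<lambda>b. cnj (r t b)))) \<le> relent I A B"
    using z fin c by (intro relent_ge_test[OF sp]) auto
  then show ?thesis
    unfolding sumT sum_subtractf sum.distrib fst_conv if_True if_False sum_distrib_left[symmetric] sum_distrib_right[symmetric] a
    by (simp add: algebra_simps)
qed

lemma Re_diag: "\<lbrakk>finite I; pos I A; x \<in> I\<rbrakk> \<Longrightarrow> 0 \<le> Re (A x x)"
  using quad_unit[of I x A 1] pos_Re[of I A "\<lambda>y. if y = x then 1 else 0"] by simp

text \<open>The slopes are \<open>D / 2\<close> on acceptance and \<open>1 / 2\<close> on rejection.
  Each penalty at the dephased operator is then at most half the trace, which the linear term of the
  test bound pays for, and the two factors \<open>1 / 2\<close> cost the trace times
  \<open>ln 2\<close>.\<close>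

lemma dephasing_ge:
  fixes D :: real
  assumes K: "finite K" and J: "finite J" and A: "pos (K \<times> J) A" and P: "proj (K \<times> J) P"
    and D: "0 < D" and b: "trp (K \<times> J) P (bdiag (block A)) \<le> Re (tr (K \<times> J) A) / D"
    and nn: "0 \<le> trp (K \<times> J) P (bdiag (block A))"
  shows "trp (K \<times> J) P A * ln D - Re (tr (K \<times> J) A) * ln 2 \<le> (\<Sum>i\<in>K. ent J (block A i)) - ent (K \<times> J) A"
proof -
  let ?t = "Re (tr (K \<times> J) A)" and ?f = "trp (K \<times> J) P A" and ?g = "trp (K \<times> J) P (bdiag (block A))"
  have t: "tr (K \<times> J) (bdiag (block A)) = tr (K \<times> J) A"
    by (simp add: tr_def bdiag_def block_def)
  have 1: "?f * ln (D / 2) + (?t - ?f) * ln (1 / 2) + ?t - D / 2 * ?g - 1 / 2 * (?t - ?g)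
     \<le> relent (K \<times> J) A (bdiag (block A))"
    using relent_ge_proj[OF relent_bdiag_block(1)[OF K J A] P, of "D / 2" "1 / 2"] D by (simp add: t)
  have 2: "D / 2 * ?g \<le> ?t / 2" using b D by (simp add: field_simps)
  have 3: "?f * ln (D / 2) + (?t - ?f) * ln (1 / 2) = ?f * ln D - ?t * ln 2"
    using D by (simp add: ln_div algebra_simps)
  show ?thesis using 1[unfolded 3 relent_bdiag_block(2)[OF K J A]] 2 nn by (simp add: algebra_simps)
qed

text \<open>Fano's inequality for the guess \<open>i\<close> on \<open>T i\<close>. The relative
  entropies of the \<open>\<nu> i\<close> to their sum add up to \<open>- chi\<close>, and the
  standard basis is measured with slope \<open>1 / 2\<close> on \<open>T i\<close> and
  \<open>1 / (2 card K)\<close> elsewhere. The penalties total at most \<open>t\<close>: one half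
  since the \<open>T i\<close> are disjoint, the other since there are \<open>card K\<close>
  labels.\<close>

lemma chi_le_fano:
  assumes K: "finite K" and J: "finite J" and \<nu>: "\<And>i. i \<in> K \<Longrightarrow> pos J (\<nu> i)" and D: "K \<noteq> {}"
    and T: "\<And>i. i \<in> K \<Longrightarrow> T i \<subseteq> J" and disj: "\<And>i j. i \<in> K \<Longrightarrow> j \<in> K \<Longrightarrow> i \<noteq> j \<Longrightarrow> T i \<inter> T j = {}"
  defines "t \<equiv> \<Sum>i\<in>K. Re (tr J (\<nu> i))" and "f \<equiv> \<Sum>i\<in>K. \<Sum>x\<in>T i. Re (\<nu> i x x)"
  shows "chi K J \<nu> \<le> t * ln 2 + (t - f) * ln (real (card K))"
proof -
  let ?n = "\<lambda>x y. \<Sum>i\<in>K. \<nu> i x y" and ?D = "real (card K)"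
  have Dp: "?D > 0" using K D by (simp add: card_gt_0_iff)
  have n: "pos J ?n" by (rule pos_sum) (rule \<nu>)
  have sp: "supported_pair J (\<nu> i) ?n" if "i \<in> K" for i
    using that K J n \<nu> by (auto simp: supported_pair_def intro!: supp_sum_member)
  have "relent J (\<nu> i) ?n = - ent J (\<nu> i) - trln J (\<nu> i) ?n" for i by (simp add: relent_def ent_def)
  then have chi: "(\<Sum>i\<in>K. relent J (\<nu> i) ?n) = - chi K J \<nu>"
    using trln_sum_left[where I = J and K = K and A = \<nu> and B = ?n] by (simp add: chi_def ent_def sum_subtractf sum_negf)
  define z where "z i x = (if x \<in> T i then 1 / 2 else 1 / (2 * ?D))" for i x
  have q: "Re (quad J A (\<lambda>b. cnj (if x = b then 1 else 0))) = Re (A x x)" if "x \<in> J" for A x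
  proof -
    have "(\<lambda>b. cnj (if x = b then 1 else 0)) = (\<lambda>b. if b = x then 1 else 0)" by auto
    then show ?thesis using quad_unit[OF J that, of A 1] by simp
  qed
  have test: "(\<Sum>x\<in>J. Re (\<nu> i x x) * ln (z i x) + Re (\<nu> i x x) - z i x * Re (?n x x)) \<le> relent J (\<nu> i) ?n"
    if i: "i \<in> K" for i
  proof -
    have "(\<Sum>x\<in>J. Re (quad J (\<nu> i) (\<lambda>b. cnj (if x = b then 1 else 0))) * ln (z i x)
        + Re (quad J (\<nu> i) (\<lambda>b. cnj (if x = b then 1 else 0)))
        - z i x * Re (quad J ?n (\<lambda>b. cnj (if x = b then 1 else 0)))) \<le> relent J (\<nu> i) ?n"
    proof (rule relent_ge_test[OF sp[OF i] J])
      fix a b assume "a \<in> J" "b \<in> J"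
      have "(\<Sum>t\<in>J. cnj (if t = a then 1 else 0) * (if t = b then 1 else 0)) = (\<Sum>t\<in>J. if t = a then (if a = b then 1 else 0) else 0 :: complex)"
        by (intro sum.cong) auto
      then show "(\<Sum>t\<in>J. cnj (if t = a then 1 else 0) * (if t = b then 1 else 0)) = (if a = b then 1 else 0 :: complex)"
        using \<open>a \<in> J\<close> J by simp
    qed (use Dp in \<open>simp add: z_def\<close>)
    then show ?thesis by (simp add: q del: Re_sum)
  qed
  have dn: "0 \<le> Re (?n x x)" if "x \<in> J" for x by (rule Re_diag[OF J n that])
  have tn: "t = (\<Sum>x\<in>J. Re (?n x x))" unfolding t_def tr_def by (simp add: sum.swap[of _ J K])
  have splitT: "(\<Sum>x\<in>J. if x \<in> T i then a x else c x) = (\<Sum>x\<in>T i. a x) + (\<Sum>x\<in>J - T i. c x)" if "i \<in> K" for i and a c :: "'b \<Rightarrow> real"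
  proof -
    have "(\<Sum>x\<in>J. if x \<in> T i then a x else c x) = (\<Sum>x\<in>T i. if x \<in> T i then a x else c x) + (\<Sum>x\<in>J - T i. if x \<in> T i then a x else c x)"
      unfolding sum.subset_diff[OF T[OF that] J, of "\<lambda>x. if x \<in> T i then a x else c x"] by (rule add.commute)
    also have "... = (\<Sum>x\<in>T i. a x) + (\<Sum>x\<in>J - T i. c x)"
      by (intro arg_cong2[where f = "(+)"] sum.cong) auto
    finally show ?thesis .
  qed
  have 1: "(\<Sum>i\<in>K. \<Sum>x\<in>J. Re (\<nu> i x x) * ln (z i x)) = - t * ln 2 - (t - f) * ln ?D"
  proof -
    have "(\<Sum>x\<in>J. Re (\<nu> i x x) * ln (z i x)) = - Re (tr J (\<nu> i)) * ln 2 - (Re (tr J (\<nu> i)) - (\<Sum>x\<in>T i. Re (\<nu> i x x))) * ln ?D"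
      if i: "i \<in> K" for i
    proof -
      have "Re (\<nu> i x x) * ln (z i x) = - ln 2 * Re (\<nu> i x x) - ln ?D * (Re (\<nu> i x x) - (if x \<in> T i then Re (\<nu> i x x) else 0))" for x
        using Dp by (simp add: z_def ln_div ln_mult algebra_simps)
      then have "(\<Sum>x\<in>J. Re (\<nu> i x x) * ln (z i x)) = - ln 2 * (\<Sum>x\<in>J. Re (\<nu> i x x)) - ln ?D * ((\<Sum>x\<in>J. Re (\<nu> i x x)) - (\<Sum>x\<in>J. if x \<in> T i then Re (\<nu> i x x) else 0))"
        by (simp only: sum_subtractf sum_distrib_left[symmetric])
      then show ?thesis using splitT[OF i, of "\<lambda>x. Re (\<nu> i x x)" "\<lambda>_. 0"] by (simp add: tr_def algebra_simps)
    qed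
    then show ?thesis by (simp add: t_def f_def sum_subtractf sum_negf flip: sum_distrib_right)
  qed
  have 2: "(\<Sum>i\<in>K. \<Sum>x\<in>J. z i x * Re (?n x x)) \<le> t"
  proof -
    have "(\<Sum>x\<in>J. z i x * Re (?n x x)) \<le> 1 / 2 * (\<Sum>x\<in>T i. Re (?n x x)) + 1 / (2 * ?D) * t" if i: "i \<in> K" for i
    proof -
      have "(\<Sum>x\<in>J. z i x * Re (?n x x)) = (\<Sum>x\<in>J. if x \<in> T i then 1 / 2 * Re (?n x x) else 1 / (2 * ?D) * Re (?n x x))"
        by (intro sum.cong) (auto simp: z_def)
      also have "... = 1 / 2 * (\<Sum>x\<in>T i. Re (?n x x)) + 1 / (2 * ?D) * (\<Sum>x\<in>J - T i. Re (?n x x))"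
        unfolding splitT[OF i] by (simp only: sum_distrib_left)
      also have "(\<Sum>x\<in>J - T i. Re (?n x x)) \<le> t"
        unfolding tn using dn J by (intro sum_mono2) auto
      finally show ?thesis using Dp by (simp add: mult_left_mono divide_right_mono)
    qed
    then have "(\<Sum>i\<in>K. \<Sum>x\<in>J. z i x * Re (?n x x)) \<le> (\<Sum>i\<in>K. 1 / 2 * (\<Sum>x\<in>T i. Re (?n x x)) + 1 / (2 * ?D) * t)"
      by (rule sum_mono)
    also have "... = 1 / 2 * (\<Sum>i\<in>K. \<Sum>x\<in>T i. Re (?n x x)) + t / 2"
      using Dp by (simp add: sum.distrib sum_distrib_left)
    also have "(\<Sum>i\<in>K. \<Sum>x\<in>T i. Re (?n x x)) = (\<Sum>x\<in>(\<Union>i\<in>K. T i). Re (?n x x))"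
      using K J T disj by (intro sum.UNION_disjoint[symmetric]) (auto intro: finite_subset)
    also have "... \<le> t"
      unfolding tn using dn J T by (intro sum_mono2) auto
    finally show ?thesis by simp
  qed
  have 3: "(\<Sum>i\<in>K. \<Sum>x\<in>J. Re (\<nu> i x x)) = t" by (simp add: t_def tr_def)
  have "(\<Sum>i\<in>K. \<Sum>x\<in>J. Re (\<nu> i x x) * ln (z i x) + Re (\<nu> i x x) - z i x * Re (?n x x)) \<le> - chi K J \<nu>"
    unfolding chi[symmetric] by (rule sum_mono) (rule test)
  then have "- t * ln 2 - (t - f) * ln ?D + t - t \<le> - chi K J \<nu>"
    using 2 unfolding sum_subtractf sum.distrib 1 3 by linarith
  then show ?thesis by linarith
qed

lemma trp_nonneg: "\<lbrakk>proj I P; pos I A\<rbrakk> \<Longrightarrow> 0 \<le> trp I P A"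
  unfolding proj_rows[symmetric] by (intro sum_nonneg pos_Re)

text \<open>\<open>P\<close> acts within the span of the basis vectors in \<open>T\<close>, so the
  projection onto that span minus \<open>P\<close> is a projection again.\<close>

lemma trp_le_diag:
  assumes I: "finite I" and P: "proj I P" and A: "pos I A" and T: "T \<subseteq> I"
    and z: "\<And>x y. x \<in> I - T \<Longrightarrow> y \<in> I \<Longrightarrow> P x y = 0"
  shows "trp I P A \<le> (\<Sum>x\<in>T. Re (A x x))"
proof -
  define Q where "Q x y = (if x = y \<and> x \<in> T then 1 else 0) - P x y" for x y
  have h: "P x y = cnj (P y x)" if "x \<in> I" "y \<in> I" for x y using P that unfolding proj_def herm_def by blast
  have z': "P x y = 0" if "x \<in> I" "y \<in> I - T" for x y using h[of x y] z[of y x] that by simp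
  have "(\<Sum>w\<in>I. Q x w * Q w y) = Q x y" if "x \<in> I" "y \<in> I" for x y
  proof -
    have "(\<Sum>w\<in>I. Q x w * Q w y)
      = (\<Sum>w\<in>I. if w = x then (if x \<in> T then (if x = y then 1 else 0) - P x y else 0) else 0) - (\<Sum>w\<in>I. if w = y then (if y \<in> T then P x y else 0) else 0) + (\<Sum>w\<in>I. P x w * P w y)"
      unfolding sum_subtractf[symmetric] sum.distrib[symmetric] by (intro sum.cong refl) (auto simp: Q_def algebra_simps)
    then show ?thesis using that I P z[of x y] z'[of x y] by (auto simp: proj_def Q_def)
  qed
  moreover have "herm I Q" unfolding herm_def Q_def by (auto simp flip: h)
  ultimately have "proj I Q" by (simp add: proj_def)
  then have "0 \<le> trp I Q A" using A by (rule trp_nonneg)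
  also have "trp I Q A = Re (\<Sum>x\<in>I. if x \<in> T then A x x else 0) - trp I P A"
  proof -
    have "(\<Sum>x\<in>I. \<Sum>y\<in>I. Q x y * A y x) = (\<Sum>x\<in>I. \<Sum>y\<in>I. if y = x then (if x \<in> T then A x x else 0) else 0) - (\<Sum>x\<in>I. \<Sum>y\<in>I. P x y * A y x)"
      unfolding sum_subtractf[symmetric] by (intro sum.cong refl) (auto simp: Q_def algebra_simps)
    then show ?thesis using I by (simp add: trp_def)
  qed
  also have "(\<Sum>x\<in>I. if x \<in> T then A x x else 0) = (\<Sum>x\<in>T. A x x)"
    using I T by (simp add: sum.If_cases Int_absorb1)
  finally show ?thesis by simp
qed

text \<open>\<open>P\<close> tests for the ideal key: up to local phases on the shields it projects onto the maximally
  entangled state of the key systems. It thus commutes with reading off the key \<open>i\<close>, on \<open>T i\<close>.\<close>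

definition key_test :: "'k set \<Rightarrow> 's set \<Rightarrow> 'b set \<Rightarrow> ('k \<Rightarrow> 'b set) \<Rightarrow> ('k \<times> 's \<times> 'b) op \<Rightarrow> bool" where
  "key_test K S B T P \<longleftrightarrow> proj (K \<times> S \<times> B) P \<and>
     (\<forall>i\<in>K. \<forall>x\<in>S \<times> B. \<forall>y\<in>S \<times> B. P (i, x) (i, y) = (if x = y \<and> snd x \<in> T i then 1 / of_nat (card K) else 0)) \<and>
     (\<forall>i\<in>K. \<forall>x\<in>S \<times> B. \<forall>y\<in>K \<times> S \<times> B. snd x \<notin> T i \<longrightarrow> P (i, x) y = 0)"

lemma key_testD:
  assumes "key_test K S B T P" "i \<in> K" "x \<in> S \<times> B"
  shows "y \<in> S \<times> B \<Longrightarrow> P (i, x) (i, y) = (if x = y \<and> snd x \<in> T i then 1 / of_nat (card K) else 0)"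
    and "z \<in> K \<times> S \<times> B \<Longrightarrow> snd x \<notin> T i \<Longrightarrow> P (i, x) z = 0"
  using assms unfolding key_test_def by blast+

text \<open>Dephasing removes the coherence between key values, and within one key value
  \<open>P\<close> is only \<open>1 / card K\<close> times a diagonal projection.\<close>

lemma trp_bdiag_key_test:
  assumes K: "finite K" and S: "finite S" and B: "finite B" and P: "key_test K S B T P" and A: "pos (K \<times> S \<times> B) A"
  shows "trp (K \<times> S \<times> B) P (bdiag (block A)) \<le> Re (tr (K \<times> S \<times> B) A) / card K"
proof -
  have "(\<Sum>x\<in>K \<times> S \<times> B. \<Sum>y\<in>K \<times> S \<times> B. P x y * bdiag (block A) y x)
    = (\<Sum>i\<in>K. \<Sum>x\<in>S \<times> B. \<Sum>j\<in>K. \<Sum>y\<in>S \<times> B. if j = i then P (i, x) (i, y) * A (i, y) (i, x) else 0)"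
    unfolding sum_Times[of _ K] by (intro sum.cong refl) (auto simp: bdiag_def block_def)
  also have "... = (\<Sum>i\<in>K. \<Sum>x\<in>S \<times> B. \<Sum>y\<in>S \<times> B. P (i, x) (i, y) * A (i, y) (i, x))"
    using K by (intro sum.cong refl sum_delta2)
  also have "... = (\<Sum>i\<in>K. \<Sum>x\<in>S \<times> B. \<Sum>y\<in>S \<times> B. if y = x then (if snd x \<in> T i then A (i, x) (i, x) / of_nat (card K) else 0) else 0)"
    by (intro sum.cong refl) (auto simp: key_testD(1)[OF P])
  also have "... = (\<Sum>i\<in>K. \<Sum>x\<in>S \<times> B. if snd x \<in> T i then A (i, x) (i, x) / of_nat (card K) else 0)"
    using S B by simp
  finally have "trp (K \<times> S \<times> B) P (bdiag (block A)) = (\<Sum>i\<in>K. \<Sum>x\<in>S \<times> B. Re (if snd x \<in> T i then A (i, x) (i, x) / of_nat (card K) else 0))"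
    by (simp add: trp_def)
  also have "... \<le> (\<Sum>i\<in>K. \<Sum>x\<in>S \<times> B. Re (A (i, x) (i, x)) / card K)"
    using Re_diag[OF _ A] K S B by (intro sum_mono) (auto simp: Re_divide_of_nat)
  also have "... = Re (tr (K \<times> S \<times> B) A) / card K"
    by (simp add: tr_def sum_Times[of _ K] sum_divide_distrib)
  finally show ?thesis .
qed

text \<open>Each of the four entropies in \<open>cmi\<close> is compared with its sum over the key
  values \<open>i\<close>. On \<open>K S B E\<close> and on \<open>E\<close> the sums exceed the
  entropies by a large amount (\<open>i\<close>, \<open>v'\<close>), which works for the bound. On
  \<open>K S E\<close> and \<open>B E\<close> the excess works against it and is at most
  \<open>chi K B \<nu>\<close> (\<open>ii\<close>, \<open>iv\<close>), small because Bob nearly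
  knows the key (\<open>fano\<close>). The sums themselves combine to conditional mutual
  informations, nonnegative by \<open>iii\<close>.\<close>

theorem cmi_ge_key_test:
  assumes K: "finite K" and S: "finite S" and B: "finite B" and E: "finite E" and ne: "K \<noteq> {}"
    and \<tau>: "pos ((K \<times> S) \<times> B \<times> E) \<tau>" and P: "key_test K S B T P"
    and T: "\<And>i. i \<in> K \<Longrightarrow> T i \<subseteq> B" and disj: "\<And>i j. i \<in> K \<Longrightarrow> j \<in> K \<Longrightarrow> i \<noteq> j \<Longrightarrow> T i \<inter> T j = {}"
  defines "t \<equiv> Re (tr ((K \<times> S) \<times> B \<times> E) \<tau>)"
    and "f \<equiv> trp (K \<times> S \<times> B) P (\<lambda>x y. \<Sum>e\<in>E. \<tau> ((fst x, fst (snd x)), snd (snd x), e) ((fst y, fst (snd y)), snd (snd y), e))"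
  shows "2 * (f * ln (card K) - t * ln 2) - 2 * (t * ln 2 + (t - f) * ln (card K)) \<le> cmi (K \<times> S) B E \<tau>"
proof -
  let ?D = "real (card K)"
  have D: "?D > 0" using K ne by (simp add: card_gt_0_iff)
  have D1: "?D \<ge> 1" using K ne by (simp add: Suc_le_eq card_gt_0_iff)
  note fin = K S B E
  define \<tau>i where "\<tau>i i x y = \<tau> ((i, fst x), snd x) ((i, fst y), snd y)" for i x y
  define \<omega> where "\<omega> x y = (\<Sum>e\<in>E. \<tau> ((fst x, fst (snd x)), snd (snd x), e) ((fst y, fst (snd y)), snd (snd y), e))" for x y
  define \<nu> where "\<nu> i b b' = (\<Sum>n\<in>S \<times> E. \<tau> ((i, fst n), b, snd n) ((i, fst n), b', snd n))" for i b b'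
  have f: "f = trp (K \<times> S \<times> B) P \<omega>" by (simp add: f_def \<omega>_def[abs_def])

  define h1 :: "'a \<times> 'b \<times> 'c \<times> 'd \<Rightarrow> ('a \<times> 'b) \<times> 'c \<times> 'd" where "h1 x = ((fst x, fst (snd x)), snd (snd x))" for x
  define h5 :: "('a \<times> 'b \<times> 'c) \<times> 'd \<Rightarrow> ('a \<times> 'b) \<times> 'c \<times> 'd" where "h5 x = ((fst (fst x), fst (snd (fst x))), snd (snd (fst x)), snd x)" for x
  define h2 :: "('a \<times> 'b \<times> 'd) \<times> 'c \<Rightarrow> ('a \<times> 'b) \<times> 'c \<times> 'd" where "h2 x = ((fst (fst x), fst (snd (fst x))), snd x, snd (snd (fst x)))" for x
  have b1: "bij_betw h1 (K \<times> S \<times> B \<times> E) ((K \<times> S) \<times> B \<times> E)"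
    by (rule bij_betwI[where g = "\<lambda>x. (fst (fst x), snd (fst x), snd x)"]) (auto simp: h1_def)
  have b5: "bij_betw h5 ((K \<times> S \<times> B) \<times> E) ((K \<times> S) \<times> B \<times> E)"
    by (rule bij_betwI[where g = "\<lambda>x. ((fst (fst x), snd (fst x), fst (snd x)), snd (snd x))"]) (auto simp: h5_def)
  have b2: "bij_betw h2 ((K \<times> S \<times> E) \<times> B) ((K \<times> S) \<times> B \<times> E)"
    by (rule bij_betwI[where g = "\<lambda>x. ((fst (fst x), snd (fst x), snd (snd x)), fst (snd x))"]) (auto simp: h2_def)
  \<comment> \<open>The same operator with its factors regrouped: the key in front, \<open>E\<close>
    split off, and Bob split off.\<close>
  define T1 T5 T2 where "T1 = (\<lambda>x y. \<tau> (h1 x) (h1 y))" and "T5 = (\<lambda>x y. \<tau> (h5 x) (h5 y))" and "T2 = (\<lambda>x y. \<tau> (h2 x) (h2 y))"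
  have p1: "pos (K \<times> S \<times> B \<times> E) T1" unfolding T1_def by (rule pos_reindex[OF b1 \<tau>])
  have p5: "pos ((K \<times> S \<times> B) \<times> E) T5" unfolding T5_def by (rule pos_reindex[OF b5 \<tau>])
  have p2: "pos ((K \<times> S \<times> E) \<times> B) T2" unfolding T2_def by (rule pos_reindex[OF b2 \<tau>])
  have h\<tau>: "herm ((K \<times> S) \<times> B \<times> E) \<tau>" using fin \<tau> by (intro pos_herm) auto
  have bl1: "block T1 i = \<tau>i i" for i by (simp add: block_def T1_def h1_def \<tau>i_def fun_eq_iff)
  have pi: "pos (S \<times> B \<times> E) (\<tau>i i)" if "i \<in> K" for i
    unfolding bl1[symmetric] by (rule pos_block[OF K that p1])
  have \<omega>5: "(\<lambda>x y. \<Sum>e\<in>E. T5 (x, e) (y, e)) = \<omega>" by (simp add: T5_def h5_def \<omega>_def fun_eq_iff)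
  have p\<omega>: "pos (K \<times> S \<times> B) \<omega>"
  proof -
    have "pos (E \<times> K \<times> S \<times> B) (\<lambda>x y. T5 (snd x, fst x) (snd y, fst y))"
      by (rule pos_reindex[OF _ p5]) (rule bij_betwI[where g = "\<lambda>x. (snd x, fst x)"], auto)
    from pos_ptr1[OF E this] show ?thesis by (simp add: ptr1_def[abs_def] \<omega>5[symmetric])
  qed
  have t\<omega>: "Re (tr (K \<times> S \<times> B) \<omega>) = t"
    unfolding t_def tr_def \<omega>_def sum_Times by simp
  have t1: "Re (tr (K \<times> S \<times> B \<times> E) T1) = t"
    unfolding t_def tr_def T1_def h1_def sum_Times by simp

  have pr: "proj (K \<times> S \<times> B) P" using P by (simp add: key_test_def)
  \<comment> \<open>The reduction to \<open>K S B\<close> passes the test, so dephasing the key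
    creates entropy there; by purification this entropy is ignorance about the key given
    \<open>E\<close>.\<close>
  have v: "f * ln ?D - t * ln 2 \<le> chi K E (\<lambda>i e e'. \<Sum>n\<in>S \<times> B. T5 ((i, n), e) ((i, n), e'))"
  proof -
    have "f * ln ?D - t * ln 2 \<le> (\<Sum>i\<in>K. ent (S \<times> B) (block \<omega> i)) - ent (K \<times> S \<times> B) \<omega>"
      unfolding f t\<omega>[symmetric] using fin D
      by (intro dephasing_ge p\<omega> pr trp_bdiag_key_test[OF K S B P p\<omega>] trp_nonneg[OF pr] pos_bdiag pos_block[OF K _ p\<omega>]) auto
    also have "... \<le> chi K E (\<lambda>i e e'. \<Sum>n\<in>S \<times> B. T5 ((i, n), e) ((i, n), e'))"
      unfolding \<omega>5[symmetric] using fin by (intro dephasing_le_chi p5) auto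
    finally show ?thesis .
  qed

  have i: "f * ln ?D - t * ln 2 \<le> (\<Sum>i\<in>K. ent (S \<times> B \<times> E) (\<tau>i i)) - ent ((K \<times> S) \<times> B \<times> E) \<tau>"
  proof -
    define c :: "'a \<times> 'b \<times> 'c \<times> 'd \<Rightarrow> 'a \<times> 'b \<times> 'c" where "c x = (fst x, fst (snd x), fst (snd (snd x)))" for x
    \<comment> \<open>The test extended by the identity on \<open>E\<close>.\<close>
    define P1 where "P1 x y = (if snd (snd (snd x)) = snd (snd (snd y)) then P (c x) (c y) else 0)" for x y
    have sumc: "(\<Sum>x\<in>K \<times> S \<times> B \<times> E. if snd (snd (snd x)) = e then g (c x) else 0) = (\<Sum>x\<in>K \<times> S \<times> B. g x)"
      if "e \<in> E" for e and g :: "'a \<times> 'b \<times> 'c \<Rightarrow> complex"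
      unfolding sum_Times using that E by (simp add: c_def)
    have cI: "c x \<in> K \<times> S \<times> B" if "x \<in> K \<times> S \<times> B \<times> E" for x using that by (auto simp: c_def)
    have pr1: "proj (K \<times> S \<times> B \<times> E) P1"
      unfolding proj_def
    proof (intro conjI ballI)
      show "herm (K \<times> S \<times> B \<times> E) P1"
        unfolding herm_def P1_def
      proof (intro ballI)
        fix x y assume "x \<in> K \<times> S \<times> B \<times> E" "y \<in> K \<times> S \<times> B \<times> E"
        then have "P (c x) (c y) = cnj (P (c y) (c x))" using pr cI unfolding proj_def herm_def by blast
        then show "(if snd (snd (snd x)) = snd (snd (snd y)) then P (c x) (c y) else 0) =
          cnj (if snd (snd (snd y)) = snd (snd (snd x)) then P (c y) (c x) else 0)" by auto
      qed
      fix x y assume x: "x \<in> K \<times> S \<times> B \<times> E" and y: "y \<in> K \<times> S \<times> B \<times> E"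
      have "(\<Sum>z\<in>K \<times> S \<times> B \<times> E. P1 x z * P1 z y) = (\<Sum>z\<in>K \<times> S \<times> B \<times> E. if snd (snd (snd z)) = snd (snd (snd x)) then
          (if snd (snd (snd x)) = snd (snd (snd y)) then P (c x) (c z) * P (c z) (c y) else 0) else 0)"
        by (intro sum.cong refl) (auto simp: P1_def)
      also have "... = (\<Sum>z\<in>K \<times> S \<times> B. if snd (snd (snd x)) = snd (snd (snd y)) then P (c x) z * P z (c y) else 0)"
        using x by (intro sumc) auto
      also have "... = P1 x y"
      proof -
        have "(\<Sum>z\<in>K \<times> S \<times> B. P (c x) z * P z (c y)) = P (c x) (c y)"
          by (rule bspec[OF bspec[OF conjunct2[OF pr[unfolded proj_def]] cI[OF x]] cI[OF y]])
        then show ?thesis by (simp add: P1_def)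
      qed
      finally show "(\<Sum>z\<in>K \<times> S \<times> B \<times> E. P1 x z * P1 z y) = P1 x y" .
    qed
    have trp1: "trp (K \<times> S \<times> B \<times> E) P1 A = trp (K \<times> S \<times> B) P (\<lambda>x y. \<Sum>e\<in>E. A (fst x, fst (snd x), snd (snd x), e) (fst y, fst (snd y), snd (snd y), e))" for A
    proof -
      have "(\<Sum>x\<in>K \<times> S \<times> B \<times> E. \<Sum>y\<in>K \<times> S \<times> B \<times> E. P1 x y * A y x)
        = (\<Sum>x\<in>K \<times> S \<times> B \<times> E. \<Sum>y\<in>K \<times> S \<times> B \<times> E. if snd (snd (snd y)) = snd (snd (snd x)) then P (c x) (c y) * A (fst (c y), fst (snd (c y)), snd (snd (c y)), snd (snd (snd x))) x else 0)"
        by (intro sum.cong refl) (auto simp: P1_def c_def)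
      also have "... = (\<Sum>x\<in>K \<times> S \<times> B \<times> E. \<Sum>y\<in>K \<times> S \<times> B. P (c x) y * A (fst y, fst (snd y), snd (snd y), snd (snd (snd x))) x)"
        by (intro sum.cong refl sumc) auto
      also have "... = (\<Sum>x\<in>K \<times> S \<times> B. \<Sum>e\<in>E. \<Sum>y\<in>K \<times> S \<times> B. P x y * A (fst y, fst (snd y), snd (snd y), e) (fst x, fst (snd x), snd (snd x), e))"
        unfolding sum_Times[of _ K] sum_Times[of _ S] sum_Times[of _ B] by (simp add: c_def)
      also have "... = (\<Sum>x\<in>K \<times> S \<times> B. \<Sum>y\<in>K \<times> S \<times> B. \<Sum>e\<in>E. P x y * A (fst y, fst (snd y), snd (snd y), e) (fst x, fst (snd x), snd (snd x), e))"
        by (intro sum.cong refl sum.swap)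
      finally show ?thesis by (simp add: trp_def sum_distrib_left)
    qed
    have "trp (K \<times> S \<times> B \<times> E) P1 T1 = f"
      unfolding trp1 f by (simp add: T1_def h1_def \<omega>_def[abs_def])
    moreover have "trp (K \<times> S \<times> B \<times> E) P1 (bdiag (block T1)) = trp (K \<times> S \<times> B) P (bdiag (block \<omega>))"
    proof -
      have "(\<lambda>x y. \<Sum>e\<in>E. bdiag (block T1) (fst x, fst (snd x), snd (snd x), e) (fst y, fst (snd y), snd (snd y), e)) = bdiag (block \<omega>)"
        by (simp add: bdiag_def block_def T1_def h1_def \<omega>_def fun_eq_iff)
      then show ?thesis unfolding trp1 by simp
    qed
    moreover have "trp (K \<times> S \<times> B \<times> E) P1 T1 * ln ?D - Re (tr (K \<times> S \<times> B \<times> E) T1) * ln 2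
        \<le> (\<Sum>i\<in>K. ent (S \<times> B \<times> E) (block T1 i)) - ent (K \<times> S \<times> B \<times> E) T1"
    proof (intro dephasing_ge p1 pr1 D)
      show "trp (K \<times> S \<times> B \<times> E) P1 (bdiag (block T1)) \<le> Re (tr (K \<times> S \<times> B \<times> E) T1) / ?D"
        unfolding calculation(2) t1 t\<omega>[symmetric] by (rule trp_bdiag_key_test[OF K S B P p\<omega>])
      show "0 \<le> trp (K \<times> S \<times> B \<times> E) P1 (bdiag (block T1))"
        by (intro trp_nonneg pr1 pos_bdiag K pos_block[OF K _ p1])
    qed (use fin in auto)
    moreover have "ent (K \<times> S \<times> B \<times> E) T1 = ent ((K \<times> S) \<times> B \<times> E) \<tau>"
      unfolding T1_def using fin by (intro ent_reindex b1 h\<tau>) auto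
    ultimately show ?thesis by (simp add: t1 bl1)
  qed

  \<comment> \<open>Bob is the complement here, so the entropy created by dephasing
    \<open>K S E\<close> is bounded by his uncertainty about the key.\<close>
  have ii: "(\<Sum>i\<in>K. ent (S \<times> E) (ptr1 B (swap12 (\<tau>i i)))) - ent ((K \<times> S) \<times> E) (ptr1 B (swap12 \<tau>)) \<le> chi K B \<nu>"
  proof -
    let ?o = "\<lambda>x y. \<Sum>z\<in>B. T2 (x, z) (y, z)"
    have "(\<Sum>i\<in>K. ent (S \<times> E) (block ?o i)) - ent (K \<times> S \<times> E) ?o \<le> chi K B (\<lambda>i z z'. \<Sum>n\<in>S \<times> E. T2 ((i, n), z) ((i, n), z'))"
      using fin by (intro dephasing_le_chi p2) auto
    moreover have "block ?o i = ptr1 B (swap12 (\<tau>i i))" for i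
      by (simp add: block_def ptr1_def swap12_def \<tau>i_def T2_def h2_def fun_eq_iff)
    moreover have "(\<lambda>i z z'. \<Sum>n\<in>S \<times> E. T2 ((i, n), z) ((i, n), z')) = \<nu>"
      by (simp add: \<nu>_def T2_def h2_def fun_eq_iff)
    moreover have "ent (K \<times> S \<times> E) ?o = ent ((K \<times> S) \<times> E) (ptr1 B (swap12 \<tau>))"
    proof -
      define h :: "'a \<times> 'b \<times> 'd \<Rightarrow> ('a \<times> 'b) \<times> 'd" where "h x = ((fst x, fst (snd x)), snd (snd x))" for x
      have "bij_betw h (K \<times> S \<times> E) ((K \<times> S) \<times> E)"
        by (rule bij_betwI[where g = "\<lambda>x. (fst (fst x), snd (fst x), snd x)"]) (auto simp: h_def)
      then have "ent (K \<times> S \<times> E) (\<lambda>x y. ptr1 B (swap12 \<tau>) (h x) (h y)) = ent ((K \<times> S) \<times> E) (ptr1 B (swap12 \<tau>))"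
        using fin by (intro ent_reindex pos_herm pos_ptr1 pos_swap12 \<tau>) auto
      moreover have "(\<lambda>x y. ptr1 B (swap12 \<tau>) (h x) (h y)) = ?o"
        by (simp add: ptr1_def swap12_def T2_def h2_def h_def fun_eq_iff)
      ultimately show ?thesis by simp
    qed
    ultimately show ?thesis by simp
  qed

  have iv: "(\<Sum>i\<in>K. ent (B \<times> E) (ptr1 S (\<tau>i i))) - ent (B \<times> E) (ptr1 (K \<times> S) \<tau>) \<le> chi K B \<nu>"
  proof -
    let ?h = "\<lambda>x. (snd x, fst x)"
    have b: "bij_betw ?h (E \<times> B) (B \<times> E)" by (rule bij_betwI[where g = ?h]) auto
    have p4: "pos (E \<times> B) (\<lambda>x y. ptr1 S (\<tau>i i) (?h x) (?h y))" if "i \<in> K" for i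
      by (intro pos_reindex[OF b] pos_ptr1 S pi that)
    have "chi K (E \<times> B) (\<lambda>i x y. ptr1 S (\<tau>i i) (?h x) (?h y)) \<le> chi K B (\<lambda>i. ptr1 E (\<lambda>x y. ptr1 S (\<tau>i i) (?h x) (?h y)))"
      by (intro chi_trace K E B p4)
    also have "(\<lambda>i. ptr1 E (\<lambda>x y. ptr1 S (\<tau>i i) (?h x) (?h y))) = \<nu>"
      unfolding ptr1_def \<nu>_def \<tau>i_def sum_Times by (intro ext, subst sum.swap) simp
    also have "chi K (E \<times> B) (\<lambda>i x y. ptr1 S (\<tau>i i) (?h x) (?h y)) = (\<Sum>i\<in>K. ent (B \<times> E) (ptr1 S (\<tau>i i))) - ent (B \<times> E) (ptr1 (K \<times> S) \<tau>)"
    proof -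
      have "ent (E \<times> B) (\<lambda>x y. ptr1 S (\<tau>i i) (?h x) (?h y)) = ent (B \<times> E) (ptr1 S (\<tau>i i))" if "i \<in> K" for i
        using fin by (intro ent_reindex b pos_herm pos_ptr1 pi that) auto
      moreover have "ent (E \<times> B) (\<lambda>x y. ptr1 (K \<times> S) \<tau> (?h x) (?h y)) = ent (B \<times> E) (ptr1 (K \<times> S) \<tau>)"
        using fin by (intro ent_reindex b pos_herm pos_ptr1 \<tau>) auto
      moreover have "(\<lambda>x y. \<Sum>i\<in>K. ptr1 S (\<tau>i i) (?h x) (?h y)) = (\<lambda>x y. ptr1 (K \<times> S) \<tau> (?h x) (?h y))"
        by (simp add: ptr1_def \<tau>i_def sum_Times fun_eq_iff)
      ultimately show ?thesis by (simp add: chi_def)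
    qed
    finally show ?thesis .
  qed

  have fano: "chi K B \<nu> \<le> t * ln 2 + (t - f) * ln ?D"
  proof -
    have p\<nu>: "pos B (\<nu> i)" if "i \<in> K" for i
    proof -
      let ?h = "\<lambda>x. (fst (fst x), snd x, snd (fst x))"
      have "bij_betw ?h ((S \<times> E) \<times> B) (S \<times> B \<times> E)"
        by (rule bij_betwI[where g = "\<lambda>x. ((fst x, snd (snd x)), fst (snd x))"]) auto
      from pos_reindex[OF this pi[OF that]] have "pos ((S \<times> E) \<times> B) (\<lambda>x y. \<tau>i i (?h x) (?h y))" .
      from pos_ptr1[OF _ this] S E show ?thesis by (simp add: ptr1_def[abs_def] \<nu>_def[abs_def] \<tau>i_def)
    qed
    define f' where "f' = (\<Sum>i\<in>K. \<Sum>x\<in>T i. Re (\<nu> i x x))"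
    have tr: "(\<Sum>i\<in>K. Re (tr B (\<nu> i))) = t"
    proof -
      have "Re (tr B (\<nu> i)) = (\<Sum>s\<in>S. \<Sum>b\<in>B. \<Sum>e\<in>E. Re (\<tau> ((i, s), b, e) ((i, s), b, e)))" for i
        unfolding tr_def \<nu>_def sum_Times by (subst sum.swap) simp
      then show ?thesis by (simp add: t_def tr_def sum_Times)
    qed
    \<comment> \<open>\<open>f'\<close> is the weight of the event that Bob's index lies in the set
      of Alice's key value, and the test accepts only within this event.\<close>
    have "f \<le> f'"
    proof -
      let ?T = "Sigma K (\<lambda>i. S \<times> T i)"
      have "f \<le> (\<Sum>x\<in>?T. Re (\<omega> x x))"
        unfolding f
      proof (intro trp_le_diag pr p\<omega>)
        fix x y assume "x \<in> K \<times> S \<times> B - ?T" "y \<in> K \<times> S \<times> B"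
        then show "P x y = 0" using key_testD(2)[OF P, of "fst x" "snd x" y] by (cases x) auto
      qed (use fin T in auto)
      also have "... = (\<Sum>i\<in>K. \<Sum>x\<in>S \<times> T i. Re (\<omega> (i, x) (i, x)))"
        using fin T by (subst sum.Sigma) (auto intro: finite_subset)
      also have "... = f'"
        unfolding f'_def
      proof (intro sum.cong refl)
        fix i
        have "(\<Sum>x\<in>S \<times> T i. Re (\<omega> (i, x) (i, x))) = (\<Sum>s\<in>S. \<Sum>b\<in>T i. \<Sum>e\<in>E. Re (\<tau> ((i, s), b, e) ((i, s), b, e)))"
          by (simp add: sum_Times \<omega>_def)
        also have "... = (\<Sum>b\<in>T i. \<Sum>s\<in>S. \<Sum>e\<in>E. Re (\<tau> ((i, s), b, e) ((i, s), b, e)))" by (rule sum.swap)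
        finally show "(\<Sum>x\<in>S \<times> T i. Re (\<omega> (i, x) (i, x))) = (\<Sum>x\<in>T i. Re (\<nu> i x x))"
          by (simp add: \<nu>_def sum_Times)
      qed
      finally show ?thesis .
    qed
    then have "(t - f') * ln ?D \<le> (t - f) * ln ?D" using D1 by (intro mult_right_mono) auto
    moreover have "chi K B \<nu> \<le> t * ln 2 + (t - f') * ln ?D"
      using chi_le_fano[of K B \<nu> T] K B p\<nu> ne T disj unfolding tr f'_def by blast
    ultimately show ?thesis by linarith
  qed

  have iii: "0 \<le> (\<Sum>i\<in>K. cmi S B E (\<tau>i i))" by (intro sum_nonneg cmi_nonneg S B E pi)
  have v': "f * ln ?D - t * ln 2 \<le> (\<Sum>i\<in>K. ent E (ptr1 B (ptr1 S (\<tau>i i)))) - ent E (ptr1 B (ptr1 (K \<times> S) \<tau>))"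
  proof -
    have "(\<lambda>i e e'. \<Sum>n\<in>S \<times> B. T5 ((i, n), e) ((i, n), e')) = (\<lambda>i. ptr1 B (ptr1 S (\<tau>i i)))"
      unfolding ptr1_def \<tau>i_def T5_def h5_def sum_Times by (intro ext, subst sum.swap) simp
    moreover have "(\<lambda>x y. \<Sum>i\<in>K. ptr1 B (ptr1 S (\<tau>i i)) x y) = ptr1 B (ptr1 (K \<times> S) \<tau>)"
      unfolding ptr1_def \<tau>i_def sum_Times by (intro ext, subst sum.swap) simp
    ultimately show ?thesis using v by (simp add: chi_def)
  qed
  show ?thesis
    using i ii iii iv v' fano
    by (simp add: cmi_def sum.distrib sum_subtractf)
qed

section \<open>Matrices as operators\<close>

definition fn :: "complex mat \<Rightarrow> nat \<Rightarrow> nat \<Rightarrow> complex" where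
  "fn A i j = A $$ (i, j)"

lemma dim_mat_adjoint [simp]: "dim_row (mat_adjoint A) = dim_col A" "dim_col (mat_adjoint A) = dim_row A"
  by (simp_all add: mat_adjoint_def)

lemma index_mat_adjoint: "\<lbrakk>i < dim_col A; j < dim_row A\<rbrakk> \<Longrightarrow> mat_adjoint A $$ (i, j) = cnj (A $$ (j, i))"
  by (simp add: mat_adjoint_def mat_of_rows_index)

lemma mat_adjoint_carrier [simp]: "A \<in> carrier_mat m n \<Longrightarrow> mat_adjoint A \<in> carrier_mat n m"
  by (auto intro: carrier_matI)

lemma index_mult: "\<lbrakk>A \<in> carrier_mat m k; B \<in> carrier_mat k n; i < m; j < n\<rbrakk> \<Longrightarrow> (A * B) $$ (i, j) = (\<Sum>l<k. A $$ (i, l) * B $$ (l, j))"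
  by (auto simp: scalar_prod_def atLeast0LessThan intro!: sum.cong)

lemma index_mult_diag_adjoint:
  assumes U: "U \<in> sqmat n" and ij: "i < n" "j < n"
  shows "(U * mat_diag n d * mat_adjoint U) $$ (i, j) = (\<Sum>k<n. d k * U $$ (i, k) * cnj (U $$ (j, k)))"
proof -
  have D: "mat_diag n d \<in> sqmat n" by (simp add: mat_diag_def)
  have 1: "(U * mat_diag n d) $$ (i, k) = U $$ (i, k) * d k" if "k < n" for k
  proof -
    have "(U * mat_diag n d) $$ (i, k) = (\<Sum>l<n. if l = k then U $$ (i, k) * d k else 0)"
      unfolding index_mult[OF U D ij(1) that] using that by (intro sum.cong) (auto simp: mat_diag_def)
    then show ?thesis using that by simp
  qed
  have "(U * mat_diag n d * mat_adjoint U) $$ (i, j) = (\<Sum>k<n. (U * mat_diag n d) $$ (i, k) * mat_adjoint U $$ (k, j))"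
    using U D ij by (intro index_mult[of _ n]) auto
  also have "... = (\<Sum>k<n. d k * U $$ (i, k) * cnj (U $$ (j, k)))"
    using U ij by (intro sum.cong refl) (simp add: 1 index_mat_adjoint)
  finally show ?thesis .
qed

text \<open>The basis vectors are the columns of \<open>U\<close>, and the two matrix equations of
  \<open>unitary\<close> are the two halves of \<open>onb\<close>.\<close>

lemma unitary_onb:
  assumes "U \<in> sqmat n"
  shows "unitary n U \<longleftrightarrow> onb {..<n} (\<lambda>k x. U $$ (x, k))"
proof -
  have a: "(mat_adjoint U * U) $$ (k, l) = inn {..<n} (\<lambda>x. U $$ (x, k)) (\<lambda>x. U $$ (x, l))" if "k < n" "l < n" for k l
    using assms that by (subst index_mult[of _ n n _ n]) (auto simp: inn_def index_mat_adjoint intro!: sum.cong)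
  have b: "(U * mat_adjoint U) $$ (x, y) = (\<Sum>k<n. U $$ (x, k) * cnj (U $$ (y, k)))" if "x < n" "y < n" for x y
    using assms that by (subst index_mult[of _ n n _ n]) (auto simp: index_mat_adjoint intro!: sum.cong)
  have "A = 1\<^sub>m n \<longleftrightarrow> (\<forall>k<n. \<forall>l<n. A $$ (k, l) = (if k = l then 1 else 0))" if "A \<in> sqmat n" for A :: "complex mat"
  proof
    assume "\<forall>k<n. \<forall>l<n. A $$ (k, l) = (if k = l then 1 else 0)"
    then show "A = 1\<^sub>m n" using that by (intro eq_matI) auto
  qed auto
  note * = this
  have 1: "mat_adjoint U * U = 1\<^sub>m n \<longleftrightarrow> (\<forall>k<n. \<forall>l<n. inn {..<n} (\<lambda>x. U $$ (x, k)) (\<lambda>x. U $$ (x, l)) = (if k = l then 1 else 0))"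
    by (subst *[OF mult_carrier_mat[OF mat_adjoint_carrier[OF assms] assms]]) (simp add: a del: index_mult_mat)
  have 2: "U * mat_adjoint U = 1\<^sub>m n \<longleftrightarrow> (\<forall>x<n. \<forall>y<n. (\<Sum>k<n. U $$ (x, k) * cnj (U $$ (y, k))) = (if x = y then 1 else 0))"
    by (subst *[OF mult_carrier_mat[OF assms mat_adjoint_carrier[OF assms]]]) (simp add: b del: index_mult_mat)
  show ?thesis unfolding unitary_def onb_def 1 2 using assms by auto
qed

lemma spec_diag_adjoint:
  assumes U: "unitary n U"
  shows "spec {..<n} d (\<lambda>k x. U $$ (x, k)) (fn (U * mat_diag n (\<lambda>i. complex_of_real (d i)) * mat_adjoint U))"
proof -
  have c: "U \<in> sqmat n" using U by (simp add: unitary_def)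
  show ?thesis
    using unitary_onb[OF c] U by (simp add: spec_def fn_def index_mult_diag_adjoint[OF c])
qed

lemma spec_fn_diag:
  assumes A: "A \<in> sqmat n" and s: "spec {..<n} d u (fn A)"
  defines "U \<equiv> mat n n (\<lambda>(x, k). u k x)"
  shows "unitary n U" "A = U * mat_diag n (\<lambda>i. complex_of_real (d i)) * mat_adjoint U"
proof -
  have c: "U \<in> sqmat n" by (simp add: U_def)
  have "onb {..<n} (\<lambda>k x. U $$ (x, k)) \<longleftrightarrow> onb {..<n} u"
    by (auto simp: onb_def inn_def U_def)
  then show "unitary n U" using s unitary_onb[OF c] by (simp add: spec_def)
  show "A = U * mat_diag n (\<lambda>i. complex_of_real (d i)) * mat_adjoint U"
  proof (rule eq_matI)
    fix i j assume "i < dim_row (U * mat_diag n (\<lambda>i. complex_of_real (d i)) * mat_adjoint U)"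
      "j < dim_col (U * mat_diag n (\<lambda>i. complex_of_real (d i)) * mat_adjoint U)"
    then have ij: "i < n" "j < n" using c by auto
    then have "A $$ (i, j) = (\<Sum>k<n. of_real (d k) * u k i * cnj (u k j))" using s by (simp add: spec_def fn_def)
    then show "A $$ (i, j) = (U * mat_diag n (\<lambda>i. complex_of_real (d i)) * mat_adjoint U) $$ (i, j)"
      unfolding index_mult_diag_adjoint[OF c ij] using ij by (simp add: U_def)
  qed (use A c in auto)
qed

text \<open>Resolves the definite description: a diagonalisation exists by the spectral theorem, and
  \<open>mfun_spec\<close> shows that all of them yield the same matrix.\<close>

lemma mat_fun_mfun:
  assumes A: "A \<in> sqmat n" and h: "herm {..<n} (fn A)"
  shows "mat_fun f A = mat n n (\<lambda>(i, j). mfun {..<n} f (fn A) i j)"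
  unfolding mat_fun_def
proof (rule the_equality)
  have dim: "dim_row A = n" using A by simp
  define p u where "p = evl {..<n} (fn A)" and "u = evc {..<n} (fn A)"
  have s: "spec {..<n} p u (fn A)" unfolding p_def u_def by (intro spec_evl_evc h) simp
  define U where "U = mat n n (\<lambda>(x, k). u k x)"
  have U: "unitary n U" "A = U * mat_diag n (\<lambda>i. complex_of_real (p i)) * mat_adjoint U"
    using spec_fn_diag[OF A s] by (auto simp: U_def)
  have c: "U \<in> sqmat n" by (simp add: U_def)
  have "mat n n (\<lambda>(i, j). mfun {..<n} f (fn A) i j) = U * mat_diag n (\<lambda>i. complex_of_real (f (p i))) * mat_adjoint U"
  proof (rule eq_matI)
    fix i j assume "i < dim_row (U * mat_diag n (\<lambda>i. complex_of_real (f (p i))) * mat_adjoint U)"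
      "j < dim_col (U * mat_diag n (\<lambda>i. complex_of_real (f (p i))) * mat_adjoint U)"
    then have ij: "i < n" "j < n" using c by auto
    then show "mat n n (\<lambda>(i, j). mfun {..<n} f (fn A) i j) $$ (i, j) = (U * mat_diag n (\<lambda>i. complex_of_real (f (p i))) * mat_adjoint U) $$ (i, j)"
      unfolding index_mult_diag_adjoint[OF c ij] by (simp add: mfun_spec[OF _ s] U_def)
  qed (use c in auto)
  with U show "\<exists>U d. unitary (dim_row A) U \<and> A = U * mat_diag (dim_row A) (\<lambda>i. complex_of_real (d i)) * mat_adjoint U \<and>
     mat n n (\<lambda>(i, j). mfun {..<n} f (fn A) i j) = U * mat_diag (dim_row A) (\<lambda>i. complex_of_real (f (d i))) * mat_adjoint U"
    unfolding dim by blast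
  fix B assume "\<exists>U d. unitary (dim_row A) U \<and> A = U * mat_diag (dim_row A) (\<lambda>i. complex_of_real (d i)) * mat_adjoint U \<and>
     B = U * mat_diag (dim_row A) (\<lambda>i. complex_of_real (f (d i))) * mat_adjoint U"
  then obtain V d where V: "unitary n V" "A = V * mat_diag n (\<lambda>i. complex_of_real (d i)) * mat_adjoint V"
    and B: "B = V * mat_diag n (\<lambda>i. complex_of_real (f (d i))) * mat_adjoint V" unfolding dim by blast
  have c: "V \<in> sqmat n" using V by (simp add: unitary_def)
  have sV: "spec {..<n} d (\<lambda>k x. V $$ (x, k)) (fn A)" using spec_diag_adjoint[OF V(1), of d] V(2) by simp
  show "B = mat n n (\<lambda>(i, j). mfun {..<n} f (fn A) i j)"
  proof (rule eq_matI)
    fix i j assume "i < dim_row (mat n n (\<lambda>(i, j). mfun {..<n} f (fn A) i j))" "j < dim_col (mat n n (\<lambda>(i, j). mfun {..<n} f (fn A) i j))"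
    then have ij: "i < n" "j < n" by auto
    then show "B $$ (i, j) = mat n n (\<lambda>(i, j). mfun {..<n} f (fn A) i j) $$ (i, j)"
      unfolding B index_mult_diag_adjoint[OF c ij] by (simp add: mfun_spec[OF _ sV])
  qed (use c in \<open>auto simp: B\<close>)
qed

lemma psd_pos: "psd n A \<longleftrightarrow> A \<in> sqmat n \<and> pos {..<n} (fn A)"
proof -
  have q: "(A *\<^sub>v v) \<bullet>c v = quad {..<n} (fn A) (($) v)" if "A \<in> sqmat n" "v \<in> carrier_vec n" for v
    using that by (auto simp: scalar_prod_def quad_def fn_def atLeast0LessThan sum_distrib_left sum_distrib_right mult_ac intro!: sum.cong)
  have q': "quad {..<n} (fn A) f = quad {..<n} (fn A) (($) (vec n f))" for f by (rule quad_cong) auto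
  show ?thesis
  proof (cases "A \<in> sqmat n")
    case True
    have "(\<forall>v\<in>carrier_vec n. 0 \<le> (A *\<^sub>v v) \<bullet>c v) \<longleftrightarrow> (\<forall>f. 0 \<le> quad {..<n} (fn A) f)"
    proof
      assume L: "\<forall>v\<in>carrier_vec n. 0 \<le> (A *\<^sub>v v) \<bullet>c v"
      show "\<forall>f. 0 \<le> quad {..<n} (fn A) f"
      proof
        fix f
        have "0 \<le> (A *\<^sub>v vec n f) \<bullet>c vec n f" using L by simp
        then show "0 \<le> quad {..<n} (fn A) f" unfolding q[OF True vec_carrier] q'[of f, symmetric] .
      qed
    qed (simp add: q[OF True])
    then show ?thesis using True by (simp add: psd_def pos_def)
  qed (simp add: psd_def)
qed

lemma mat_trace_tr: "A \<in> sqmat n \<Longrightarrow> mat_trace A = tr {..<n} (fn A)"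
  by (simp add: mat_trace_def tr_def fn_def)

lemma Re_trace_mat_fun:
  assumes A: "A \<in> sqmat n" and B: "B \<in> sqmat n" and h: "herm {..<n} (fn B)"
  shows "Re (mat_trace (A * mat_fun f B)) = Re (\<Sum>x<n. \<Sum>y<n. fn A x y * mfun {..<n} f (fn B) y x)"
  unfolding mat_fun_mfun[OF B h] using A
  by (auto simp: mat_trace_def scalar_prod_def atLeast0LessThan fn_def intro!: sum.cong)

lemma mfun_log: "mfun I (log 2) A x y = mfun I ln A x y / of_real (ln 2)"
  by (simp add: mfun_def log_def sum_divide_distrib)

lemma vn_entropy_ent:
  assumes A: "A \<in> sqmat n" and h: "herm {..<n} (fn A)"
  shows "vn_entropy A = ent {..<n} (fn A) / ln 2"
  unfolding vn_entropy_def Re_trace_mat_fun[OF A A h] mfun_log ent_def trln_def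
  by (simp add: sum_divide_distrib)

lemma relative_entropy_relent:
  assumes A: "psd n A" and B: "psd n B"
  shows "relative_entropy n A B = (if supp {..<n} (fn A) (fn B) then ereal (relent {..<n} (fn A) (fn B) / ln 2) else \<infinity>)"
proof -
  let ?I = "{..<n}"
  have cA: "A \<in> sqmat n" and cB: "B \<in> sqmat n" and pA: "pos ?I (fn A)" and pB: "pos ?I (fn B)"
    using A B by (auto simp: psd_pos)
  have hA: "herm ?I (fn A)" and hB: "herm ?I (fn B)" using pA pB by (auto intro: pos_herm)
  \<comment> \<open>A positive form vanishes at a vector exactly if the operator does, which
    identifies the kernel condition of \<open>relative_entropy\<close> with
    \<open>supp\<close>.\<close>
  have ker: "X *\<^sub>v v = 0\<^sub>v n \<longleftrightarrow> quad ?I (fn X) (($) v) = 0" if X: "psd n X" and v: "v \<in> carrier_vec n" for X v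
  proof -
    have cX: "X \<in> sqmat n" and pX: "pos ?I (fn X)" using X by (auto simp: psd_pos)
    have s: "spec ?I (evl ?I (fn X)) (evc ?I (fn X)) (fn X)" using pX by (intro spec_evl_evc pos_herm) auto
    have ap: "(X *\<^sub>v v) $ i = app ?I (fn X) (($) v) i" if "i < n" for i
      using that cX v by (auto simp: app_def fn_def scalar_prod_def atLeast0LessThan intro!: sum.cong)
    show ?thesis
    proof
      assume "X *\<^sub>v v = 0\<^sub>v n"
      then have "app ?I (fn X) (($) v) i = 0" if "i < n" for i using ap[OF that] that by simp
      then show "quad ?I (fn X) (($) v) = 0" by (simp add: quad_inn_app inn_def)
    next
      assume "quad ?I (fn X) (($) v) = 0"
      then have z: "\<forall>k\<in>?I. evl ?I (fn X) k = 0 \<or> inn ?I (evc ?I (fn X) k) (($) v) = 0"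
        using quad_zero_iff[OF _ pX s] by simp
      have "(X *\<^sub>v v) $ i = 0" if i: "i < n" for i
      proof -
        have "app ?I (fn X) (($) v) i = (\<Sum>y<n. \<Sum>k<n. of_real (evl ?I (fn X) k) * evc ?I (fn X) k i * (cnj (evc ?I (fn X) k y) * v $ y))"
          unfolding app_def using s i by (intro sum.cong refl) (simp add: spec_def sum_distrib_left sum_distrib_right mult_ac)
        also have "... = (\<Sum>k<n. \<Sum>y<n. of_real (evl ?I (fn X) k) * evc ?I (fn X) k i * (cnj (evc ?I (fn X) k y) * v $ y))"
          by (rule sum.swap)
        also have "... = (\<Sum>k<n. of_real (evl ?I (fn X) k) * evc ?I (fn X) k i * inn ?I (evc ?I (fn X) k) (($) v))"
          by (simp add: inn_def sum_distrib_left)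
        also have "... = 0" using z by (intro sum.neutral) auto
        finally show ?thesis using ap[OF i] by simp
      qed
      then show "X *\<^sub>v v = 0\<^sub>v n" using cX v by (intro eq_vecI) auto
    qed
  qed
  have q': "quad ?I (fn X) f = quad ?I (fn X) (($) (vec n f))" for f X by (rule quad_cong) auto
  have "(\<forall>v\<in>carrier_vec n. B *\<^sub>v v = 0\<^sub>v n \<longrightarrow> A *\<^sub>v v = 0\<^sub>v n) \<longleftrightarrow> supp ?I (fn A) (fn B)"
  proof
    assume "\<forall>v\<in>carrier_vec n. B *\<^sub>v v = 0\<^sub>v n \<longrightarrow> A *\<^sub>v v = 0\<^sub>v n"
    then show "supp ?I (fn A) (fn B)"
      unfolding supp_def using ker[OF A] ker[OF B] by (metis q' vec_carrier)
  next
    assume "supp ?I (fn A) (fn B)"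
    then show "\<forall>v\<in>carrier_vec n. B *\<^sub>v v = 0\<^sub>v n \<longrightarrow> A *\<^sub>v v = 0\<^sub>v n"
      unfolding supp_def using ker[OF A] ker[OF B] by blast
  qed
  moreover have "Re (mat_trace (A * (mat_fun (log 2) A - mat_fun (log 2) B))) = relent ?I (fn A) (fn B) / ln 2"
  proof -
    have m: "mat_fun (log 2) A \<in> sqmat n" "mat_fun (log 2) B \<in> sqmat n"
      by (simp_all add: mat_fun_mfun[OF cA hA] mat_fun_mfun[OF cB hB])
    have "mat_trace (A * (mat_fun (log 2) A - mat_fun (log 2) B)) = mat_trace (A * mat_fun (log 2) A) - mat_trace (A * mat_fun (log 2) B)"
      using cA m by (simp add: mult_minus_distrib_mat mat_trace_def sum_subtractf)
    then show ?thesis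
      by (simp add: Re_trace_mat_fun[OF cA cA hA] Re_trace_mat_fun[OF cA cB hB] mfun_log relent_def trln_def diff_divide_distrib sum_divide_distrib)
  qed
  ultimately show ?thesis by (simp add: relative_entropy_def)
qed

text \<open>The eigenbasis of the Hermitian \<open>X\<close> also diagonalises
  \<open>mat_adjoint X * X\<close>, so the trace norm is the sum of the
  \<open>\<bar>d k\<bar>\<close>; the diagonal entries of a projection in that basis lie between 0
  and 1.\<close>

lemma trace_norm_ge_test:
  assumes X: "X \<in> sqmat n" and h: "herm {..<n} (fn X)" and P: "proj {..<n} P"
  shows "- trp {..<n} P (fn X) \<le> trace_norm X"
proof -
  let ?I = "{..<n}"
  define d u where "d = evl ?I (fn X)" and "u = evc ?I (fn X)"
  have s: "spec ?I d u (fn X)" unfolding d_def u_def by (intro spec_evl_evc h) simp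
  have o: "onb ?I u" using s by (simp add: spec_def)
  let ?Y = "mat_adjoint X * X"
  have cY: "?Y \<in> sqmat n" by (rule mult_carrier_mat[OF mat_adjoint_carrier[OF X] X])
  have sY: "spec ?I (\<lambda>k. (d k)\<^sup>2) u (fn ?Y)"
    unfolding spec_def
  proof (intro conjI o ballI)
    fix x y assume xy: "x \<in> ?I" "y \<in> ?I"
    have "fn ?Y x y = (\<Sum>z<n. cnj (X $$ (z, x)) * X $$ (z, y))"
      unfolding fn_def using X xy by (subst index_mult[of _ n n _ n]) (auto simp: index_mat_adjoint intro!: sum.cong)
    also have "... = (\<Sum>z<n. X $$ (x, z) * X $$ (z, y))"
      using h xy unfolding herm_def fn_def by (intro sum.cong refl) (metis complex_cnj_cnj)
    also have "... = (\<Sum>z<n. \<Sum>k<n. X $$ (x, z) * u k z * (of_real (d k) * cnj (u k y)))"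
    proof (intro sum.cong refl)
      fix z assume "z \<in> {..<n}"
      then have e: "X $$ (z, y) = (\<Sum>k<n. of_real (d k) * u k z * cnj (u k y))" using s xy by (simp add: spec_def fn_def)
      show "X $$ (x, z) * X $$ (z, y) = (\<Sum>k<n. X $$ (x, z) * u k z * (of_real (d k) * cnj (u k y)))"
        unfolding e by (simp add: sum_distrib_left mult_ac)
    qed
    also have "... = (\<Sum>k<n. \<Sum>z<n. X $$ (x, z) * u k z * (of_real (d k) * cnj (u k y)))" by (rule sum.swap)
    also have "... = (\<Sum>k<n. app ?I (fn X) (u k) x * (of_real (d k) * cnj (u k y)))"
      by (simp add: app_def fn_def sum_distrib_right)
    also have "... = (\<Sum>k<n. of_real ((d k)\<^sup>2) * u k x * cnj (u k y))"
      using xy by (intro sum.cong refl) (simp add: spec_app[OF _ s] power2_eq_square)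
    finally show "fn ?Y x y = (\<Sum>k<n. of_real ((d k)\<^sup>2) * u k x * cnj (u k y))" .
  qed
  have "mat_trace (mat_fun sqrt ?Y) = (\<Sum>x<n. \<Sum>k<n. of_real \<bar>d k\<bar> * u k x * cnj (u k x))"
    unfolding mat_fun_mfun[OF cY spec_herm[OF sY]] by (simp add: mat_trace_def mfun_spec[OF _ sY])
  also have "... = (\<Sum>k<n. \<Sum>x<n. of_real \<bar>d k\<bar> * u k x * cnj (u k x))" by (rule sum.swap)
  also have "... = (\<Sum>k<n. of_real \<bar>d k\<bar> * inn ?I (u k) (u k))"
    by (simp add: inn_def sum_distrib_left mult_ac)
  also have "... = of_real (\<Sum>k<n. \<bar>d k\<bar>)" using o by (simp add: onb_inn)
  finally have tn: "trace_norm X = (\<Sum>k<n. \<bar>d k\<bar>)" by (simp add: trace_norm_def)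
  have hP: "P x y = cnj (P y x)" if "x < n" "y < n" for x y using P that unfolding proj_def herm_def by blast
  have q: "0 \<le> Re (quad ?I P (u k)) \<and> Re (quad ?I P (u k)) \<le> 1" if k: "k < n" for k
  proof -
    define g where "g y x = u k y * cnj (u k x)" for y x
    have pg: "pos ?I g"
    proof -
      have "quad ?I g f = inn ?I f (u k) * cnj (inn ?I f (u k))" for f
        unfolding quad_def inn_def g_def cnj_sum sum_product by (simp add: mult_ac)
      then show ?thesis by (simp add: pos_def less_eq_complex_def complex_norm_square[symmetric] del: of_real_power)
    qed
    have tg: "Re (tr ?I g) = 1"
      using o k onb_inn[of ?I u k k] by (simp add: tr_def g_def inn_def mult.commute)
    have "trp ?I P g = Re (quad ?I P (u k))" by (simp add: trp_def quad_def g_def mult_ac)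
    moreover have "0 \<le> trp ?I P g" by (rule trp_nonneg[OF P pg])
    moreover have "0 \<le> Re (tr ?I g) - trp ?I P g"
      unfolding trp_compl[OF finite_lessThan, symmetric] by (rule trp_nonneg[OF proj_compl[OF finite_lessThan P] pg])
    ultimately show ?thesis using tg by simp
  qed
  have "trp ?I P (fn X) = Re (\<Sum>x<n. \<Sum>y<n. \<Sum>k<n. of_real (d k) * (cnj (u k x) * P x y * u k y))"
    unfolding trp_def using s by (intro arg_cong[where f = Re] sum.cong refl) (simp add: spec_def sum_distrib_left mult_ac)
  also have "... = Re (\<Sum>k<n. \<Sum>x<n. \<Sum>y<n. of_real (d k) * (cnj (u k x) * P x y * u k y))"
    by (intro arg_cong[where f = Re]) (rule sum3_swap)
  also have "... = (\<Sum>k<n. d k * Re (quad ?I P (u k)))"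
    by (simp add: quad_def flip: sum_distrib_left)
  finally have "- trp ?I P (fn X) = (\<Sum>k<n. - d k * Re (quad ?I P (u k)))" by (simp add: sum_negf)
  also have "... \<le> (\<Sum>k<n. \<bar>d k\<bar>)"
  proof (rule sum_mono)
    fix k assume "k \<in> {..<n}"
    then have "0 \<le> Re (quad ?I P (u k))" "Re (quad ?I P (u k)) \<le> 1" using q by auto
    then have "\<bar>d k\<bar> * Re (quad ?I P (u k)) \<le> \<bar>d k\<bar>" "- d k * Re (quad ?I P (u k)) \<le> \<bar>d k\<bar> * Re (quad ?I P (u k))"
      by (auto intro: mult_left_le mult_right_mono[of "- d k" "\<bar>d k\<bar>", simplified])
    then show "- d k * Re (quad ?I P (u k)) \<le> \<bar>d k\<bar>" by linarith
  qed
  finally show ?thesis by (simp add: tn)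
qed

section \<open>Composite systems as products of index sets\<close>

abbreviation ix2 :: "nat \<Rightarrow> nat \<Rightarrow> (nat \<times> nat) set" where
  "ix2 a b \<equiv> {..<a} \<times> {..<b}"

abbreviation ix3 :: "nat \<Rightarrow> nat \<Rightarrow> nat \<Rightarrow> (nat \<times> nat \<times> nat) set" where
  "ix3 a b c \<equiv> {..<a} \<times> {..<b} \<times> {..<c}"

text \<open>Only the trailing dimensions enter a mixed-radix index, so \<open>o2\<close> takes the
  second dimension and \<open>o3\<close> the last two.\<close>

definition o2 :: "nat \<Rightarrow> complex mat \<Rightarrow> nat \<times> nat \<Rightarrow> nat \<times> nat \<Rightarrow> complex" where
  "o2 b X p q = X $$ (fst p * b + snd p, fst q * b + snd q)"

definition o3 :: "nat \<Rightarrow> nat \<Rightarrow> complex mat \<Rightarrow> nat \<times> nat \<times> nat \<Rightarrow> nat \<times> nat \<times> nat \<Rightarrow> complex" where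
  "o3 b c X p q = X $$ ((fst p * b + fst (snd p)) * c + snd (snd p), (fst q * b + fst (snd q)) * c + snd (snd q))"

abbreviation cmin :: "nat \<Rightarrow> nat \<Rightarrow> nat \<Rightarrow> (nat \<times> nat \<times> nat) op \<Rightarrow> real" where
  "cmin a b e \<equiv> cmi {..<a} {..<b} {..<e}"

lemma pair_less: "x < a \<Longrightarrow> y < b \<Longrightarrow> x * b + y < a * (b::nat)"
proof -
  assume "x < a" "y < b"
  then have "x * b + y < (x + 1) * b" by simp
  also have "... \<le> a * b" using \<open>x < a\<close> by (intro mult_right_mono) auto
  finally show ?thesis .
qed

lemma div_less_pair: "i < a * b \<Longrightarrow> i div b < (a::nat)"
  by (simp add: less_mult_imp_div_less)

lemma mod_less_pair: "i < a * b \<Longrightarrow> i mod b < (b::nat)"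
  by (metis mod_less_divisor mult_is_0 not_gr_zero not_less_zero)

lemma bij_pair: "bij_betw (\<lambda>p. fst p * b + snd p) (ix2 a b) {..<a * (b::nat)}"
  by (rule bij_betwI[where g = "\<lambda>i. (i div b, i mod b)"]) (auto simp: pair_less div_less_pair mod_less_pair)

lemma bij_pair_inv: "bij_betw (\<lambda>i. (i div b, i mod b)) {..<a * b} ({..<a} \<times> {..<(b::nat)})"
  by (rule bij_betwI[where g = "\<lambda>p. fst p * b + snd p"]) (auto simp: pair_less div_less_pair mod_less_pair)

lemma bij_triple: "bij_betw (\<lambda>p. (fst p * b + fst (snd p)) * c + snd (snd p)) (ix3 a b c) {..<a * b * (c::nat)}"
proof -
  have "bij_betw (\<lambda>p. (fst p * b + fst (snd p), snd (snd p))) (ix3 a b c) (ix2 (a * b) c)"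
    by (rule bij_betwI[where g = "\<lambda>p. (fst p div b, fst p mod b, snd p)"]) (auto simp: pair_less div_less_pair mod_less_pair)
  from bij_betw_trans[OF this bij_pair[of c "a * b"]] show ?thesis by (simp add: comp_def)
qed

lemma sum_pair: "(\<Sum>i<a * (b::nat). g i) = (\<Sum>x<a. \<Sum>y<b. g (x * b + y))"
  using sum.reindex_bij_betw[OF bij_pair[of b a], of g] by (simp add: sum_Times)

lemma sum_triple: "(\<Sum>i<a * b * (c::nat). g i) = (\<Sum>x<a. \<Sum>y<b. \<Sum>z<c. g ((x * b + y) * c + z))"
  by (simp add: sum_pair)

lemma pos_o2: "pos {..<a * b} (fn X) \<Longrightarrow> pos (ix2 a b) (o2 b X)"
  using pos_reindex[OF bij_pair[of b a], of "fn X"] by (simp add: o2_def[abs_def] fn_def)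

lemma pos_o3: "pos {..<a * b * c} (fn X) \<Longrightarrow> pos (ix3 a b c) (o3 b c X)"
  using pos_reindex[OF bij_triple[of b c a], of "fn X"] by (simp add: o3_def[abs_def] fn_def)

lemma fn_o2: "fn X i j = o2 b X (i div b, i mod b) (j div b, j mod b)"
  by (simp add: fn_def o2_def)

lemma pos_fn_o2:
  assumes "pos (ix2 a b) (o2 b X)" shows "pos {..<a * b} (fn X)"
  using pos_reindex[OF bij_pair_inv assms] by (simp flip: fn_o2)

section \<open>Kronecker products, conjugation by a matrix and local operators\<close>

lemma kron_carrier: "\<lbrakk>A \<in> carrier_mat a a'; B \<in> carrier_mat b b'\<rbrakk> \<Longrightarrow> kron A B \<in> carrier_mat (a * b) (a' * b')"
  by (auto simp: kron_def)

lemma kron_index: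
  assumes "A \<in> carrier_mat a a'" "B \<in> carrier_mat b b'" "x < a" "y < b" "x' < a'" "y' < b'"
  shows "kron A B $$ (x * b + y, x' * b' + y') = A $$ (x, x') * B $$ (y, y')"
  using assms pair_less[of x a y b] pair_less[of x' a' y' b'] by (auto simp: kron_def)

abbreviation sandwich :: "complex mat \<Rightarrow> complex mat \<Rightarrow> complex mat" where
  "sandwich L X \<equiv> L * X * mat_adjoint L"

lemma sandwich_index:
  assumes L: "L \<in> carrier_mat m n" and X: "X \<in> sqmat n" and ij: "i < m" "j < m"
  shows "sandwich L X $$ (i, j) = (\<Sum>r<n. \<Sum>s<n. L $$ (i, r) * X $$ (r, s) * cnj (L $$ (j, s)))"
proof -
  have "sandwich L X $$ (i, j) = (\<Sum>s<n. (L * X) $$ (i, s) * mat_adjoint L $$ (s, j))"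
    using L X ij by (intro index_mult[of _ m]) auto
  also have "... = (\<Sum>s<n. (\<Sum>r<n. L $$ (i, r) * X $$ (r, s)) * cnj (L $$ (j, s)))"
    using L X ij by (intro sum.cong refl) (simp add: index_mult[OF L X] index_mat_adjoint del: index_mult_mat)
  also have "... = (\<Sum>s<n. \<Sum>r<n. L $$ (i, r) * X $$ (r, s) * cnj (L $$ (j, s)))"
    by (simp add: sum_distrib_right)
  also have "... = (\<Sum>r<n. \<Sum>s<n. L $$ (i, r) * X $$ (r, s) * cnj (L $$ (j, s)))" by (rule sum.swap)
  finally show ?thesis .
qed

text \<open>For one party among any number, only the products of the dimensions before and after it
  matter; two- and three-party protocols share the formula \<open>sandwich_mid_op\<close>.\<close>

definition mid_op :: "nat \<Rightarrow> nat \<Rightarrow> complex mat \<Rightarrow> complex mat" where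
  "mid_op p q K = kron (1\<^sub>m p) (kron K (1\<^sub>m q))"

lemma local_op_mid: "local_op ds k K = mid_op (prod_list (take k ds)) (prod_list (drop (Suc k) ds)) K"
  by (simp add: local_op_def mid_op_def)

lemma mid_op_carrier: "K \<in> carrier_mat e d \<Longrightarrow> mid_op p q K \<in> carrier_mat (p * e * q) (p * d * q)"
  unfolding mid_op_def mult.assoc by (intro kron_carrier) auto

lemma mid_op_index:
  assumes "K \<in> carrier_mat e d" "x < p" "i < e" "z < q" "x' < p" "j < d" "z' < q"
  shows "mid_op p q K $$ ((x * e + i) * q + z, (x' * d + j) * q + z') = (if x = x' \<and> z = z' then K $$ (i, j) else 0)"
proof -
  have "mid_op p q K $$ (x * (e * q) + (i * q + z), x' * (d * q) + (j * q + z')) = 1\<^sub>m p $$ (x, x') * (K $$ (i, j) * 1\<^sub>m q $$ (z, z'))"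
    unfolding mid_op_def using assms
    by (subst kron_index[of _ p p _ "e * q" "d * q"]) (auto simp: kron_index[of K e d _ q q] pair_less intro!: kron_carrier)
  then show ?thesis using assms by (simp add: algebra_simps)
qed

lemma sandwich_mid_op:
  assumes K: "K \<in> carrier_mat e d" and X: "X \<in> sqmat (p * d * q)"
    and x: "x < p" "x' < p" and i: "i < e" "i' < e" and z: "z < q" "z' < q"
  shows "o3 e q (sandwich (mid_op p q K) X) (x, i, z) (x', i', z')
    = (\<Sum>r<d. \<Sum>s<d. K $$ (i, r) * o3 d q X (x, r, z) (x', s, z') * cnj (K $$ (i', s)))"
proof -
  let ?L = "mid_op p q K"
  have less: "(x * e + i) * q + z < p * e * q" "(x' * e + i') * q + z' < p * e * q"
    using x i z by (auto intro!: pair_less)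
  have inner: "(\<Sum>s<p * d * q. g s * cnj (?L $$ ((x' * e + i') * q + z', s))) = (\<Sum>s<d. g ((x' * d + s) * q + z') * cnj (K $$ (i', s)))"
    for g
  proof -
    have "(\<Sum>s<p * d * q. g s * cnj (?L $$ ((x' * e + i') * q + z', s)))
      = (\<Sum>u<p. \<Sum>s<d. \<Sum>w<q. if w = z' then (if u = x' then g ((x' * d + s) * q + z') * cnj (K $$ (i', s)) else 0) else 0)"
      unfolding sum_triple using x i z by (intro sum.cong refl) (auto simp: mid_op_index[OF K])
    also have "... = (\<Sum>u<p. \<Sum>s<d. if u = x' then g ((x' * d + s) * q + z') * cnj (K $$ (i', s)) else 0)"
      using z by simp
    also have "... = (\<Sum>s<d. g ((x' * d + s) * q + z') * cnj (K $$ (i', s)))"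
      using x by (intro sum_delta2) auto
    finally show ?thesis .
  qed
  have outer: "(\<Sum>s<p * d * q. ?L $$ ((x * e + i) * q + z, s) * g s) = (\<Sum>s<d. K $$ (i, s) * g ((x * d + s) * q + z))"
    for g
  proof -
    have "(\<Sum>s<p * d * q. ?L $$ ((x * e + i) * q + z, s) * g s)
      = (\<Sum>u<p. \<Sum>s<d. \<Sum>w<q. if w = z then (if u = x then K $$ (i, s) * g ((x * d + s) * q + z) else 0) else 0)"
      unfolding sum_triple using x i z by (intro sum.cong refl) (auto simp: mid_op_index[OF K])
    also have "... = (\<Sum>u<p. \<Sum>s<d. if u = x then K $$ (i, s) * g ((x * d + s) * q + z) else 0)"
      using z by simp
    also have "... = (\<Sum>s<d. K $$ (i, s) * g ((x * d + s) * q + z))"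
      using x by (intro sum_delta2) auto
    finally show ?thesis .
  qed
  have "o3 e q (sandwich ?L X) (x, i, z) (x', i', z')
    = (\<Sum>r<p * d * q. \<Sum>s<p * d * q. ?L $$ ((x * e + i) * q + z, r) * X $$ (r, s) * cnj (?L $$ ((x' * e + i') * q + z', s)))"
    unfolding o3_def fst_conv snd_conv by (rule sandwich_index[OF mid_op_carrier[OF K] X less])
  also have "... = (\<Sum>r<p * d * q. ?L $$ ((x * e + i) * q + z, r) * (\<Sum>s<d. X $$ (r, (x' * d + s) * q + z') * cnj (K $$ (i', s))))"
    unfolding inner by (simp add: sum_distrib_left mult.assoc)
  also have "... = (\<Sum>r<d. K $$ (i, r) * (\<Sum>s<d. X $$ ((x * d + r) * q + z, (x' * d + s) * q + z') * cnj (K $$ (i', s))))"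
    by (rule outer)
  finally show ?thesis by (simp add: o3_def sum_distrib_left mult.assoc)
qed

lemma mat_sum_carrier [simp]: "mat_sum n f I \<in> sqmat n"
  by (simp add: mat_sum_def)

lemma mat_sum_index: "\<lbrakk>i < n; j < n\<rbrakk> \<Longrightarrow> mat_sum n f I $$ (i, j) = (\<Sum>k\<in>I. f k $$ (i, j))"
  by (simp add: mat_sum_def)

lemma index_adj_mult:
  assumes "K \<in> carrier_mat e d" "x < d" "y < d"
  shows "(mat_adjoint K * K) $$ (x, y) = (\<Sum>z<e. cnj (fn K z x) * fn K z y)"
proof -
  have "(mat_adjoint K * K) $$ (x, y) = (\<Sum>z<e. mat_adjoint K $$ (x, z) * K $$ (z, y))"
    using assms by (intro index_mult[of _ d]) auto
  then show ?thesis using assms by (simp add: fn_def index_mat_adjoint del: index_mult_mat)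
qed

lemma kraus_fn:
  assumes K: "\<And>k. k < r \<Longrightarrow> K k \<in> carrier_mat (e k) d"
    and s: "mat_sum d (\<lambda>k. mat_adjoint (K k) * K k) {..<r::nat} = 1\<^sub>m d"
  shows "kraus {..<d} {..<r} (\<lambda>k. {..<e k}) (\<lambda>k. fn (K k))"
  unfolding kraus_def
proof (intro ballI)
  fix x y assume xy: "x \<in> {..<d}" "y \<in> {..<d}"
  have "(\<Sum>k<r. \<Sum>z<e k. cnj (fn (K k) z x) * fn (K k) z y) = (\<Sum>k<r. (mat_adjoint (K k) * K k) $$ (x, y))"
    using K xy by (intro sum.cong refl index_adj_mult[symmetric]) auto
  also have "... = 1\<^sub>m d $$ (x, y)" using xy by (simp add: mat_sum_index flip: s del: index_mult_mat)
  finally show "(\<Sum>k<r. \<Sum>z<e k. cnj (fn (K k) z x) * fn (K k) z y) = (if x = y then 1 else 0)" using xy by simp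
qed

section \<open>LOCC monotones\<close>

text \<open>A functional \<open>v\<close> of objects \<open>s\<close>, which describe the bipartite states \<open>opn s\<close>, is an LOCC
  monotone if local measurements do not increase the sum of its values on the unnormalised
  post-measurement objects.\<close>

locale pair_monotone =
  fixes ok :: "nat \<Rightarrow> nat \<Rightarrow> 's \<Rightarrow> bool" and opn :: "'s \<Rightarrow> nat \<times> nat \<Rightarrow> nat \<times> nat \<Rightarrow> complex"
    and v :: "nat \<Rightarrow> nat \<Rightarrow> 's \<Rightarrow> real"
  assumes measure_left: "\<And>a b s r e K. ok a b s \<Longrightarrow> kraus {..<a} {..<r::nat} (\<lambda>k. {..<e k}) K \<Longrightarrow>
      \<exists>s'. (\<forall>k<r. ok (e k) b (s' k) \<and> (\<forall>p\<in>ix2 (e k) b. \<forall>q\<in>ix2 (e k) b.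
         opn (s' k) p q = sand (ix2 a b) (lop (K k)) (opn s) p q)) \<and> (\<Sum>k<r. v (e k) b (s' k)) \<le> v a b s"
    and measure_right: "\<And>a b s r e K. ok a b s \<Longrightarrow> kraus {..<b} {..<r::nat} (\<lambda>k. {..<e k}) K \<Longrightarrow>
      \<exists>s'. (\<forall>k<r. ok a (e k) (s' k) \<and> (\<forall>p\<in>ix2 a (e k). \<forall>q\<in>ix2 a (e k).
         opn (s' k) p q = sand (ix2 a b) (rop (K k)) (opn s) p q)) \<and> (\<Sum>k<r. v a (e k) (s' k)) \<le> v a b s"
begin

text \<open>The list \<open>ss\<close> has one object for each leaf of the protocol tree. The output
  is the sum of the leaf states, but the objects are kept apart, so nothing is asked of
  \<open>v\<close> on mixtures: later bounds are applied to each leaf and added.\<close>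

lemma locc_pair:
  assumes "locc ds ds' \<Lambda>" "ds = [a, b]" "ds' = [a', b']" "ok a b s" "X \<in> sqmat (a * b)"
    "\<And>p q. p \<in> ix2 a b \<Longrightarrow> q \<in> ix2 a b \<Longrightarrow> o2 b X p q = opn s p q"
  shows "\<Lambda> X \<in> sqmat (a' * b') \<and> (\<exists>ss. (\<forall>t\<in>set ss. ok a' b' t) \<and>
    (\<forall>p\<in>ix2 a' b'. \<forall>q\<in>ix2 a' b'. o2 b' (\<Lambda> X) p q = (\<Sum>t\<leftarrow>ss. opn t p q)) \<and>
    (\<Sum>t\<leftarrow>ss. tr (ix2 a' b') (opn t)) = tr (ix2 a b) (opn s) \<and>
    (\<Sum>t\<leftarrow>ss. v a' b' t) \<le> v a b s)"
  using assms
proof (induction arbitrary: a b s X rule: locc.induct)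
  case (locc_done ds)
  then show ?case by (auto intro!: exI[of _ "[s]"])
next
  case (locc_round p ds r e K ds' \<Lambda>)
  let ?A = "ix2 a b"
  define L where "L k = local_op ds p (K k)" for k
  define dim where "dim k = (ds[p := e k]) ! 0 * (ds[p := e k]) ! 1" for k
  \<comment> \<open>The dimensions after outcome \<open>k\<close>, named uniformly so that the
    induction step is the same whichever party measures.\<close>
  obtain a1 b1 where ab1: "\<And>k. ds[p := e k] = [a1 k, b1 k]"
    using locc_round.prems(1) locc_round.hyps(1) that[of "\<lambda>k. (ds[p := e k]) ! 0" "\<lambda>k. (ds[p := e k]) ! 1"]
    by (auto simp: less_Suc_eq list_update_append split: nat.splits)
  have "\<exists>s'. (\<forall>k<r. ok (a1 k) (b1 k) (s' k) \<and> sandwich (L k) X \<in> sqmat (a1 k * b1 k) \<and>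
      (\<forall>p\<in>ix2 (a1 k) (b1 k). \<forall>q\<in>ix2 (a1 k) (b1 k). o2 (b1 k) (sandwich (L k) X) p q = opn (s' k) p q)) \<and>
      (\<Sum>k<r. tr (ix2 (a1 k) (b1 k)) (opn (s' k))) = tr ?A (opn s) \<and>
      (\<Sum>k<r. v (a1 k) (b1 k) (s' k)) \<le> v a b s"
  proof -
    note X = locc_round.prems(4) and op = locc_round.prems(5)
    have sc: "sand ?A K1 (o2 b X) = sand ?A K1 (opn s)" for K1 :: "nat \<times> nat \<Rightarrow> _"
      unfolding sand_def by (intro ext sum.cong refl) (simp add: op)
    consider "p = 0" | "p = 1" using locc_round.hyps(1) locc_round.prems(1) by (auto simp: less_Suc_eq)
    then show ?thesis
    proof cases
      case 1
      have ab: "a1 k = e k" "b1 k = b" for k using ab1[of k] locc_round.prems(1) 1 by auto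
      have K: "K k \<in> carrier_mat (e k) a" if "k < r" for k using locc_round.hyps(2) locc_round.prems(1) that 1 by auto
      have kr: "kraus {..<a} {..<r} (\<lambda>k. {..<e k}) (\<lambda>k. fn (K k))"
        using K locc_round.hyps(3) locc_round.prems(1) 1 by (intro kraus_fn) auto
      have L: "L k = mid_op 1 b (K k)" for k using locc_round.prems(1) 1 by (simp add: L_def local_op_mid)
      have LX: "sandwich (L k) X \<in> sqmat (e k * b)" if "k < r" for k
        using mid_op_carrier[OF K[OF that], of 1 b] X unfolding L by auto
      have sl: "o2 b (sandwich (L k) X) x y = sand ?A (lop (fn (K k))) (o2 b X) x y"
        if k: "k < r" and x: "x \<in> ix2 (e k) b" and y: "y \<in> ix2 (e k) b" for k x y
      proof -
        \<comment> \<open>The bipartite matrix is read as tripartite with a one-dimensional first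
          factor, which makes the measured party the middle one.\<close>
        have "o2 b (sandwich (L k) X) x y = o3 (e k) b (sandwich (L k) X) (0, fst x, snd x) (0, fst y, snd y)"
          by (simp add: o2_def o3_def)
        also have "... = (\<Sum>i<a. \<Sum>j<a. K k $$ (fst x, i) * o3 a b X (0, i, snd x) (0, j, snd y) * cnj (K k $$ (fst y, j)))"
          unfolding L using X x y by (intro sandwich_mid_op[OF K[OF k]]) (auto simp: mem_Times_iff)
        also have "... = sand ?A (lop (fn (K k))) (o2 b X) x y"
          using x y by (subst sand_lop) (auto simp: o2_def o3_def fn_def mem_Times_iff)
        finally show ?thesis .
      qed
      from measure_left[OF locc_round.prems(3) kr] obtain s' where
        s': "\<And>k. k < r \<Longrightarrow> ok (e k) b (s' k)"
        "\<And>k p q. k < r \<Longrightarrow> p \<in> ix2 (e k) b \<Longrightarrow> q \<in> ix2 (e k) b \<Longrightarrow> opn (s' k) p q = sand ?A (lop (fn (K k))) (opn s) p q"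
        "(\<Sum>k<r. v (e k) b (s' k)) \<le> v a b s" by blast
      have "(\<Sum>k<r. tr (ix2 (e k) b) (opn (s' k))) = (\<Sum>k<r. tr (ix2 (e k) b) (sand ?A (lop (fn (K k))) (opn s)))"
        using s'(2) by (intro sum.cong refl) (simp add: tr_def)
      also have "... = tr ?A (opn s)" by (intro tr_sand_sum[OF _ kraus_lop[OF _ kr]]) auto
      finally show ?thesis
        unfolding ab using s' LX sl by (intro exI[of _ s']) (simp add: sc)
    next
      case 2
      have ab: "a1 k = a" "b1 k = e k" for k using ab1[of k] locc_round.prems(1) 2 by auto
      have K: "K k \<in> carrier_mat (e k) b" if "k < r" for k using locc_round.hyps(2) locc_round.prems(1) that 2 by auto
      have kr: "kraus {..<b} {..<r} (\<lambda>k. {..<e k}) (\<lambda>k. fn (K k))"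
        using K locc_round.hyps(3) locc_round.prems(1) 2 by (intro kraus_fn) auto
      have L: "L k = mid_op a 1 (K k)" for k using locc_round.prems(1) 2 by (simp add: L_def local_op_mid)
      have LX: "sandwich (L k) X \<in> sqmat (a * e k)" if "k < r" for k
        using mid_op_carrier[OF K[OF that], of a 1] X unfolding L by auto
      have sl: "o2 (e k) (sandwich (L k) X) x y = sand ?A (rop (fn (K k))) (o2 b X) x y"
        if k: "k < r" and x: "x \<in> ix2 a (e k)" and y: "y \<in> ix2 a (e k)" for k x y
      proof -
        have "o2 (e k) (sandwich (L k) X) x y = o3 (e k) 1 (sandwich (L k) X) (fst x, snd x, 0) (fst y, snd y, 0)"
          by (simp add: o2_def o3_def)
        also have "... = (\<Sum>i<b. \<Sum>j<b. K k $$ (snd x, i) * o3 b 1 X (fst x, i, 0) (fst y, j, 0) * cnj (K k $$ (snd y, j)))"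
          unfolding L using X x y by (intro sandwich_mid_op[OF K[OF k]]) (auto simp: mem_Times_iff)
        also have "... = sand ?A (rop (fn (K k))) (o2 b X) x y"
          using x y by (subst sand_rop) (auto simp: o2_def o3_def fn_def mem_Times_iff)
        finally show ?thesis .
      qed
      from measure_right[OF locc_round.prems(3) kr] obtain s' where
        s': "\<And>k. k < r \<Longrightarrow> ok a (e k) (s' k)"
        "\<And>k p q. k < r \<Longrightarrow> p \<in> ix2 a (e k) \<Longrightarrow> q \<in> ix2 a (e k) \<Longrightarrow> opn (s' k) p q = sand ?A (rop (fn (K k))) (opn s) p q"
        "(\<Sum>k<r. v a (e k) (s' k)) \<le> v a b s" by blast
      have "(\<Sum>k<r. tr (ix2 a (e k)) (opn (s' k))) = (\<Sum>k<r. tr (ix2 a (e k)) (sand ?A (rop (fn (K k))) (opn s)))"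
        using s'(2) by (intro sum.cong refl) (simp add: tr_def)
      also have "... = tr ?A (opn s)" by (intro tr_sand_sum[OF _ kraus_rop[OF _ kr]]) auto
      finally show ?thesis
        unfolding ab using s' LX sl by (intro exI[of _ s']) (simp add: sc)
    qed
  qed
  then obtain s' where s1: "\<And>k. k < r \<Longrightarrow> ok (a1 k) (b1 k) (s' k)"
    and s2: "\<And>k. k < r \<Longrightarrow> sandwich (L k) X \<in> sqmat (a1 k * b1 k)"
    and s3: "\<And>k p q. k < r \<Longrightarrow> p \<in> ix2 (a1 k) (b1 k) \<Longrightarrow> q \<in> ix2 (a1 k) (b1 k) \<Longrightarrow> o2 (b1 k) (sandwich (L k) X) p q = opn (s' k) p q"
    and s4: "(\<Sum>k<r. tr (ix2 (a1 k) (b1 k)) (opn (s' k))) = tr ?A (opn s)"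
    and s5: "(\<Sum>k<r. v (a1 k) (b1 k) (s' k)) \<le> v a b s"
    by blast
  define Y where "Y k = \<Lambda> k (sandwich (L k) X)" for k
  define Q where "Q k ss \<longleftrightarrow> (\<forall>t\<in>set ss. ok a' b' t) \<and>
    (\<forall>p\<in>ix2 a' b'. \<forall>q\<in>ix2 a' b'. o2 b' (Y k) p q = (\<Sum>t\<leftarrow>ss. opn t p q)) \<and>
    (\<Sum>t\<leftarrow>ss. tr (ix2 a' b') (opn t)) = tr (ix2 (a1 k) (b1 k)) (opn (s' k)) \<and>
    (\<Sum>t\<leftarrow>ss. v a' b' t) \<le> v (a1 k) (b1 k) (s' k)" for k ss
  \<comment> \<open>One list of leaves for each outcome of the first round; their concatenation
    lists the leaves of the whole protocol.\<close>
  define S where "S k = (SOME ss. Q k ss)" for k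
  have ex: "\<exists>ss. Q k ss" if k: "k < r" for k
    using locc_round.IH k ab1 locc_round.prems(2) s1[OF k] s2[OF k] s3[OF k] unfolding Y_def Q_def by blast
  have "Q k (S k)" if "k < r" for k unfolding S_def by (rule someI_ex[OF ex[OF that]])
  then have S: "\<And>k. k < r \<Longrightarrow> \<forall>t\<in>set (S k). ok a' b' t"
    "\<And>k p q. k < r \<Longrightarrow> p \<in> ix2 a' b' \<Longrightarrow> q \<in> ix2 a' b' \<Longrightarrow> o2 b' (Y k) p q = (\<Sum>t\<leftarrow>S k. opn t p q)"
    "\<And>k. k < r \<Longrightarrow> (\<Sum>t\<leftarrow>S k. tr (ix2 a' b') (opn t)) = tr (ix2 (a1 k) (b1 k)) (opn (s' k))"
    "\<And>k. k < r \<Longrightarrow> (\<Sum>t\<leftarrow>S k. v a' b' t) \<le> v (a1 k) (b1 k) (s' k)"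
    unfolding Q_def by blast+
  have cc: "(\<Sum>t\<leftarrow>concat (map S [0..<r]). g t) = (\<Sum>k<r. \<Sum>t\<leftarrow>S k. g t)" for g :: "'s \<Rightarrow> 'x::comm_monoid_add"
    by (induction r) auto
  show ?case
  proof (intro conjI exI[of _ "concat (map S [0..<r])"])
    show "mat_sum (prod_list ds') (\<lambda>k. \<Lambda> k (sandwich (local_op ds p (K k)) X)) {..<r} \<in> sqmat (a' * b')"
      using locc_round.prems(2) by (simp add: mat_sum_def)
    show "\<forall>t\<in>set (concat (map S [0..<r])). ok a' b' t" using S(1) by auto
    show "\<forall>p'\<in>ix2 a' b'. \<forall>q\<in>ix2 a' b'. o2 b' (mat_sum (prod_list ds') (\<lambda>k. \<Lambda> k (sandwich (local_op ds p (K k)) X)) {..<r}) p' q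
       = (\<Sum>t\<leftarrow>concat (map S [0..<r]). opn t p' q)"
    proof (intro ballI)
      fix x y assume xy: "x \<in> ix2 a' b'" "y \<in> ix2 a' b'"
      have "o2 b' (mat_sum (a' * b') Y {..<r}) x y = (\<Sum>k<r. o2 b' (Y k) x y)"
        unfolding o2_def using xy by (intro mat_sum_index pair_less) (auto simp: mem_Times_iff)
      then show "o2 b' (mat_sum (prod_list ds') (\<lambda>k. \<Lambda> k (sandwich (local_op ds p (K k)) X)) {..<r}) x y
       = (\<Sum>t\<leftarrow>concat (map S [0..<r]). opn t x y)"
        using xy S(2) locc_round.prems(2) by (simp add: cc Y_def[abs_def] L_def)
    qed
    show "(\<Sum>t\<leftarrow>concat (map S [0..<r]). tr (ix2 a' b') (opn t)) = tr ?A (opn s)"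
      using S(3) s4 by (simp add: cc)
    show "(\<Sum>t\<leftarrow>concat (map S [0..<r]). v a' b' t) \<le> v a b s"
      unfolding cc using S(4) by (intro order_trans[OF _ s5] sum_mono) auto
  qed
qed

end

section \<open>The test for a private state\<close>

text \<open>With \<open>S\<close> and \<open>W\<close> the sums of \<open>c\<close> and
  \<open>w\<close>, this is the expansion of the nonnegative sum of
  \<open>\<bar>S w_i - c_i W\<bar>^2 / c_i\<close>. Weights may vanish where \<open>w\<close> does,
  the quotient then being 0.\<close>

lemma weighted_cauchy_schwarz:
  fixes w :: "'i \<Rightarrow> complex" and c :: "'i \<Rightarrow> real"
  assumes fin: "finite K" and c: "\<And>i. i \<in> K \<Longrightarrow> 0 \<le> c i" and z: "\<And>i. i \<in> K \<Longrightarrow> c i = 0 \<Longrightarrow> w i = 0"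
  shows "(cmod (\<Sum>i\<in>K. w i))\<^sup>2 \<le> (\<Sum>i\<in>K. c i) * (\<Sum>i\<in>K. (cmod (w i))\<^sup>2 / c i)"
proof -
  define S where "S = (\<Sum>i\<in>K. c i)"
  define W where "W = (\<Sum>i\<in>K. w i)"
  have S0: "0 \<le> S" unfolding S_def by (rule sum_nonneg) (rule c)
  show ?thesis
  proof (cases "S = 0")
    case True
    then have "w i = 0" if "i \<in> K" for i
      using that z c fin unfolding S_def by (simp add: sum_nonneg_eq_0_iff)
    then show ?thesis by (simp add: True flip: S_def)
  next
    case False
    then have Sp: "S > 0" using S0 by simp
    have "0 \<le> (\<Sum>i\<in>K. (cmod (S * w i - c i * W))\<^sup>2 / c i)" using c by (intro sum_nonneg) simp
    also have "... = (\<Sum>i\<in>K. S\<^sup>2 * ((cmod (w i))\<^sup>2 / c i) - 2 * S * Re (cnj W * w i) + c i * (cmod W)\<^sup>2)"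
    proof (intro sum.cong refl)
      fix i assume i: "i \<in> K"
      show "(cmod (S * w i - c i * W))\<^sup>2 / c i = S\<^sup>2 * ((cmod (w i))\<^sup>2 / c i) - 2 * S * Re (cnj W * w i) + c i * (cmod W)\<^sup>2"
      proof (cases "c i = 0")
        case True
        then show ?thesis using z[OF i] by simp
      next
        case False
        have "(cmod (S * w i - c i * W))\<^sup>2 = S\<^sup>2 * (cmod (w i))\<^sup>2 - 2 * S * c i * Re (cnj W * w i) + (c i)\<^sup>2 * (cmod W)\<^sup>2"
          unfolding cmod_power2 by (simp add: power2_eq_square algebra_simps)
        then show ?thesis using False by (simp add: field_simps power2_eq_square)
      qed
    qed
    also have "... = S\<^sup>2 * (\<Sum>i\<in>K. (cmod (w i))\<^sup>2 / c i) - 2 * S * Re (cnj W * W) + S * (cmod W)\<^sup>2"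
    proof -
      have "(\<Sum>i\<in>K. Re (cnj W * w i)) = Re (cnj W * W)" by (simp only: W_def sum_distrib_left Re_sum)
      then show ?thesis
        by (simp only: sum.distrib sum_subtractf sum_distrib_left[symmetric] sum_distrib_right[symmetric] S_def[symmetric])
    qed
    also have "Re (cnj W * W) = (cmod W)\<^sup>2" using cmod_power2[of W] by (simp add: power2_eq_square)
    finally have "S * (cmod W)\<^sup>2 \<le> S * (S * (\<Sum>i\<in>K. (cmod (w i))\<^sup>2 / c i))"
      by (simp add: power2_eq_square algebra_simps)
    then show ?thesis using Sp by (simp add: S_def W_def)
  qed
qed

lemma proj_reindex:
  assumes b: "bij_betw h J I" and P: "proj I P"
  shows "proj J (\<lambda>x y. P (h x) (h y))"
proof -
  have hI: "h x \<in> I" if "x \<in> J" for x using b that by (auto simp: bij_betw_def)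
  have "(\<Sum>z\<in>J. P (h x) (h z) * P (h z) (h y)) = (\<Sum>z\<in>I. P (h x) z * P z (h y))" for x y
    by (rule sum.reindex_bij_betw[OF b])
  moreover have "herm J (\<lambda>x y. P (h x) (h y))" using P hI unfolding proj_def herm_def by blast
  moreover have "(\<Sum>z\<in>I. P (h x) z * P z (h y)) = P (h x) (h y)" if "x \<in> J" "y \<in> J" for x y
    using P hI that unfolding proj_def by blast
  ultimately show ?thesis by (simp add: proj_def)
qed

lemma trp_reindex:
  assumes b: "bij_betw h J I"
  shows "trp J (\<lambda>x y. P (h x) (h y)) (\<lambda>x y. A (h x) (h y)) = trp I P A"
proof -
  have "(\<Sum>y\<in>J. P x (h y) * A (h y) x) = (\<Sum>y\<in>I. P x y * A y x)" for x
    by (rule sum.reindex_bij_betw[OF b])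
  then show ?thesis
    unfolding trp_def using sum.reindex_bij_betw[OF b, of "\<lambda>x. \<Sum>y\<in>I. P x y * A y x"] by simp
qed

lemma trp_decomp:
  assumes "\<And>x y. x \<in> I \<Longrightarrow> y \<in> I \<Longrightarrow> A x y = (\<Sum>m\<in>M. of_real (c m) * g m x * cnj (g m y))"
  shows "trp I P A = (\<Sum>m\<in>M. c m * Re (quad I P (g m)))"
proof -
  have "trp I P A = Re (\<Sum>x\<in>I. \<Sum>y\<in>I. \<Sum>m\<in>M. of_real (c m) * (cnj (g m x) * P x y * g m y))"
    unfolding trp_def using assms by (intro arg_cong[where f = Re] sum.cong refl) (simp add: sum_distrib_left mult_ac)
  also have "... = Re (\<Sum>m\<in>M. \<Sum>x\<in>I. \<Sum>y\<in>I. of_real (c m) * (cnj (g m x) * P x y * g m y))"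
    by (intro arg_cong[where f = Re]) (rule sum3_swap)
  finally show ?thesis by (simp add: quad_def flip: sum_distrib_left)
qed

text \<open>The operator \<open>\<Sum>i j. |ii><jj| \<otimes> U_i U_j^* / D\<close>: the maximally
  entangled state of the keys, with the identity on the shields, conjugated by the twisting unitary
  of a private state. The shield state does not enter.\<close>

definition ptest :: "nat \<Rightarrow> nat \<Rightarrow> nat \<Rightarrow> (nat \<Rightarrow> complex mat) \<Rightarrow> nat \<times> nat \<Rightarrow> nat \<times> nat \<Rightarrow> complex" where
  "ptest D a b U p q = (if fst p div a = snd p div b \<and> fst q div a = snd q div b
     then (U (fst p div a) * mat_adjoint (U (fst q div a))) $$
            (fst p mod a * b + snd p mod b, fst q mod a * b + snd q mod b) / of_nat D else 0)"

locale private_test =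
  fixes D a b :: nat and U :: "nat \<Rightarrow> complex mat"
  assumes D: "0 < D" and U: "\<And>i. i < D \<Longrightarrow> unitary (a * b) (U i)"
begin

abbreviation "I \<equiv> ix2 (D * a) (D * b)"
abbreviation "P \<equiv> ptest D a b U"

lemma carrier [simp]: "i < D \<Longrightarrow> U i \<in> sqmat (a * b)"
  using U by (simp add: unitary_def)

lemma adj_mult: "i < D \<Longrightarrow> mat_adjoint (U i) * U i = 1\<^sub>m (a * b)" "i < D \<Longrightarrow> U i * mat_adjoint (U i) = 1\<^sub>m (a * b)"
  using U by (simp_all add: unitary_def)

lemma UU_index:
  assumes "i < D" "j < D" "x < a * b" "y < a * b"
  shows "(U i * mat_adjoint (U j)) $$ (x, y) = (\<Sum>k<a * b. U i $$ (x, k) * cnj (U j $$ (y, k)))"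
proof -
  have "(U i * mat_adjoint (U j)) $$ (x, y) = (\<Sum>k<a * b. U i $$ (x, k) * mat_adjoint (U j) $$ (k, y))"
    using assms by (intro index_mult[of _ "a * b"]) auto
  then show ?thesis using carrier[OF assms(2)] assms by (simp add: index_mat_adjoint del: index_mult_mat carrier)
qed

abbreviation "key p \<equiv> fst p div a"
abbreviation "agree p \<equiv> key p = snd p div b"
abbreviation "sh p \<equiv> fst p mod a * b + snd p mod b"

lemma key_sum: "(\<Sum>p\<in>I. if agree p then g (key p) (sh p) else 0)
    = (\<Sum>i<D. \<Sum>r<a * b. g i r :: complex)"
proof -
  have "(\<Sum>p\<in>I. if agree p then g (key p) (sh p) else 0)
    = (\<Sum>i<D. \<Sum>s<a. \<Sum>j<D. \<Sum>t<b. if j = i then g i (s * b + t) else 0)"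
    unfolding sum_Times sum_pair by (intro sum.cong refl) auto
  also have "... = (\<Sum>i<D. \<Sum>s<a. \<Sum>t<b. g i (s * b + t))"
    by (intro sum.cong refl sum_delta2) auto
  finally show ?thesis by (simp add: sum_pair)
qed

lemma index_less: "p \<in> I \<Longrightarrow> key p < D \<and> snd p div b < D \<and> sh p < a * b"
  by (auto simp: div_less_pair mod_less_pair intro!: pair_less)

lemma proj_P: "proj I P"
  unfolding proj_def
proof (intro conjI ballI)
  show "herm I P"
    unfolding herm_def
  proof (intro ballI)
    fix p q assume "p \<in> I" "q \<in> I"
    then show "P p q = cnj (P q p)"
      using index_less[of p] index_less[of q] by (simp add: ptest_def UU_index mult.commute del: index_mult_mat)
  qed
  fix p q assume p: "p \<in> I" and q: "q \<in> I"
  let ?i = "key p" and ?j = "key q" and ?x = "sh p" and ?y = "sh q"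
  have lp: "?i < D" "?x < a * b" and lq: "?j < D" "?y < a * b" using index_less[OF p] index_less[OF q] by auto
  \<comment> \<open>The inner factors cancel by \<open>U_k^* U_k = 1\<close>. All \<open>D\<close>
    values of \<open>k\<close> thus give the same term, and one of the two factors
    \<open>1 / D\<close> is used up.\<close>
  have UU: "(\<Sum>r<a * b. (U ?i * mat_adjoint (U k)) $$ (?x, r) * (U k * mat_adjoint (U ?j)) $$ (r, ?y)) = (U ?i * mat_adjoint (U ?j)) $$ (?x, ?y)"
    if k: "k < D" for k
  proof -
    have c: "U ?i \<in> sqmat (a * b)" "U k \<in> sqmat (a * b)" "U ?j \<in> sqmat (a * b)"
      using lp lq k by auto
    have "(U ?i * mat_adjoint (U k)) * (U k * mat_adjoint (U ?j)) = U ?i * ((mat_adjoint (U k) * U k) * mat_adjoint (U ?j))"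
      using c by (simp add: assoc_mult_mat[of _ "a * b" "a * b" _ "a * b" _ "a * b"])
    also have "... = U ?i * mat_adjoint (U ?j)" using c k by (simp add: adj_mult)
    finally have e: "(U ?i * mat_adjoint (U k)) * (U k * mat_adjoint (U ?j)) = U ?i * mat_adjoint (U ?j)" .
    have "((U ?i * mat_adjoint (U k)) * (U k * mat_adjoint (U ?j))) $$ (?x, ?y) = (\<Sum>r<a * b. (U ?i * mat_adjoint (U k)) $$ (?x, r) * (U k * mat_adjoint (U ?j)) $$ (r, ?y))"
      using lp lq by (intro index_mult[OF mult_carrier_mat[OF c(1) mat_adjoint_carrier[OF c(2)]] mult_carrier_mat[OF c(2) mat_adjoint_carrier[OF c(3)]]])
    then show ?thesis unfolding e by simp
  qed
  define C where "C = (if agree p \<and> agree q then 1 else 0 :: complex)"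
  have "(\<Sum>r\<in>I. P p r * P r q) = (\<Sum>r\<in>I. if agree r then
      C * ((U ?i * mat_adjoint (U (key r))) $$ (?x, sh r) * (U (key r) * mat_adjoint (U ?j)) $$ (sh r, ?y)) / (of_nat D)\<^sup>2 else 0)"
    by (intro sum.cong refl) (auto simp: ptest_def C_def power2_eq_square simp del: index_mult_mat)
  also have "... = (\<Sum>k<D. \<Sum>r<a * b. C * ((U ?i * mat_adjoint (U k)) $$ (?x, r) * (U k * mat_adjoint (U ?j)) $$ (r, ?y)) / (of_nat D)\<^sup>2)"
    by (rule key_sum)
  also have "... = (\<Sum>k<D. C * (U ?i * mat_adjoint (U ?j)) $$ (?x, ?y) / (of_nat D)\<^sup>2)"
    by (intro sum.cong refl) (simp add: UU sum_divide_distrib[symmetric] sum_distrib_left[symmetric] del: index_mult_mat)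
  also have "... = P p q" using D by (simp add: ptest_def C_def power2_eq_square del: index_mult_mat)
  finally show "(\<Sum>r\<in>I. P p r * P r q) = P p q" .
qed

lemma bij_key: "bij_betw (\<lambda>p. (fst p * a + fst (snd p), snd (snd p))) (ix3 D a (D * b)) I"
  by (rule bij_betwI[where g = "\<lambda>p. (key p, fst p mod a, snd p)"]) (auto simp: pair_less div_less_pair mod_less_pair)

text \<open>Bob's key and shield stay together as one system, with \<open>T i\<close> the indices at
  which his key is \<open>i\<close>. The diagonal blocks have the required form because
  \<open>U_i U_i^*\<close> is the identity.\<close>

lemma key_test: "key_test {..<D} {..<a} {..<D * b} (\<lambda>i. {y. y < D * b \<and> y div b = i})
    (\<lambda>p q. P (fst p * a + fst (snd p), snd (snd p)) (fst q * a + fst (snd q), snd (snd q)))"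
  unfolding key_test_def
proof (intro conjI ballI impI)
  show "proj (ix3 D a (D * b)) (\<lambda>p q. P (fst p * a + fst (snd p), snd (snd p)) (fst q * a + fst (snd q), snd (snd q)))"
    by (rule proj_reindex[OF bij_key proj_P])
next
  fix i x y assume i: "i \<in> {..<D}" and x: "x \<in> ix2 a (D * b)" and y: "y \<in> ix2 a (D * b)"
  have lx: "fst x < a" "snd x < D * b" and ly: "fst y < a" "snd y < D * b" using x y by auto
  have r: "fst x * b + snd x mod b < a * b" "fst y * b + snd y mod b < a * b"
    using lx ly by (auto intro!: pair_less mod_less_pair)
  have b0: "b > 0" using lx by (cases b) auto
  have inj: "fst x * b + snd x mod b = fst y * b + snd y mod b \<longleftrightarrow> x = y" if "snd x div b = snd y div b"
  proof
    assume e: "fst x * b + snd x mod b = fst y * b + snd y mod b"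
    have "(fst x * b + snd x mod b) div b = fst x" "(fst y * b + snd y mod b) div b = fst y"
      "(fst x * b + snd x mod b) mod b = snd x mod b" "(fst y * b + snd y mod b) mod b = snd y mod b" using b0 by auto
    with e have "fst x = fst y" "snd x mod b = snd y mod b" by metis+
    moreover then have "snd x = snd y" using that by (metis div_mult_mod_eq)
    ultimately show "x = y" by (simp add: prod_eq_iff)
  qed simp
  have "P (fst (i, x) * a + fst (snd (i, x)), snd (snd (i, x))) (fst (i, y) * a + fst (snd (i, y)), snd (snd (i, y)))
    = (if snd x div b = i \<and> snd y div b = i then 1\<^sub>m (a * b) $$ (fst x * b + snd x mod b, fst y * b + snd y mod b) / of_nat D else 0)"
    using lx ly i by (auto simp: ptest_def adj_mult simp del: index_mult_mat)
  also have "... = (if x = y \<and> snd x \<in> {y. y < D * b \<and> y div b = i} then 1 / of_nat (card {..<D}) else 0)"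
    using r inj lx by auto
  finally show "P (fst (i, x) * a + fst (snd (i, x)), snd (snd (i, x))) (fst (i, y) * a + fst (snd (i, y)), snd (snd (i, y)))
    = (if x = y \<and> snd x \<in> {y. y < D * b \<and> y div b = i} then 1 / of_nat (card {..<D}) else 0)" .
next
  fix i x y assume "i \<in> {..<D}" "x \<in> ix2 a (D * b)" "snd x \<notin> {y. y < D * b \<and> y div b = i}"
  then show "P (fst (i, x) * a + fst (snd (i, x)), snd (snd (i, x))) (fst y * a + fst (snd y), snd (snd y)) = 0"
    by (auto simp: ptest_def)
qed

text \<open>Let \<open>g_i\<close> be the part of the product vector with both keys equal to
  \<open>i\<close>, and \<open>w_i = U_i^* g_i\<close>. The form is the squared norm of
  \<open>\<Sum>i. w_i\<close> over \<open>D\<close>, and \<open>w_i\<close> has squared norm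
  \<open>X i * Y i\<close>. Cauchy-Schwarz with weights \<open>X i\<close> bounds it by
  \<open>(\<Sum>i. X i) * (\<Sum>i. Y i) / D\<close>, whatever the unitaries do.\<close>

lemma quad_P_product_le:
  "Re (quad I P (\<lambda>p. x (fst p) * y (snd p))) \<le> (\<Sum>i<D * a. (cmod (x i))\<^sup>2) * (\<Sum>i<D * b. (cmod (y i))\<^sup>2) / D"
proof -
  define g where "g i r = x (i * a + r div b) * y (i * b + r mod b)" for i r
  define w where "w i k = inn {..<a * b} (\<lambda>r. U i $$ (r, k)) (g i)" for i k
  have dist: "(\<Sum>i<D. \<Sum>r<a * b. A i r) * (\<Sum>j<D. \<Sum>s<a * b. B j s) / d
      = (\<Sum>i<D. \<Sum>r<a * b. \<Sum>j<D. \<Sum>s<a * b. A i r * B j s / d)" for A B and d :: complex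
  proof -
    have "(\<Sum>i<D. \<Sum>r<a * b. A i r) * (\<Sum>j<D. \<Sum>s<a * b. B j s) / d = (\<Sum>i<D. \<Sum>j<D. \<Sum>r<a * b. \<Sum>s<a * b. A i r * B j s / d)"
      by (simp only: sum_product sum_divide_distrib)
    also have "... = (\<Sum>i<D. \<Sum>r<a * b. \<Sum>j<D. \<Sum>s<a * b. A i r * B j s / d)"
      by (intro sum.cong refl sum.swap)
    finally show ?thesis .
  qed
  have ab0: "a > 0 \<and> b > 0" if "p \<in> I" for p using that by (cases a; cases b) auto
  have gI: "x (fst p) * y (snd p) = g (key p) (sh p)" if "p \<in> I" "agree p" for p
    using ab0[OF that(1)] that(2) unfolding g_def by (metis add_cancel_right_right add_diff_cancel_left' div_mult_self3 mod_mult_self3 mod_div_trivial mod_mod_trivial div_mult_mod_eq mult.commute not_gr_zero add.commute)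
  have "quad I P (\<lambda>p. x (fst p) * y (snd p)) = (\<Sum>p\<in>I. if agree p then
     (\<Sum>q\<in>I. if agree q then
      cnj (g (key p) (sh p)) * ((U (key p) * mat_adjoint (U (key q))) $$
            (sh p, sh q) / of_nat D) * g (key q) (sh q) else 0) else 0)"
    unfolding quad_def
  proof (intro sum.cong refl)
    fix p assume p: "p \<in> I"
    have "cnj (x (fst p) * y (snd p)) * P p q * (x (fst q) * y (snd q)) = (if agree p then
      (if agree q then
      cnj (g (key p) (sh p)) * ((U (key p) * mat_adjoint (U (key q))) $$
            (sh p, sh q) / of_nat D) * g (key q) (sh q) else 0) else 0)"
      if "q \<in> I" for q
      using gI[OF p] gI[OF that]
      by (cases "agree p"; cases "agree q") (simp_all add: ptest_def del: index_mult_mat complex_cnj_mult)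
    then show "(\<Sum>q\<in>I. cnj (x (fst p) * y (snd p)) * P p q * (x (fst q) * y (snd q))) = (if agree p then
     (\<Sum>q\<in>I. if agree q then
      cnj (g (key p) (sh p)) * ((U (key p) * mat_adjoint (U (key q))) $$
            (sh p, sh q) / of_nat D) * g (key q) (sh q) else 0) else 0)"
      by (simp del: index_mult_mat complex_cnj_mult)
  qed
  also have "... = (\<Sum>i<D. \<Sum>r<a * b. \<Sum>j<D. \<Sum>s<a * b. cnj (g i r) * ((U i * mat_adjoint (U j)) $$ (r, s) / of_nat D) * g j s)"
    unfolding key_sum[of "\<lambda>j s. _ * ((U _ * mat_adjoint (U j)) $$ (_, s) / of_nat D) * g j s"]
    by (rule key_sum)
  also have "... = (\<Sum>i<D. \<Sum>r<a * b. \<Sum>j<D. \<Sum>s<a * b. \<Sum>k<a * b. (cnj (g i r) * U i $$ (r, k)) * (cnj (U j $$ (s, k)) * g j s) / of_nat D)"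
    by (intro sum.cong refl) (simp add: UU_index sum_distrib_left sum_distrib_right sum_divide_distrib mult_ac del: index_mult_mat)
  also have "... = (\<Sum>i<D. \<Sum>r<a * b. \<Sum>k<a * b. \<Sum>j<D. \<Sum>s<a * b. (cnj (g i r) * U i $$ (r, k)) * (cnj (U j $$ (s, k)) * g j s) / of_nat D)"
    by (intro sum.cong refl sum3_swap)
  also have "... = (\<Sum>k<a * b. \<Sum>i<D. \<Sum>r<a * b. \<Sum>j<D. \<Sum>s<a * b. (cnj (g i r) * U i $$ (r, k)) * (cnj (U j $$ (s, k)) * g j s) / of_nat D)"
    by (rule sum3_swap)
  also have "... = (\<Sum>k<a * b. cnj (\<Sum>i<D. w i k) * (\<Sum>i<D. w i k) / of_nat D)"
  proof (intro sum.cong refl)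
    fix k
    have "cnj (\<Sum>i<D. w i k) = (\<Sum>i<D. \<Sum>r<a * b. cnj (g i r) * U i $$ (r, k))" by (simp add: w_def inn_def mult.commute)
    then show "(\<Sum>i<D. \<Sum>r<a * b. \<Sum>j<D. \<Sum>s<a * b. (cnj (g i r) * U i $$ (r, k)) * (cnj (U j $$ (s, k)) * g j s) / of_nat D)
      = cnj (\<Sum>i<D. w i k) * (\<Sum>i<D. w i k) / of_nat D"
      unfolding w_def inn_def[of _ "\<lambda>r. U _ $$ (r, k)"] by (simp only: dist)
  qed
  finally have q: "Re (quad I P (\<lambda>p. x (fst p) * y (snd p))) = (\<Sum>k<a * b. (cmod (\<Sum>i<D. w i k))\<^sup>2) / D"
    by (simp add: mult.commute[of "cnj _"] complex_norm_square[symmetric] sum_divide_distrib del: of_real_power cnj_sum)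
  define X Y where "X i = (\<Sum>r<a. (cmod (x (i * a + r)))\<^sup>2)" and "Y i = (\<Sum>r<b. (cmod (y (i * b + r)))\<^sup>2)" for i
  have X0: "0 \<le> X i" and Y0: "0 \<le> Y i" for i by (simp_all add: X_def Y_def sum_nonneg)
  have wn: "(\<Sum>k<a * b. (cmod (w i k))\<^sup>2) = X i * Y i" if i: "i < D" for i
  proof -
    have "onb {..<a * b} (\<lambda>k r. U i $$ (r, k))" using unitary_onb[OF carrier[OF i]] U[OF i] by simp
    then have "(\<Sum>k<a * b. (cmod (w i k))\<^sup>2) = (\<Sum>r<a * b. (cmod (g i r))\<^sup>2)"
      unfolding w_def by (intro parseval_norm) auto
    also have "... = X i * Y i"
      by (simp add: sum_pair g_def X_def Y_def sum_product norm_mult power_mult_distrib)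
    finally show ?thesis .
  qed
  have "(\<Sum>k<a * b. (cmod (\<Sum>i<D. w i k))\<^sup>2) \<le> (\<Sum>k<a * b. (\<Sum>i<D. X i) * (\<Sum>i<D. (cmod (w i k))\<^sup>2 / X i))"
  proof (intro sum_mono weighted_cauchy_schwarz X0)
    fix k i assume k: "k \<in> {..<a * b}" and i: "i \<in> {..<D}" and "X i = 0"
    then have "(\<Sum>k<a * b. (cmod (w i k))\<^sup>2) = 0" using wn by simp
    then show "w i k = 0" using k by (subst (asm) sum_nonneg_eq_0_iff) auto
  qed simp
  also have "... = (\<Sum>i<D. X i) * (\<Sum>k<a * b. \<Sum>i<D. (cmod (w i k))\<^sup>2 / X i)" by (simp add: sum_distrib_left)
  also have "(\<Sum>k<a * b. \<Sum>i<D. (cmod (w i k))\<^sup>2 / X i) = (\<Sum>i<D. X i * Y i / X i)"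
    by (subst sum.swap) (simp add: wn sum_divide_distrib[symmetric])
  also have "(\<Sum>i<D. X i) * (\<Sum>i<D. X i * Y i / X i) \<le> (\<Sum>i<D. X i) * (\<Sum>i<D. Y i)"
  proof (intro mult_left_mono sum_mono sum_nonneg X0)
    fix i show "X i * Y i / X i \<le> Y i" using Y0[of i] by (cases "X i = 0") auto
  qed
  also have "... = (\<Sum>i<D * a. (cmod (x i))\<^sup>2) * (\<Sum>i<D * b. (cmod (y i))\<^sup>2)"
    by (simp add: X_def Y_def sum_pair)
  finally show ?thesis unfolding q by (rule divide_right_mono) simp
qed

end

section \<open>Tensor products of parties entry by entry, and separable operators\<close>

lemma pair_div: "y < b \<Longrightarrow> (x * b + y) div b = (x::nat)" and pair_mod: "y < b \<Longrightarrow> (x * b + y) mod b = (y::nat)"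
  by auto

lemma bij_betw_fst:
  assumes "bij_betw h A B" shows "bij_betw (\<lambda>p. (h (fst p), snd p)) (A \<times> X) (B \<times> X)"
  using assms unfolding bij_betw_def inj_on_def by (auto simp: image_iff Bex_def)

lemma party_tensor2_carrier: "party_tensor [d1, d2] [e1, e2] X Y \<in> sqmat (d1 * e1 * (d2 * e2))"
  by (simp add: party_tensor_def Let_def)

lemma party_tensor3_carrier: "party_tensor [d1, d2, d3] [e1, e2, e3] X Y \<in> sqmat (d1 * e1 * (d2 * e2) * (d3 * e3))"
  by (simp add: party_tensor_def Let_def mult.assoc)

lemma o2_party_tensor:
  assumes "p \<in> ix2 (d1 * e1) (d2 * e2)" "q \<in> ix2 (d1 * e1) (d2 * e2)"
  shows "o2 (d2 * e2) (party_tensor [d1, d2] [e1, e2] X Y) p q =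
    o2 d2 X (fst p div e1, snd p div e2) (fst q div e1, snd q div e2) * o2 e2 Y (fst p mod e1, snd p mod e2) (fst q mod e1, snd q mod e2)"
proof -
  have "fst p * (d2 * e2) + snd p < d1 * e1 * (d2 * e2)" "fst q * (d2 * e2) + snd q < d1 * e1 * (d2 * e2)"
    using assms by (auto intro!: pair_less)
  moreover have "d2 * e2 > 0" using assms by (cases "d2 * e2") auto
  ultimately show ?thesis
    using assms by (auto simp: party_tensor_def Let_def o2_def)
qed

lemma o3_party_tensor:
  assumes "p \<in> ix3 (d1 * e1) (d2 * e2) (d3 * e3)" "q \<in> ix3 (d1 * e1) (d2 * e2) (d3 * e3)"
  shows "o3 (d2 * e2) (d3 * e3) (party_tensor [d1, d2, d3] [e1, e2, e3] X Y) p q =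
    o3 d2 d3 X (fst p div e1, fst (snd p) div e2, snd (snd p) div e3) (fst q div e1, fst (snd q) div e2, snd (snd q) div e3) *
    o3 e2 e3 Y (fst p mod e1, fst (snd p) mod e2, snd (snd p) mod e3) (fst q mod e1, fst (snd q) mod e2, snd (snd q) mod e3)"
proof -
  have less: "(fst r * (d2 * e2) + fst (snd r)) * (d3 * e3) + snd (snd r) < d1 * e1 * (d2 * e2) * (d3 * e3)"
    if "r \<in> ix3 (d1 * e1) (d2 * e2) (d3 * e3)" for r
    using that by (auto intro!: pair_less)
  have pos: "d2 * e2 > 0" "d3 * e3 > 0" using assms by (cases "d2 * e2"; cases "d3 * e3"; auto)+
  have dec: "decode [d1 * e1, d2 * e2, d3 * e3] ((fst r * (d2 * e2) + fst (snd r)) * (d3 * e3) + snd (snd r)) = [fst r, fst (snd r), snd (snd r)]"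
    if "r \<in> ix3 (d1 * e1) (d2 * e2) (d3 * e3)" for r
  proof -
    let ?i = "(fst r * (d2 * e2) + fst (snd r)) * (d3 * e3) + snd (snd r)"
    have l: "fst (snd r) * (d3 * e3) + snd (snd r) < d2 * e2 * (d3 * e3)" using that by (auto intro!: pair_less)
    have e: "?i = fst r * (d2 * e2 * (d3 * e3)) + (fst (snd r) * (d3 * e3) + snd (snd r))" by (simp add: algebra_simps)
    have "?i div (d2 * e2 * (d3 * e3)) = fst r" "?i mod (d2 * e2 * (d3 * e3)) = fst (snd r) * (d3 * e3) + snd (snd r)"
      unfolding e by (rule pair_div[OF l], rule pair_mod[OF l])
    then show ?thesis using that pos by auto
  qed
  show ?thesis
    using less[OF assms(1)] less[OF assms(2)] dec[OF assms(1)] dec[OF assms(2)]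
    by (simp add: party_tensor_def Let_def o3_def mult.assoc[symmetric]) (simp add: algebra_simps)
qed

text \<open>Separability without normalisation: the weights are absorbed into the positive factors,
  so local operators preserve it outcome by outcome.\<close>

definition sep :: "'a set \<Rightarrow> 'b set \<Rightarrow> ('a \<times> 'b) op \<Rightarrow> bool" where
  "sep A B \<sigma> \<longleftrightarrow> (\<exists>(n::nat) \<alpha> \<beta>. (\<forall>i<n. pos A (\<alpha> i) \<and> pos B (\<beta> i)) \<and>
     (\<forall>p\<in>A \<times> B. \<forall>q\<in>A \<times> B. \<sigma> p q = (\<Sum>i<n. \<alpha> i (fst p) (fst q) * \<beta> i (snd p) (snd q))))"

lemma trp_cong: "(\<And>x y. x \<in> I \<Longrightarrow> y \<in> I \<Longrightarrow> A x y = B x y) \<Longrightarrow> trp I P A = trp I P B"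
  by (simp add: trp_def)

lemma tr_cong: "(\<And>x. x \<in> I \<Longrightarrow> A x x = B x x) \<Longrightarrow> tr I A = tr I B"
  by (simp add: tr_def)

lemma trp_sum: "trp I P (\<lambda>x y. \<Sum>k\<in>K. A k x y) = (\<Sum>k\<in>K. trp I P (A k))"
proof -
  have "(\<Sum>x\<in>I. \<Sum>y\<in>I. P x y * (\<Sum>k\<in>K. A k y x)) = (\<Sum>k\<in>K. \<Sum>x\<in>I. \<Sum>y\<in>I. P x y * A k y x)"
    unfolding sum_distrib_left by (rule sum3_swap)
  then show ?thesis by (simp only: trp_def Re_sum[of _ K])
qed

lemma onb_norm: "\<lbrakk>onb I u; k \<in> I\<rbrakk> \<Longrightarrow> (\<Sum>x\<in>I. (cmod (u k x))\<^sup>2) = 1"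
proof -
  assume "onb I u" "k \<in> I"
  then have "complex_of_real (\<Sum>x\<in>I. (cmod (u k x))\<^sup>2) = 1" unfolding inn_self[symmetric] by (simp add: onb_inn)
  then show ?thesis by (simp only: of_real_eq_1_iff)
qed

context private_test
begin

lemma trp_product_le:
  assumes \<alpha>: "pos {..<D * a} \<alpha>" and \<beta>: "pos {..<D * b} \<beta>"
  shows "trp I P (\<lambda>p q. \<alpha> (fst p) (fst q) * \<beta> (snd p) (snd q)) \<le> Re (tr I (\<lambda>p q. \<alpha> (fst p) (fst q) * \<beta> (snd p) (snd q))) / D"
proof -
  define p u where "p = evl {..<D * a} \<alpha>" and "u = evc {..<D * a} \<alpha>"
  define r v where "r = evl {..<D * b} \<beta>" and "v = evc {..<D * b} \<beta>"
  have s: "spec {..<D * a} p u \<alpha>" unfolding p_def u_def by (intro spec_evl_evc pos_herm \<alpha>) auto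
  have t: "spec {..<D * b} r v \<beta>" unfolding r_def v_def by (intro spec_evl_evc pos_herm \<beta>) auto
  have p0: "0 \<le> p k" if "k < D * a" for k using spec_pos_nonneg[OF _ s \<alpha>] that by simp
  have r0: "0 \<le> r k" if "k < D * b" for k using spec_pos_nonneg[OF _ t \<beta>] that by simp
  have "trp I P (\<lambda>p q. \<alpha> (fst p) (fst q) * \<beta> (snd p) (snd q))
    = (\<Sum>m\<in>I. p (fst m) * r (snd m) * Re (quad I P (\<lambda>q. u (fst m) (fst q) * v (snd m) (snd q))))"
  proof (rule trp_decomp)
    fix x y assume xy: "x \<in> I" "y \<in> I"
    have "\<alpha> (fst x) (fst y) * \<beta> (snd x) (snd y) = (\<Sum>k<D * a. of_real (p k) * u k (fst x) * cnj (u k (fst y))) * (\<Sum>l<D * b. of_real (r l) * v l (snd x) * cnj (v l (snd y)))"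
      using s t xy by (auto simp: spec_def mem_Times_iff)
    then show "\<alpha> (fst x) (fst y) * \<beta> (snd x) (snd y) = (\<Sum>m\<in>I. of_real (p (fst m) * r (snd m)) * (u (fst m) (fst x) * v (snd m) (snd x)) * cnj (u (fst m) (fst y) * v (snd m) (snd y)))"
      by (simp add: sum_product sum_Times mult_ac)
  qed
  also have "... \<le> (\<Sum>m\<in>I. p (fst m) * r (snd m) * (1 * 1 / D))"
  proof (intro sum_mono mult_left_mono)
    fix m assume m: "m \<in> I"
    have "(\<Sum>i<D * a. (cmod (u (fst m) i))\<^sup>2) = 1" "(\<Sum>i<D * b. (cmod (v (snd m) i))\<^sup>2) = 1"
      using m s t by (auto simp: spec_def onb_norm mem_Times_iff)
    then show "Re (quad I P (\<lambda>q. u (fst m) (fst q) * v (snd m) (snd q))) \<le> 1 * 1 / D"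
      using quad_P_product_le[of "u (fst m)" "v (snd m)"] by simp
    show "0 \<le> p (fst m) * r (snd m)" using m p0 r0 by auto
  qed
  also have "... = (\<Sum>k<D * a. p k) * (\<Sum>l<D * b. r l) / D"
    by (simp add: sum_Times sum_product sum_divide_distrib)
  also have "(\<Sum>k<D * a. p k) * (\<Sum>l<D * b. r l) = Re (tr I (\<lambda>p q. \<alpha> (fst p) (fst q) * \<beta> (snd p) (snd q)))"
  proof -
    have "tr I (\<lambda>p q. \<alpha> (fst p) (fst q) * \<beta> (snd p) (snd q)) = tr {..<D * a} \<alpha> * tr {..<D * b} \<beta>"
      by (simp add: tr_def sum_Times sum_product)
    then show ?thesis unfolding spec_trace[OF s] spec_trace[OF t] by (simp flip: of_real_mult of_real_sum)
  qed
  finally show ?thesis .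
qed

lemma trp_sep_le:
  assumes "sep {..<D * a} {..<D * b} \<sigma>"
  shows "trp I P \<sigma> \<le> Re (tr I \<sigma>) / D"
proof -
  from assms obtain n \<alpha> \<beta> where ab: "\<And>i. i < n \<Longrightarrow> pos {..<D * a} (\<alpha> i) \<and> pos {..<D * b} (\<beta> i)"
    and s: "\<And>p q. p \<in> I \<Longrightarrow> q \<in> I \<Longrightarrow> \<sigma> p q = (\<Sum>i<(n::nat). \<alpha> i (fst p) (fst q) * \<beta> i (snd p) (snd q))"
    unfolding sep_def by blast
  let ?S = "\<lambda>i p q. \<alpha> i (fst p) (fst q) * \<beta> i (snd p) (snd q)"
  have "trp I P \<sigma> = (\<Sum>i<n. trp I P (?S i))"
    unfolding trp_sum[symmetric] by (rule trp_cong) (rule s)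
  also have "... \<le> (\<Sum>i<n. Re (tr I (?S i)) / D)"
    using ab by (intro sum_mono trp_product_le) auto
  also have "... = Re (tr I \<sigma>) / D"
    using tr_cong[of I \<sigma> "\<lambda>p q. \<Sum>i<n. ?S i p q"] s tr_sum[of I ?S "{..<n}"] by (simp add: sum_divide_distrib)
  finally show ?thesis .
qed

text \<open>The slopes \<open>D / 2\<close> and \<open>1 / 2\<close> again, with
  \<open>trp_sep_le\<close> controlling the penalty at \<sigma>. The trace of \<sigma> stays in the
  bound because in a single branch it need not match that of \<rho>; only its sum over the branches
  is known.\<close>

lemma relent_sep_ge:
  assumes sp: "supported_pair I \<rho> \<sigma>" and s: "sep {..<D * a} {..<D * b} \<sigma>"
  shows "trp I P \<rho> * ln D + (1 - ln 2) * Re (tr I \<rho>) \<le> relent I \<rho> \<sigma> + Re (tr I \<sigma>)"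
proof -
  interpret supported_pair I \<rho> \<sigma> by fact
  have 1: "trp I P \<rho> * ln (D / 2) + (Re (tr I \<rho>) - trp I P \<rho>) * ln (1 / 2) + Re (tr I \<rho>) - D / 2 * trp I P \<sigma> - 1 / 2 * (Re (tr I \<sigma>) - trp I P \<sigma>)
    \<le> relent I \<rho> \<sigma>"
    using relent_ge_proj[OF sp proj_P, of "D / 2" "1 / 2"] D by simp
  have 2: "trp I P \<rho> * ln (D / 2) + (Re (tr I \<rho>) - trp I P \<rho>) * ln (1 / 2) = trp I P \<rho> * ln D - Re (tr I \<rho>) * ln 2"
    using D by (simp add: ln_div algebra_simps)
  have 3: "D / 2 * trp I P \<sigma> \<le> Re (tr I \<sigma>) / 2" using trp_sep_le[OF s] D by (simp add: field_simps)
  have 4: "0 \<le> trp I P \<sigma>" by (rule trp_nonneg[OF proj_P B])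
  show ?thesis using 1[unfolded 2] 3 4 by (simp add: algebra_simps)
qed

end

section \<open>The two LOCC monotones and their values at a state that passes the test\<close>

lemma cmi_reindex:
  assumes A: "finite A" and B: "finite B" and E: "finite E" and \<tau>: "pos (A \<times> B \<times> E) \<tau>" and h: "bij_betw h A2 A"
  shows "cmi A2 B E (\<lambda>p q. \<tau> (h (fst p), snd p) (h (fst q), snd q)) = cmi A B E \<tau>"
proof -
  let ?t = "\<lambda>p q. \<tau> (h (fst p), snd p) (h (fst q), snd q)"
  note b = bij_betw_fst[OF h]
  have "ent (A2 \<times> B \<times> E) ?t = ent (A \<times> B \<times> E) \<tau>"
    using A B E \<tau> by (intro ent_reindex b pos_herm) auto
  moreover have "ent (A2 \<times> E) (ptr1 B (swap12 ?t)) = ent (A \<times> E) (ptr1 B (swap12 \<tau>))"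
  proof -
    have "ptr1 B (swap12 ?t) = (\<lambda>p q. ptr1 B (swap12 \<tau>) (h (fst p), snd p) (h (fst q), snd q))"
      by (simp add: ptr1_def swap12_def fun_eq_iff)
    then show ?thesis using A B E \<tau> by (simp only:) (intro ent_reindex b pos_herm pos_ptr1 pos_swap12, auto)
  qed
  moreover have "ptr1 A2 ?t = ptr1 A \<tau>"
    unfolding ptr1_def by (intro ext) (simp add: sum.reindex_bij_betw[OF h, of "\<lambda>m. \<tau> (m, _) (m, _)"])
  ultimately show ?thesis by (simp add: cmi_def)
qed

definition trE :: "nat \<Rightarrow> (nat \<times> nat \<times> nat) op \<Rightarrow> nat \<times> nat \<Rightarrow> nat \<times> nat \<Rightarrow> complex" where
  "trE e \<tau> p q = (\<Sum>k<e. \<tau> (fst p, snd p, k) (fst q, snd q, k))"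

text \<open>Alice's index is split into key and shield to fit \<open>cmi_ge_key_test\<close>. The
  resulting bound is linear in the operator and so can be added over branches.\<close>

lemma (in private_test) cmi_ge:
  assumes \<tau>: "pos (ix3 (D * a) (D * b) e) \<tau>"
  shows "4 * ln D * trp I P (trE e \<tau>) - (2 * ln D + 4 * ln 2) * Re (tr I (trE e \<tau>)) \<le> cmin (D * a) (D * b) e \<tau>"
proof -
  define h where "h p = fst p * a + snd p" for p :: "nat \<times> nat"
  have h: "bij_betw h (ix2 D a) {..<D * a}" unfolding h_def by (rule bij_pair)
  let ?t = "\<lambda>p q. \<tau> (h (fst p), snd p) (h (fst q), snd q)"
  have pt: "pos (ix2 D a \<times> ix2 (D * b) e) ?t"
    by (rule pos_reindex[OF bij_betw_fst[OF h] \<tau>])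
  let ?f = "trp I P (trE e \<tau>)" and ?tr = "Re (tr I (trE e \<tau>))"
  have f: "trp (ix3 D a (D * b)) (\<lambda>p q. P (fst p * a + fst (snd p), snd (snd p)) (fst q * a + fst (snd q), snd (snd q)))
    (\<lambda>x y. \<Sum>k<e. ?t ((fst x, fst (snd x)), snd (snd x), k) ((fst y, fst (snd y)), snd (snd y), k)) = ?f"
    using trp_reindex[OF bij_key, of P "trE e \<tau>"] by (simp add: trE_def h_def)
  have t: "Re (tr (ix2 D a \<times> ix2 (D * b) e) ?t) = ?tr"
    by (simp add: tr_def trE_def sum_Times h_def sum_pair)
  have "2 * (?f * ln (card {..<D}) - ?tr * ln 2) - 2 * (?tr * ln 2 + (?tr - ?f) * ln (card {..<D})) \<le> cmi (ix2 D a) {..<D * b} {..<e} ?t"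
    unfolding f[symmetric] t[symmetric] using D
    by (intro cmi_ge_key_test[OF _ _ _ _ _ pt key_test]) auto
  also have "... = cmin (D * a) (D * b) e \<tau>"
    by (intro cmi_reindex \<tau> h) auto
  finally show ?thesis by (simp add: algebra_simps)
qed

text \<open>The objects are operators on \<open>A B E\<close> with \<open>E\<close> never touched. A
  measurement by the second party is reduced to one by the first with \<open>swap12\<close>.\<close>

lemma pair_monotone_cmi:
  "pair_monotone (\<lambda>a b. pos (ix3 a b e)) (trE e) (\<lambda>a b. cmin a b e)"
proof
  fix a b r e' and \<tau> :: "nat \<times> nat \<times> nat \<Rightarrow> _" and K :: "nat \<Rightarrow> nat \<Rightarrow> nat \<Rightarrow> complex"
  assume \<tau>: "pos (ix3 a b e) \<tau>" and K: "kraus {..<a} {..<r} (\<lambda>k. {..<e' k}) K"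
  let ?s = "\<lambda>k. sand (ix3 a b e) (lop (K k)) \<tau>"
  have "trE e (?s k) p q = sand (ix2 a b) (lop (K k)) (trE e \<tau>) p q"
    if "p \<in> ix2 (e' k) b" "q \<in> ix2 (e' k) b" for k p q
  proof -
    have "trE e (?s k) p q = (\<Sum>l<e. \<Sum>m<a. \<Sum>m'<a. K k (fst p) m * \<tau> (m, snd p, l) (m', snd q, l) * cnj (K k (fst q) m'))"
      unfolding trE_def using that by (intro sum.cong refl) (auto simp: sand_lop)
    also have "... = (\<Sum>m<a. \<Sum>m'<a. \<Sum>l<e. K k (fst p) m * \<tau> (m, snd p, l) (m', snd q, l) * cnj (K k (fst q) m'))"
      by (rule sum3_swap[symmetric])
    also have "... = sand (ix2 a b) (lop (K k)) (trE e \<tau>) p q"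
      using that by (subst sand_lop) (auto simp: trE_def sum_distrib_left sum_distrib_right)
    finally show ?thesis .
  qed
  then show "\<exists>s'. (\<forall>k<r. pos (ix3 (e' k) b e) (s' k) \<and> (\<forall>p\<in>ix2 (e' k) b. \<forall>q\<in>ix2 (e' k) b.
         trE e (s' k) p q = sand (ix2 a b) (lop (K k)) (trE e \<tau>) p q)) \<and> (\<Sum>k<r. cmin (e' k) b e (s' k)) \<le> cmin a b e \<tau>"
    using \<tau> by (intro exI[of _ ?s] conjI cmi_measure_left \<tau> K) (auto intro: pos_sand)
next
  fix a b r e' and \<tau> :: "nat \<times> nat \<times> nat \<Rightarrow> _" and K :: "nat \<Rightarrow> nat \<Rightarrow> nat \<Rightarrow> complex"
  assume \<tau>: "pos (ix3 a b e) \<tau>" and K: "kraus {..<b} {..<r} (\<lambda>k. {..<e' k}) K"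
  let ?s = "\<lambda>k. sand (ix3 b a e) (lop (K k)) (swap12 \<tau>)"
  have \<tau>': "pos (ix3 b a e) (swap12 \<tau>)" by (rule pos_swap12[OF \<tau>])
  have op: "trE e (swap12 (?s k)) p q = sand (ix2 a b) (rop (K k)) (trE e \<tau>) p q"
    if "p \<in> ix2 a (e' k)" "q \<in> ix2 a (e' k)" for k p q
  proof -
    have "trE e (swap12 (?s k)) p q = (\<Sum>l<e. \<Sum>m<b. \<Sum>m'<b. K k (snd p) m * \<tau> (fst p, m, l) (fst q, m', l) * cnj (K k (snd q) m'))"
      unfolding trE_def swap12_def[of "sand _ _ _"] using that by (intro sum.cong refl) (auto simp: sand_lop swap12_def)
    also have "... = (\<Sum>m<b. \<Sum>m'<b. \<Sum>l<e. K k (snd p) m * \<tau> (fst p, m, l) (fst q, m', l) * cnj (K k (snd q) m'))"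
      by (rule sum3_swap[symmetric])
    also have "... = sand (ix2 a b) (rop (K k)) (trE e \<tau>) p q"
      using that by (subst sand_rop) (auto simp: trE_def sum_distrib_left sum_distrib_right)
    finally show ?thesis .
  qed
  have ps: "pos (ix3 a (e' k) e) (swap12 (?s k))" for k by (intro pos_swap12 pos_sand \<tau>')
  have "(\<Sum>k<r. cmin a (e' k) e (swap12 (?s k))) = (\<Sum>k<r. cmin (e' k) a e (?s k))"
    by (intro sum.cong refl cmi_swap12 pos_sand \<tau>') auto
  also have "... \<le> cmin b a e (swap12 \<tau>)"
    by (intro cmi_measure_left \<tau>' K) auto
  also have "... = cmin a b e \<tau>" by (intro cmi_swap12 \<tau>) auto
  finally have "(\<Sum>k<r. cmin a (e' k) e (swap12 (?s k))) \<le> cmin a b e \<tau>" .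
  then show "\<exists>s'. (\<forall>k<r. pos (ix3 a (e' k) e) (s' k) \<and> (\<forall>p\<in>ix2 a (e' k). \<forall>q\<in>ix2 a (e' k).
         trE e (s' k) p q = sand (ix2 a b) (rop (K k)) (trE e \<tau>) p q)) \<and> (\<Sum>k<r. cmin a (e' k) e (s' k)) \<le> cmin a b e \<tau>"
    using op ps by (intro exI[of _ "\<lambda>k. swap12 (?s k)"]) auto
qed

lemma sep_sand_lop:
  assumes B: "finite B" and s: "sep A B \<sigma>"
  shows "sep A' B (sand (A \<times> B) (lop K) \<sigma>)"
proof -
  from s obtain n \<alpha> \<beta> where ab: "\<And>i. i < n \<Longrightarrow> pos A (\<alpha> i) \<and> pos B (\<beta> i)"
    and s: "\<And>p q. p \<in> A \<times> B \<Longrightarrow> q \<in> A \<times> B \<Longrightarrow> \<sigma> p q = (\<Sum>i<(n::nat). \<alpha> i (fst p) (fst q) * \<beta> i (snd p) (snd q))"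
    unfolding sep_def by blast
  have "sand (A \<times> B) (lop K) \<sigma> p q = (\<Sum>i<n. sand A K (\<alpha> i) (fst p) (fst q) * \<beta> i (snd p) (snd q))"
    if "p \<in> A' \<times> B" "q \<in> A' \<times> B" for p q
  proof -
    have "sand (A \<times> B) (lop K) \<sigma> p q = (\<Sum>m\<in>A. \<Sum>m'\<in>A. \<Sum>i<n. K (fst p) m * \<alpha> i m m' * cnj (K (fst q) m') * \<beta> i (snd p) (snd q))"
      using that B by (subst sand_lop) (auto simp: s sum_distrib_left sum_distrib_right mult_ac intro!: sum.cong)
    also have "... = (\<Sum>i<n. \<Sum>m\<in>A. \<Sum>m'\<in>A. K (fst p) m * \<alpha> i m m' * cnj (K (fst q) m') * \<beta> i (snd p) (snd q))"
      by (rule sum3_swap)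
    finally show ?thesis by (simp add: sand_def sum_distrib_right)
  qed
  then show ?thesis
    unfolding sep_def using ab by (intro exI[of _ n] exI[of _ "\<lambda>i. sand A K (\<alpha> i)"] exI[of _ \<beta>]) (auto intro: pos_sand)
qed

lemma sep_sand_rop:
  assumes A: "finite A" and s: "sep A B \<sigma>"
  shows "sep A B' (sand (A \<times> B) (rop K) \<sigma>)"
proof -
  from s obtain n \<alpha> \<beta> where ab: "\<And>i. i < n \<Longrightarrow> pos A (\<alpha> i) \<and> pos B (\<beta> i)"
    and s: "\<And>p q. p \<in> A \<times> B \<Longrightarrow> q \<in> A \<times> B \<Longrightarrow> \<sigma> p q = (\<Sum>i<(n::nat). \<alpha> i (fst p) (fst q) * \<beta> i (snd p) (snd q))"
    unfolding sep_def by blast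
  have "sand (A \<times> B) (rop K) \<sigma> p q = (\<Sum>i<n. \<alpha> i (fst p) (fst q) * sand B K (\<beta> i) (snd p) (snd q))"
    if "p \<in> A \<times> B'" "q \<in> A \<times> B'" for p q
  proof -
    have "sand (A \<times> B) (rop K) \<sigma> p q = (\<Sum>m\<in>B. \<Sum>m'\<in>B. \<Sum>i<n. \<alpha> i (fst p) (fst q) * (K (snd p) m * \<beta> i m m' * cnj (K (snd q) m')))"
      using that A by (subst sand_rop) (auto simp: s sum_distrib_left sum_distrib_right mult_ac intro!: sum.cong)
    also have "... = (\<Sum>i<n. \<Sum>m\<in>B. \<Sum>m'\<in>B. \<alpha> i (fst p) (fst q) * (K (snd p) m * \<beta> i m m' * cnj (K (snd q) m')))"
      by (rule sum3_swap)
    finally show ?thesis by (simp add: sand_def sum_distrib_left)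
  qed
  then show ?thesis
    unfolding sep_def using ab by (intro exI[of _ n] exI[of _ \<alpha>] exI[of _ "\<lambda>i. sand B K (\<beta> i)"]) (auto intro: pos_sand)
qed

text \<open>An object is a state together with a separable operator that undergoes the same
  measurements. The added trace is conserved in total and makes the value fit
  \<open>relent_sep_ge\<close>.\<close>

lemma pair_monotone_relent:
  "pair_monotone (\<lambda>a b s. supported_pair (ix2 a b) (fst s) (snd s) \<and> sep {..<a} {..<b} (snd s)) fst
     (\<lambda>a b s. relent (ix2 a b) (fst s) (snd s) + Re (tr (ix2 a b) (snd s)))"
proof
  fix a b r e' and s :: "(nat \<times> nat) op \<times> (nat \<times> nat) op" and K :: "nat \<Rightarrow> nat \<Rightarrow> nat \<Rightarrow> complex"
  assume s: "supported_pair (ix2 a b) (fst s) (snd s) \<and> sep {..<a} {..<b} (snd s)" and K: "kraus {..<a} {..<r} (\<lambda>k. {..<e' k}) K"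
  let ?s = "\<lambda>k A. sand (ix2 a b) (lop (K k)) A"
  have K': "kraus (ix2 a b) {..<r} (\<lambda>k. ix2 (e' k) b) (\<lambda>k. lop (K k))" by (intro kraus_lop K) simp
  have "(\<Sum>k<r. Re (tr (ix2 (e' k) b) (?s k (snd s)))) = Re (tr (ix2 a b) (snd s))"
    unfolding Re_sum[symmetric] by (subst tr_sand_sum[OF _ K']) auto
  moreover have "(\<Sum>k<r. relent (ix2 (e' k) b) (?s k (fst s)) (?s k (snd s))) \<le> relent (ix2 a b) (fst s) (snd s)"
    using s by (intro relent_kraus[OF _ K']) auto
  ultimately show "\<exists>s'. (\<forall>k<r. (supported_pair (ix2 (e' k) b) (fst (s' k)) (snd (s' k)) \<and> sep {..<e' k} {..<b} (snd (s' k))) \<and> (\<forall>p\<in>ix2 (e' k) b. \<forall>q\<in>ix2 (e' k) b.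
         fst (s' k) p q = sand (ix2 a b) (lop (K k)) (fst s) p q)) \<and>
      (\<Sum>k<r. relent (ix2 (e' k) b) (fst (s' k)) (snd (s' k)) + Re (tr (ix2 (e' k) b) (snd (s' k))))
       \<le> relent (ix2 a b) (fst s) (snd s) + Re (tr (ix2 a b) (snd s))"
    using s by (intro exI[of _ "\<lambda>k. (?s k (fst s), ?s k (snd s))"]) (auto simp: sum.distrib intro!: supported_sand sep_sand_lop)
next
  fix a b r e' and s :: "(nat \<times> nat) op \<times> (nat \<times> nat) op" and K :: "nat \<Rightarrow> nat \<Rightarrow> nat \<Rightarrow> complex"
  assume s: "supported_pair (ix2 a b) (fst s) (snd s) \<and> sep {..<a} {..<b} (snd s)" and K: "kraus {..<b} {..<r} (\<lambda>k. {..<e' k}) K"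
  let ?s = "\<lambda>k A. sand (ix2 a b) (rop (K k)) A"
  have K': "kraus (ix2 a b) {..<r} (\<lambda>k. ix2 a (e' k)) (\<lambda>k. rop (K k))" by (intro kraus_rop K) simp
  have "(\<Sum>k<r. Re (tr (ix2 a (e' k)) (?s k (snd s)))) = Re (tr (ix2 a b) (snd s))"
    unfolding Re_sum[symmetric] by (subst tr_sand_sum[OF _ K']) auto
  moreover have "(\<Sum>k<r. relent (ix2 a (e' k)) (?s k (fst s)) (?s k (snd s))) \<le> relent (ix2 a b) (fst s) (snd s)"
    using s by (intro relent_kraus[OF _ K']) auto
  ultimately show "\<exists>s'. (\<forall>k<r. (supported_pair (ix2 a (e' k)) (fst (s' k)) (snd (s' k)) \<and> sep {..<a} {..<e' k} (snd (s' k))) \<and> (\<forall>p\<in>ix2 a (e' k). \<forall>q\<in>ix2 a (e' k).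
         fst (s' k) p q = sand (ix2 a b) (rop (K k)) (fst s) p q)) \<and>
      (\<Sum>k<r. relent (ix2 a (e' k)) (fst (s' k)) (snd (s' k)) + Re (tr (ix2 a (e' k)) (snd (s' k))))
       \<le> relent (ix2 a b) (fst s) (snd s) + Re (tr (ix2 a b) (snd s))"
    using s by (intro exI[of _ "\<lambda>k. (?s k (fst s), ?s k (snd s))"]) (auto simp: sum.distrib intro!: supported_sand sep_sand_rop)
qed

section \<open>Private states pass their tests\<close>

lemma psd_carrier: "psd n A \<Longrightarrow> A \<in> sqmat n"
  by (simp add: psd_def)

lemma psd_herm: "psd n A \<Longrightarrow> herm {..<n} (fn A)"
  by (auto simp: psd_pos intro: pos_herm)

lemma unitary_matI: "\<lbrakk>unitary n U; \<sigma> \<in> sqmat n\<rbrakk> \<Longrightarrow> mat_trace (sandwich U \<sigma>) = mat_trace \<sigma>"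
proof -
  assume U: "unitary n U" and \<sigma>: "\<sigma> \<in> sqmat n"
  then have c: "U \<in> sqmat n" by (simp add: unitary_def)
  have "mat_trace (sandwich U \<sigma>) = (\<Sum>i<n. \<Sum>r<n. \<Sum>s<n. U $$ (i, r) * \<sigma> $$ (r, s) * cnj (U $$ (i, s)))"
    using c by (auto simp: mat_trace_def sandwich_index[OF c \<sigma>] simp del: index_mult_mat(1) intro!: sum.cong)
  also have "... = (\<Sum>r<n. \<Sum>s<n. \<Sum>i<n. U $$ (i, r) * \<sigma> $$ (r, s) * cnj (U $$ (i, s)))"
    by (rule sum3_swap[symmetric])
  also have "... = (\<Sum>r<n. \<Sum>s<n. if s = r then \<sigma> $$ (r, s) else 0)"
  proof (intro sum.cong refl)
    fix r s assume rs: "r \<in> {..<n}" "s \<in> {..<n}"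
    have "(\<Sum>i<n. U $$ (i, r) * \<sigma> $$ (r, s) * cnj (U $$ (i, s))) = \<sigma> $$ (r, s) * inn {..<n} (\<lambda>i. U $$ (i, s)) (\<lambda>i. U $$ (i, r))"
      by (simp add: inn_def sum_distrib_left mult_ac)
    also have "inn {..<n} (\<lambda>i. U $$ (i, s)) (\<lambda>i. U $$ (i, r)) = (if s = r then 1 else 0)"
      using unitary_onb[OF c] U onb_inn[of "{..<n}" "\<lambda>k x. U $$ (x, k)" s r] rs by simp
    finally show "(\<Sum>i<n. U $$ (i, r) * \<sigma> $$ (r, s) * cnj (U $$ (i, s))) = (if s = r then \<sigma> $$ (r, s) else 0)" by simp
  qed
  finally show ?thesis using \<sigma> by (simp add: mat_trace_def)
qed

text \<open>The test uses the unitaries of the private state itself. The acceptance weight is then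
  the average over \<open>i\<close> and \<open>j\<close> of the traces of
  \<open>U_i U_j^* U_j \<sigma> U_i^*\<close>, and each of these is the trace of \<sigma>.\<close>

lemma private_state_test:
  assumes "private_state m a b \<gamma>"
  shows "\<exists>U. private_test (2 ^ m) a b U \<and> \<gamma> \<in> sqmat (2 ^ m * a * (2 ^ m * b)) \<and>
    herm {..<2 ^ m * a * (2 ^ m * b)} (fn \<gamma>) \<and>
    trp (ix2 (2 ^ m * a) (2 ^ m * b)) (ptest (2 ^ m) a b U) (o2 (2 ^ m * b) \<gamma>) = 1"
proof -
  define D where "D = (2::nat) ^ m"
  have Dpos: "0 < D" by (simp add: D_def)
  from assms obtain \<sigma> U where \<sigma>: "density (a * b) \<sigma>" and U: "\<And>i. i < D \<Longrightarrow> unitary (a * b) (U i)"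
    and \<gamma>: "\<gamma> = complex_of_real (1 / 2 ^ m) \<cdot>\<^sub>m mat_sum (D * a * (D * b))
           (\<lambda>(i, j). party_tensor [D, D] [a, b]
              (matrix_unit (D * D) (encode [D, D] [i, i]) (encode [D, D] [j, j]))
              (U i * \<sigma> * mat_adjoint (U j))) (ix2 D D)"
    unfolding private_state_def D_def by blast
  interpret private_test D a b U by unfold_locales (use Dpos U in auto)
  have c\<sigma>: "\<sigma> \<in> sqmat (a * b)" and t\<sigma>: "mat_trace \<sigma> = 1" and h\<sigma>: "herm {..<a * b} (fn \<sigma>)"
    using \<sigma> by (auto simp: density_def psd_carrier psd_herm)
  have c\<gamma>: "\<gamma> \<in> sqmat (D * a * (D * b))" by (simp add: \<gamma>)
  have ix: "o2 (D * b) \<gamma> p q = (if agree p \<and> agree q then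
     (U (key p) * \<sigma> * mat_adjoint (U (key q))) $$ (sh p, sh q) / of_nat D else 0)"
    if p: "p \<in> I" and q: "q \<in> I" for p q
  proof -
    let ?W = "\<lambda>i j. (U i * \<sigma> * mat_adjoint (U j)) $$ (sh p, sh q)"
    have less: "fst p * (D * b) + snd p < D * a * (D * b)" "fst q * (D * b) + snd q < D * a * (D * b)"
      using p q by (auto intro!: pair_less)
    have lp: "key p < D" "snd p div b < D" and lq: "key q < D" "snd q div b < D"
      using index_less[OF p] index_less[OF q] by auto
    have enc: "x * D + y = i * D + i \<longleftrightarrow> x = i \<and> y = i" if "x < D" "y < D" "i < D" for x y i
      using pair_div[OF that(2), of x] pair_div[OF that(3), of i] pair_mod[OF that(2), of x] pair_mod[OF that(3), of i] by metis
    have mu: "o2 D (matrix_unit (D * D) (encode [D, D] [i, i]) (encode [D, D] [j, j])) (key p, snd p div b) (key q, snd q div b)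
       = (if j = key q then if i = key p then (if agree p \<and> agree q then 1 else 0) else 0 else 0)"
      if "i < D" "j < D" for i j
      using that lp lq by (auto simp: o2_def matrix_unit_def enc pair_less)
    have "o2 (D * b) \<gamma> p q = of_real (1 / 2 ^ m) * (\<Sum>i<D. \<Sum>j<D. o2 (D * b) (party_tensor [D, D] [a, b]
              (matrix_unit (D * D) (encode [D, D] [i, i]) (encode [D, D] [j, j])) (U i * \<sigma> * mat_adjoint (U j))) p q)"
      using less by (simp add: \<gamma> o2_def mat_sum_def sum_Times)
    also have "(\<Sum>i<D. \<Sum>j<D. o2 (D * b) (party_tensor [D, D] [a, b]
              (matrix_unit (D * D) (encode [D, D] [i, i]) (encode [D, D] [j, j])) (U i * \<sigma> * mat_adjoint (U j))) p q)
      = (\<Sum>i<D. \<Sum>j<D. if j = key q then if i = key p then (if agree p \<and> agree q then ?W i j else 0) else 0 else 0)"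
    proof (intro sum.cong refl)
      fix i j assume "i \<in> {..<D}" "j \<in> {..<D}"
      then have ij: "i < D" "j < D" by auto
      show "o2 (D * b) (party_tensor [D, D] [a, b] (matrix_unit (D * D) (encode [D, D] [i, i]) (encode [D, D] [j, j])) (U i * \<sigma> * mat_adjoint (U j))) p q
        = (if j = key q then if i = key p then (if agree p \<and> agree q then ?W i j else 0) else 0 else 0)"
        unfolding o2_party_tensor[OF p q] mu[OF ij] by (simp add: o2_def del: index_mult_mat)
    qed
    also have "... = (if agree p \<and> agree q then ?W (key p) (key q) else 0)"
      using lp lq by (simp del: index_mult_mat)
    finally show ?thesis by (simp add: D_def del: index_mult_mat)
  qed
  have hW: "(U i * \<sigma> * mat_adjoint (U j)) $$ (r, s) = cnj ((U j * \<sigma> * mat_adjoint (U i)) $$ (s, r))"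
    if ij: "i < D" "j < D" and rs: "r < a * b" "s < a * b" for i j r s
  proof -
    have e: "(U i * \<sigma> * mat_adjoint (U j)) $$ (r, s) = (\<Sum>k<a * b. \<Sum>l<a * b. U i $$ (r, k) * \<sigma> $$ (k, l) * cnj (U j $$ (s, l)))"
      if ij: "i < D" "j < D" and rs: "r < a * b" "s < a * b" for i j r s
    proof -
      have cc: "U i \<in> sqmat (a * b)" "U j \<in> sqmat (a * b)" using ij by auto
      have "(U i * \<sigma> * mat_adjoint (U j)) $$ (r, s) = (\<Sum>l<a * b. (U i * \<sigma>) $$ (r, l) * mat_adjoint (U j) $$ (l, s))"
        using cc rs by (intro index_mult[OF mult_carrier_mat[OF cc(1) c\<sigma>] mat_adjoint_carrier[OF cc(2)]])
      also have "... = (\<Sum>l<a * b. \<Sum>k<a * b. U i $$ (r, k) * \<sigma> $$ (k, l) * cnj (U j $$ (s, l)))"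
        using cc rs by (intro sum.cong refl) (simp add: index_mult[OF cc(1) c\<sigma>] index_mat_adjoint sum_distrib_right del: index_mult_mat)
      finally show ?thesis by (subst sum.swap)
    qed
    have "cnj ((U j * \<sigma> * mat_adjoint (U i)) $$ (s, r)) = (\<Sum>k<a * b. \<Sum>l<a * b. cnj (U j $$ (s, k)) * cnj (\<sigma> $$ (k, l)) * U i $$ (r, l))"
      unfolding e[OF ij(2,1) rs(2,1)] by simp
    also have "... = (\<Sum>l<a * b. \<Sum>k<a * b. cnj (U j $$ (s, k)) * cnj (\<sigma> $$ (k, l)) * U i $$ (r, l))" by (rule sum.swap)
    also have "... = (\<Sum>l<a * b. \<Sum>k<a * b. U i $$ (r, l) * \<sigma> $$ (l, k) * cnj (U j $$ (s, k)))"
    proof (intro sum.cong refl)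
      fix l k assume "l \<in> {..<a * b}" "k \<in> {..<a * b}"
      then have "\<sigma> $$ (l, k) = cnj (\<sigma> $$ (k, l))" using h\<sigma> unfolding herm_def fn_def by blast
      then show "cnj (U j $$ (s, k)) * cnj (\<sigma> $$ (k, l)) * U i $$ (r, l) = U i $$ (r, l) * \<sigma> $$ (l, k) * cnj (U j $$ (s, k))" by simp
    qed
    finally show ?thesis unfolding e[OF ij rs] by simp
  qed
  have h\<gamma>: "herm {..<D * a * (D * b)} (fn \<gamma>)"
    unfolding herm_def
  proof (intro ballI)
    fix x y assume "x \<in> {..<D * a * (D * b)}" "y \<in> {..<D * a * (D * b)}"
    then have p: "(x div (D * b), x mod (D * b)) \<in> I" and q: "(y div (D * b), y mod (D * b)) \<in> I"
      by (auto simp: div_less_pair mod_less_pair)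
    let ?p = "(x div (D * b), x mod (D * b))" and ?q = "(y div (D * b), y mod (D * b))"
    have e: "(U (key ?p) * \<sigma> * mat_adjoint (U (key ?q))) $$ (sh ?p, sh ?q)
      = cnj ((U (key ?q) * \<sigma> * mat_adjoint (U (key ?p))) $$ (sh ?q, sh ?p))"
      using index_less[OF p] index_less[OF q] by (intro hW) auto
    show "fn \<gamma> x y = cnj (fn \<gamma> y x)"
      unfolding fn_o2[of _ _ _ "D * b"] ix[OF p q] ix[OF q p] e by simp
  qed
  have "(\<Sum>p\<in>I. \<Sum>q\<in>I. P p q * o2 (D * b) \<gamma> q p) = 1"
  proof -
    let ?A = "\<lambda>i j r s. (U i * mat_adjoint (U j)) $$ (r, s)"
    let ?B = "\<lambda>i j r s. (U i * \<sigma> * mat_adjoint (U j)) $$ (r, s)"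
    let ?r = "\<lambda>p. sh p"
    have "(\<Sum>p\<in>I. \<Sum>q\<in>I. P p q * o2 (D * b) \<gamma> q p) = (\<Sum>p\<in>I. if agree p then
       (\<Sum>q\<in>I. if agree q then
         ?A (key p) (key q) (?r p) (?r q) * ?B (key q) (key p) (?r q) (?r p) / (of_nat D)\<^sup>2 else 0) else 0)"
    proof (intro sum.cong refl)
      fix p assume p: "p \<in> I"
      have "P p q * o2 (D * b) \<gamma> q p = (if agree p then (if agree q then
         ?A (key p) (key q) (?r p) (?r q) * ?B (key q) (key p) (?r q) (?r p) / (of_nat D)\<^sup>2 else 0) else 0)"
        if q: "q \<in> I" for q
        unfolding ix[OF q p] by (auto simp: ptest_def power2_eq_square simp del: index_mult_mat)
      then show "(\<Sum>q\<in>I. P p q * o2 (D * b) \<gamma> q p) = (if agree p then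
       (\<Sum>q\<in>I. if agree q then
         ?A (key p) (key q) (?r p) (?r q) * ?B (key q) (key p) (?r q) (?r p) / (of_nat D)\<^sup>2 else 0) else 0)"
        by (simp del: index_mult_mat)
    qed
    also have "... = (\<Sum>i<D. \<Sum>r<a * b. \<Sum>j<D. \<Sum>s<a * b. ?A i j r s * ?B j i s r / (of_nat D)\<^sup>2)"
      unfolding key_sum[of "\<lambda>j s. (U _ * mat_adjoint (U j)) $$ (_, s) * (U j * \<sigma> * mat_adjoint (U _)) $$ (s, _) / (of_nat D)\<^sup>2"]
      by (rule key_sum)
    also have "... = (\<Sum>i<D. \<Sum>j<D. \<Sum>r<a * b. \<Sum>s<a * b. ?A i j r s * ?B j i s r / (of_nat D)\<^sup>2)"
      by (intro sum.cong refl sum.swap)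
    also have "... = (\<Sum>i<D. \<Sum>j<D. 1 / (of_nat D)\<^sup>2)"
    proof (intro sum.cong refl)
      fix i j assume "i \<in> {..<D}" "j \<in> {..<D}"
      then have ij: "i < D" "j < D" by auto
      note ci = carrier[OF ij(1)] and cj = carrier[OF ij(2)]
      note ai = mat_adjoint_carrier[OF ci] and aj = mat_adjoint_carrier[OF cj]
      have "(U i * mat_adjoint (U j)) * (U j * \<sigma> * mat_adjoint (U i)) = U i * (mat_adjoint (U j) * U j) * \<sigma> * mat_adjoint (U i)"
        using ci cj ai aj c\<sigma> by (simp add: assoc_mult_mat[of _ "a * b" "a * b" _ "a * b" _ "a * b"] mult_carrier_mat[of _ "a * b" "a * b" _ "a * b"])
      also have "... = sandwich (U i) \<sigma>" unfolding adj_mult(1)[OF ij(2)] using ci by simp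
      finally have e: "(U i * mat_adjoint (U j)) * (U j * \<sigma> * mat_adjoint (U i)) = sandwich (U i) \<sigma>" .
      have cAB: "U i * mat_adjoint (U j) \<in> sqmat (a * b)" "U j * \<sigma> * mat_adjoint (U i) \<in> sqmat (a * b)"
        by (intro mult_carrier_mat[OF ci aj], intro mult_carrier_mat[OF mult_carrier_mat[OF cj c\<sigma>] ai])
      have "(\<Sum>r<a * b. \<Sum>s<a * b. ?A i j r s * ?B j i s r) = (\<Sum>r<a * b. ((U i * mat_adjoint (U j)) * (U j * \<sigma> * mat_adjoint (U i))) $$ (r, r))"
        by (intro sum.cong refl index_mult[OF cAB, symmetric]) auto
      also have "... = mat_trace (sandwich (U i) \<sigma>)"
        unfolding e mat_trace_def using ci by (simp del: index_mult_mat(1))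
      also have "... = 1" unfolding unitary_matI[OF U[OF ij(1)] c\<sigma>] by (rule t\<sigma>)
      finally show "(\<Sum>r<a * b. \<Sum>s<a * b. ?A i j r s * ?B j i s r / (of_nat D)\<^sup>2) = 1 / (of_nat D)\<^sup>2"
        by (simp del: index_mult_mat flip: sum_divide_distrib)
    qed
    also have "... = 1" using Dpos by (simp add: power2_eq_square)
    finally show ?thesis .
  qed
  then have "trp I P (o2 (D * b) \<gamma>) = 1" by (simp add: trp_def)
  then show ?thesis
    using private_test_axioms c\<gamma> h\<gamma> unfolding D_def by blast
qed

lemma (in private_test) trp_ge_of_trace_norm:
  assumes \<omega>: "\<omega> \<in> sqmat (D * a * (D * b))" "herm {..<D * a * (D * b)} (fn \<omega>)"
    and \<gamma>: "\<gamma> \<in> sqmat (D * a * (D * b))" "herm {..<D * a * (D * b)} (fn \<gamma>)"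
    and n: "trace_norm (\<omega> - \<gamma>) \<le> \<epsilon>"
  shows "trp I P (o2 (D * b) \<gamma>) - \<epsilon> \<le> trp I P (o2 (D * b) \<omega>)"
proof -
  let ?N = "D * a * (D * b)"
  note b = bij_pair_inv[of "D * b" "D * a"]
  define Q where "Q i j = P (i div (D * b), i mod (D * b)) (j div (D * b), j mod (D * b))" for i j
  have Q: "proj {..<?N} Q" unfolding Q_def by (rule proj_reindex[OF b proj_P])
  have tQ: "trp {..<?N} Q (fn X) = trp I P (o2 (D * b) X)" for X
  proof -
    have "fn X = (\<lambda>i j. o2 (D * b) X (i div (D * b), i mod (D * b)) (j div (D * b), j mod (D * b)))"
      by (intro ext fn_o2)
    then show ?thesis using trp_reindex[OF b, of P "o2 (D * b) X"] by (simp only: Q_def[abs_def])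
  qed
  have d: "fn (\<omega> - \<gamma>) x y = fn \<omega> x y - fn \<gamma> x y" if "x < ?N" "y < ?N" for x y
    using \<omega>(1) \<gamma>(1) that by (simp add: fn_def)
  have h: "herm {..<?N} (fn (\<omega> - \<gamma>))"
    unfolding herm_def
  proof (intro ballI)
    fix x y assume "x \<in> {..<?N}" "y \<in> {..<?N}"
    moreover from this have "fn \<omega> x y = cnj (fn \<omega> y x)" "fn \<gamma> x y = cnj (fn \<gamma> y x)"
      using \<omega>(2) \<gamma>(2) unfolding herm_def by blast+
    ultimately show "fn (\<omega> - \<gamma>) x y = cnj (fn (\<omega> - \<gamma>) y x)" by (simp add: d)
  qed
  have "- trp {..<?N} Q (fn (\<omega> - \<gamma>)) \<le> \<epsilon>"
    using trace_norm_ge_test[OF _ h Q] \<omega>(1) \<gamma>(1) n by (simp add: minus_carrier_mat)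
  moreover have "trp {..<?N} Q (fn (\<omega> - \<gamma>)) = trp {..<?N} Q (fn \<omega>) - trp {..<?N} Q (fn \<gamma>)"
    by (simp add: trp_def d sum_subtractf algebra_simps)
  ultimately show ?thesis unfolding tQ by linarith
qed

section \<open>From the monotones to bounds on the number of key bits\<close>

lemma herm_cong: "(\<And>x y. x \<in> I \<Longrightarrow> y \<in> I \<Longrightarrow> A x y = B x y) \<Longrightarrow> herm I A \<Longrightarrow> herm I B"
  unfolding herm_def by metis

lemma herm_sum_list:
  assumes "\<And>t. t \<in> set ss \<Longrightarrow> herm I (g t)" shows "herm I (\<lambda>p q. \<Sum>t\<leftarrow>ss. g t p q)"
  using assms
proof (induction ss)
  case Nil
  then show ?case by (simp add: herm_def)
next
  case (Cons t ss)
  have 1: "herm I (g t)" "herm I (\<lambda>p q. \<Sum>t\<leftarrow>ss. g t p q)" using Cons by auto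
  show ?case
    unfolding herm_def
  proof (intro ballI)
    fix x y assume xy: "x \<in> I" "y \<in> I"
    have "g t x y = cnj (g t y x)" "(\<Sum>t\<leftarrow>ss. g t x y) = cnj (\<Sum>t\<leftarrow>ss. g t y x)"
      using 1 xy unfolding herm_def by blast+
    then show "(\<Sum>t\<leftarrow>t # ss. g t x y) = cnj (\<Sum>t\<leftarrow>t # ss. g t y x)" by simp
  qed
qed

lemma trp_sum_list: "trp I P (\<lambda>p q. \<Sum>t\<leftarrow>ss. g t p q) = (\<Sum>t\<leftarrow>ss. trp I P (g t))"
  by (induction ss) (simp_all add: trp_def sum.distrib distrib_left)

lemma Re_sum_list: "Re (\<Sum>t\<leftarrow>ss. f t) = (\<Sum>t\<leftarrow>ss. Re (f t))"
  by (induction ss) auto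

text \<open>The private state passes its test with weight 1, so the output passes with weight at
  least \<open>1 - \<epsilon>\<close>. The bound on \<open>v\<close>, linear in acceptance weight
  and trace, is added over the leaves, where the weights sum to that of the output and the traces to
  that of the input. The constant \<open>d\<close> may have either sign since the trace is conserved
  exactly.\<close>

lemma (in pair_monotone) locc_private_bound:
  assumes l: "locc [a, b] [2 ^ m * a', 2 ^ m * b'] \<Lambda>" and \<gamma>: "private_state m a' b' \<gamma>"
    and n: "trace_norm (\<Lambda> X - \<gamma>) \<le> \<epsilon>"
    and s: "ok a b s" and X: "X \<in> sqmat (a * b)"
    and sX: "\<And>p q. p \<in> ix2 a b \<Longrightarrow> q \<in> ix2 a b \<Longrightarrow> o2 b X p q = opn s p q"
    and h: "\<And>a b t. ok a b t \<Longrightarrow> herm (ix2 a b) (opn t)"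
    and c: "0 \<le> c"
    and bound: "\<And>U t. private_test (2 ^ m) a' b' U \<Longrightarrow> ok (2 ^ m * a') (2 ^ m * b') t \<Longrightarrow>
      c * trp (ix2 (2 ^ m * a') (2 ^ m * b')) (ptest (2 ^ m) a' b' U) (opn t) + d * Re (tr (ix2 (2 ^ m * a') (2 ^ m * b')) (opn t))
      \<le> v (2 ^ m * a') (2 ^ m * b') t"
  shows "c * (1 - \<epsilon>) + d * Re (tr (ix2 a b) (opn s)) \<le> v a b s"
proof -
  let ?I = "ix2 (2 ^ m * a') (2 ^ m * b')"
  from locc_pair[OF l refl refl s X sX] obtain ss where
    car: "\<Lambda> X \<in> sqmat (2 ^ m * a' * (2 ^ m * b'))"
    and ok: "\<And>t. t \<in> set ss \<Longrightarrow> ok (2 ^ m * a') (2 ^ m * b') t"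
    and op: "\<And>p q. p \<in> ?I \<Longrightarrow> q \<in> ?I \<Longrightarrow> o2 (2 ^ m * b') (\<Lambda> X) p q = (\<Sum>t\<leftarrow>ss. opn t p q)"
    and tr: "(\<Sum>t\<leftarrow>ss. tr ?I (opn t)) = tr (ix2 a b) (opn s)"
    and v: "(\<Sum>t\<leftarrow>ss. v (2 ^ m * a') (2 ^ m * b') t) \<le> v a b s"
    by blast
  from private_state_test[OF \<gamma>] obtain U where U: "private_test (2 ^ m) a' b' U"
    and g: "\<gamma> \<in> sqmat (2 ^ m * a' * (2 ^ m * b'))" "herm {..<2 ^ m * a' * (2 ^ m * b')} (fn \<gamma>)"
    "trp ?I (ptest (2 ^ m) a' b' U) (o2 (2 ^ m * b') \<gamma>) = 1" by blast
  let ?P = "ptest (2 ^ m) a' b' U"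
  have "herm ?I (\<lambda>p q. \<Sum>t\<leftarrow>ss. opn t p q)" by (intro herm_sum_list h ok)
  then have ho: "herm ?I (o2 (2 ^ m * b') (\<Lambda> X))" by (rule herm_cong[rotated]) (simp add: op)
  have "herm {..<2 ^ m * a' * (2 ^ m * b')} (fn (\<Lambda> X))"
    unfolding herm_def
  proof (intro ballI)
    fix x y assume "x \<in> {..<2 ^ m * a' * (2 ^ m * b')}" "y \<in> {..<2 ^ m * a' * (2 ^ m * b')}"
    then show "fn (\<Lambda> X) x y = cnj (fn (\<Lambda> X) y x)"
      unfolding fn_o2[of _ _ _ "2 ^ m * b'"]
      by (intro ho[unfolded herm_def, rule_format]) (auto simp: div_less_pair mod_less_pair)
  qed
  from private_test.trp_ge_of_trace_norm[OF U car this g(1,2) n]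
  have "1 - \<epsilon> \<le> trp ?I ?P (o2 (2 ^ m * b') (\<Lambda> X))" unfolding g(3) .
  also have "... = (\<Sum>t\<leftarrow>ss. trp ?I ?P (opn t))"
    unfolding trp_sum_list[symmetric] by (rule trp_cong) (rule op)
  finally have "c * (1 - \<epsilon>) \<le> c * (\<Sum>t\<leftarrow>ss. trp ?I ?P (opn t))" using c by (rule mult_left_mono)
  moreover have "Re (tr (ix2 a b) (opn s)) = (\<Sum>t\<leftarrow>ss. Re (tr ?I (opn t)))"
    unfolding tr[symmetric] by (rule Re_sum_list)
  moreover have "c * (\<Sum>t\<leftarrow>ss. trp ?I ?P (opn t)) + d * (\<Sum>t\<leftarrow>ss. Re (tr ?I (opn t))) \<le> (\<Sum>t\<leftarrow>ss. v (2 ^ m * a') (2 ^ m * b') t)"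
  proof -
    have "(\<Sum>t\<leftarrow>ss. c * trp ?I ?P (opn t) + d * Re (tr ?I (opn t))) \<le> (\<Sum>t\<leftarrow>ss. v (2 ^ m * a') (2 ^ m * b') t)"
      by (intro sum_list_mono bound[OF U ok])
    then show ?thesis by (simp only: sum_list_addf sum_list_const_mult)
  qed
  ultimately show ?thesis using v by simp
qed

lemma pos_trE:
  assumes "pos (ix3 a b e) \<tau>" shows "pos (ix2 a b) (trE e \<tau>)"
proof -
  have "bij_betw (\<lambda>p. (fst (snd p), snd (snd p), fst p)) (ix3 e a b) (ix3 a b e)"
    by (rule bij_betwI[where g = "\<lambda>p. (snd (snd p), fst p, fst (snd p))"]) auto
  from pos_ptr1[OF _ pos_reindex[OF this assms]] show ?thesis by (simp add: ptr1_def[abs_def] trE_def[abs_def])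
qed

text \<open>For \<open>D = 2 ^ m\<close> the constants of \<open>cmi_ge\<close> are
  \<open>c = 4 m ln 2\<close> and \<open>d = - (2 m + 4) ln 2\<close>, and
  \<open>4 m (1 - \<epsilon>) - 2 m - 4 = 2 (1 - 2 \<epsilon>) m - 4\<close>.\<close>

theorem key_le_cmi:
  assumes l: "locc [a, b] [2 ^ m * a', 2 ^ m * b'] \<Lambda>" and \<gamma>: "private_state m a' b' \<gamma>"
    and n: "trace_norm (\<Lambda> X - \<gamma>) \<le> \<epsilon>" and X: "X \<in> sqmat (a * b)" "mat_trace X = 1"
    and \<tau>: "pos (ix3 a b e) \<tau>"
    and \<tau>X: "\<And>p q. p \<in> ix2 a b \<Longrightarrow> q \<in> ix2 a b \<Longrightarrow> o2 b X p q = trE e \<tau> p q"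
  shows "(2 * (1 - 2 * \<epsilon>) * m - 4) * ln 2 \<le> cmin a b e \<tau>"
proof -
  have t: "tr (ix2 a b) (trE e \<tau>) = 1"
  proof -
    have "tr (ix2 a b) (trE e \<tau>) = tr (ix2 a b) (o2 b X)" by (rule tr_cong) (simp add: \<tau>X)
    also have "... = mat_trace X" using X(1) by (simp add: tr_def o2_def mat_trace_def sum_pair sum_Times)
    finally show ?thesis using X(2) by simp
  qed
  have D: "ln (real (2 ^ m)) = m * ln 2" by (simp add: ln_realpow)
  interpret pair_monotone "\<lambda>a b. pos (ix3 a b e)" "trE e" "\<lambda>a b. cmin a b e"
    by (rule pair_monotone_cmi)
  have "4 * ln (real (2 ^ m)) * (1 - \<epsilon>) + - (2 * ln (real (2 ^ m)) + 4 * ln 2) * Re (tr (ix2 a b) (trE e \<tau>))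
    \<le> cmin a b e \<tau>"
  proof (rule locc_private_bound[OF l \<gamma> n \<tau> X(1) \<tau>X])
    show "herm (ix2 a b) (trE e t)" if "pos (ix3 a b e) t" for a b t
      by (intro pos_herm pos_trE that) auto
    fix U t assume U: "private_test (2 ^ m) a' b' U" and t: "pos (ix3 (2 ^ m * a') (2 ^ m * b') e) t"
    from private_test.cmi_ge[OF U t]
    show "4 * ln (real (2 ^ m)) * trp (ix2 (2 ^ m * a') (2 ^ m * b')) (ptest (2 ^ m) a' b' U) (trE e t) +
       - (2 * ln (real (2 ^ m)) + 4 * ln 2) * Re (tr (ix2 (2 ^ m * a') (2 ^ m * b')) (trE e t))
      \<le> cmin (2 ^ m * a') (2 ^ m * b') e t" by (simp only: mult_minus_left add_uminus_conv_diff)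
  qed (auto simp: D)
  then show ?thesis unfolding t D by (simp add: algebra_simps)
qed

text \<open>Here \<open>c = m ln 2\<close> and \<open>d = 1 - ln 2\<close>; the trace of \<sigma>
  contained in the monotone cancels the 1 in \<open>d\<close>.\<close>

theorem key_le_relent:
  assumes l: "locc [a, b] [2 ^ m * a', 2 ^ m * b'] \<Lambda>" and \<gamma>: "private_state m a' b' \<gamma>"
    and n: "trace_norm (\<Lambda> X - \<gamma>) \<le> \<epsilon>" and X: "X \<in> sqmat (a * b)" "mat_trace X = 1"
    and sp: "supported_pair (ix2 a b) (o2 b X) \<sigma>" and s: "sep {..<a} {..<b} \<sigma>" and t\<sigma>: "Re (tr (ix2 a b) \<sigma>) = 1"
  shows "((1 - \<epsilon>) * m - 1) * ln 2 \<le> relent (ix2 a b) (o2 b X) \<sigma>"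
proof -
  have t: "tr (ix2 a b) (o2 b X) = 1"
    using X by (simp add: tr_def o2_def mat_trace_def sum_pair sum_Times)
  have D: "ln (real (2 ^ m)) = m * ln 2" by (simp add: ln_realpow)
  have "ln (real (2 ^ m)) * (1 - \<epsilon>) + (1 - ln 2) * Re (tr (ix2 a b) (fst (o2 b X, \<sigma>)))
    \<le> relent (ix2 a b) (fst (o2 b X, \<sigma>)) (snd (o2 b X, \<sigma>)) + Re (tr (ix2 a b) (snd (o2 b X, \<sigma>)))"
  proof (rule pair_monotone.locc_private_bound[OF pair_monotone_relent l \<gamma> n _ X(1)])
    show "herm (ix2 a b) (fst t)" if "supported_pair (ix2 a b) (fst t) (snd t) \<and> sep {..<a} {..<b} (snd t)"
      for a b and t :: "(nat \<times> nat) op \<times> _"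
      using that by (auto simp: supported_pair_def intro: pos_herm)
    fix U t assume U: "private_test (2 ^ m) a' b' U"
      and t: "supported_pair (ix2 (2 ^ m * a') (2 ^ m * b')) (fst t) (snd t) \<and> sep {..<2 ^ m * a'} {..<2 ^ m * b'} (snd t)"
    from private_test.relent_sep_ge[OF U] t
    show "ln (real (2 ^ m)) * trp (ix2 (2 ^ m * a') (2 ^ m * b')) (ptest (2 ^ m) a' b' U) (fst t) +
       (1 - ln 2) * Re (tr (ix2 (2 ^ m * a') (2 ^ m * b')) (fst t))
      \<le> relent (ix2 (2 ^ m * a') (2 ^ m * b')) (fst t) (snd t) + Re (tr (ix2 (2 ^ m * a') (2 ^ m * b')) (snd t))" by (simp add: mult.commute)
  qed (use sp s in \<open>auto simp: D\<close>)
  then show ?thesis unfolding D fst_conv snd_conv t t\<sigma> by (simp add: algebra_simps)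
qed

section \<open>Tensor powers\<close>

definition tens :: "'i op \<Rightarrow> 'j op \<Rightarrow> 'i \<times> 'j \<Rightarrow> 'i \<times> 'j \<Rightarrow> complex" where
  "tens A B p q = A (fst p) (fst q) * B (snd p) (snd q)"

lemma spec_tens:
  assumes "spec I p u A" "spec J q v B"
  shows "spec (I \<times> J) (\<lambda>k. p (fst k) * q (snd k)) (\<lambda>k x. u (fst k) (fst x) * v (snd k) (snd x)) (tens A B)"
proof -
  have u: "onb I u" and v: "onb J v" using assms by (auto simp: spec_def)
  have sp: "(\<Sum>x\<in>I \<times> J. f (fst x) * g (snd x)) = (\<Sum>i\<in>I. f i) * (\<Sum>j\<in>J. g j)" for f :: "'a \<Rightarrow> complex" and g :: "'b \<Rightarrow> complex"
    by (simp add: sum_Times sum_product)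
  have 1: "inn (I \<times> J) (\<lambda>x. u (fst k) (fst x) * v (snd k) (snd x)) (\<lambda>x. u (fst l) (fst x) * v (snd l) (snd x))
    = inn I (u (fst k)) (u (fst l)) * inn J (v (snd k)) (v (snd l))" for k l
    unfolding inn_def sp[symmetric] by (simp add: mult_ac)
  have 2: "(\<Sum>k\<in>I \<times> J. of_real (c (fst k) * d (snd k)) * (u (fst k) (fst x) * v (snd k) (snd x)) * cnj (u (fst k) (fst y) * v (snd k) (snd y)))
    = (\<Sum>k\<in>I. of_real (c k) * u k (fst x) * cnj (u k (fst y))) * (\<Sum>k\<in>J. of_real (d k) * v k (snd x) * cnj (v k (snd y)))" for x y c d
    unfolding sp[symmetric] by (simp add: mult_ac)
  have 3: "(\<Sum>k\<in>I \<times> J. (u (fst k) (fst x) * v (snd k) (snd x)) * cnj (u (fst k) (fst y) * v (snd k) (snd y))) = (if x = y then 1 else 0)"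
    if "x \<in> I \<times> J" "y \<in> I \<times> J" for x y
    using 2[of "\<lambda>_. 1" "\<lambda>_. 1" x y] u v that by (auto simp: onb_def prod_eq_iff mem_Times_iff)
  have 4: "inn I (u (fst k)) (u (fst l)) * inn J (v (snd k)) (v (snd l)) = (if k = l then 1 else 0)" if "k \<in> I \<times> J" "l \<in> I \<times> J" for k l
    using onb_inn[OF u, of "fst k" "fst l"] onb_inn[OF v, of "snd k" "snd l"] that by (auto simp: prod_eq_iff mem_Times_iff)
  have 5: "tens A B x y = (\<Sum>k\<in>I. of_real (p k) * u k (fst x) * cnj (u k (fst y))) * (\<Sum>k\<in>J. of_real (q k) * v k (snd x) * cnj (v k (snd y)))"
    if "x \<in> I \<times> J" "y \<in> I \<times> J" for x y
    using assms that by (auto simp: tens_def spec_def mem_Times_iff)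
  show ?thesis
    unfolding spec_def onb_def 1 2 using 3 4 5 by blast
qed

lemma quad_tens: "quad (I \<times> J) (tens A B) (\<lambda>x. f (fst x) * g (snd x)) = quad I A f * quad J B g"
proof -
  have "quad (I \<times> J) (tens A B) (\<lambda>x. f (fst x) * g (snd x))
    = (\<Sum>x\<in>I. \<Sum>y\<in>J. \<Sum>x'\<in>I. \<Sum>y'\<in>J. (cnj (f x) * A x x' * f x') * (cnj (g y) * B y y' * g y'))"
    by (simp add: quad_def sum_Times tens_def mult_ac)
  also have "... = (\<Sum>x\<in>I. \<Sum>x'\<in>I. \<Sum>y\<in>J. \<Sum>y'\<in>J. (cnj (f x) * A x x' * f x') * (cnj (g y) * B y y' * g y'))"
    by (intro sum.cong refl sum.swap)
  also have "... = quad I A f * quad J B g"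
    unfolding quad_def sum_distrib_right by (simp only: sum_distrib_left)
  finally show ?thesis .
qed

lemma tr_tens: "tr (I \<times> J) (tens A B) = tr I A * tr J B"
  by (simp add: tr_def tens_def sum_Times sum_product)

lemma supported_spec_zero:
  assumes "supported_pair I A B" "spec I q v B" "j \<in> I" "q j = 0" shows "quad I A (v j) = 0"
proof -
  interpret supported_pair I A B by fact
  have "quad I B (v j) = 0" using spec_quad_self[OF fin assms(2,3)] assms(4) by simp
  then show ?thesis using sup by (simp add: supp_def)
qed

lemma pos_tens: "\<lbrakk>finite I; finite J; pos I A; pos J B\<rbrakk> \<Longrightarrow> pos (I \<times> J) (tens A B)"
  by (rule pos_specI[OF spec_tens[OF spec_evl_evc[OF _ pos_herm] spec_evl_evc[OF _ pos_herm]]])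
     (auto intro!: mult_nonneg_nonneg spec_pos_nonneg[OF _ spec_evl_evc[OF _ pos_herm]])

lemma sum_quad_onb:
  assumes I: "finite I" and A: "herm I A" and v: "onb I v"
  shows "(\<Sum>j\<in>I. Re (quad I A (v j))) = Re (tr I A)"
proof -
  have s: "spec I (evl I A) (evc I A) A" by (rule spec_evl_evc[OF I A])
  have "(\<Sum>j\<in>I. Re (quad I A (v j))) = (\<Sum>j\<in>I. \<Sum>i\<in>I. evl I A i * (cmod (inn I (evc I A i) (v j)))\<^sup>2)"
    by (simp add: spec_quad[OF s])
  also have "... = (\<Sum>i\<in>I. evl I A i * (\<Sum>j\<in>I. (cmod (inn I (v j) (evc I A i)))\<^sup>2))"
    by (subst sum.swap) (simp add: sum_distrib_left inn_cnj[of _ "v _", symmetric] del: inn_cnj)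
  also have "... = (\<Sum>i\<in>I. evl I A i)"
    using s by (intro sum.cong refl) (simp add: parseval_norm[OF I v] spec_def onb_norm)
  finally show ?thesis by (simp add: spec_trace[OF s])
qed

text \<open>The product basis diagonalises \<open>tens B D\<close>. The rule
  \<open>ln (q r) = ln q + ln r\<close> fails where an eigenvalue is 0, but there the support
  conditions make the weight of \<open>A\<close> or of \<open>C\<close> vanish.\<close>

lemma supported_tens:
  assumes 1: "supported_pair I A B" and 2: "supported_pair J C D"
  shows "supported_pair (I \<times> J) (tens A C) (tens B D)"
    and "trln (I \<times> J) (tens A C) (tens B D) = Re (tr J C) * trln I A B + Re (tr I A) * trln J C D"
proof -
  interpret X: supported_pair I A B by fact
  interpret Y: supported_pair J C D by fact
  define q v where "q = evl I B" and "v = evc I B"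
  define r w where "r = evl J D" and "w = evc J D"
  have s: "spec I q v B" and t: "spec J r w D" using X.sB Y.sB by (simp_all add: q_def v_def r_def w_def)
  have st: "spec (I \<times> J) (\<lambda>k. q (fst k) * r (snd k)) (\<lambda>k x. v (fst k) (fst x) * w (snd k) (snd x)) (tens B D)"
    by (rule spec_tens[OF s t])
  have pAC: "pos (I \<times> J) (tens A C)" and pBD: "pos (I \<times> J) (tens B D)"
    by (intro pos_tens X.fin Y.fin X.A Y.A X.B Y.B)+
  show "supported_pair (I \<times> J) (tens A C) (tens B D)"
  proof
    show "supp (I \<times> J) (tens A C) (tens B D)"
      unfolding supp_def
    proof (intro allI impI)
      fix f assume z: "quad (I \<times> J) (tens B D) f = 0"
      \<comment> \<open>A component of \<open>f\<close> in the product basis is nonzero only where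
        \<open>q\<close> or \<open>r\<close> vanishes. The form of \<open>tens A C\<close> is 0 on
        each such component, and its zeros form a subspace.\<close>
      define V where "V k x = v (fst k) (fst x) * w (snd k) (snd x)" for k x
      have zz: "q (fst k) * r (snd k) = 0 \<or> inn (I \<times> J) (V k) f = 0" if "k \<in> I \<times> J" for k
        using z quad_zero_iff[OF _ pBD st] X.fin Y.fin that unfolding V_def by (cases k) auto
      have o: "onb (I \<times> J) V" using st by (simp add: spec_def V_def[abs_def])
      have "quad (I \<times> J) (tens A C) (\<lambda>x. \<Sum>k\<in>I \<times> J. inn (I \<times> J) (V k) f * V k x) = 0"
      proof (rule quad_zero_sum[OF _ pAC])
        fix k assume k: "k \<in> I \<times> J"
        show "quad (I \<times> J) (tens A C) (\<lambda>x. inn (I \<times> J) (V k) f * V k x) = 0"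
        proof (cases "inn (I \<times> J) (V k) f = 0")
          case True
          then show ?thesis by (simp add: quad_def)
        next
          case False
          then have "q (fst k) = 0 \<or> r (snd k) = 0" using zz[OF k] by auto
          then have "quad I A (v (fst k)) * quad J C (w (snd k)) = 0"
            using k supported_spec_zero[OF 1 s] supported_spec_zero[OF 2 t] by auto
          then have "quad (I \<times> J) (tens A C) (V k) = 0" unfolding V_def quad_tens .
          moreover have "quad (I \<times> J) (tens A C) (\<lambda>x. c * V k x) = cnj c * c * quad (I \<times> J) (tens A C) (V k)" for c
            by (simp add: quad_def sum_distrib_left mult_ac)
          ultimately show ?thesis by simp
        qed
      qed (use X.fin Y.fin in auto)
      also have "quad (I \<times> J) (tens A C) (\<lambda>x. \<Sum>k\<in>I \<times> J. inn (I \<times> J) (V k) f * V k x) = quad (I \<times> J) (tens A C) f"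
        using X.fin Y.fin by (intro quad_cong onb_expand[OF _ o]) auto
      finally show "quad (I \<times> J) (tens A C) f = 0" .
    qed
  qed (use X.fin Y.fin pAC pBD in auto)
  have qr: "quad I A f = of_real (Re (quad I A f))" "quad J C g = of_real (Re (quad J C g))" for f g
    by (rule pos_real[OF X.A], rule pos_real[OF Y.A])
  have Rq: "Re (quad I A f * quad J C g) = Re (quad I A f) * Re (quad J C g)" for f g
    by (subst qr(1), subst qr(2)) simp
  have sumq: "(\<Sum>j\<in>I. Re (quad I A (v j))) = Re (tr I A)" using s by (intro sum_quad_onb X.fin pos_herm X.A) (simp add: spec_def)
  have sumr: "(\<Sum>j\<in>J. Re (quad J C (w j))) = Re (tr J C)" using t by (intro sum_quad_onb Y.fin pos_herm Y.A) (simp add: spec_def)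
  have "trln (I \<times> J) (tens A C) (tens B D) = (\<Sum>i\<in>I. \<Sum>j\<in>J. ln (q i * r j) * (Re (quad I A (v i)) * Re (quad J C (w j))))"
    using X.fin Y.fin by (simp add: trln_spec[OF _ st] quad_tens Rq sum_Times del: times_complex.sel)
  also have "... = (\<Sum>i\<in>I. \<Sum>j\<in>J. (ln (q i) * Re (quad I A (v i))) * Re (quad J C (w j)) + Re (quad I A (v i)) * (ln (r j) * Re (quad J C (w j))))"
  proof (intro sum.cong refl)
    fix i j assume ij: "i \<in> I" "j \<in> J"
    have nn: "0 \<le> q i" "0 \<le> r j" using spec_pos_nonneg[OF X.fin s X.B ij(1)] spec_pos_nonneg[OF Y.fin t Y.B ij(2)] by auto
    show "ln (q i * r j) * (Re (quad I A (v i)) * Re (quad J C (w j)))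
      = (ln (q i) * Re (quad I A (v i))) * Re (quad J C (w j)) + Re (quad I A (v i)) * (ln (r j) * Re (quad J C (w j)))"
    proof (cases "q i = 0 \<or> r j = 0")
      case True
      then have "Re (quad I A (v i)) = 0 \<or> Re (quad J C (w j)) = 0"
        using supported_spec_zero[OF 1 s ij(1)] supported_spec_zero[OF 2 t ij(2)] by auto
      then show ?thesis by auto
    next
      case False
      then have "ln (q i * r j) = ln (q i) + ln (r j)" using nn by (simp add: ln_mult)
      then show ?thesis by (simp add: algebra_simps)
    qed
  qed
  also have "... = (\<Sum>i\<in>I. ln (q i) * Re (quad I A (v i))) * (\<Sum>j\<in>J. Re (quad J C (w j))) + (\<Sum>i\<in>I. Re (quad I A (v i))) * (\<Sum>j\<in>J. ln (r j) * Re (quad J C (w j)))"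
    by (simp only: sum.distrib sum_product)
  finally show "trln (I \<times> J) (tens A C) (tens B D) = Re (tr J C) * trln I A B + Re (tr I A) * trln J C D"
    by (simp add: sumq sumr trln_spec[OF X.fin s] trln_spec[OF Y.fin t])
qed

lemma ent_tens:
  assumes "finite I" "finite J" "pos I A" "pos J B" "Re (tr I A) = 1" "Re (tr J B) = 1"
  shows "ent (I \<times> J) (tens A B) = ent I A + ent J B"
proof -
  have "supported_pair I A A" "supported_pair J B B" using assms by (auto simp: supported_pair_def supp_def)
  from supported_tens(2)[OF this] assms show ?thesis by (simp add: ent_def)
qed

lemma relent_tens:
  assumes "supported_pair I A B" "supported_pair J C D" "Re (tr I A) = 1" "Re (tr J C) = 1"
  shows "relent (I \<times> J) (tens A C) (tens B D) = relent I A B + relent J C D"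
proof -
  have "supported_pair I A A" "supported_pair J C C" using assms by (auto simp: supported_pair_def supp_def)
  from supported_tens(2)[OF this] supported_tens(2)[OF assms(1,2)] assms show ?thesis by (simp add: relent_def)
qed

section \<open>Additivity of conditional mutual information over copies\<close>

lemma bij_divmod: "bij_betw (\<lambda>x. (x div b, x mod b)) {..<a * b} ({..<a} \<times> {..<(b::nat)})"
  by (rule bij_pair_inv)

lemma bij_divmod2:
  "bij_betw (\<lambda>p. ((fst p div b, snd p div d), (fst p mod b, snd p mod d))) (ix2 (a * b) (c * d)) (ix2 a c \<times> ({..<(b::nat)} \<times> {..<(d::nat)}))"
  by (rule bij_betwI[where g = "\<lambda>p. (fst (fst p) * b + fst (snd p), snd (fst p) * d + snd (snd p))"])
     (auto simp: pair_less div_less_pair mod_less_pair)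

lemma bij_divmod3:
  "bij_betw (\<lambda>p. ((fst p div b, fst (snd p) div d, snd (snd p) div f), (fst p mod b, fst (snd p) mod d, snd (snd p) mod f)))
    (ix3 (a * b) (c * d) (e * f)) (ix3 a c e \<times> ({..<(b::nat)} \<times> {..<(d::nat)} \<times> {..<(f::nat)}))"
  by (rule bij_betwI[where g = "\<lambda>p. (fst (fst p) * b + fst (snd p), fst (snd (fst p)) * d + fst (snd (snd p)), snd (snd (fst p)) * f + snd (snd (snd p)))"])
     (auto simp: pair_less div_less_pair mod_less_pair)

text \<open>The tensor product with corresponding systems merged, in the digit order of
  \<open>party_tensor\<close>.\<close>

definition mix3 :: "nat \<Rightarrow> nat \<Rightarrow> nat \<Rightarrow> (nat \<times> nat \<times> nat) op \<Rightarrow>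
    (nat \<times> nat \<times> nat) op \<Rightarrow> nat \<times> nat \<times> nat \<Rightarrow> nat \<times> nat \<times> nat \<Rightarrow> complex" where
  "mix3 b d f S T p q = S (fst p div b, fst (snd p) div d, snd (snd p) div f) (fst q div b, fst (snd q) div d, snd (snd q) div f)
     * T (fst p mod b, fst (snd p) mod d, snd (snd p) mod f) (fst q mod b, fst (snd q) mod d, snd (snd q) mod f)"

lemma sum_divmod: "(\<Sum>k<a * (b::nat). f (k div b) * g (k mod b)) = (\<Sum>i<a. f i) * (\<Sum>j<b. g j :: complex)"
proof (cases "b = 0")
  case False
  then show ?thesis by (simp add: sum_pair sum_product)
qed simp

lemma tr_ptr1: "tr N (ptr1 M A) = tr (M \<times> N) A"
  unfolding tr_def ptr1_def sum_Times by (rule sum.swap)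

lemma tr_swap12: "tr (B \<times> A \<times> E) (swap12 \<tau>) = tr (A \<times> B \<times> E) \<tau>"
  unfolding tr_def swap12_def by (rule sum.reindex_bij_betw[OF bij_swap12])

text \<open>All four reduced operators are tensor products up to a regrouping of indices, and
  entropy is additive for factors of trace one.\<close>

lemma cmi_mix3:
  assumes S: "pos (ix3 a1 b1 e1) S" and T: "pos (ix3 a2 b2 e2) T"
    and t: "Re (tr (ix3 a1 b1 e1) S) = 1" "Re (tr (ix3 a2 b2 e2) T) = 1"
  defines "M \<equiv> mix3 a2 b2 e2 S T"
  shows "pos (ix3 (a1 * a2) (b1 * b2) (e1 * e2)) M" (is ?P)
    and "Re (tr (ix3 (a1 * a2) (b1 * b2) (e1 * e2)) M) = 1" (is ?T)
    and "cmin (a1 * a2) (b1 * b2) (e1 * e2) M = cmin a1 b1 e1 S + cmin a2 b2 e2 T" (is ?C)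
proof -
  have M: "M = (\<lambda>p q. tens S T ((fst p div a2, fst (snd p) div b2, snd (snd p) div e2), (fst p mod a2, fst (snd p) mod b2, snd (snd p) mod e2))
     ((fst q div a2, fst (snd q) div b2, snd (snd q) div e2), (fst q mod a2, fst (snd q) mod b2, snd (snd q) mod e2)))"
    by (simp add: M_def mix3_def tens_def fun_eq_iff)
  note pt = pos_tens[OF _ _ S T]
  show ?P unfolding M by (rule pos_reindex[OF bij_divmod3 pt]) auto
  have im: "Im (tr (ix3 a1 b1 e1) S) = 0"
    using spec_trace[OF spec_evl_evc[OF _ pos_herm[OF _ S]]] by simp
  show ?T
  proof -
    have "tr (ix3 (a1 * a2) (b1 * b2) (e1 * e2)) M = tr (ix3 a1 b1 e1 \<times> (ix3 a2 b2 e2)) (tens S T)"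
      unfolding tr_def M by (rule sum.reindex_bij_betw[OF bij_divmod3])
    then show ?thesis using t im by (simp add: tr_tens)
  qed
  have e3: "ent (ix3 (a1 * a2) (b1 * b2) (e1 * e2)) M = ent (ix3 a1 b1 e1) S + ent (ix3 a2 b2 e2) T"
    unfolding M by (subst ent_reindex[OF _ bij_divmod3 pos_herm[OF _ pt]], simp_all) (rule ent_tens[OF _ _ S T t], simp_all)
  have eb: "ent (ix2 (b1 * b2) (e1 * e2)) (ptr1 {..<a1 * a2} M) = ent (ix2 b1 e1) (ptr1 {..<a1} S) + ent (ix2 b2 e2) (ptr1 {..<a2} T)"
  proof -
    have p: "pos (ix2 b1 e1) (ptr1 {..<a1} S)" "pos (ix2 b2 e2) (ptr1 {..<a2} T)"
      by (intro pos_ptr1 S T finite_lessThan)+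
    have tt: "Re (tr (ix2 b1 e1) (ptr1 {..<a1} S)) = 1" "Re (tr (ix2 b2 e2) (ptr1 {..<a2} T)) = 1"
      by (simp_all only: tr_ptr1 t)
    have "ptr1 {..<a1 * a2} M = (\<lambda>p q. tens (ptr1 {..<a1} S) (ptr1 {..<a2} T) ((fst p div b2, snd p div e2), (fst p mod b2, snd p mod e2))
       ((fst q div b2, snd q div e2), (fst q mod b2, snd q mod e2)))"
      unfolding ptr1_def M_def mix3_def tens_def fst_conv snd_conv by (intro ext) (rule sum_divmod)
    then show ?thesis
      by (simp only:) (subst ent_reindex[OF _ bij_divmod2 pos_herm[OF _ pos_tens[OF _ _ p]]], simp_all, rule ent_tens[OF _ _ p tt], simp_all)
  qed
  have ea: "ent (ix2 (a1 * a2) (e1 * e2)) (ptr1 {..<b1 * b2} (swap12 M)) = ent (ix2 a1 e1) (ptr1 {..<b1} (swap12 S)) + ent (ix2 a2 e2) (ptr1 {..<b2} (swap12 T))"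
  proof -
    have p: "pos (ix2 a1 e1) (ptr1 {..<b1} (swap12 S))" "pos (ix2 a2 e2) (ptr1 {..<b2} (swap12 T))"
      by (intro pos_ptr1 pos_swap12 S T finite_lessThan)+
    have tt: "Re (tr (ix2 a1 e1) (ptr1 {..<b1} (swap12 S))) = 1" "Re (tr (ix2 a2 e2) (ptr1 {..<b2} (swap12 T))) = 1"
      by (simp_all only: tr_ptr1 tr_swap12 t)
    have "ptr1 {..<b1 * b2} (swap12 M) = (\<lambda>p q. tens (ptr1 {..<b1} (swap12 S)) (ptr1 {..<b2} (swap12 T)) ((fst p div a2, snd p div e2), (fst p mod a2, snd p mod e2))
       ((fst q div a2, snd q div e2), (fst q mod a2, snd q mod e2)))"
      unfolding ptr1_def swap12_def M_def mix3_def tens_def fst_conv snd_conv by (intro ext) (rule sum_divmod)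
    then show ?thesis
      by (simp only:) (subst ent_reindex[OF _ bij_divmod2 pos_herm[OF _ pos_tens[OF _ _ p]]], simp_all, rule ent_tens[OF _ _ p tt], simp_all)
  qed
  have ee: "ent {..<e1 * e2} (ptr1 {..<b1 * b2} (ptr1 {..<a1 * a2} M)) = ent {..<e1} (ptr1 {..<b1} (ptr1 {..<a1} S)) + ent {..<e2} (ptr1 {..<b2} (ptr1 {..<a2} T))"
  proof -
    have p: "pos {..<e1} (ptr1 {..<b1} (ptr1 {..<a1} S))" "pos {..<e2} (ptr1 {..<b2} (ptr1 {..<a2} T))"
      by (intro pos_ptr1 S T finite_lessThan)+
    have tt: "Re (tr {..<e1} (ptr1 {..<b1} (ptr1 {..<a1} S))) = 1" "Re (tr {..<e2} (ptr1 {..<b2} (ptr1 {..<a2} T))) = 1"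
      by (simp_all only: tr_ptr1 t)
    have "ptr1 {..<b1 * b2} (ptr1 {..<a1 * a2} M) = (\<lambda>p q. tens (ptr1 {..<b1} (ptr1 {..<a1} S)) (ptr1 {..<b2} (ptr1 {..<a2} T)) (p div e2, p mod e2) (q div e2, q mod e2))"
    proof -
      have m: "ptr1 {..<a1 * a2} M = (\<lambda>p q. ptr1 {..<a1} S (fst p div b2, snd p div e2) (fst q div b2, snd q div e2)
          * ptr1 {..<a2} T (fst p mod b2, snd p mod e2) (fst q mod b2, snd q mod e2))"
        unfolding ptr1_def M_def mix3_def fst_conv snd_conv by (intro ext) (rule sum_divmod)
      show ?thesis
        unfolding m ptr1_def[of "{..<b1 * b2}"] ptr1_def[of "{..<b1}"] ptr1_def[of "{..<b2}"] tens_def fst_conv snd_conv by (intro ext) (rule sum_divmod)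
    qed
    then show ?thesis
      by (simp only:) (subst ent_reindex[OF _ bij_divmod pos_herm[OF _ pos_tens[OF _ _ p]]], simp_all, rule ent_tens[OF _ _ p tt], simp_all)
  qed
  show ?C unfolding cmi_def e3 eb ea ee by simp
qed

lemma trE_mix3: "trE (e1 * e2) (mix3 a2 b2 e2 S T) p q =
    trE e1 S (fst p div a2, snd p div b2) (fst q div a2, snd q div b2) * trE e2 T (fst p mod a2, snd p mod b2) (fst q mod a2, snd q mod b2)"
  unfolding trE_def mix3_def fst_conv snd_conv by (rule sum_divmod)

section \<open>Powers of a state and of its extension\<close>

lemma party_power_carrier: "party_power [a, b] \<rho> n \<in> sqmat (a ^ n * b ^ n)"
proof (cases n)
  case (Suc k)
  then show ?thesis using party_tensor2_carrier[of a b "a ^ k" "b ^ k"] by simp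
qed simp

lemma o2_party_power_Suc:
  assumes "p \<in> ix2 (a ^ Suc n) (b ^ Suc n)" "q \<in> ix2 (a ^ Suc n) (b ^ Suc n)"
  shows "o2 (b ^ Suc n) (party_power [a, b] \<rho> (Suc n)) p q =
    o2 b \<rho> (fst p div a ^ n, snd p div b ^ n) (fst q div a ^ n, snd q div b ^ n) *
    o2 (b ^ n) (party_power [a, b] \<rho> n) (fst p mod a ^ n, snd p mod b ^ n) (fst q mod a ^ n, snd q mod b ^ n)"
  using o2_party_tensor[of p a "a ^ n" b "b ^ n" q \<rho> "party_power [a, b] \<rho> n"] assms by simp

text \<open>Powers of an extension extend the powers of the state, so a single extension bounds the
  key from any number of copies.\<close>

fun ext_power :: "nat \<Rightarrow> nat \<Rightarrow> nat \<Rightarrow> (nat \<times> nat \<times> nat) op \<Rightarrow> nat \<Rightarrow> nat \<times> nat \<times> nat \<Rightarrow> nat \<times> nat \<times> nat \<Rightarrow> complex" where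
  "ext_power a b e \<tau> 0 = (\<lambda>_ _. 1)"
| "ext_power a b e \<tau> (Suc n) = mix3 (a ^ n) (b ^ n) (e ^ n) \<tau> (ext_power a b e \<tau> n)"

lemma ext_power:
  assumes \<tau>: "pos (ix3 a b e) \<tau>" and t: "Re (tr (ix3 a b e) \<tau>) = 1"
  shows "pos (ix3 (a ^ n) (b ^ n) (e ^ n)) (ext_power a b e \<tau> n) \<and>
    Re (tr (ix3 (a ^ n) (b ^ n) (e ^ n)) (ext_power a b e \<tau> n)) = 1 \<and>
    cmin (a ^ n) (b ^ n) (e ^ n) (ext_power a b e \<tau> n) = n * cmin a b e \<tau>"
proof (induction n)
  case 0
  have e1: "ent {x} A = 0" if "A x x = 1" for x and A :: "'x op"
  proof -
    have "spec {x} (\<lambda>_. 1) (\<lambda>_ _. 1) A" using that by (auto simp: spec_def onb_def inn_def)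
    from ent_spec[OF _ this] show ?thesis by simp
  qed
  have "{..<1} = {0::nat}" by auto
  then show ?case
    by (auto simp: cmi_def e1 ptr1_def swap12_def tr_def pos_def quad_def less_eq_complex_def)
next
  case (Suc n)
  then show ?case
    using cmi_mix3[OF \<tau> conjunct1[OF Suc] t conjunct1[OF conjunct2[OF Suc]]] by (simp add: algebra_simps)
qed

lemma trE_ext_power:
  assumes "\<And>p q. p \<in> ix2 a b \<Longrightarrow> q \<in> ix2 a b \<Longrightarrow> trE e \<tau> p q = o2 b \<rho> p q"
  shows "\<lbrakk>p \<in> ix2 (a ^ n) (b ^ n); q \<in> ix2 (a ^ n) (b ^ n)\<rbrakk> \<Longrightarrow>
    trE (e ^ n) (ext_power a b e \<tau> n) p q = o2 (b ^ n) (party_power [a, b] \<rho> n) p q"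
proof (induction n arbitrary: p q)
  case 0
  then show ?case by (auto simp: trE_def o2_def)
next
  case (Suc n)
  have "trE (e ^ Suc n) (ext_power a b e \<tau> (Suc n)) p q = trE e \<tau> (fst p div a ^ n, snd p div b ^ n) (fst q div a ^ n, snd q div b ^ n)
      * trE (e ^ n) (ext_power a b e \<tau> n) (fst p mod a ^ n, snd p mod b ^ n) (fst q mod a ^ n, snd q mod b ^ n)"
    using trE_mix3[of e "e ^ n"] by simp
  also have "... = o2 (b ^ Suc n) (party_power [a, b] \<rho> (Suc n)) p q"
    unfolding o2_party_power_Suc[OF Suc.prems] using Suc.prems
    by (intro arg_cong2[where f = "(*)"] assms Suc.IH) (auto simp: div_less_pair mod_less_pair)
  finally show ?case .
qed

section \<open>Relative entropy of entanglement\<close>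

lemma o2_eqI:
  assumes "X \<in> sqmat (a * b)" "Y \<in> sqmat (a * b)"
    and "\<And>p q. p \<in> ix2 a b \<Longrightarrow> q \<in> ix2 a b \<Longrightarrow> o2 b X p q = o2 b Y p q"
  shows "X = Y"
proof (rule eq_matI)
  fix i j assume "i < dim_row Y" "j < dim_col Y"
  then have "fn X i j = fn Y i j"
    unfolding fn_o2[of _ _ _ b] using assms(2) by (intro assms(3)) (auto simp: div_less_pair mod_less_pair)
  then show "X $$ (i, j) = Y $$ (i, j)" by (simp add: fn_def)
qed (use assms in auto)

lemma density_o2:
  "density (a * b) X \<longleftrightarrow> X \<in> sqmat (a * b) \<and> pos (ix2 a b) (o2 b X) \<and> tr (ix2 a b) (o2 b X) = 1"
proof -
  have "mat_trace X = tr (ix2 a b) (o2 b X)" if "X \<in> sqmat (a * b)"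
    using that by (simp add: tr_def o2_def mat_trace_def sum_pair sum_Times)
  moreover have "pos {..<a * b} (fn X) \<longleftrightarrow> pos (ix2 a b) (o2 b X)"
    using pos_o2 pos_fn_o2 by blast
  ultimately show ?thesis by (auto simp: density_def psd_pos)
qed

lemma density_o2_cong:
  assumes "X \<in> sqmat (a * b)"
    and "\<And>p q. p \<in> ix2 a b \<Longrightarrow> q \<in> ix2 a b \<Longrightarrow> o2 b X p q = T p q"
    and "pos (ix2 a b) T" "tr (ix2 a b) T = 1"
  shows "density (a * b) X"
  unfolding density_o2
  using assms pos_cong[of "ix2 a b" "o2 b X" T] tr_cong[of "ix2 a b" "o2 b X" T] by simp

lemma smult_index: "\<lbrakk>A \<in> sqmat n; i < n; j < n\<rbrakk> \<Longrightarrow> (c \<cdot>\<^sub>m A) $$ (i, j) = c * A $$ (i, j)"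
  by auto

lemma density_party_tensor:
  assumes X: "density (d1 * d2) X" and Y: "density (e1 * e2) Y"
  shows "density (d1 * e1 * (d2 * e2)) (party_tensor [d1, d2] [e1, e2] X Y)"
proof -
  let ?h = "\<lambda>p. ((fst p div e1, snd p div e2), (fst p mod e1, snd p mod e2))"
  let ?T = "tens (o2 d2 X) (o2 e2 Y)"
  have e: "o2 (d2 * e2) (party_tensor [d1, d2] [e1, e2] X Y) p q = ?T (?h p) (?h q)"
    if "p \<in> ix2 (d1 * e1) (d2 * e2)" "q \<in> ix2 (d1 * e1) (d2 * e2)" for p q
    using o2_party_tensor[OF that] by (simp add: tens_def)
  have "pos (ix2 (d1 * e1) (d2 * e2)) (\<lambda>p q. ?T (?h p) (?h q))"
    using X Y by (intro pos_reindex[OF bij_divmod2] pos_tens) (auto simp: density_o2)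
  moreover have "tr (ix2 (d1 * e1) (d2 * e2)) (\<lambda>p q. ?T (?h p) (?h q)) = tr (ix2 d1 d2 \<times> ix2 e1 e2) ?T"
    unfolding tr_def by (rule sum.reindex_bij_betw[OF bij_divmod2])
  moreover have "tr (ix2 d1 d2 \<times> ix2 e1 e2) ?T = 1"
    using X Y by (simp add: tr_tens density_o2)
  ultimately show ?thesis by (intro density_o2_cong[OF party_tensor2_carrier e]) simp_all
qed

lemma density_power: "density (a * b) \<rho> \<Longrightarrow> density (a ^ n * b ^ n) (party_power [a, b] \<rho> n)"
proof (induction n)
  case 0
  have "{..<1} = {0::nat}" by auto
  then show ?case
    using density_o2[of 1 1 "1\<^sub>m 1"] by (simp add: pos_def quad_def tr_def o2_def less_eq_complex_def)
next
  case (Suc n)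
  then show ?case using density_party_tensor[of a b \<rho> "a ^ n" "b ^ n"] by simp
qed

lemma supp_reindex:
  assumes b: "bij_betw h J I"
  shows "supp J (\<lambda>x y. A (h x) (h y)) (\<lambda>x y. B (h x) (h y)) \<longleftrightarrow> supp I A B"
proof -
  have "quad J (\<lambda>x y. A (h x) (h y)) f = quad I A (\<lambda>x. f (inv_into J h x))" for f A
    unfolding quad_reindex[OF b, of A] using b by (intro quad_cong) (auto simp: bij_betw_def inv_into_f_f)
  then show ?thesis unfolding supp_def by (metis quad_reindex[OF b])
qed

lemma relent_reindex:
  assumes "finite I" "bij_betw h J I" "herm I A" "herm I B"
  shows "relent J (\<lambda>x y. A (h x) (h y)) (\<lambda>x y. B (h x) (h y)) = relent I A B"
  unfolding relent_def trln_reindex[OF assms(1,2,3)] trln_reindex[OF assms(1,2,4)] ..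

lemma relative_entropy_o2:
  assumes A: "psd (a * b) A" and B: "psd (a * b) B"
  shows "relative_entropy (a * b) A B = (if supp (ix2 a b) (o2 b A) (o2 b B)
     then ereal (relent (ix2 a b) (o2 b A) (o2 b B) / ln 2) else \<infinity>)"
proof -
  have o: "o2 b X = (\<lambda>x y. fn X (fst x * b + snd x) (fst y * b + snd y))" for X
    by (simp add: o2_def fn_def fun_eq_iff)
  show ?thesis
    unfolding relative_entropy_relent[OF A B] o
    using supp_reindex[OF bij_pair[of b a], of "fn A" "fn B"] relent_reindex[OF _ bij_pair[of b a] psd_herm[OF A] psd_herm[OF B]] by simp
qed

lemma pos_scale: "\<lbrakk>0 \<le> c; pos I A\<rbrakk> \<Longrightarrow> pos I (\<lambda>x y. of_real c * A x y)"
proof -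
  assume c: "0 \<le> c" and A: "pos I A"
  have "quad I (\<lambda>x y. of_real c * A x y) f = of_real c * quad I A f" for f
    by (simp add: quad_def sum_distrib_left mult_ac)
  then show ?thesis using c A by (auto simp: pos_def less_eq_complex_def)
qed

lemma density_fn: "density n A \<longleftrightarrow> A \<in> sqmat n \<and> pos {..<n} (fn A) \<and> tr {..<n} (fn A) = 1"
  by (auto simp: density_def psd_pos mat_trace_tr)

lemma density_kron:
  assumes X: "density a X" and Y: "density b Y" shows "density (a * b) (kron X Y)"
proof -
  have c: "X \<in> sqmat a" "Y \<in> sqmat b" using X Y by (auto simp: density_fn)
  have e: "o2 b (kron X Y) p q = tens (fn X) (fn Y) p q" if "p \<in> ix2 a b" "q \<in> ix2 a b" for p q
    using that kron_index[OF c, of "fst p" "snd p" "fst q" "snd q"] by (auto simp: o2_def tens_def fn_def)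
  have "pos (ix2 a b) (tens (fn X) (fn Y))" using X Y by (intro pos_tens) (auto simp: density_fn)
  moreover have "tr (ix2 a b) (tens (fn X) (fn Y)) = 1" using X Y by (simp add: tr_tens density_fn)
  ultimately show ?thesis by (intro density_o2_cong[OF kron_carrier[OF c] e])
qed

lemma separable_o2:
  assumes "separable a b \<sigma>"
  shows "density (a * b) \<sigma>" "sep {..<a} {..<b} (o2 b \<sigma>)"
proof -
  from assms obtain r w \<alpha> \<beta> where k: "\<And>k. k < (r::nat) \<Longrightarrow> 0 \<le> w k \<and> density a (\<alpha> k) \<and> density b (\<beta> k)"
    and w: "(\<Sum>k<r. w k) = (1::real)"
    and \<sigma>: "\<sigma> = mat_sum (a * b) (\<lambda>k. complex_of_real (w k) \<cdot>\<^sub>m kron (\<alpha> k) (\<beta> k)) {..<r}"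
    unfolding separable_def by blast
  have c: "\<alpha> k \<in> sqmat a" "\<beta> k \<in> sqmat b" if "k < r" for k using k[OF that] by (auto simp: density_fn)
  have ck: "kron (\<alpha> k) (\<beta> k) \<in> sqmat (a * b)" if "k < r" for k using kron_carrier[OF c[OF that]] .
  have e: "o2 b \<sigma> p q = (\<Sum>k<r. of_real (w k) * o2 b (kron (\<alpha> k) (\<beta> k)) p q)" if "p \<in> ix2 a b" "q \<in> ix2 a b" for p q
  proof -
    have "fst p * b + snd p < a * b" "fst q * b + snd q < a * b" using that by (auto intro: pair_less)
    then show ?thesis unfolding \<sigma> o2_def using ck by (simp add: mat_sum_index del: index_smult_mat) (intro sum.cong refl smult_index[of _ "a * b"], auto)
  qed
  have e2: "o2 b (kron (\<alpha> k) (\<beta> k)) p q = fn (\<alpha> k) (fst p) (fst q) * fn (\<beta> k) (snd p) (snd q)"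
    if "k < r" "p \<in> ix2 a b" "q \<in> ix2 a b" for k p q
    using that kron_index[OF c[OF that(1)], of "fst p" "snd p" "fst q" "snd q"] by (auto simp: o2_def fn_def)
  show "sep {..<a} {..<b} (o2 b \<sigma>)"
    unfolding sep_def
    by (rule exI[of _ r], rule exI[of _ "\<lambda>k x y. of_real (w k) * fn (\<alpha> k) x y"], rule exI[of _ "\<lambda>k. fn (\<beta> k)"])
       (use k in \<open>auto simp: e e2 density_fn mult.assoc intro!: pos_scale\<close>)
  have d: "density (a * b) (kron (\<alpha> k) (\<beta> k))" if "k < r" for k using k[OF that] by (intro density_kron) auto
  have "pos (ix2 a b) (\<lambda>p q. \<Sum>k<r. of_real (w k) * o2 b (kron (\<alpha> k) (\<beta> k)) p q)"
    using k d by (intro pos_sum pos_scale) (auto simp: density_o2)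
  moreover have "tr (ix2 a b) (\<lambda>p q. \<Sum>k<r. of_real (w k) * o2 b (kron (\<alpha> k) (\<beta> k)) p q) = 1"
  proof -
    have "tr (ix2 a b) (\<lambda>p q. of_real (w k) * o2 b (kron (\<alpha> k) (\<beta> k)) p q) = of_real (w k)" if "k < r" for k
    proof -
      have "tr (ix2 a b) (\<lambda>p q. of_real (w k) * o2 b (kron (\<alpha> k) (\<beta> k)) p q) = of_real (w k) * tr (ix2 a b) (o2 b (kron (\<alpha> k) (\<beta> k)))"
        by (simp add: tr_def sum_distrib_left)
      then show ?thesis using d[OF that] by (simp add: density_o2)
    qed
    then show ?thesis using w by (simp add: tr_sum flip: of_real_sum)
  qed
  ultimately show "density (a * b) \<sigma>"
    by (intro density_o2_cong[OF _ e]) (simp_all add: \<sigma>)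
qed

lemma kron_div_mod:
  assumes "X \<in> sqmat a" "Y \<in> sqmat b" "i < a * b" "j < a * b"
  shows "kron X Y $$ (i, j) = X $$ (i div b, j div b) * Y $$ (i mod b, j mod b)"
  using assms by (simp add: kron_def)

text \<open>The terms of the two decompositions are multiplied out, a pair of term indices being
  encoded as \<open>k div s\<close> and \<open>k mod s\<close> with
  \<open>k < r * s\<close>.\<close>

lemma separable_party_tensor:
  assumes "separable a1 b1 \<sigma>1" "separable a2 b2 \<sigma>2"
  shows "separable (a1 * a2) (b1 * b2) (party_tensor [a1, b1] [a2, b2] \<sigma>1 \<sigma>2)"
proof -
  from assms(1) obtain r w \<alpha> \<beta> where k: "\<And>k. k < (r::nat) \<Longrightarrow> 0 \<le> w k \<and> density a1 (\<alpha> k) \<and> density b1 (\<beta> k)"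
    and w: "(\<Sum>k<r. w k) = (1::real)"
    and \<sigma>1: "\<sigma>1 = mat_sum (a1 * b1) (\<lambda>k. complex_of_real (w k) \<cdot>\<^sub>m kron (\<alpha> k) (\<beta> k)) {..<r}"
    unfolding separable_def by blast
  from assms(2) obtain s v \<gamma> \<delta> where l: "\<And>k. k < (s::nat) \<Longrightarrow> 0 \<le> v k \<and> density a2 (\<gamma> k) \<and> density b2 (\<delta> k)"
    and v: "(\<Sum>k<s. v k) = (1::real)"
    and \<sigma>2: "\<sigma>2 = mat_sum (a2 * b2) (\<lambda>k. complex_of_real (v k) \<cdot>\<^sub>m kron (\<gamma> k) (\<delta> k)) {..<s}"
    unfolding separable_def by blast
  define z where "z k = w (k div s) * v (k mod s)" for k
  define \<mu> where "\<mu> k = kron (\<alpha> (k div s)) (\<gamma> (k mod s))" for k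
  define \<nu> where "\<nu> k = kron (\<beta> (k div s)) (\<delta> (k mod s))" for k
  have d: "0 \<le> z k \<and> density (a1 * a2) (\<mu> k) \<and> density (b1 * b2) (\<nu> k)" if "k < r * s" for k
    using k[OF div_less_pair[OF that]] l[OF mod_less_pair[OF that]] by (simp add: z_def \<mu>_def \<nu>_def density_kron)
  have sz: "(\<Sum>k<r * s. z k) = 1"
  proof (cases "s = 0")
    case False
    then show ?thesis using w v by (simp add: z_def sum_pair sum_distrib_left[symmetric])
  qed (use v in simp)
  have ca: "\<alpha> k \<in> sqmat a1" "\<beta> k \<in> sqmat b1" if "k < r" for k using k[OF that] by (auto simp: density_fn)
  have cg: "\<gamma> k \<in> sqmat a2" "\<delta> k \<in> sqmat b2" if "k < s" for k using l[OF that] by (auto simp: density_fn)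
  have ms: "o2 b (mat_sum (a * b) (\<lambda>k. complex_of_real (w k) \<cdot>\<^sub>m kron (\<alpha> k) (\<beta> k)) {..<r}) p q
      = (\<Sum>k<r. of_real (w k) * (\<alpha> k $$ (fst p, fst q) * \<beta> k $$ (snd p, snd q)))"
    if c: "\<And>k. k < (r::nat) \<Longrightarrow> \<alpha> k \<in> sqmat a \<and> \<beta> k \<in> sqmat b" and pq: "p \<in> ix2 a b" "q \<in> ix2 a b"
    for a b r w \<alpha> \<beta> p q
  proof -
    have less: "fst p * b + snd p < a * b" "fst q * b + snd q < a * b" using pq by (auto intro: pair_less)
    have "kron (\<alpha> k) (\<beta> k) \<in> sqmat (a * b)" if "k < r" for k using c[OF that] by (intro kron_carrier) auto
    then have "o2 b (mat_sum (a * b) (\<lambda>k. complex_of_real (w k) \<cdot>\<^sub>m kron (\<alpha> k) (\<beta> k)) {..<r}) p q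
      = (\<Sum>k<r. of_real (w k) * kron (\<alpha> k) (\<beta> k) $$ (fst p * b + snd p, fst q * b + snd q))"
      unfolding o2_def using less by (simp add: mat_sum_index del: index_smult_mat) (intro sum.cong refl smult_index[of _ "a * b"], auto)
    also have "... = (\<Sum>k<r. of_real (w k) * (\<alpha> k $$ (fst p, fst q) * \<beta> k $$ (snd p, snd q)))"
      using c pq by (intro sum.cong refl) (auto simp: kron_index[of _ a a _ b b])
    finally show ?thesis .
  qed
  have "party_tensor [a1, b1] [a2, b2] \<sigma>1 \<sigma>2 = mat_sum (a1 * a2 * (b1 * b2)) (\<lambda>k. complex_of_real (z k) \<cdot>\<^sub>m kron (\<mu> k) (\<nu> k)) {..<r * s}"
  proof (rule o2_eqI[OF party_tensor2_carrier])
    fix p q assume p: "p \<in> ix2 (a1 * a2) (b1 * b2)" and q: "q \<in> ix2 (a1 * a2) (b1 * b2)"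
    let ?pd = "(fst p div a2, snd p div b2)" and ?qd = "(fst q div a2, snd q div b2)"
    let ?pm = "(fst p mod a2, snd p mod b2)" and ?qm = "(fst q mod a2, snd q mod b2)"
    have pd: "?pd \<in> ix2 a1 b1" "?qd \<in> ix2 a1 b1" and pm: "?pm \<in> ix2 a2 b2" "?qm \<in> ix2 a2 b2"
      using p q by (auto simp: div_less_pair mod_less_pair)
    have "o2 (b1 * b2) (party_tensor [a1, b1] [a2, b2] \<sigma>1 \<sigma>2) p q
      = (\<Sum>k<r. of_real (w k) * (\<alpha> k $$ (fst ?pd, fst ?qd) * \<beta> k $$ (snd ?pd, snd ?qd))) * (\<Sum>k<s. of_real (v k) * (\<gamma> k $$ (fst ?pm, fst ?qm) * \<delta> k $$ (snd ?pm, snd ?qm)))"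
      unfolding o2_party_tensor[OF p q] \<sigma>1 \<sigma>2 using ca cg by (subst ms[OF _ pd], simp, subst ms[OF _ pm], simp_all)
    also have "... = (\<Sum>k<r * s. (of_real (w (k div s)) * (\<alpha> (k div s) $$ (fst ?pd, fst ?qd) * \<beta> (k div s) $$ (snd ?pd, snd ?qd)))
        * (of_real (v (k mod s)) * (\<gamma> (k mod s) $$ (fst ?pm, fst ?qm) * \<delta> (k mod s) $$ (snd ?pm, snd ?qm))))"
      by (rule sum_divmod[symmetric])
    also have "... = (\<Sum>k<r * s. of_real (z k) * (\<mu> k $$ (fst p, fst q) * \<nu> k $$ (snd p, snd q)))"
    proof (intro sum.cong refl)
      fix k assume "k \<in> {..<r * s}"
      then have kl: "k div s < r" "k mod s < s" by (auto simp: div_less_pair mod_less_pair)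
      have "\<mu> k $$ (fst p, fst q) = \<alpha> (k div s) $$ (fst ?pd, fst ?qd) * \<gamma> (k mod s) $$ (fst ?pm, fst ?qm)"
        "\<nu> k $$ (snd p, snd q) = \<beta> (k div s) $$ (snd ?pd, snd ?qd) * \<delta> (k mod s) $$ (snd ?pm, snd ?qm)"
        unfolding \<mu>_def \<nu>_def using p q by (auto simp: kron_div_mod[OF ca(1)[OF kl(1)] cg(1)[OF kl(2)]] kron_div_mod[OF ca(2)[OF kl(1)] cg(2)[OF kl(2)]])
      then show "(of_real (w (k div s)) * (\<alpha> (k div s) $$ (fst ?pd, fst ?qd) * \<beta> (k div s) $$ (snd ?pd, snd ?qd)))
        * (of_real (v (k mod s)) * (\<gamma> (k mod s) $$ (fst ?pm, fst ?qm) * \<delta> (k mod s) $$ (snd ?pm, snd ?qm)))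
        = of_real (z k) * (\<mu> k $$ (fst p, fst q) * \<nu> k $$ (snd p, snd q))"
        by (simp add: z_def mult_ac)
    qed
    also have "... = o2 (b1 * b2) (mat_sum (a1 * a2 * (b1 * b2)) (\<lambda>k. complex_of_real (z k) \<cdot>\<^sub>m kron (\<mu> k) (\<nu> k)) {..<r * s}) p q"
      by (rule ms[OF _ p q, symmetric]) (use d in \<open>auto simp: density_fn\<close>)
    finally show "o2 (b1 * b2) (party_tensor [a1, b1] [a2, b2] \<sigma>1 \<sigma>2) p q = o2 (b1 * b2) (mat_sum (a1 * a2 * (b1 * b2)) (\<lambda>k. complex_of_real (z k) \<cdot>\<^sub>m kron (\<mu> k) (\<nu> k)) {..<r * s}) p q" .
  qed simp
  then show ?thesis unfolding separable_def using d sz by blast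
qed

text \<open>\<open>party_power\<close> adds one copy at a time at the front; this splitting into two
  blocks is what subadditivity in the number of copies starts from. It reduces to the digit rules
  \<open>dm1\<close> to \<open>dm3\<close>.\<close>

lemma party_power_add:
  "party_power [a, b] \<rho> (n + k) = party_tensor [a ^ n, b ^ n] [a ^ k, b ^ k] (party_power [a, b] \<rho> n) (party_power [a, b] \<rho> k)"
proof (induction n)
  case 0
  show ?case
  proof (rule o2_eqI[of _ "a ^ k" "b ^ k"])
    show "party_power [a, b] \<rho> (0 + k) \<in> sqmat (a ^ k * b ^ k)" by (simp add: party_power_carrier)
    show "party_tensor [a ^ 0, b ^ 0] [a ^ k, b ^ k] (party_power [a, b] \<rho> 0) (party_power [a, b] \<rho> k) \<in> sqmat (a ^ k * b ^ k)"
      using party_tensor2_carrier[of 1 1 "a ^ k" "b ^ k"] by simp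
    fix p q assume "p \<in> ix2 (a ^ k) (b ^ k)" "q \<in> ix2 (a ^ k) (b ^ k)"
    then show "o2 (b ^ k) (party_power [a, b] \<rho> (0 + k)) p q
      = o2 (b ^ k) (party_tensor [a ^ 0, b ^ 0] [a ^ k, b ^ k] (party_power [a, b] \<rho> 0) (party_power [a, b] \<rho> k)) p q"
      using o2_party_tensor[of p 1 "a ^ k" 1 "b ^ k" q "1\<^sub>m 1" "party_power [a, b] \<rho> k"] by (auto simp: o2_def)
  qed
next
  case (Suc n)
  let ?N = "n + k"
  have dm1: "x div c ^ ?N = x div c ^ k div c ^ n" for x c :: nat
    by (simp add: power_add div_mult2_eq mult.commute[of "c ^ n"])
  have dm2: "x mod c ^ ?N div c ^ k = x div c ^ k mod c ^ n" for x c :: nat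
  proof (cases "c ^ k = 0")
    case False
    have "c ^ ?N = c ^ k * c ^ n" by (simp add: power_add mult.commute)
    then have "x mod c ^ ?N = c ^ k * (x div c ^ k mod c ^ n) + x mod c ^ k" by (simp only: mod_mult2_eq)
    then show ?thesis using False by simp
  next
    case True
    then show ?thesis by (simp only: div_by_0 mod_0)
  qed
  have dm3: "x mod c ^ ?N mod c ^ k = x mod c ^ k" for x c :: nat
    by (simp add: mod_mod_cancel le_imp_power_dvd)
  note dm = dm1 dm2 dm3
  show ?case
  proof (rule o2_eqI[of _ "a ^ (Suc n + k)" "b ^ (Suc n + k)"])
    show "party_power [a, b] \<rho> (Suc n + k) \<in> sqmat (a ^ (Suc n + k) * b ^ (Suc n + k))"
      by (rule party_power_carrier)
    show "party_tensor [a ^ Suc n, b ^ Suc n] [a ^ k, b ^ k] (party_power [a, b] \<rho> (Suc n)) (party_power [a, b] \<rho> k)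
      \<in> sqmat (a ^ (Suc n + k) * b ^ (Suc n + k))"
      using party_tensor2_carrier[of "a ^ Suc n" "b ^ Suc n" "a ^ k" "b ^ k"] by (simp only: power_add)
    fix p q assume p: "p \<in> ix2 (a ^ (Suc n + k)) (b ^ (Suc n + k))" and q: "q \<in> ix2 (a ^ (Suc n + k)) (b ^ (Suc n + k))"
    have l: "x div c ^ k < c ^ Suc n \<and> x mod c ^ ?N < c ^ n * c ^ k" if "x < c ^ (Suc n + k)" for x c :: nat
      using that div_less_pair[of x "c ^ Suc n" "c ^ k"] mod_less_pair[of x c "c ^ ?N"] by (simp add: power_add mult.assoc)
    have p1: "(fst p mod a ^ ?N, snd p mod b ^ ?N) \<in> ix2 (a ^ n * a ^ k) (b ^ n * b ^ k)"
      "(fst q mod a ^ ?N, snd q mod b ^ ?N) \<in> ix2 (a ^ n * a ^ k) (b ^ n * b ^ k)"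
      and p2: "(fst p div a ^ k, snd p div b ^ k) \<in> ix2 (a ^ Suc n) (b ^ Suc n)"
      "(fst q div a ^ k, snd q div b ^ k) \<in> ix2 (a ^ Suc n) (b ^ Suc n)"
      using p q l by (auto simp only: mem_Times_iff fst_conv snd_conv lessThan_iff)
    have p3: "p \<in> ix2 (a ^ Suc n * a ^ k) (b ^ Suc n * b ^ k)" "q \<in> ix2 (a ^ Suc n * a ^ k) (b ^ Suc n * b ^ k)"
      using p q by (simp_all only: power_add)
    have "o2 (b ^ (Suc n + k)) (party_power [a, b] \<rho> (Suc n + k)) p q
      = o2 b \<rho> (fst p div a ^ ?N, snd p div b ^ ?N) (fst q div a ^ ?N, snd q div b ^ ?N)
        * o2 (b ^ n * b ^ k) (party_power [a, b] \<rho> ?N) (fst p mod a ^ ?N, snd p mod b ^ ?N) (fst q mod a ^ ?N, snd q mod b ^ ?N)"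
      using o2_party_power_Suc[of p a ?N b q \<rho>] p q by (simp only: add_Suc power_add)
    also have "o2 (b ^ n * b ^ k) (party_power [a, b] \<rho> ?N) (fst p mod a ^ ?N, snd p mod b ^ ?N) (fst q mod a ^ ?N, snd q mod b ^ ?N)
      = o2 (b ^ n) (party_power [a, b] \<rho> n) (fst p div a ^ k mod a ^ n, snd p div b ^ k mod b ^ n) (fst q div a ^ k mod a ^ n, snd q div b ^ k mod b ^ n)
        * o2 (b ^ k) (party_power [a, b] \<rho> k) (fst p mod a ^ k, snd p mod b ^ k) (fst q mod a ^ k, snd q mod b ^ k)"
      unfolding Suc.IH o2_party_tensor[OF p1] fst_conv snd_conv dm ..
    finally show "o2 (b ^ (Suc n + k)) (party_power [a, b] \<rho> (Suc n + k)) p q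
      = o2 (b ^ (Suc n + k)) (party_tensor [a ^ Suc n, b ^ Suc n] [a ^ k, b ^ k] (party_power [a, b] \<rho> (Suc n)) (party_power [a, b] \<rho> k)) p q"
      unfolding power_add[of _ "Suc n" k] o2_party_tensor[OF p3] o2_party_power_Suc[OF p2] fst_conv snd_conv dm by (simp only: mult.assoc)
  qed
qed

text \<open>If a support condition fails, the right side is infinite; otherwise both sides agree by
  \<open>relent_tens\<close>.\<close>

lemma relative_entropy_party_tensor:
  assumes A: "density (a1 * b1) A" "density (a1 * b1) B" and C: "density (a2 * b2) C" "density (a2 * b2) D"
  shows "relative_entropy (a1 * a2 * (b1 * b2)) (party_tensor [a1, b1] [a2, b2] A C) (party_tensor [a1, b1] [a2, b2] B D)
    \<le> relative_entropy (a1 * b1) A B + relative_entropy (a2 * b2) C D"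
proof -
  let ?I = "ix2 a1 b1" and ?J = "ix2 a2 b2" and ?N = "ix2 (a1 * a2) (b1 * b2)"
  let ?h = "\<lambda>p. ((fst p div a2, snd p div b2), (fst p mod a2, snd p mod b2))"
  have psd: "psd (a1 * b1) A" "psd (a1 * b1) B" "psd (a2 * b2) C" "psd (a2 * b2) D" using assms by (auto simp: density_def)
  have psdT: "psd (a1 * a2 * (b1 * b2)) (party_tensor [a1, b1] [a2, b2] A C)" "psd (a1 * a2 * (b1 * b2)) (party_tensor [a1, b1] [a2, b2] B D)"
    using density_party_tensor[of a1 b1 _ a2 b2] assms by (auto simp: density_def)
  show ?thesis
  proof (cases "supp ?I (o2 b1 A) (o2 b1 B) \<and> supp ?J (o2 b2 C) (o2 b2 D)")
    case False
    then show ?thesis using relative_entropy_o2[OF psd(1,2)] relative_entropy_o2[OF psd(3,4)] by auto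
  next
    case True
    then have sp: "supported_pair ?I (o2 b1 A) (o2 b1 B)" "supported_pair ?J (o2 b2 C) (o2 b2 D)"
      using assms by (auto simp: supported_pair_def density_o2)
    have e: "o2 (b1 * b2) (party_tensor [a1, b1] [a2, b2] X Y) p q = tens (o2 b1 X) (o2 b2 Y) (?h p) (?h q)"
      if "p \<in> ?N" "q \<in> ?N" for X Y p q using o2_party_tensor[OF that] by (simp add: tens_def)
    have h: "herm (?I \<times> ?J) (tens (o2 b1 A) (o2 b2 C))" "herm (?I \<times> ?J) (tens (o2 b1 B) (o2 b2 D))"
      using assms by (auto intro!: pos_herm pos_tens simp: density_o2)
    have "relent ?N (o2 (b1 * b2) (party_tensor [a1, b1] [a2, b2] A C)) (o2 (b1 * b2) (party_tensor [a1, b1] [a2, b2] B D))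
      = relent ?N (\<lambda>p q. tens (o2 b1 A) (o2 b2 C) (?h p) (?h q)) (\<lambda>p q. tens (o2 b1 B) (o2 b2 D) (?h p) (?h q))"
      by (rule relent_cong) (rule e; assumption)+
    also have "... = relent (?I \<times> ?J) (tens (o2 b1 A) (o2 b2 C)) (tens (o2 b1 B) (o2 b2 D))"
      by (rule relent_reindex[OF _ bij_divmod2 h]) auto
    also have "... = relent ?I (o2 b1 A) (o2 b1 B) + relent ?J (o2 b2 C) (o2 b2 D)"
      using assms by (intro relent_tens sp) (auto simp: density_o2)
    finally have r: "relent ?N (o2 (b1 * b2) (party_tensor [a1, b1] [a2, b2] A C)) (o2 (b1 * b2) (party_tensor [a1, b1] [a2, b2] B D))
      = relent ?I (o2 b1 A) (o2 b1 B) + relent ?J (o2 b2 C) (o2 b2 D)" .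
    have "supp ?N (\<lambda>p q. tens (o2 b1 A) (o2 b2 C) (?h p) (?h q)) (\<lambda>p q. tens (o2 b1 B) (o2 b2 D) (?h p) (?h q))"
      unfolding supp_reindex[OF bij_divmod2] using supported_tens(1)[OF sp] by (simp add: supported_pair_def)
    moreover have "quad ?N (\<lambda>p q. tens (o2 b1 X) (o2 b2 Y) (?h p) (?h q)) f = quad ?N (o2 (b1 * b2) (party_tensor [a1, b1] [a2, b2] X Y)) f" for X Y f
      by (rule quad_cong) (simp_all add: e)
    ultimately have "supp ?N (o2 (b1 * b2) (party_tensor [a1, b1] [a2, b2] A C)) (o2 (b1 * b2) (party_tensor [a1, b1] [a2, b2] B D))"
      by (simp add: supp_def)
    then show ?thesis
      unfolding relative_entropy_o2[OF psdT] relative_entropy_o2[OF psd(1,2)] relative_entropy_o2[OF psd(3,4)] using True r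
      by (simp add: add_divide_distrib)
  qed
qed

lemma relative_entropy_nonneg:
  assumes A: "density (a * b) A" and B: "density (a * b) B"
  shows "0 \<le> relative_entropy (a * b) A B"
proof -
  let ?I = "ix2 a b"
  have "0 \<le> relent ?I (o2 b A) (o2 b B)" if "supp ?I (o2 b A) (o2 b B)"
  proof -
    have "supported_pair ?I (o2 b A) (o2 b B)" using A B that by (auto simp: supported_pair_def density_o2)
    \<comment> \<open>The test that never accepts, with both slopes 1, leaves the difference of the
      traces as lower bound.\<close>
    from relent_ge_proj[OF this, of "\<lambda>_ _. 0" 1 1] show ?thesis
      using A B by (simp add: proj_def herm_def trp_def density_o2)
  qed
  then show ?thesis using A B by (simp add: relative_entropy_o2 density_def)
qed

lemma rel_ent_entanglement_nonneg: "density (a * b) \<rho> \<Longrightarrow> 0 \<le> rel_ent_entanglement a b \<rho>"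
  unfolding rel_ent_entanglement_def
  by (intro INF_greatest relative_entropy_nonneg) (auto dest: separable_o2)

lemma density_maximally_mixed:
  assumes "0 < n" shows "density n (complex_of_real (1 / n) \<cdot>\<^sub>m 1\<^sub>m n)"
proof -
  have "spec {..<n} (\<lambda>_. 1 / n) (\<lambda>k x. if x = k then 1 else 0) (fn (complex_of_real (1 / n) \<cdot>\<^sub>m 1\<^sub>m n))"
    by (auto simp: spec_def onb_def inn_def fn_def if_distrib cong: if_cong)
  then have "pos {..<n} (fn (complex_of_real (1 / n) \<cdot>\<^sub>m 1\<^sub>m n))"
    by (rule pos_specI) auto
  then show ?thesis using assms by (simp add: density_fn tr_def fn_def)
qed

text \<open>The maximally mixed state is separable and has trivial kernel, so the relative entropy
  to it is finite.\<close>

lemma rel_ent_entanglement_finite: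
  assumes \<rho>: "density (a * b) \<rho>"
  shows "rel_ent_entanglement a b \<rho> < \<infinity>"
proof -
  have "tr {..<a * b} (fn \<rho>) = 1" using \<rho> by (simp add: density_fn)
  then have ab: "0 < a" "0 < b" by (auto simp: tr_def intro!: Nat.gr0I)
  let ?J = "\<lambda>n. complex_of_real (1 / real n) \<cdot>\<^sub>m 1\<^sub>m n"
  let ?\<sigma> = "mat_sum (a * b) (\<lambda>k. complex_of_real 1 \<cdot>\<^sub>m kron (?J a) (?J b)) {..<1::nat}"
  have s: "separable a b ?\<sigma>"
    unfolding separable_def
    by (rule exI[of _ "1::nat"], rule exI[of _ "\<lambda>_. 1"], rule exI[of _ "\<lambda>_. ?J a"], rule exI[of _ "\<lambda>_. ?J b"])
       (use density_maximally_mixed[OF ab(1)] density_maximally_mixed[OF ab(2)] in auto)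
  have e: "o2 b ?\<sigma> p q = (if p = q then of_real (1 / (a * b)) else 0)" if "p \<in> ix2 a b" "q \<in> ix2 a b" for p q
  proof -
    have "o2 b ?\<sigma> p q = kron (?J a) (?J b) $$ (fst p * b + snd p, fst q * b + snd q)"
      unfolding o2_def using that kron_carrier[of "?J a" a a "?J b" b b]
      by (subst mat_sum_index) (auto simp: pair_less)
    also have "... = ?J a $$ (fst p, fst q) * ?J b $$ (snd p, snd q)"
      using that by (intro kron_index) auto
    also have "... = (if p = q then of_real (1 / (a * b)) else 0)"
      using that by (auto simp: prod_eq_iff)
    finally show ?thesis .
  qed
  have "supp (ix2 a b) (o2 b \<rho>) (o2 b ?\<sigma>)"
    unfolding supp_def
  proof (intro allI impI)
    fix f assume "quad (ix2 a b) (o2 b ?\<sigma>) f = 0"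
    moreover have "quad (ix2 a b) (o2 b ?\<sigma>) f = (\<Sum>p\<in>ix2 a b. \<Sum>q\<in>ix2 a b. if p = q then of_real (1 / (a * b)) * (cnj (f p) * f p) else 0)"
      unfolding quad_def by (intro sum.cong refl) (simp only: e if_distrib mult_ac, simp)
    ultimately have "(\<Sum>p\<in>ix2 a b. of_real (1 / (a * b)) * (cnj (f p) * f p)) = 0" by simp
    then have "of_real (\<Sum>p\<in>ix2 a b. 1 / (a * b) * (cmod (f p))\<^sup>2) = (0::complex)"
      by (simp add: complex_norm_square mult.commute del: mem_Times_iff flip: of_real_power)
    then have "(\<Sum>p\<in>ix2 a b. 1 / (a * b) * (cmod (f p))\<^sup>2) = 0" by (simp only: of_real_eq_0_iff)
    then have "\<forall>p\<in>ix2 a b. 1 / (a * b) * (cmod (f p))\<^sup>2 = 0" by (subst (asm) sum_nonneg_eq_0_iff) auto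
    then have "\<forall>p\<in>ix2 a b. f p = 0" using ab by auto
    then have "quad (ix2 a b) (o2 b \<rho>) f = quad (ix2 a b) (o2 b \<rho>) (\<lambda>_. 0)" by (intro quad_cong) blast+
    then show "quad (ix2 a b) (o2 b \<rho>) f = 0" by (simp add: quad_def)
  qed
  then have "relative_entropy (a * b) \<rho> ?\<sigma> < \<infinity>"
    using \<rho> separable_o2(1)[OF s] by (simp add: relative_entropy_o2 density_def)
  then show ?thesis unfolding rel_ent_entanglement_def unfolding INF_less_iff using s by blast
qed

lemma rel_ent_entanglement_subadditive:
  assumes "density (a1 * b1) \<rho>" "density (a2 * b2) \<rho>'"
  shows "rel_ent_entanglement (a1 * a2) (b1 * b2) (party_tensor [a1, b1] [a2, b2] \<rho> \<rho>')
    \<le> rel_ent_entanglement a1 b1 \<rho> + rel_ent_entanglement a2 b2 \<rho>'"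
proof (rule ereal_le_epsilon2)
  fix \<epsilon> :: real assume \<epsilon>: "0 < \<epsilon>"
  have "\<exists>\<sigma>. separable a b \<sigma> \<and> relative_entropy (a * b) \<rho> \<sigma> \<le> rel_ent_entanglement a b \<rho> + ereal (\<epsilon> / 2)"
    if "density (a * b) \<rho>" for a b \<rho>
  proof -
    have "rel_ent_entanglement a b \<rho> < rel_ent_entanglement a b \<rho> + ereal (\<epsilon> / 2)"
      using rel_ent_entanglement_nonneg[OF that] rel_ent_entanglement_finite[OF that] \<epsilon>
      by (cases "rel_ent_entanglement a b \<rho>") auto
    then obtain \<sigma> where "separable a b \<sigma>" "relative_entropy (a * b) \<rho> \<sigma> < rel_ent_entanglement a b \<rho> + ereal (\<epsilon> / 2)"
      unfolding rel_ent_entanglement_def[of a b \<rho>] INF_less_iff by auto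
    then show ?thesis by auto
  qed
  from this[OF assms(1)] this[OF assms(2)] obtain \<sigma> \<sigma>' where s: "separable a1 b1 \<sigma>" "separable a2 b2 \<sigma>'"
    and le: "relative_entropy (a1 * b1) \<rho> \<sigma> \<le> rel_ent_entanglement a1 b1 \<rho> + ereal (\<epsilon> / 2)"
      "relative_entropy (a2 * b2) \<rho>' \<sigma>' \<le> rel_ent_entanglement a2 b2 \<rho>' + ereal (\<epsilon> / 2)" by blast
  have "rel_ent_entanglement (a1 * a2) (b1 * b2) (party_tensor [a1, b1] [a2, b2] \<rho> \<rho>')
    \<le> relative_entropy (a1 * a2 * (b1 * b2)) (party_tensor [a1, b1] [a2, b2] \<rho> \<rho>') (party_tensor [a1, b1] [a2, b2] \<sigma> \<sigma>')"
    unfolding rel_ent_entanglement_def using separable_party_tensor[OF s] by (intro INF_lower) simp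
  also have "... \<le> relative_entropy (a1 * b1) \<rho> \<sigma> + relative_entropy (a2 * b2) \<rho>' \<sigma>'"
    by (rule relative_entropy_party_tensor) (use assms s in \<open>auto dest: separable_o2\<close>)
  also have "... \<le> (rel_ent_entanglement a1 b1 \<rho> + ereal (\<epsilon> / 2)) + (rel_ent_entanglement a2 b2 \<rho>' + ereal (\<epsilon> / 2))"
    by (rule add_mono[OF le])
  also have "... = rel_ent_entanglement a1 b1 \<rho> + rel_ent_entanglement a2 b2 \<rho>' + (ereal (\<epsilon> / 2) + ereal (\<epsilon> / 2))"
    by (simp only: ac_simps)
  finally show "rel_ent_entanglement (a1 * a2) (b1 * b2) (party_tensor [a1, b1] [a2, b2] \<rho> \<rho>')
    \<le> rel_ent_entanglement a1 b1 \<rho> + rel_ent_entanglement a2 b2 \<rho>' + ereal \<epsilon>" by simp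
qed

text \<open>Fekete's lemma: the limit is the infimum over \<open>n \<ge> 1\<close>. It ensures that
  the \<open>lim\<close> in the regularised measure is an actual limit.\<close>

lemma subadditive_convergent:
  fixes e :: "nat \<Rightarrow> real"
  assumes e0: "\<And>n. 0 \<le> e n" and sub: "\<And>n k. e (n + k) \<le> e n + e k"
  shows "\<exists>L\<ge>0. (\<lambda>n. e n / n) \<longlonglongrightarrow> L"
proof -
  define L where "L = (INF n\<in>{1..}. e n / real n)"
  have bdd: "bdd_below ((\<lambda>n. e n / real n) ` {1..})" using e0 by (intro bdd_belowI2[of _ 0]) auto
  have L: "L \<le> e n / n" if "1 \<le> n" for n unfolding L_def using that by (intro cINF_lower[OF bdd]) auto
  have L0: "0 \<le> L" unfolding L_def using e0 by (intro cINF_greatest) auto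
  have lin: "e r \<le> r * e 1 + e 0" for r
  proof (induction r)
    case (Suc r)
    then show ?case using sub[of r 1] by (simp add: algebra_simps)
  qed simp
  have mul: "e (q * N + r) \<le> q * e N + e r" for q N r
  proof (induction q)
    case (Suc q)
    then show ?case using sub[of N "q * N + r"] by (simp add: algebra_simps)
  qed simp
  have "(\<lambda>n. e n / n) \<longlonglongrightarrow> L"
  proof (rule LIMSEQ_I)
    fix \<epsilon> :: real assume \<epsilon>: "0 < \<epsilon>"
    have "L < L + \<epsilon> / 2" using \<epsilon> by simp
    then obtain N where N: "1 \<le> N" "e N / N < L + \<epsilon> / 2"
      unfolding L_def by (subst (asm) cINF_less_iff[OF _ bdd]) auto
    \<comment> \<open>A bound on \<open>e (n mod N)\<close> that is uniform in \<open>n\<close>. It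
      contains \<open>e 0\<close>, for which subadditivity gives no upper bound.\<close>
    define C where "C = N * e 1 + e 0"
    have C: "0 \<le> C" using e0 by (simp add: C_def)
    obtain M :: nat where M: "2 * C / \<epsilon> < M" using reals_Archimedean2 by blast
    have "norm (e n / n - L) < \<epsilon>" if n: "Suc M \<le> n" for n
    proof -
      have n0: "0 < real n" using n by simp
      have "e n = e (n div N * N + n mod N)" by simp
      also have "... \<le> real (n div N) * e N + e (n mod N)" by (rule mul)
      also have "... \<le> real (n div N) * e N + C"
      proof -
        have "real (n mod N) * e 1 \<le> N * e 1" using N e0 by (intro mult_right_mono) (auto intro: less_imp_le)
        then show ?thesis using lin[of "n mod N"] by (simp add: C_def)
      qed
      also have "real (n div N) * e N = real (n div N * N) * (e N / N)" using N by simp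
      also have "... \<le> n * (e N / N)" using e0 by (intro mult_right_mono) (auto simp del: of_nat_mult)
      also have "... \<le> n * (L + \<epsilon> / 2)" using N by (intro mult_left_mono) auto
      finally have "e n / n \<le> (n * (L + \<epsilon> / 2) + C) / n" using n0 by (intro divide_right_mono) auto
      also have "... = L + \<epsilon> / 2 + C / n" using n0 by (simp add: field_simps)
      also have "C / n < \<epsilon> / 2"
      proof -
        have "2 * C / \<epsilon> < n" using M n by simp
        then have "2 * C < n * \<epsilon>" using \<epsilon> by (simp add: field_simps)
        then show ?thesis using n0 by (simp add: field_simps)
      qed
      finally have "e n / n < L + \<epsilon>" by simp
      moreover have "L \<le> e n / n" using n by (intro L) simp
      ultimately show ?thesis by simp
    qed
    then show "\<exists>no. \<forall>n\<ge>no. norm (e n / n - L) < \<epsilon>" by blast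
  qed
  then show ?thesis using L0 by blast
qed

section \<open>Converse bounds on rates\<close>

text \<open>For fixed \<epsilon> with \<open>c * \<epsilon> < 1\<close>, dividing by
  \<open>n (1 - c \<epsilon>)\<close> makes the constant \<open>d\<close> vanish in the limit;
  letting \<epsilon> tend to 0 then removes the factor \<open>1 - c \<epsilon>\<close>.\<close>

lemma asymptotic_rate_le:
  fixes g :: "nat \<Rightarrow> real" and d :: real
  assumes bound: "\<And>\<epsilon> n m. \<lbrakk>0 < \<epsilon>; 1 \<le> n; achievable \<epsilon> n m\<rbrakk> \<Longrightarrow> (1 - c * \<epsilon>) * m \<le> n * g n + d"
    and c: "0 < c" and g: "g \<longlonglongrightarrow> G"
  shows "asymptotic_rate achievable \<le> ereal G"
proof -
  have le: "asymptotic_rate achievable \<le> ereal (G / (1 - c * \<epsilon>))" if \<epsilon>: "0 < \<epsilon>" "c * \<epsilon> < 1" for \<epsilon>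
  proof -
    have "asymptotic_rate achievable \<le> limsup (\<lambda>n. SUP m\<in>{m. achievable \<epsilon> n m}. ereal (real m / real n))"
      unfolding asymptotic_rate_def using \<epsilon> by (intro INF_lower) simp
    also have "... \<le> limsup (\<lambda>n. ereal ((g n + d / n) / (1 - c * \<epsilon>)))"
    proof (rule Limsup_mono, rule eventually_sequentiallyI[of 1], rule SUP_least)
      fix n m assume n: "1 \<le> n" and "m \<in> {m. achievable \<epsilon> n m}"
      then have "(1 - c * \<epsilon>) * m \<le> n * g n + d" using bound \<epsilon> by simp
      then have "real m / real n \<le> (n * g n + d) / (1 - c * \<epsilon>) / n"
        using n \<epsilon> by (intro divide_right_mono) (simp_all add: pos_le_divide_eq mult.commute)
      also have "... = (g n + d / n) / (1 - c * \<epsilon>)" using n by (simp add: add_divide_distrib)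
      finally have "real m / real n \<le> (g n + d / n) / (1 - c * \<epsilon>)" .
      then show "ereal (real m / real n) \<le> ereal ((g n + d / n) / (1 - c * \<epsilon>))" by simp
    qed
    also have "... = ereal (G / (1 - c * \<epsilon>))"
    proof (rule lim_imp_Limsup)
      have "(\<lambda>n. (g n + d / n) / (1 - c * \<epsilon>)) \<longlonglongrightarrow> (G + 0) / (1 - c * \<epsilon>)"
        using \<epsilon> by (intro tendsto_intros g lim_const_over_n) auto
      then show "(\<lambda>n. ereal ((g n + d / n) / (1 - c * \<epsilon>))) \<longlonglongrightarrow> ereal (G / (1 - c * \<epsilon>))" by simp
    qed simp
    finally show ?thesis .
  qed
  \<comment> \<open>Chosen such that \<open>c * \<epsilon> k = 1 / (k + 2)\<close>, below 1 from the
    start and tending to 0.\<close>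
  define \<epsilon> where "\<epsilon> k = 1 / c / (real k + 2)" for k :: nat
  have ce: "c * \<epsilon> k = 1 / (real k + 2)" for k using c by (simp add: \<epsilon>_def)
  have "(\<lambda>k. G / (1 - 1 / (real (k + 2)))) \<longlonglongrightarrow> G / (1 - 0)"
    by (intro tendsto_intros LIMSEQ_ignore_initial_segment[OF lim_const_over_n]) auto
  then have lim: "(\<lambda>k. ereal (G / (1 - c * \<epsilon> k))) \<longlonglongrightarrow> ereal G" by (simp add: ce add.commute)
  have "asymptotic_rate achievable \<le> ereal (G / (1 - c * \<epsilon> k))" for k
    by (rule le) (use c in \<open>simp_all add: ce\<close>, simp_all add: \<epsilon>_def)
  then show ?thesis by (intro LIMSEQ_le_const[OF lim] exI[of _ 0]) blast
qed

theorem distillable_key_le_reg_rel_ent_entanglement: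
  assumes \<rho>: "density (a * b) \<rho>"
  shows "distillable_key a b \<rho> \<le> reg_rel_ent_entanglement a b \<rho>"
proof -
  let ?\<rho> = "party_power [a, b] \<rho>"
  define E where "E n = rel_ent_entanglement (a ^ n) (b ^ n) (?\<rho> n)" for n
  define e where "e n = real_of_ereal (E n)" for n
  have E: "E n = ereal (e n)" "0 \<le> e n" for n
    using rel_ent_entanglement_nonneg[OF density_power[OF \<rho>]] rel_ent_entanglement_finite[OF density_power[OF \<rho>]]
    by (auto simp: e_def E_def ereal_real real_of_ereal_pos)
  have "E (n + k) \<le> E n + E k" for n k
    unfolding E_def party_power_add power_add
    by (intro rel_ent_entanglement_subadditive density_power \<rho>)
  then have "e (n + k) \<le> e n + e k" for n k by (simp add: E)
  from subadditive_convergent[OF E(2) this] obtain L where L: "(\<lambda>n. e n / n) \<longlonglongrightarrow> L" by blast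
  have "(\<lambda>n. ereal (1 / real n) * E n) \<longlonglongrightarrow> ereal L" using L by (simp add: E)
  then have "reg_rel_ent_entanglement a b \<rho> = ereal L"
    unfolding reg_rel_ent_entanglement_def E_def by (rule limI)
  moreover have "distillable_key a b \<rho> \<le> ereal L"
    unfolding distillable_key_def
  \<comment> \<open>In bits \<open>key_le_relent\<close> reads
    \<open>(1 - \<epsilon>) m - 1\<close>, the same for every separable state, so the infimum over
    these keeps it.\<close>
  proof (rule asymptotic_rate_le[where c = 1 and d = 1, OF _ _ L])
    fix \<epsilon> :: real and n m :: nat assume n: "1 \<le> n" and "\<exists>\<Lambda> a' b' \<gamma>. locc [a ^ n, b ^ n] [2 ^ m * a', 2 ^ m * b'] \<Lambda> \<and>
      private_state m a' b' \<gamma> \<and> trace_norm (\<Lambda> (?\<rho> n) - \<gamma>) \<le> \<epsilon>"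
    then obtain \<Lambda> a' b' \<gamma> where l: "locc [a ^ n, b ^ n] [2 ^ m * a', 2 ^ m * b'] \<Lambda>" "private_state m a' b' \<gamma>" "trace_norm (\<Lambda> (?\<rho> n) - \<gamma>) \<le> \<epsilon>"
      by blast
    have "ereal ((1 - \<epsilon>) * m - 1) \<le> E n"
      unfolding E_def rel_ent_entanglement_def
    proof (rule INF_greatest)
      fix \<sigma> assume "\<sigma> \<in> {\<sigma>. separable (a ^ n) (b ^ n) \<sigma>}"
      then have \<sigma>: "density (a ^ n * b ^ n) \<sigma>" "sep {..<a ^ n} {..<b ^ n} (o2 (b ^ n) \<sigma>)" by (auto dest: separable_o2)
      have \<rho>n: "density (a ^ n * b ^ n) (?\<rho> n)" by (rule density_power[OF \<rho>])
      have "(1 - \<epsilon>) * m - 1 \<le> relent (ix2 (a ^ n) (b ^ n)) (o2 (b ^ n) (?\<rho> n)) (o2 (b ^ n) \<sigma>) / ln 2"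
        if "supp (ix2 (a ^ n) (b ^ n)) (o2 (b ^ n) (?\<rho> n)) (o2 (b ^ n) \<sigma>)"
      proof -
        have sp: "supported_pair (ix2 (a ^ n) (b ^ n)) (o2 (b ^ n) (?\<rho> n)) (o2 (b ^ n) \<sigma>)"
          using that \<rho>n \<sigma>(1) by (auto simp: supported_pair_def density_o2)
        have "Re (tr (ix2 (a ^ n) (b ^ n)) (o2 (b ^ n) \<sigma>)) = 1" using \<sigma>(1) by (simp add: density_o2)
        from key_le_relent[OF l party_power_carrier _ sp \<sigma>(2) this] show ?thesis
          using \<rho>n by (simp add: density_def field_simps)
      qed
      then show "ereal ((1 - \<epsilon>) * m - 1) \<le> relative_entropy (a ^ n * b ^ n) (?\<rho> n) \<sigma>"
        using \<rho>n \<sigma>(1) by (simp add: relative_entropy_o2 density_def)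
    qed
    then show "(1 - 1 * \<epsilon>) * m \<le> n * (e n / n) + 1" using n by (simp add: E)
  qed simp
  ultimately show ?thesis by simp
qed

section \<open>Partial traces and entropies of tripartite matrices\<close>

lemma o2_ptrace2:
  assumes "p \<in> ix2 a b" "q \<in> ix2 a b"
  shows "o2 b (ptrace [a, b, e] 2 \<tau>) p q = trE e (o3 b e \<tau>) p q"
proof -
  have "fst p * b + snd p < a * b" "fst q * b + snd q < a * b" using assms by (auto intro: pair_less)
  then show ?thesis using assms
    by (auto simp: o2_def ptrace_def Let_def trE_def o3_def numeral_2_eq_2 add_mult_distrib mult.assoc add.assoc)
qed

lemma o2_ptrace1:
  assumes "p \<in> ix2 a e" "q \<in> ix2 a e"
  shows "o2 e (ptrace [a, b, e] 1 \<tau>) p q = ptr1 {..<b} (swap12 (o3 b e \<tau>)) p q"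
proof -
  have "fst p * e + snd p < a * e" "fst q * e + snd q < a * e" using assms by (auto intro: pair_less)
  then show ?thesis using assms
    by (auto simp: o2_def ptrace_def Let_def ptr1_def swap12_def o3_def add_mult_distrib mult.assoc add.assoc)
qed

lemma o2_ptrace0:
  assumes "p \<in> ix2 b e" "q \<in> ix2 b e"
  shows "o2 e (ptrace [a, b, e] 0 \<tau>) p q = ptr1 {..<a} (o3 b e \<tau>) p q"
proof -
  have "fst p * e + snd p < b * e" "fst q * e + snd q < b * e" using assms by (auto intro: pair_less)
  then show ?thesis using assms
    by (auto simp: o2_def ptrace_def Let_def ptr1_def o3_def add_mult_distrib mult.assoc add.assoc)
qed

lemma fn_ptrace0: "\<lbrakk>i < e; j < e\<rbrakk> \<Longrightarrow> fn (ptrace [b, e] 0 Y) i j = ptr1 {..<b} (o2 e Y) i j"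
  by (simp add: fn_def ptrace_def Let_def ptr1_def o2_def)

lemma vn_entropy_o2:
  assumes X: "X \<in> sqmat (a * b)" and p: "pos (ix2 a b) T"
    and e: "\<And>p q. p \<in> ix2 a b \<Longrightarrow> q \<in> ix2 a b \<Longrightarrow> o2 b X p q = T p q"
  shows "vn_entropy X = ent (ix2 a b) T / ln 2"
proof -
  have "pos (ix2 a b) (o2 b X)" using p pos_cong[of "ix2 a b" "o2 b X" T] e by simp
  then have h: "herm {..<a * b} (fn X)" by (intro pos_herm pos_fn_o2) auto
  have "ent (ix2 a b) T = ent (ix2 a b) (\<lambda>x y. fn X (fst x * b + snd x) (fst y * b + snd y))"
    by (rule ent_cong) (simp add: fn_def flip: e, simp add: o2_def)
  also have "... = ent {..<a * b} (fn X)" by (rule ent_reindex[OF _ bij_pair h]) simp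
  finally show ?thesis using vn_entropy_ent[OF X h] by simp
qed

lemma cond_mutual_info_cmi:
  assumes \<tau>: "density (a * b * e) \<tau>"
  shows "pos (ix3 a b e) (o3 b e \<tau>)"
    and "cond_mutual_info a b e \<tau> = cmin a b e (o3 b e \<tau>) / ln 2"
proof -
  have c: "\<tau> \<in> sqmat (a * b * e)" and p: "pos {..<a * b * e} (fn \<tau>)" using \<tau> by (auto simp: density_fn)
  show P: "pos (ix3 a b e) (o3 b e \<tau>)" by (rule pos_o3[OF p])
  have S: "pos (ix3 b a e) (swap12 (o3 b e \<tau>))" by (rule pos_swap12[OF P])
  have P0: "pos (ix2 b e) (ptr1 {..<a} (o3 b e \<tau>))" by (rule pos_ptr1[OF _ P]) simp
  have P1: "pos (ix2 a e) (ptr1 {..<b} (swap12 (o3 b e \<tau>)))" by (rule pos_ptr1[OF _ S]) simp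
  have P2: "pos {..<e} (ptr1 {..<b} (ptr1 {..<a} (o3 b e \<tau>)))" by (rule pos_ptr1[OF _ P0]) simp
  have h: "herm {..<a * b * e} (fn \<tau>)" by (rule pos_herm[OF _ p]) simp
  have "vn_entropy \<tau> = ent {..<a * b * e} (fn \<tau>) / ln 2" by (rule vn_entropy_ent[OF c h])
  also have "ent {..<a * b * e} (fn \<tau>) = ent (ix3 a b e) (o3 b e \<tau>)"
    using ent_reindex[OF _ bij_triple[of b e a] h] by (simp add: o3_def[abs_def] fn_def)
  finally have v: "vn_entropy \<tau> = ent (ix3 a b e) (o3 b e \<tau>) / ln 2" .
  have v1: "vn_entropy (ptrace [a, b, e] 1 \<tau>) = ent (ix2 a e) (ptr1 {..<b} (swap12 (o3 b e \<tau>))) / ln 2"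
    by (rule vn_entropy_o2[OF _ P1 o2_ptrace1]) (auto simp: ptrace_def Let_def)
  have v0: "vn_entropy (ptrace [a, b, e] 0 \<tau>) = ent (ix2 b e) (ptr1 {..<a} (o3 b e \<tau>)) / ln 2"
    by (rule vn_entropy_o2[OF _ P0 o2_ptrace0]) (auto simp: ptrace_def Let_def)
  have f: "fn (ptrace [b, e] 0 (ptrace [a, b, e] 0 \<tau>)) i j = ptr1 {..<b} (ptr1 {..<a} (o3 b e \<tau>)) i j" if "i < e" "j < e" for i j
    unfolding fn_ptrace0[OF that] ptr1_def[of "{..<b}"] using that by (intro sum.cong refl o2_ptrace0) auto
  have "vn_entropy (ptrace [b, e] 0 (ptrace [a, b, e] 0 \<tau>)) = ent {..<e} (fn (ptrace [b, e] 0 (ptrace [a, b, e] 0 \<tau>))) / ln 2"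
  proof (rule vn_entropy_ent)
    show "ptrace [b, e] 0 (ptrace [a, b, e] 0 \<tau>) \<in> sqmat e" by (simp add: ptrace_def Let_def)
    show "herm {..<e} (fn (ptrace [b, e] 0 (ptrace [a, b, e] 0 \<tau>)))"
      by (rule herm_cong[OF _ pos_herm[OF _ P2]]) (simp_all add: f)
  qed
  also have "ent {..<e} (fn (ptrace [b, e] 0 (ptrace [a, b, e] 0 \<tau>))) = ent {..<e} (ptr1 {..<b} (ptr1 {..<a} (o3 b e \<tau>)))"
    by (rule ent_cong) (simp add: f)
  finally show "cond_mutual_info a b e \<tau> = cmin a b e (o3 b e \<tau>) / ln 2"
    unfolding cond_mutual_info_def cmi_def v v0 v1 by (simp add: diff_divide_distrib add_divide_distrib)
qed

text \<open>Every extension gives a bound of its own through its tensor powers; by additivity the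
  bound per copy does not depend on the number of copies, so the limit is immediate.\<close>

theorem distillable_key_le_squashed_entanglement:
  assumes \<rho>: "density (a * b) \<rho>"
  shows "distillable_key a b \<rho> \<le> squashed_entanglement a b \<rho>"
  unfolding squashed_entanglement_def
proof (rule INF_greatest, clarify)
  fix e \<tau> assume \<tau>: "density (a * b * e) \<tau>" and \<rho>\<tau>: "\<rho> = ptrace [a, b, e] 2 \<tau>"
  let ?t = "o3 b e \<tau>" and ?\<rho> = "party_power [a, b] \<rho>"
  let ?c = "cmin a b e ?t"
  have P: "pos (ix3 a b e) ?t" by (rule cond_mutual_info_cmi(1)[OF \<tau>])
  have "tr (ix3 a b e) ?t = tr (ix2 a b) (o2 b \<rho>)"
    by (simp add: tr_def sum_Times \<rho>\<tau> o2_ptrace2 trE_def)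
  then have t1: "Re (tr (ix3 a b e) ?t) = 1" using \<rho> by (simp add: density_o2)
  note xp = ext_power[OF P t1]
  have "distillable_key a b \<rho> \<le> ereal (?c / (2 * ln 2))"
    unfolding distillable_key_def
  \<comment> \<open>\<open>key_le_cmi\<close> divided by \<open>2 ln 2\<close>: the slack 4 becomes
    \<open>d = 2\<close>, and the factor \<open>1 - 2 \<epsilon>\<close> there gives
    \<open>c = 2\<close>.\<close>
  proof (rule asymptotic_rate_le[where c = 2 and d = 2 and g = "\<lambda>_. ?c / (2 * ln 2)"])
    fix \<epsilon> :: real and n m :: nat assume n: "1 \<le> n" and "\<exists>\<Lambda> a' b' \<gamma>. locc [a ^ n, b ^ n] [2 ^ m * a', 2 ^ m * b'] \<Lambda> \<and>
      private_state m a' b' \<gamma> \<and> trace_norm (\<Lambda> (?\<rho> n) - \<gamma>) \<le> \<epsilon>"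
    then obtain \<Lambda> a' b' \<gamma> where l: "locc [a ^ n, b ^ n] [2 ^ m * a', 2 ^ m * b'] \<Lambda>" "private_state m a' b' \<gamma>" "trace_norm (\<Lambda> (?\<rho> n) - \<gamma>) \<le> \<epsilon>"
      by blast
    have \<rho>n: "density (a ^ n * b ^ n) (?\<rho> n)" by (rule density_power[OF \<rho>])
    have "(2 * (1 - 2 * \<epsilon>) * m - 4) * ln 2 \<le> cmin (a ^ n) (b ^ n) (e ^ n) (ext_power a b e ?t n)"
    proof (rule key_le_cmi[OF l party_power_carrier])
      show "mat_trace (?\<rho> n) = 1" using \<rho>n by (simp add: density_def)
      show "pos (ix3 (a ^ n) (b ^ n) (e ^ n)) (ext_power a b e ?t n)" using xp by blast
      fix p q assume pq: "p \<in> ix2 (a ^ n) (b ^ n)" "q \<in> ix2 (a ^ n) (b ^ n)"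
      show "o2 (b ^ n) (?\<rho> n) p q = trE (e ^ n) (ext_power a b e ?t n) p q"
        by (rule trE_ext_power[OF _ pq, symmetric]) (simp add: \<rho>\<tau> o2_ptrace2)
    qed
    also have "... = n * ?c" using xp by blast
    finally show "(1 - 2 * \<epsilon>) * real m \<le> n * (?c / (2 * ln 2)) + 2" by (simp add: field_simps)
  qed auto
  then show "distillable_key a b (ptrace [a, b, e] 2 \<tau>) \<le> ereal (1 / 2 * cond_mutual_info a b e \<tau>)"
    by (simp add: cond_mutual_info_cmi(2)[OF \<tau>] \<rho>\<tau>)
qed

section \<open>Key repeaters\<close>

lemma o3_eqI:
  assumes "X \<in> sqmat (a * b * c)" "Y \<in> sqmat (a * b * c)"
    and "\<And>x y z x' y' z'. \<lbrakk>x < a; y < b; z < c; x' < a; y' < b; z' < c\<rbrakk> \<Longrightarrow> o3 b c X (x, y, z) (x', y', z') = o3 b c Y (x, y, z) (x', y', z')"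
  shows "X = Y"
proof (rule eq_matI)
  fix i j assume "i < dim_row Y" "j < dim_col Y"
  then have ij: "i < a * b * c" "j < a * b * c" using assms(2) by auto
  have "o3 b c X (i div c div b, i div c mod b, i mod c) (j div c div b, j div c mod b, j mod c)
    = o3 b c Y (i div c div b, i div c mod b, i mod c) (j div c div b, j div c mod b, j mod c)"
    using ij by (intro assms(3) div_less_pair mod_less_pair[of _ a b] mod_less_pair[of _ "a * b" c]) (auto simp: div_less_pair)
  then show "X $$ (i, j) = Y $$ (i, j)" by (simp add: o3_def)
qed (use assms in auto)

section \<open>Kronecker products with identities\<close>

lemma kron_one_right: "kron M (1\<^sub>m 1) = M"
  by (rule eq_matI) (auto simp: kron_def)

lemma kron_one_one: "kron (1\<^sub>m a) (1\<^sub>m b) = 1\<^sub>m (a * b)"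
proof (rule eq_matI)
  fix i j assume "i < dim_row (1\<^sub>m (a * b))" "j < dim_col (1\<^sub>m (a * b))"
  then show "kron (1\<^sub>m a) (1\<^sub>m b) $$ (i, j) = 1\<^sub>m (a * b) $$ (i, j)"
    by (auto simp: kron_def div_less_pair mod_less_pair) (metis div_mult_mod_eq)
qed (simp_all add: kron_def)

lemma kron_assoc: "kron (kron A B) C = kron A (kron B C)"
proof (rule eq_matI)
  have l: "i mod (b * c) < b * c" if "i < a * (b * c)" for i a b c :: nat using mod_less_pair[OF that] .
  have d: "i mod (b * c) div c = i div c mod b" if "i < a * (b * c)" for i a b c :: nat
    using that by (cases "c = 0") (simp_all add: mod_mult2_eq[of i c b, unfolded mult.commute[of c b]])
  fix i j assume "i < dim_row (kron A (kron B C))" "j < dim_col (kron A (kron B C))"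
  then have "i < dim_row A * (dim_row B * dim_row C)" "j < dim_col A * (dim_col B * dim_col C)" by (simp_all add: kron_def)
  moreover have "i mod (b * c) mod c = i mod c" for i b c :: nat by (rule mod_mod_cancel) simp
  ultimately show "kron (kron A B) C $$ (i, j) = kron A (kron B C) $$ (i, j)"
    by (simp add: kron_def l d div_less_pair mult.assoc div_mult2_eq[of _ "dim_row C", symmetric] div_mult2_eq[of _ "dim_col C", symmetric] mult.commute[of "dim_row C"] mult.commute[of "dim_col C"])
qed (simp_all add: kron_def mult.assoc)

section \<open>Measurements, their conjugates and their extensions by an identity\<close>

lemma kraus_complete:
  assumes K: "\<And>k. k < r \<Longrightarrow> K k \<in> carrier_mat (e k) d"
    and kr: "kraus {..<d} {..<r} (\<lambda>k. {..<e k}) (\<lambda>k. fn (K k))"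
  shows "mat_sum d (\<lambda>k. mat_adjoint (K k) * K k) {..<r::nat} = 1\<^sub>m d"
proof (rule eq_matI)
  fix x y assume "x < dim_row (1\<^sub>m d)" "y < dim_col (1\<^sub>m d)"
  then have xy: "x < d" "y < d" by auto
  have "mat_sum d (\<lambda>k. mat_adjoint (K k) * K k) {..<r} $$ (x, y) = (\<Sum>k<r. (mat_adjoint (K k) * K k) $$ (x, y))"
    by (rule mat_sum_index[OF xy])
  also have "... = (\<Sum>k<r. \<Sum>z<e k. cnj (fn (K k) z x) * fn (K k) z y)"
    using K xy by (intro sum.cong refl index_adj_mult) auto
  also have "... = 1\<^sub>m d $$ (x, y)" using kr xy by (simp add: kraus_def)
  finally show "mat_sum d (\<lambda>k. mat_adjoint (K k) * K k) {..<r} $$ (x, y) = 1\<^sub>m d $$ (x, y)" .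
qed (simp_all add: mat_sum_def)

lemma kraus_cnj: "kraus I R F K \<Longrightarrow> kraus I R F (\<lambda>k z x. cnj (K k z x))"
  unfolding kraus_def
proof (intro ballI)
  fix x y assume k: "\<forall>x\<in>I. \<forall>y\<in>I. (\<Sum>k\<in>R. \<Sum>z\<in>F k. cnj (K k z x) * K k z y) = (if x = y then 1 else 0)"
    and xy: "x \<in> I" "y \<in> I"
  have "(\<Sum>k\<in>R. \<Sum>z\<in>F k. cnj (cnj (K k z x)) * cnj (K k z y)) = cnj (\<Sum>k\<in>R. \<Sum>z\<in>F k. cnj (K k z x) * K k z y)"
    by (simp only: cnj_sum complex_cnj_mult)
  also have "... = (if x = y then 1 else 0)" using k xy by simp
  finally show "(\<Sum>k\<in>R. \<Sum>z\<in>F k. cnj (cnj (K k z x)) * cnj (K k z y)) = (if x = y then 1 else 0)" .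
qed

text \<open>The side conditions of \<open>locc_round\<close> for one party, bundled so that they can
  be carried through conjugation and through tensoring with an identity.\<close>

definition measurement :: "nat \<Rightarrow> nat \<Rightarrow> (nat \<Rightarrow> nat) \<Rightarrow> (nat \<Rightarrow> complex mat) \<Rightarrow> bool" where
  "measurement d r e K \<longleftrightarrow> (\<forall>k<r. 0 < e k \<and> K k \<in> carrier_mat (e k) d) \<and>
     mat_sum d (\<lambda>k. mat_adjoint (K k) * K k) {..<r} = 1\<^sub>m d"

lemma measurement_kraus:
  "measurement d r e K \<longleftrightarrow> (\<forall>k<r. 0 < e k \<and> K k \<in> carrier_mat (e k) d) \<and> kraus {..<d} {..<r} (\<lambda>k. {..<e k}) (\<lambda>k. fn (K k))"
  unfolding measurement_def using kraus_fn[of r K e d] kraus_complete[of r K e d] by blast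

lemma locc_measurement:
  assumes "p < length ds" "measurement (ds ! p) r e K" "\<And>k. k < r \<Longrightarrow> locc (ds[p := e k]) ds' (\<Lambda> k)"
  shows "locc ds ds' (\<lambda>X. mat_sum (prod_list ds') (\<lambda>k. \<Lambda> k (sandwich (local_op ds p (K k)) X)) {..<r})"
  using assms by (intro locc.locc_round[where e = e]) (auto simp: measurement_def)

text \<open>Completeness is a family of scalar equations whose right sides are 0 or 1, hence stable
  under conjugation.\<close>

lemma measurement_cnj:
  assumes "measurement d r e K" shows "measurement d r e (\<lambda>k. map_mat cnj (K k))"
proof -
  have K: "K k \<in> carrier_mat (e k) d" if "k < r" for k using assms that by (simp add: measurement_kraus)
  have "kraus {..<d} {..<r} (\<lambda>k. {..<e k}) (\<lambda>k z x. cnj (fn (K k) z x))"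
    using assms by (intro kraus_cnj) (simp add: measurement_kraus)
  moreover have eq: "(\<Sum>k<r. \<Sum>z<e k. cnj (cnj (fn (K k) z x)) * cnj (fn (K k) z y))
    = (\<Sum>k<r. \<Sum>z<e k. cnj (fn (map_mat cnj (K k)) z x) * fn (map_mat cnj (K k)) z y)" if "x \<in> {..<d}" "y \<in> {..<d}" for x y
  proof (intro sum.cong refl)
    fix k z assume "k \<in> {..<r}" "z \<in> {..<e k}"
    then show "cnj (cnj (fn (K k) z x)) * cnj (fn (K k) z y) = cnj (fn (map_mat cnj (K k)) z x) * fn (map_mat cnj (K k)) z y"
      using K[of k] that by (simp add: fn_def)
  qed
  ultimately have "kraus {..<d} {..<r} (\<lambda>k. {..<e k}) (\<lambda>k. fn (map_mat cnj (K k)))"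
    unfolding kraus_def by (intro ballI) (subst eq[symmetric], blast+)
  then show ?thesis using assms by (simp add: measurement_kraus)
qed

lemma measurement_kron_right:
  assumes M: "measurement d r e K" and b: "0 < b"
  shows "measurement (d * b) r (\<lambda>k. e k * b) (\<lambda>k. kron (K k) (1\<^sub>m b))"
proof -
  have K: "K k \<in> carrier_mat (e k) d" if "k < r" for k using M that by (simp add: measurement_kraus)
  have "kraus {..<d * b} {..<r} (\<lambda>k. {..<e k * b}) (\<lambda>k. fn (kron (K k) (1\<^sub>m b)))"
    unfolding kraus_def
  proof (intro ballI)
    fix x y assume "x \<in> {..<d * b}" "y \<in> {..<d * b}"
    then have xy: "x < d * b" "y < d * b" and m: "x mod b < b" "y mod b < b" and dv: "x div b < d" "y div b < d"
      by (auto simp: div_less_pair mod_less_pair)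
    have "(\<Sum>k<r. \<Sum>z<e k * b. cnj (fn (kron (K k) (1\<^sub>m b)) z x) * fn (kron (K k) (1\<^sub>m b)) z y)
      = (\<Sum>k<r. \<Sum>u<e k. \<Sum>v<b. if v = x mod b then (if x mod b = y mod b then cnj (fn (K k) u (x div b)) * fn (K k) u (y div b) else 0) else 0)"
      unfolding sum_pair
    proof (intro sum.cong refl)
      fix k u v assume k: "k \<in> {..<r}" and u: "u \<in> {..<e k}" "v \<in> {..<b}"
      have kr: "fn (kron (K k) (1\<^sub>m b)) (u * b + v) w = (if v = w mod b then fn (K k) u (w div b) else 0)"
        if "w < d * b" for w
        using that kron_index[OF K, of k "1\<^sub>m b" b b u v "w div b" "w mod b"] k u
        by (simp add: fn_def div_less_pair mod_less_pair)
      show "cnj (fn (kron (K k) (1\<^sub>m b)) (u * b + v) x) * fn (kron (K k) (1\<^sub>m b)) (u * b + v) y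
        = (if v = x mod b then (if x mod b = y mod b then cnj (fn (K k) u (x div b)) * fn (K k) u (y div b) else 0) else 0)"
        by (simp add: kr[OF xy(1)] kr[OF xy(2)])
    qed
    also have "... = (if x mod b = y mod b then (\<Sum>k<r. \<Sum>u<e k. cnj (fn (K k) u (x div b)) * fn (K k) u (y div b)) else 0)"
      using m by simp
    also have "(\<Sum>k<r. \<Sum>u<e k. cnj (fn (K k) u (x div b)) * fn (K k) u (y div b)) = (if x div b = y div b then 1 else 0)"
      using M dv by (simp add: measurement_kraus kraus_def)
    also have "(if x mod b = y mod b then if x div b = y div b then 1 else 0 else 0) = (if x = y then 1 else (0::complex))"
      by (metis div_mult_mod_eq)
    finally show "(\<Sum>k<r. \<Sum>z<e k * b. cnj (fn (kron (K k) (1\<^sub>m b)) z x) * fn (kron (K k) (1\<^sub>m b)) z y) = (if x = y then 1 else 0)" .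
  qed
  then show ?thesis using M b by (simp add: measurement_kraus kron_carrier)
qed

lemma measurement_kron_left:
  assumes M: "measurement d r e K" and a: "0 < a"
  shows "measurement (a * d) r (\<lambda>k. a * e k) (\<lambda>k. kron (1\<^sub>m a) (K k))"
proof -
  have K: "K k \<in> carrier_mat (e k) d" if "k < r" for k using M that by (simp add: measurement_kraus)
  have "kraus {..<a * d} {..<r} (\<lambda>k. {..<a * e k}) (\<lambda>k. fn (kron (1\<^sub>m a) (K k)))"
    unfolding kraus_def
  proof (intro ballI)
    fix x y assume "x \<in> {..<a * d}" "y \<in> {..<a * d}"
    then have xy: "x < a * d" "y < a * d" and m: "x mod d < d" "y mod d < d" and dv: "x div d < a" "y div d < a"
      by (auto simp: div_less_pair mod_less_pair)
    have "(\<Sum>k<r. \<Sum>z<a * e k. cnj (fn (kron (1\<^sub>m a) (K k)) z x) * fn (kron (1\<^sub>m a) (K k)) z y)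
      = (\<Sum>k<r. \<Sum>u<a. if u = x div d then (if x div d = y div d then \<Sum>v<e k. cnj (fn (K k) v (x mod d)) * fn (K k) v (y mod d) else 0) else 0)"
      unfolding sum_pair
    proof (intro sum.cong refl)
      fix k u assume k: "k \<in> {..<r}" and u: "u \<in> {..<a}"
      have kr: "fn (kron (1\<^sub>m a) (K k)) (u * e k + v) w = (if u = w div d then fn (K k) v (w mod d) else 0)"
        if "w < a * d" "v < e k" for w v
        using that kron_index[of "1\<^sub>m a" a a "K k" "e k" d u v "w div d" "w mod d"] K[of k] k u
        by (simp add: fn_def div_less_pair mod_less_pair)
      show "(\<Sum>v<e k. cnj (fn (kron (1\<^sub>m a) (K k)) (u * e k + v) x) * fn (kron (1\<^sub>m a) (K k)) (u * e k + v) y)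
        = (if u = x div d then (if x div d = y div d then \<Sum>v<e k. cnj (fn (K k) v (x mod d)) * fn (K k) v (y mod d) else 0) else 0)"
        by (simp add: kr[OF xy(1)] kr[OF xy(2)])
    qed
    also have "... = (if x div d = y div d then (\<Sum>k<r. \<Sum>v<e k. cnj (fn (K k) v (x mod d)) * fn (K k) v (y mod d)) else 0)"
      using dv by simp
    also have "(\<Sum>k<r. \<Sum>u<e k. cnj (fn (K k) u (x mod d)) * fn (K k) u (y mod d)) = (if x mod d = y mod d then 1 else 0)"
      using M m by (simp add: measurement_kraus kraus_def)
    also have "(if x div d = y div d then if x mod d = y mod d then 1 else 0 else 0) = (if x = y then 1 else (0::complex))"
      by (metis div_mult_mod_eq)
    finally show "(\<Sum>k<r. \<Sum>z<a * e k. cnj (fn (kron (1\<^sub>m a) (K k)) z x) * fn (kron (1\<^sub>m a) (K k)) z y) = (if x = y then 1 else 0)" .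
  qed
  then show ?thesis using M a by (simp add: measurement_kraus kron_carrier)
qed

section \<open>Partial transposition against local operations\<close>

lemma o3_ptranspose1:
  assumes "x < a" "y < c" "z < b" "x' < a" "y' < c" "z' < b"
  shows "o3 c b (ptranspose [a, c, b] 1 X) (x, y, z) (x', y', z') = o3 c b X (x, y', z) (x', y, z')"
proof -
  have "y * b + z < c * b" "y' * b + z' < c * b" using assms by (auto intro: pair_less)
  moreover have "x * (c * b) + (y * b + z) < a * (c * b)" "x' * (c * b) + (y' * b + z') < a * (c * b)"
    using assms calculation by (auto intro: pair_less)
  ultimately show ?thesis using assms
    by (simp add: o3_def ptranspose_def add_mult_distrib mult.assoc add.assoc)
qed

lemma o2_ptranspose1:
  assumes "x < a" "y < b" "x' < a" "y' < b"
  shows "o2 b (ptranspose [a, b] 1 X) (x, y) (x', y') = o2 b X (x, y') (x', y)"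
proof -
  have "x * b + y < a * b" "x' * b + y' < a * b" using assms by (auto intro: pair_less)
  then show ?thesis using assms by (simp add: o2_def ptranspose_def)
qed

lemma o2_ptranspose0:
  assumes "x < a" "y < b" "x' < a" "y' < b"
  shows "o2 b (ptranspose [a, b] 0 X) (x, y) (x', y') = o2 b X (x', y) (x, y')"
proof -
  have "x * b + y < a * b" "x' * b + y' < a * b" using assms by (auto intro: pair_less)
  then show ?thesis using assms by (simp add: o2_def ptranspose_def)
qed

lemma o2_ptrace_mid:
  assumes "x < a" "z < b" "x' < a" "z' < b"
  shows "o2 b (ptrace [a, c, b] 1 X) (x, z) (x', z') = (\<Sum>l<c. o3 c b X (x, l, z) (x', l, z'))"
  using o2_ptrace1[of "(x, z)" a b "(x', z')" c X] assms by (simp add: ptr1_def swap12_def)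

lemma sandwich_carrier: "\<lbrakk>L \<in> carrier_mat m n; X \<in> sqmat n\<rbrakk> \<Longrightarrow> sandwich L X \<in> sqmat m"
  by auto

text \<open>Transposing the middle system lets the row index meet the factor that carries
  \<open>cnj\<close>, and the column index the other one: the two factors of the conjugation trade
  places.\<close>

lemma ptranspose_mid_op:
  assumes K: "K \<in> carrier_mat e c" and X: "X \<in> sqmat (a * c * b)"
  shows "ptranspose [a, e, b] 1 (sandwich (mid_op a b K) X)
    = sandwich (mid_op a b (map_mat cnj K)) (ptranspose [a, c, b] 1 X)" (is "?l = ?r")
proof (rule o3_eqI[of _ a e b])
  have K': "map_mat cnj K \<in> carrier_mat e c" using K by simp
  have T: "ptranspose [a, c, b] 1 X \<in> sqmat (a * c * b)" by (simp add: ptranspose_def mult.assoc)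
  show "?l \<in> sqmat (a * e * b)" by (simp add: ptranspose_def mult.assoc)
  show "?r \<in> sqmat (a * e * b)" by (rule sandwich_carrier[OF mid_op_carrier[OF K'] T])
  fix x y z x' y' z' assume l: "x < a" "y < e" "z < b" "x' < a" "y' < e" "z' < b"
  have "o3 e b ?l (x, y, z) (x', y', z') = (\<Sum>r<c. \<Sum>s<c. K $$ (y', r) * o3 c b X (x, r, z) (x', s, z') * cnj (K $$ (y, s)))"
    using l by (simp add: o3_ptranspose1 sandwich_mid_op[OF K X] del: One_nat_def)
  also have "... = (\<Sum>s<c. \<Sum>r<c. K $$ (y', r) * o3 c b X (x, r, z) (x', s, z') * cnj (K $$ (y, s)))" by (rule sum.swap)
  also have "... = o3 e b ?r (x, y, z) (x', y', z')"
    unfolding sandwich_mid_op[OF K' T l(1,4,2,5,3,6)] using l K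
    by (intro sum.cong refl) (simp add: o3_ptranspose1[OF l(1) _ l(3,4) _ l(6)] del: One_nat_def)
  finally show "o3 e b ?l (x, y, z) (x', y', z') = o3 e b ?r (x, y, z) (x', y', z')" .
qed

text \<open>The outer operators do not touch the transposed indices. The other two systems are
  grouped into one of dimension \<open>c * b\<close> so that the acting party is again the middle
  one, now with a trivial first factor.\<close>

lemma ptranspose_left_op:
  assumes K: "K \<in> carrier_mat e a" and X: "X \<in> sqmat (a * c * b)"
  shows "ptranspose [e, c, b] 1 (sandwich (mid_op 1 (c * b) K) X)
    = sandwich (mid_op 1 (c * b) K) (ptranspose [a, c, b] 1 X)" (is "?l = ?r")
proof (rule o3_eqI[of _ e c b])
  have T: "ptranspose [a, c, b] 1 X \<in> sqmat (1 * a * (c * b))" by (simp add: ptranspose_def)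
  have X': "X \<in> sqmat (1 * a * (c * b))" using X by (simp add: mult.assoc)
  show "?l \<in> sqmat (e * c * b)" by (simp add: ptranspose_def mult.assoc)
  show "?r \<in> sqmat (e * c * b)" using sandwich_carrier[OF mid_op_carrier[OF K] T] by (simp add: mult.assoc)
  have one: "(0::nat) < 1" by simp
  have o: "o3 c b Y (x, y, z) (x', y', z') = o3 d (c * b) Y (0, x, y * b + z) (0, x', y' * b + z')" for d Y x y z x' y' z'
    by (simp add: o3_def algebra_simps)
  fix x y z x' y' z' assume l: "x < e" "y < c" "z < b" "x' < e" "y' < c" "z' < b"
  have l2: "y * b + z < c * b" "y' * b + z' < c * b" "y' * b + z < c * b" "y * b + z' < c * b" using l by (auto intro: pair_less)
  have "o3 c b ?l (x, y, z) (x', y', z') = o3 c b (sandwich (mid_op 1 (c * b) K) X) (x, y', z) (x', y, z')"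
    by (rule o3_ptranspose1[OF l])
  also have "... = (\<Sum>r<a. \<Sum>s<a. K $$ (x, r) * o3 a (c * b) X (0, r, y' * b + z) (0, s, y * b + z') * cnj (K $$ (x', s)))"
    unfolding o[of _ _ _ _ _ _ _ e] by (rule sandwich_mid_op[OF K X' one one l(1,4) l2(3,4)])
  also have "... = (\<Sum>r<a. \<Sum>s<a. K $$ (x, r) * o3 c b X (r, y', z) (s, y, z') * cnj (K $$ (x', s)))"
    unfolding o[of _ _ _ _ _ _ _ a] ..
  also have "... = (\<Sum>r<a. \<Sum>s<a. K $$ (x, r) * o3 c b (ptranspose [a, c, b] 1 X) (r, y, z) (s, y', z') * cnj (K $$ (x', s)))"
    using l by (intro sum.cong refl) (simp add: o3_ptranspose1 del: One_nat_def)
  also have "... = (\<Sum>r<a. \<Sum>s<a. K $$ (x, r) * o3 a (c * b) (ptranspose [a, c, b] 1 X) (0, r, y * b + z) (0, s, y' * b + z') * cnj (K $$ (x', s)))"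
    unfolding o[of _ _ _ _ _ _ _ a] ..
  also have "... = o3 c b ?r (x, y, z) (x', y', z')"
    unfolding o[of _ _ _ _ _ _ _ e] by (rule sandwich_mid_op[OF K T one one l(1,4) l2(1,2), symmetric])
  finally show "o3 c b ?l (x, y, z) (x', y', z') = o3 c b ?r (x, y, z) (x', y', z')" .
qed

lemma ptranspose_right_op:
  assumes K: "K \<in> carrier_mat e b" and X: "X \<in> sqmat (a * c * b)"
  shows "ptranspose [a, c, e] 1 (sandwich (mid_op (a * c) 1 K) X)
    = sandwich (mid_op (a * c) 1 K) (ptranspose [a, c, b] 1 X)" (is "?l = ?r")
proof (rule o3_eqI[of _ a c e])
  have T: "ptranspose [a, c, b] 1 X \<in> sqmat (a * c * b * 1)" by (simp add: ptranspose_def mult.assoc)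
  have X': "X \<in> sqmat (a * c * b * 1)" using X by simp
  show "?l \<in> sqmat (a * c * e)" by (simp add: ptranspose_def mult.assoc)
  show "?r \<in> sqmat (a * c * e)" using sandwich_carrier[OF mid_op_carrier[OF K] T] by simp
  have one: "(0::nat) < 1" by simp
  have o: "o3 c b Y (x, y, z) (x', y', z') = o3 b 1 Y (x * c + y, z, 0) (x' * c + y', z', 0)" for b Y x y z x' y' z'
    by (simp add: o3_def)
  fix x y z x' y' z' assume l: "x < a" "y < c" "z < e" "x' < a" "y' < c" "z' < e"
  have l2: "x * c + y < a * c" "x' * c + y' < a * c" "x * c + y' < a * c" "x' * c + y < a * c" using l by (auto intro: pair_less)
  have "o3 c e ?l (x, y, z) (x', y', z') = o3 c e (sandwich (mid_op (a * c) 1 K) X) (x, y', z) (x', y, z')"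
    by (rule o3_ptranspose1[OF l])
  also have "... = (\<Sum>r<b. \<Sum>s<b. K $$ (z, r) * o3 b 1 X (x * c + y', r, 0) (x' * c + y, s, 0) * cnj (K $$ (z', s)))"
    unfolding o by (rule sandwich_mid_op[OF K X' l2(3,4) l(3,6) one one])
  also have "... = (\<Sum>r<b. \<Sum>s<b. K $$ (z, r) * o3 c b X (x, y', r) (x', y, s) * cnj (K $$ (z', s)))"
    unfolding o ..
  also have "... = (\<Sum>r<b. \<Sum>s<b. K $$ (z, r) * o3 c b (ptranspose [a, c, b] 1 X) (x, y, r) (x', y', s) * cnj (K $$ (z', s)))"
    using l by (intro sum.cong refl) (simp add: o3_ptranspose1 del: One_nat_def)
  also have "... = (\<Sum>r<b. \<Sum>s<b. K $$ (z, r) * o3 b 1 (ptranspose [a, c, b] 1 X) (x * c + y, r, 0) (x' * c + y', s, 0) * cnj (K $$ (z', s)))"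
    unfolding o ..
  also have "... = o3 c e ?r (x, y, z) (x', y', z')"
    unfolding o by (rule sandwich_mid_op[OF K T l2(1,2) l(3,6) one one, symmetric])
  finally show "o3 c e ?l (x, y, z) (x', y', z') = o3 c e ?r (x, y, z) (x', y', z')" .
qed

section \<open>Additivity of protocols\<close>

lemma sandwich_mat_sum:
  assumes L: "L \<in> carrier_mat m n" and F: "\<And>k. k \<in> S \<Longrightarrow> F k \<in> sqmat n"
  shows "sandwich L (mat_sum n F S) = mat_sum m (\<lambda>k. sandwich L (F k)) S"
proof (rule eq_matI)
  fix i j assume "i < dim_row (mat_sum m (\<lambda>k. sandwich L (F k)) S)" "j < dim_col (mat_sum m (\<lambda>k. sandwich L (F k)) S)"
  then have ij: "i < m" "j < m" by (auto simp: mat_sum_def)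
  have "sandwich L (mat_sum n F S) $$ (i, j) = (\<Sum>r<n. \<Sum>s<n. L $$ (i, r) * mat_sum n F S $$ (r, s) * cnj (L $$ (j, s)))"
    by (rule sandwich_index[OF L mat_sum_carrier ij])
  also have "... = (\<Sum>r<n. \<Sum>s<n. \<Sum>k\<in>S. L $$ (i, r) * F k $$ (r, s) * cnj (L $$ (j, s)))"
    by (intro sum.cong refl) (simp add: mat_sum_index sum_distrib_left sum_distrib_right)
  also have "... = (\<Sum>r<n. \<Sum>k\<in>S. \<Sum>s<n. L $$ (i, r) * F k $$ (r, s) * cnj (L $$ (j, s)))"
    by (intro sum.cong refl sum.swap)
  also have "... = (\<Sum>k\<in>S. \<Sum>r<n. \<Sum>s<n. L $$ (i, r) * F k $$ (r, s) * cnj (L $$ (j, s)))"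
    by (rule sum.swap)
  also have "... = (\<Sum>k\<in>S. sandwich L (F k) $$ (i, j))"
    by (intro sum.cong refl sandwich_index[OF L F ij, symmetric])
  finally show "sandwich L (mat_sum n F S) $$ (i, j) = mat_sum m (\<lambda>k. sandwich L (F k)) S $$ (i, j)"
    by (simp add: mat_sum_index[OF ij])
qed (use L in \<open>simp_all add: mat_sum_def\<close>)

lemma mat_sum_swap: "mat_sum n (\<lambda>k. mat_sum n (F k) S) R = mat_sum n (\<lambda>s. mat_sum n (\<lambda>k. F k s) R) S"
  by (rule eq_matI) (auto simp: mat_sum_index sum.swap[of _ R S] mat_sum_def)

lemma mat_sum_cong: "(\<And>k. k \<in> S \<Longrightarrow> F k = G k) \<Longrightarrow> mat_sum n F S = mat_sum n G S"
  by (simp add: mat_sum_def cong: sum.cong)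

lemma prod_list_split: "p < length ds \<Longrightarrow> prod_list (take p ds) * ds ! p * prod_list (drop (Suc p) ds) = prod_list (ds :: nat list)"
  by (subst (4) id_take_nth_drop[of p ds]) simp_all

lemma prod_list_update: "p < length ds \<Longrightarrow> prod_list (ds[p := e]) = prod_list (take p ds) * e * prod_list (drop (Suc p) (ds :: nat list))"
  by (simp add: upd_conv_take_nth_drop)

lemma local_op_carrier:
  "\<lbrakk>p < length ds; K \<in> carrier_mat e (ds ! p)\<rbrakk> \<Longrightarrow> local_op ds p K \<in> carrier_mat (prod_list (ds[p := e])) (prod_list ds)"
  using mid_op_carrier[of K e "ds ! p" "prod_list (take p ds)" "prod_list (drop (Suc p) ds)"]
  by (simp add: local_op_mid prod_list_split prod_list_update)

text \<open>Attaching a state takes several Kraus operators whose outcome is then ignored.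
  Additivity turns the sum of the branch outputs into the output of the protocol at the attached
  state.\<close>

lemma locc_mat_sum:
  assumes "locc ds ds' \<Lambda>" "\<And>k. k \<in> S \<Longrightarrow> F k \<in> sqmat (prod_list ds)"
  shows "\<Lambda> (mat_sum (prod_list ds) F S) = mat_sum (prod_list ds') (\<lambda>k. \<Lambda> (F k)) S"
  using assms
proof (induction arbitrary: F rule: locc.induct)
  case (locc_round p ds r e K ds' \<Lambda>)
  let ?L = "\<lambda>k. local_op ds p (K k)"
  have L: "?L k \<in> carrier_mat (prod_list (ds[p := e k])) (prod_list ds)" if "k < r" for k
    using locc_round.hyps that by (intro local_op_carrier) auto
  have "mat_sum (prod_list ds') (\<lambda>k. \<Lambda> k (sandwich (?L k) (mat_sum (prod_list ds) F S))) {..<r}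
    = mat_sum (prod_list ds') (\<lambda>k. mat_sum (prod_list ds') (\<lambda>s. \<Lambda> k (sandwich (?L k) (F s))) S) {..<r}"
  proof (rule mat_sum_cong)
    fix k assume "k \<in> {..<r}"
    then have k: "k < r" by simp
    have "\<Lambda> k (sandwich (?L k) (mat_sum (prod_list ds) F S))
      = \<Lambda> k (mat_sum (prod_list (ds[p := e k])) (\<lambda>s. sandwich (?L k) (F s)) S)"
      by (simp only: sandwich_mat_sum[OF L[OF k] locc_round.prems])
    also have "... = mat_sum (prod_list ds') (\<lambda>s. \<Lambda> k (sandwich (?L k) (F s))) S"
      by (rule locc_round.IH[rule_format, OF k, THEN conjunct2, rule_format, OF sandwich_carrier[OF L[OF k] locc_round.prems]])
    finally show "\<Lambda> k (sandwich (?L k) (mat_sum (prod_list ds) F S))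
      = mat_sum (prod_list ds') (\<lambda>s. \<Lambda> k (sandwich (?L k) (F s))) S" .
  qed
  then show ?case unfolding mat_sum_swap[of _ _ S] .
qed simp

lemma ptrace_mat_sum:
  "ptrace [a, c, b] 1 (mat_sum (a * c * b) F S) = mat_sum (a * b) (\<lambda>k. ptrace [a, c, b] 1 (F k)) S"
proof (rule o2_eqI[of _ a b])
  fix p q assume p: "p \<in> ix2 a b" and q: "q \<in> ix2 a b"
  have l: "fst p * b + snd p < a * b" "fst q * b + snd q < a * b" using p q by (auto intro: pair_less)
  have l3: "(fst p * c + l) * b + snd p < a * c * b" "(fst q * c + l) * b + snd q < a * c * b" if "l < c" for l
    using p q that by (auto intro!: pair_less)
  have "o2 b (ptrace [a, c, b] 1 (mat_sum (a * c * b) F S)) p q = (\<Sum>l<c. \<Sum>k\<in>S. o3 c b (F k) (fst p, l, snd p) (fst q, l, snd q))"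
    using o2_ptrace1[OF p q, of c "mat_sum (a * c * b) F S"] l3 by (simp add: ptr1_def swap12_def o3_def mat_sum_index)
  also have "... = (\<Sum>k\<in>S. \<Sum>l<c. o3 c b (F k) (fst p, l, snd p) (fst q, l, snd q))" by (rule sum.swap)
  also have "... = (\<Sum>k\<in>S. o2 b (ptrace [a, c, b] 1 (F k)) p q)"
    by (simp add: o2_ptrace1[OF p q] ptr1_def swap12_def del: One_nat_def)
  also have "... = o2 b (mat_sum (a * b) (\<lambda>k. ptrace [a, c, b] 1 (F k)) S) p q" by (simp add: o2_def mat_sum_index[OF l])
  finally show "o2 b (ptrace [a, c, b] 1 (mat_sum (a * c * b) F S)) p q = o2 b (mat_sum (a * b) (\<lambda>k. ptrace [a, c, b] 1 (F k)) S) p q" .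
qed (simp_all add: ptrace_def Let_def)

text \<open>Merging Charlie with one of the other parties, which acts with the complex conjugates of his
  Kraus operators: the merged protocol takes the partial transpose of a state to the partial
  transpose of the output, and these have the same reduced state on Alice and Bob.\<close>

definition simulates where
  "simulates \<Lambda>' a c b \<Lambda> a' c' b' \<longleftrightarrow>
     (\<forall>X\<in>sqmat (a * c * b). \<Lambda>' (ptranspose [a, c, b] 1 X) = ptrace [a', c', b'] 1 (\<Lambda> X))"

text \<open>One induction for both ways of merging: \<open>\<mu>\<close> maps the three dimensions
  to the two merged ones. \<open>base\<close> treats the end of the protocol, where the merged party
  must still discard Charlie's system, and \<open>step\<close> translates a single
  measurement.\<close>

lemma locc_merge:
  assumes base: "\<And>a c b. \<lbrakk>0 < a; 0 < c; 0 < b\<rbrakk> \<Longrightarrow> \<exists>\<Lambda>'. locc (\<mu> [a, c, b]) [a, b] \<Lambda>' \<and> simulates \<Lambda>' a c b (\<lambda>X. X) a c b"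
    and step: "\<And>a c b p r e K. \<lbrakk>0 < a; 0 < c; 0 < b; p < 3; measurement ([a, c, b] ! p) r e K\<rbrakk> \<Longrightarrow>
      \<exists>p' e' K'. p' < length (\<mu> [a, c, b]) \<and> measurement (\<mu> [a, c, b] ! p') r e' K' \<and>
        (\<forall>k<r. (\<mu> [a, c, b])[p' := e' k] = \<mu> ([a, c, b][p := e k]) \<and> (\<forall>X\<in>sqmat (a * c * b).
            ptranspose ([a, c, b][p := e k]) 1 (sandwich (local_op [a, c, b] p (K k)) X)
            = sandwich (local_op (\<mu> [a, c, b]) p' (K' k)) (ptranspose [a, c, b] 1 X)))"
    and l: "locc [a, c, b] [a', c', b'] \<Lambda>" and pos: "0 < a" "0 < c" "0 < b"
  shows "\<exists>\<Lambda>'. locc (\<mu> [a, c, b]) [a', b'] \<Lambda>' \<and> simulates \<Lambda>' a c b \<Lambda> a' c' b'"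
proof -
  have "\<exists>\<Lambda>'. locc (\<mu> [a, c, b]) [a', b'] \<Lambda>' \<and> simulates \<Lambda>' a c b \<Lambda> a' c' b'"
    if "locc ds ds' \<Lambda>" "ds = [a, c, b]" "ds' = [a', c', b']" "0 < a" "0 < c" "0 < b" for ds ds' \<Lambda> a b c
    using that
  proof (induction arbitrary: a b c rule: locc.induct)
    case (locc_done ds)
    then show ?case using base[of a c b] by auto
  next
    case (locc_round p ds r e K ds' \<Lambda>)
    note [simp] = locc_round.prems(1,2)
    have p: "p < 3" using locc_round.hyps(1) by simp
    obtain a1 c1 b1 where abc: "\<And>k. [a, c, b][p := e k] = [a1 k, c1 k, b1 k]"
      using p that[of "\<lambda>k. [a, c, b][p := e k] ! 0" "\<lambda>k. [a, c, b][p := e k] ! 1" "\<lambda>k. [a, c, b][p := e k] ! 2"]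
      by (auto simp: less_Suc_eq numeral_3_eq_3 numeral_2_eq_2)
    have pos1: "0 < a1 k" "0 < c1 k" "0 < b1 k" if "k < r" for k
      using abc[of k] locc_round.prems(3-5) locc_round.hyps(2) that p by (auto simp: less_Suc_eq numeral_3_eq_3)
    let ?n = "a * c * b"
    let ?L = "\<lambda>k. local_op [a, c, b] p (K k)"
    have L: "?L k \<in> carrier_mat (a1 k * c1 k * b1 k) ?n" if "k < r" for k
      using local_op_carrier[of p "[a, c, b]" "K k" "e k"] locc_round.hyps(2) that p abc[of k] by (simp add: mult.assoc)
    have K: "measurement ([a, c, b] ! p) r e K" using locc_round.hyps(2,3) by (auto simp: measurement_def)
    obtain p' e' K' where st0: "p' < length (\<mu> [a, c, b]) \<and> measurement (\<mu> [a, c, b] ! p') r e' K' \<and>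
      (\<forall>k<r. (\<mu> [a, c, b])[p' := e' k] = \<mu> [a1 k, c1 k, b1 k] \<and>
        (\<forall>X\<in>sqmat ?n. ptranspose [a1 k, c1 k, b1 k] 1 (sandwich (?L k) X)
            = sandwich (local_op (\<mu> [a, c, b]) p' (K' k)) (ptranspose [a, c, b] 1 X)))"
      using step[OF locc_round.prems(3-5) p K, unfolded abc] by (elim exE) (rule that)
    note st = st0[THEN conjunct2, THEN conjunct2, rule_format]
    note u' = st[THEN conjunct1] and T = st[THEN conjunct2, rule_format]
    let ?L' = "\<lambda>k. local_op (\<mu> [a, c, b]) p' (K' k)"
    define Q where "Q k \<Lambda>' \<longleftrightarrow> locc (\<mu> [a1 k, c1 k, b1 k]) [a', b'] \<Lambda>' \<and> simulates \<Lambda>' (a1 k) (c1 k) (b1 k) (\<Lambda> k) a' c' b'" for k \<Lambda>'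
    define \<Lambda>' where "\<Lambda>' k = (SOME F. Q k F)" for k
    have "ds[p := e k] = [a1 k, c1 k, b1 k]" for k unfolding locc_round.prems(1) by (rule abc)
    then have ex: "\<exists>F. Q k F" if "k < r" for k
      unfolding Q_def by (rule locc_round.IH[rule_format, OF that, THEN conjunct2, rule_format, OF _ locc_round.prems(2) pos1[OF that]])
    have "Q k (\<Lambda>' k)" if "k < r" for k unfolding \<Lambda>'_def by (rule someI_ex[OF ex[OF that]])
    then have \<Lambda>': "\<And>k. k < r \<Longrightarrow> locc (\<mu> [a1 k, c1 k, b1 k]) [a', b'] (\<Lambda>' k)"
      "\<And>k X. k < r \<Longrightarrow> X \<in> sqmat (a1 k * c1 k * b1 k) \<Longrightarrow> \<Lambda>' k (ptranspose [a1 k, c1 k, b1 k] 1 X) = ptrace [a', c', b'] 1 (\<Lambda> k X)"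
      unfolding Q_def simulates_def by blast+
    have "locc (\<mu> [a, c, b]) [a', b'] (\<lambda>X. mat_sum (prod_list [a', b']) (\<lambda>k. \<Lambda>' k (sandwich (?L' k) X)) {..<r})"
      by (rule locc_measurement[OF st0[THEN conjunct1] st0[THEN conjunct2, THEN conjunct1]]) (simp only: u' \<Lambda>'(1))
    moreover have "simulates (\<lambda>X. mat_sum (prod_list [a', b']) (\<lambda>k. \<Lambda>' k (sandwich (?L' k) X)) {..<r}) a c b
        (\<lambda>X. mat_sum (prod_list ds') (\<lambda>k. \<Lambda> k (sandwich (local_op ds p (K k)) X)) {..<r}) a' c' b'"
      unfolding simulates_def
    proof
      fix X assume X: "X \<in> sqmat ?n"
      have "mat_sum (a' * b') (\<lambda>k. \<Lambda>' k (sandwich (?L' k) (ptranspose [a, c, b] 1 X))) {..<r}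
        = mat_sum (a' * b') (\<lambda>k. ptrace [a', c', b'] 1 (\<Lambda> k (sandwich (?L k) X))) {..<r}"
      proof (rule mat_sum_cong)
        fix k assume "k \<in> {..<r}"
        then have k: "k < r" by simp
        show "\<Lambda>' k (sandwich (?L' k) (ptranspose [a, c, b] 1 X)) = ptrace [a', c', b'] 1 (\<Lambda> k (sandwich (?L k) X))"
          unfolding T[OF k X, symmetric] by (rule \<Lambda>'(2)[OF k sandwich_carrier[OF L[OF k] X]])
      qed
      then show "mat_sum (prod_list [a', b']) (\<lambda>k. \<Lambda>' k (sandwich (?L' k) (ptranspose [a, c, b] 1 X))) {..<r}
        = ptrace [a', c', b'] 1 (mat_sum (prod_list ds') (\<lambda>k. \<Lambda> k (sandwich (local_op ds p (K k)) X)) {..<r})"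
        using ptrace_mat_sum[of a' c' b' _ "{..<r}"] by (simp add: mult.assoc)
    qed
    ultimately show ?case by (intro exI conjI)
  qed
  from this[OF l refl refl pos] show ?thesis .
qed

text \<open>The row vector of basis state \<open>l\<close>. Measuring Charlie with these leaves a
  one-dimensional system, which makes the trace over him a step of the protocol.\<close>

definition bra :: "nat \<Rightarrow> nat \<Rightarrow> complex mat" where
  "bra c l = mat 1 c (\<lambda>(i, j). if j = l then 1 else 0)"

lemma bra_carrier: "bra c l \<in> carrier_mat 1 c"
  by (simp add: bra_def)

lemma measurement_bra: "measurement c c (\<lambda>_. 1) (bra c)"
  using bra_carrier by (auto simp: measurement_kraus kraus_def fn_def bra_def if_distrib cong: if_cong)

text \<open>The trace adds up the entries that are diagonal in Charlie's index, and these are fixed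
  by transposing his system.\<close>

lemma sum_bra:
  "mat_sum (a * b) (\<lambda>l. sandwich (mid_op a b (bra c l)) (ptranspose [a, c, b] 1 X)) {..<c} = ptrace [a, c, b] 1 X"
  (is "?l = ?r")
proof (rule o2_eqI[of _ a b])
  show "?r \<in> sqmat (a * b)" by (simp add: ptrace_def Let_def)
  have T: "ptranspose [a, c, b] 1 X \<in> sqmat (a * c * b)" by (simp add: ptranspose_def mult.assoc)
  fix p q assume p: "p \<in> ix2 a b" and q: "q \<in> ix2 a b"
  then have l: "fst p < a" "fst q < a" "snd p < b" "snd q < b" by auto
  have pq: "fst p * b + snd p < a * b" "fst q * b + snd q < a * b" using l by (auto intro: pair_less)
  have "o2 b (sandwich (mid_op a b (bra c l)) (ptranspose [a, c, b] 1 X)) p q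
    = o3 c b X (fst p, l, snd p) (fst q, l, snd q)" if "l < c" for l
  proof -
    have "o2 b (sandwich (mid_op a b (bra c l)) (ptranspose [a, c, b] 1 X)) p q
      = o3 1 b (sandwich (mid_op a b (bra c l)) (ptranspose [a, c, b] 1 X)) (fst p, 0, snd p) (fst q, 0, snd q)"
      by (simp add: o2_def o3_def)
    also have "... = (\<Sum>r<c. \<Sum>s<c. bra c l $$ (0, r) * o3 c b (ptranspose [a, c, b] 1 X) (fst p, r, snd p) (fst q, s, snd q) * cnj (bra c l $$ (0, s)))"
      using l by (intro sandwich_mid_op[OF bra_carrier T]) auto
    also have "... = (\<Sum>r<c. \<Sum>s<c. if s = l then (if r = l then o3 c b (ptranspose [a, c, b] 1 X) (fst p, l, snd p) (fst q, l, snd q) else 0) else 0)"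
      by (intro sum.cong refl) (auto simp: bra_def)
    also have "... = o3 c b (ptranspose [a, c, b] 1 X) (fst p, l, snd p) (fst q, l, snd q)"
      using that by simp
    finally show ?thesis using l that by (simp add: o3_ptranspose1 del: One_nat_def)
  qed
  then have "o2 b ?l p q = (\<Sum>l<c. o3 c b X (fst p, l, snd p) (fst q, l, snd q))"
    unfolding o2_def mat_sum_index[OF pq] by (intro sum.cong refl) simp
  then show "o2 b ?l p q = o2 b ?r p q" using o2_ptrace_mid[OF l(1,3,2,4), of c X] by simp
qed simp

section \<open>Merging Charlie with Bob and with Alice\<close>

lemma mid_op_kron_right: "mid_op a 1 (kron K (1\<^sub>m b)) = mid_op a b K"
  unfolding mid_op_def kron_one_right ..

lemma mid_op_kron_left: "mid_op 1 b (kron (1\<^sub>m a) K) = mid_op a b K"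
  unfolding mid_op_def kron_assoc[of "1\<^sub>m a"] kron_assoc[of "1\<^sub>m 1", symmetric] kron_one_one by simp

lemma mid_op_kron_left': "mid_op a 1 (kron (1\<^sub>m c) K) = mid_op (a * c) 1 K"
  unfolding mid_op_def kron_one_right kron_assoc[symmetric] kron_one_one ..

lemma mid_op_kron_right': "mid_op 1 b (kron K (1\<^sub>m c)) = mid_op 1 (c * b) K"
  unfolding mid_op_def kron_assoc[of K] kron_one_one ..

text \<open>In a round of Charlie or Bob the merged party applies the operator tensor the identity
  on its other half, conjugated in Charlie's case. Alice's rounds are unchanged.\<close>

lemma locc_merge_right:
  assumes l: "locc [a, c, b] [a', c', b'] \<Lambda>" and pos: "0 < a" "0 < c" "0 < b"
  shows "\<exists>\<Lambda>'. locc [a, c * b] [a', b'] \<Lambda>' \<and> simulates \<Lambda>' a c b \<Lambda> a' c' b'"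
proof -
  let ?m = "\<lambda>ds :: nat list. [ds ! 0, ds ! 1 * ds ! 2]"
  have "\<exists>\<Lambda>'. locc (?m [a, c, b]) [a', b'] \<Lambda>' \<and> simulates \<Lambda>' a c b \<Lambda> a' c' b'"
  proof (rule locc_merge[OF _ _ l pos])
    fix a c b :: nat assume pos: "0 < a" "0 < c" "0 < b"
    let ?K = "\<lambda>l. kron (bra c l) (1\<^sub>m b)"
    have "locc [a, c * b] [a, b] (\<lambda>X. mat_sum (prod_list [a, b]) (\<lambda>k. (\<lambda>k X. X) k (sandwich (local_op [a, c * b] 1 (?K k)) X)) {..<c})"
      using pos measurement_kron_right[OF measurement_bra] by (intro locc_measurement[where e = "\<lambda>_. 1 * b"]) (auto intro: locc.locc_done)
    moreover have "local_op [a, c * b] 1 (?K k) = mid_op a b (bra c k)" for k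
      by (simp add: local_op_mid mid_op_kron_right[unfolded One_nat_def])
    ultimately show "\<exists>\<Lambda>'. locc (?m [a, c, b]) [a, b] \<Lambda>' \<and> simulates \<Lambda>' a c b (\<lambda>X. X) a c b"
      using sum_bra[of a b c] unfolding simulates_def by (intro exI conjI) (auto simp: numeral_2_eq_2)
  next
    fix a c b p r e and K :: "nat \<Rightarrow> complex mat"
    assume pos: "0 < a" "0 < c" "0 < b" and p: "p < 3" and M: "measurement ([a, c, b] ! p) r e K"
    let ?g = "\<lambda>p' e' K'. p' < length (?m [a, c, b]) \<and> measurement (?m [a, c, b] ! p') r e' K' \<and>
        (\<forall>k<r. (?m [a, c, b])[p' := e' k] = ?m ([a, c, b][p := e k]) \<and> (\<forall>X\<in>sqmat (a * c * b).
            ptranspose ([a, c, b][p := e k]) 1 (sandwich (local_op [a, c, b] p (K k)) X)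
            = sandwich (local_op (?m [a, c, b]) p' (K' k)) (ptranspose [a, c, b] 1 X)))"
    have K: "\<forall>k<r. K k \<in> carrier_mat (e k) ([a, c, b] ! p)" using M by (simp add: measurement_def)
    consider "p = 0" | "p = 1" | "p = 2" using p by linarith
    then show "\<exists>p' e' K'. ?g p' e' K'"
    proof cases
      case 1
      have "?g 0 e K"
        using K M unfolding 1 by (simp add: local_op_mid ptranspose_left_op[unfolded One_nat_def] numeral_2_eq_2)
      then show ?thesis by - (rule exI[of _ 0], rule exI[of _ e], rule exI[of _ K], assumption)
    next
      case 2
      have "?g 1 (\<lambda>k. e k * b) (\<lambda>k. kron (map_mat cnj (K k)) (1\<^sub>m b))"
        using K measurement_kron_right[OF measurement_cnj[OF M], of b] pos unfolding 2
        by (simp add: local_op_mid ptranspose_mid_op[unfolded One_nat_def] mid_op_kron_right[unfolded One_nat_def] numeral_2_eq_2)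
      then show ?thesis by - (rule exI[of _ 1], rule exI[of _ "\<lambda>k. e k * b"], rule exI[of _ "\<lambda>k. kron (map_mat cnj (K k)) (1\<^sub>m b)"], assumption)
    next
      case 3
      have "?g 1 (\<lambda>k. c * e k) (\<lambda>k. kron (1\<^sub>m c) (K k))"
        using K measurement_kron_left[OF M, of c] pos unfolding 3
        by (simp add: local_op_mid ptranspose_right_op[unfolded One_nat_def] mid_op_kron_left'[unfolded One_nat_def] numeral_2_eq_2)
      then show ?thesis by - (rule exI[of _ 1], rule exI[of _ "\<lambda>k. c * e k"], rule exI[of _ "\<lambda>k. kron (1\<^sub>m c) (K k)"], assumption)
    qed
  qed
  then show ?thesis by (simp add: numeral_2_eq_2)
qed

lemma locc_merge_left:
  assumes l: "locc [a, c, b] [a', c', b'] \<Lambda>" and pos: "0 < a" "0 < c" "0 < b"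
  shows "\<exists>\<Lambda>'. locc [a * c, b] [a', b'] \<Lambda>' \<and> simulates \<Lambda>' a c b \<Lambda> a' c' b'"
proof -
  let ?m = "\<lambda>ds :: nat list. [ds ! 0 * ds ! 1, ds ! 2]"
  have "\<exists>\<Lambda>'. locc (?m [a, c, b]) [a', b'] \<Lambda>' \<and> simulates \<Lambda>' a c b \<Lambda> a' c' b'"
  proof (rule locc_merge[OF _ _ l pos])
    fix a c b :: nat assume pos: "0 < a" "0 < c" "0 < b"
    let ?K = "\<lambda>l. kron (1\<^sub>m a) (bra c l)"
    have "locc [a * c, b] [a, b] (\<lambda>X. mat_sum (prod_list [a, b]) (\<lambda>k. (\<lambda>k X. X) k (sandwich (local_op [a * c, b] 0 (?K k)) X)) {..<c})"
      using pos measurement_kron_left[OF measurement_bra] by (intro locc_measurement[where e = "\<lambda>_. a * 1"]) (auto intro: locc.locc_done)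
    moreover have "local_op [a * c, b] 0 (?K k) = mid_op a b (bra c k)" for k
      by (simp add: local_op_mid mid_op_kron_left[unfolded One_nat_def])
    ultimately show "\<exists>\<Lambda>'. locc (?m [a, c, b]) [a, b] \<Lambda>' \<and> simulates \<Lambda>' a c b (\<lambda>X. X) a c b"
      using sum_bra[of a b c] unfolding simulates_def by (intro exI conjI) (auto simp: numeral_2_eq_2)
  next
    fix a c b p r e and K :: "nat \<Rightarrow> complex mat"
    assume pos: "0 < a" "0 < c" "0 < b" and p: "p < 3" and M: "measurement ([a, c, b] ! p) r e K"
    let ?g = "\<lambda>p' e' K'. p' < length (?m [a, c, b]) \<and> measurement (?m [a, c, b] ! p') r e' K' \<and>
        (\<forall>k<r. (?m [a, c, b])[p' := e' k] = ?m ([a, c, b][p := e k]) \<and> (\<forall>X\<in>sqmat (a * c * b).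
            ptranspose ([a, c, b][p := e k]) 1 (sandwich (local_op [a, c, b] p (K k)) X)
            = sandwich (local_op (?m [a, c, b]) p' (K' k)) (ptranspose [a, c, b] 1 X)))"
    have K: "\<forall>k<r. K k \<in> carrier_mat (e k) ([a, c, b] ! p)" using M by (simp add: measurement_def)
    consider "p = 0" | "p = 1" | "p = 2" using p by linarith
    then show "\<exists>p' e' K'. ?g p' e' K'"
    proof cases
      case 1
      have "?g 0 (\<lambda>k. e k * c) (\<lambda>k. kron (K k) (1\<^sub>m c))"
        using K measurement_kron_right[OF M, of c] pos unfolding 1
        by (simp add: local_op_mid ptranspose_left_op[unfolded One_nat_def] mid_op_kron_right'[unfolded One_nat_def] numeral_2_eq_2)
      then show ?thesis by - (rule exI[of _ 0], rule exI[of _ "\<lambda>k. e k * c"], rule exI[of _ "\<lambda>k. kron (K k) (1\<^sub>m c)"], assumption)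
    next
      case 2
      have "?g 0 (\<lambda>k. a * e k) (\<lambda>k. kron (1\<^sub>m a) (map_mat cnj (K k)))"
        using K measurement_kron_left[OF measurement_cnj[OF M], of a] pos unfolding 2
        by (simp add: local_op_mid ptranspose_mid_op[unfolded One_nat_def] mid_op_kron_left[unfolded One_nat_def] numeral_2_eq_2)
      then show ?thesis by - (rule exI[of _ 0], rule exI[of _ "\<lambda>k. a * e k"], rule exI[of _ "\<lambda>k. kron (1\<^sub>m a) (map_mat cnj (K k))"], assumption)
    next
      case 3
      have "?g 1 e K"
        using K M unfolding 3 by (simp add: local_op_mid ptranspose_right_op[unfolded One_nat_def] numeral_2_eq_2)
      then show ?thesis by - (rule exI[of _ 1], rule exI[of _ e], rule exI[of _ K], assumption)
    qed
  qed
  then show ?thesis by (simp add: numeral_2_eq_2)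
qed

section \<open>Local preparation of the other input\<close>

lemma asymptotic_rate_mono:
  assumes "\<And>\<epsilon> n m. P \<epsilon> n m \<Longrightarrow> Q \<epsilon> n m"
  shows "asymptotic_rate P \<le> asymptotic_rate Q"
  unfolding asymptotic_rate_def using assms
  by (intro INF_mono' Limsup_mono always_eventually allI SUP_subset_mono) auto

text \<open>Kraus operators that attach the state \<open>T\<close> to a system of dimension \<open>d\<close>, where \<open>f\<close> and \<open>g\<close>
  read off the two components of an index of the composite system.\<close>

lemma attach_kraus:
  assumes T: "density s T" and fg: "\<And>i. i < N \<Longrightarrow> f i < d \<and> g i < s"
    and sum: "\<And>h :: nat \<Rightarrow> nat \<Rightarrow> complex. (\<Sum>i<N. h (f i) (g i)) = (\<Sum>u<d. \<Sum>j<s. h u j)"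
  obtains K where "\<And>k. K k \<in> carrier_mat N d" "kraus {..<d} {..<s} (\<lambda>_. {..<N}) (\<lambda>k. fn (K k))"
    "\<And>i i' u u'. \<lbrakk>i < N; i' < N; u < d; u' < d\<rbrakk> \<Longrightarrow>
      (\<Sum>k<s. K k $$ (i, u) * cnj (K k $$ (i', u'))) = (if f i = u \<and> f i' = u' then T $$ (g i, g i') else 0)"
proof -
  have pT: "pos {..<s} (fn T)" and tT: "tr {..<s} (fn T) = 1" using T by (auto simp: density_fn)
  define p where "p = evl {..<s} (fn T)"
  define v where "v = evc {..<s} (fn T)"
  have sp: "spec {..<s} p v (fn T)" unfolding p_def v_def by (rule spec_evl_evc[OF _ pos_herm[OF _ pT]]) auto
  have p0: "0 \<le> p k" if "k < s" for k using spec_pos_nonneg[OF _ sp pT, of k] that by simp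
  \<comment> \<open>\<open>K k\<close> attaches the eigenvector \<open>v k\<close> of
    \<open>T\<close> scaled by the root of its eigenvalue, so that forgetting the outcome leaves
    \<open>T\<close>.\<close>
  define K where "K k = mat N d (\<lambda>(i, u). if f i = u then of_real (sqrt (p k)) * v k (g i) else 0)" for k
  have K: "K k \<in> carrier_mat N d" for k by (simp add: K_def)
  have Ki: "K k $$ (i, u) = (if f i = u then of_real (sqrt (p k)) * v k (g i) else 0)" if "i < N" "u < d" for k i u
    using that by (simp add: K_def)
  have sq: "complex_of_real (sqrt (p k)) * of_real (sqrt (p k)) = of_real (p k)" if "k < s" for k
    using p0[OF that] by (simp flip: of_real_mult)
  have c: "kraus {..<d} {..<s} (\<lambda>_. {..<N}) (\<lambda>k. fn (K k))"
    unfolding kraus_def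
  proof (intro ballI)
    fix x y assume xy: "x \<in> {..<d}" "y \<in> {..<d}"
    have "(\<Sum>z<N. cnj (fn (K k) z x) * fn (K k) z y) = (if x = y then of_real (p k) else 0)" if k: "k < s" for k
    proof -
      let ?h = "\<lambda>u j. if u = x then if x = y then of_real (p k) * (cnj (v k j) * v k j) else 0 else 0"
      have "(\<Sum>z<N. cnj (fn (K k) z x) * fn (K k) z y) = (\<Sum>z<N. ?h (f z) (g z))"
        using xy sq[OF k] by (intro sum.cong refl) (auto simp: fn_def Ki mult_ac)
      also have "... = (\<Sum>u<d. \<Sum>j<s. ?h u j)" by (rule sum)
      also have "... = (\<Sum>u<d. if u = x then if x = y then \<Sum>j<s. of_real (p k) * (cnj (v k j) * v k j) else 0 else 0)"
        by (intro sum.cong refl) simp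
      also have "... = (if x = y then of_real (p k) * inn {..<s} (v k) (v k) else 0)"
        using xy by (simp add: inn_def sum_distrib_left)
      also have "inn {..<s} (v k) (v k) = 1" using sp k by (simp add: spec_def onb_def)
      finally show ?thesis by simp
    qed
    then have "(\<Sum>k<s. \<Sum>z<N. cnj (fn (K k) z x) * fn (K k) z y) = (if x = y then of_real (\<Sum>k<s. p k) else 0)" by simp
    also have "of_real (\<Sum>k<s. p k) = (1 :: complex)" using spec_trace[OF sp] tT by simp
    finally show "(\<Sum>k<s. \<Sum>z<N. cnj (fn (K k) z x) * fn (K k) z y) = (if x = y then 1 else 0)" .
  qed
  show thesis
  proof (rule that[OF K c])
    fix i i' u u' assume l: "i < N" "i' < N" "u < d" "u' < d"
    have "(\<Sum>k<s. K k $$ (i, u) * cnj (K k $$ (i', u')))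
      = (\<Sum>k<s. if f i = u \<and> f i' = u' then of_real (p k) * v k (g i) * cnj (v k (g i')) else 0)"
      using l sq by (intro sum.cong refl) (auto simp: Ki mult_ac)
    also have "... = (if f i = u \<and> f i' = u' then \<Sum>k<s. of_real (p k) * v k (g i) * cnj (v k (g i')) else 0)"
      by (cases "f i = u \<and> f i' = u'") (simp, simp only: if_False sum.neutral_const)
    also have "(\<Sum>k<s. of_real (p k) * v k (g i) * cnj (v k (g i'))) = T $$ (g i, g i')"
      using sp fg[OF l(1)] fg[OF l(2)] by (simp add: spec_def fn_def)
    finally show "(\<Sum>k<s. K k $$ (i, u) * cnj (K k $$ (i', u'))) = (if f i = u \<and> f i' = u' then T $$ (g i, g i') else 0)" .
  qed
qed

text \<open>Party \<open>q\<close> prepares \<open>T\<close> beside its system and continues with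
  \<Lambda> for every outcome. The maps \<open>f\<close> and \<open>g\<close> allow the prepared
  system to be interleaved with the given one, as it is among the copies in Charlie's hands.\<close>

lemma locc_attach:
  assumes l: "locc (ds[q := N]) ds' \<Lambda>" and q: "q < length ds" "ds ! q = d" and N: "0 < N"
    and T: "density s T" and fg: "\<And>i. i < N \<Longrightarrow> f i < d \<and> g i < s"
    and sum: "\<And>h :: nat \<Rightarrow> nat \<Rightarrow> complex. (\<Sum>i<N. h (f i) (g i)) = (\<Sum>u<d. \<Sum>j<s. h u j)"
    and PQ: "prod_list (take q ds) = P" "prod_list (drop (Suc q) ds) = Q"
    and X: "X \<in> sqmat (P * d * Q)" and Y: "Y \<in> sqmat (P * N * Q)"
    and XY: "\<And>x i z x' i' z'. \<lbrakk>x < P; i < N; z < Q; x' < P; i' < N; z' < Q\<rbrakk> \<Longrightarrow>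
        o3 N Q Y (x, i, z) (x', i', z') = o3 d Q X (x, f i, z) (x', f i', z') * T $$ (g i, g i')"
  shows "\<exists>\<Lambda>'. locc ds ds' \<Lambda>' \<and> \<Lambda>' X = \<Lambda> Y"
proof -
  obtain K where K: "\<And>k. K k \<in> carrier_mat N d" and c: "kraus {..<d} {..<s} (\<lambda>_. {..<N}) (\<lambda>k. fn (K k))"
    and KT: "\<And>i i' u u'. \<lbrakk>i < N; i' < N; u < d; u' < d\<rbrakk> \<Longrightarrow>
      (\<Sum>k<s. K k $$ (i, u) * cnj (K k $$ (i', u'))) = (if f i = u \<and> f i' = u' then T $$ (g i, g i') else 0)"
    by (rule attach_kraus[OF T fg sum]) (assumption, rule that, assumption+)
  let ?L = "\<lambda>k. mid_op P Q (K k)"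
  have n: "prod_list ds = P * d * Q" "prod_list (ds[q := N]) = P * N * Q"
    using prod_list_split[OF q(1)] prod_list_update[OF q(1), of N] q(2) PQ by auto
  have L: "local_op ds q (K k) = ?L k" for k using PQ by (simp add: local_op_mid)
  show ?thesis
  proof (intro exI conjI)
    show "locc ds ds' (\<lambda>X. mat_sum (prod_list ds') (\<lambda>k. (\<lambda>_. \<Lambda>) k (sandwich (local_op ds q (K k)) X)) {..<s})"
      using q N K c l by (intro locc_measurement[where e = "\<lambda>_. N"]) (auto simp: measurement_kraus)
    let ?F = "\<lambda>k. sandwich (?L k) X"
    have F: "?F k \<in> sqmat (P * N * Q)" for k by (rule sandwich_carrier[OF mid_op_carrier[OF K] X])
    have "Y = mat_sum (P * N * Q) ?F {..<s}"
    proof (rule o3_eqI[OF Y])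
      fix x i z x' i' z' assume b: "x < P" "i < N" "z < Q" "x' < P" "i' < N" "z' < Q"
      have ij: "(x * N + i) * Q + z < P * N * Q" "(x' * N + i') * Q + z' < P * N * Q" using b by (auto intro!: pair_less)
      let ?G = "\<lambda>r t. o3 d Q X (x, r, z) (x', t, z')"
      have "o3 N Q (mat_sum (P * N * Q) ?F {..<s}) (x, i, z) (x', i', z') = (\<Sum>k<s. o3 N Q (?F k) (x, i, z) (x', i', z'))"
        by (simp only: o3_def fst_conv snd_conv mat_sum_index[OF ij])
      also have "... = (\<Sum>k<s. \<Sum>r<d. \<Sum>t<d. K k $$ (i, r) * ?G r t * cnj (K k $$ (i', t)))"
        using b by (simp only: sandwich_mid_op[OF K X])
      also have "... = (\<Sum>r<d. \<Sum>t<d. \<Sum>k<s. K k $$ (i, r) * ?G r t * cnj (K k $$ (i', t)))"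
        by (rule sum.swap[THEN trans]) (intro sum.cong refl sum.swap)
      also have "... = (\<Sum>r<d. \<Sum>t<d. ?G r t * (\<Sum>k<s. K k $$ (i, r) * cnj (K k $$ (i', t))))"
        by (simp add: sum_distrib_left mult_ac)
      also have "... = (\<Sum>r<d. \<Sum>t<d. if t = f i' then if r = f i then ?G r t * T $$ (g i, g i') else 0 else 0)"
        using b by (intro sum.cong refl) (auto simp: KT)
      also have "... = ?G (f i) (f i') * T $$ (g i, g i')" using fg[OF b(2)] fg[OF b(5)] by simp
      finally show "o3 N Q Y (x, i, z) (x', i', z') = o3 N Q (mat_sum (P * N * Q) ?F {..<s}) (x, i, z) (x', i', z')"
        using XY[OF b] by simp
    qed simp
    then have "\<Lambda> Y = \<Lambda> (mat_sum (prod_list (ds[q := N])) ?F {..<s})" by (simp add: n)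
    also have "... = mat_sum (prod_list ds') (\<lambda>k. \<Lambda> (?F k)) {..<s}" by (rule locc_mat_sum[OF l]) (use F in \<open>simp add: n\<close>)
    finally show "mat_sum (prod_list ds') (\<lambda>k. (\<lambda>_. \<Lambda>) k (sandwich (local_op ds q (K k)) X)) {..<s} = \<Lambda> Y"
      by (simp add: L)
  qed
qed

text \<open>The two components of an index of \<open>n\<close> copies of a system of dimension \<open>p * q\<close>.\<close>

fun splitL :: "nat \<Rightarrow> nat \<Rightarrow> nat \<Rightarrow> nat \<Rightarrow> nat" where
  "splitL p q 0 c = 0"
| "splitL p q (Suc n) c = (c div (p * q) ^ n div q) * p ^ n + splitL p q n (c mod (p * q) ^ n)"

fun splitR :: "nat \<Rightarrow> nat \<Rightarrow> nat \<Rightarrow> nat \<Rightarrow> nat" where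
  "splitR p q 0 c = 0"
| "splitR p q (Suc n) c = (c div (p * q) ^ n mod q) * q ^ n + splitR p q n (c mod (p * q) ^ n)"

lemma split_less: "c < (p * q) ^ n \<Longrightarrow> splitL p q n c < p ^ n \<and> splitR p q n c < q ^ n"
proof (induction n arbitrary: c)
  case (Suc n)
  then have "c mod (p * q) ^ n < (p * q) ^ n" "c div (p * q) ^ n < p * q"
    using div_less_pair[of c "p * q" "(p * q) ^ n"] mod_less_pair[of c "p * q" "(p * q) ^ n"] by simp_all
  then show ?case
    using Suc.IH[of "c mod (p * q) ^ n"] div_less_pair[of "c div (p * q) ^ n" p q] mod_less_pair[of "c div (p * q) ^ n" p q]
      pair_less[of _ p _ "p ^ n"] pair_less[of _ q _ "q ^ n"] by simp
qed simp

text \<open>That \<open>splitL\<close> and \<open>splitR\<close> together enumerate all pairs once,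
  in the summation form in which \<open>locc_attach\<close> expects it.\<close>

lemma sum_split:
  fixes h :: "nat \<Rightarrow> nat \<Rightarrow> 'a :: comm_monoid_add"
  shows "(\<Sum>c<(p * q) ^ n. h (splitL p q n c) (splitR p q n c)) = (\<Sum>u<p ^ n. \<Sum>v<q ^ n. h u v)"
proof (induction n arbitrary: h)
  case (Suc n)
  let ?C = "(p * q) ^ n"
  have "(\<Sum>c<p * q * ?C. h (splitL p q (Suc n) c) (splitR p q (Suc n) c))
    = (\<Sum>i<p * q. \<Sum>j<?C. h (i div q * p ^ n + splitL p q n j) (i mod q * q ^ n + splitR p q n j))"
    unfolding sum_pair[of _ "p * q" ?C] by (intro sum.cong refl) (simp add: pair_div)
  also have "... = (\<Sum>i<p * q. \<Sum>u<p ^ n. \<Sum>v<q ^ n. h (i div q * p ^ n + u) (i mod q * q ^ n + v))"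
    by (intro sum.cong refl Suc.IH)
  also have "... = (\<Sum>x<p. \<Sum>y<q. \<Sum>u<p ^ n. \<Sum>v<q ^ n. h (x * p ^ n + u) (y * q ^ n + v))"
    unfolding sum_pair by (intro sum.cong refl) simp
  also have "... = (\<Sum>x<p. \<Sum>u<p ^ n. \<Sum>y<q. \<Sum>v<q ^ n. h (x * p ^ n + u) (y * q ^ n + v))"
    by (intro sum.cong refl sum.swap)
  also have "... = (\<Sum>u<p ^ Suc n. \<Sum>v<q ^ Suc n. h u v)" by (simp add: sum_pair)
  finally show ?case by simp
qed simp

section \<open>Copies of the repeater's input\<close>

lemma party_power3_carrier: "party_power [a, c, b] X n \<in> sqmat (a ^ n * c ^ n * b ^ n)"
proof (cases n)
  case (Suc k)
  then show ?thesis using party_tensor3_carrier[of a c b "a ^ k" "c ^ k" "b ^ k"] by simp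
qed simp

lemma o3_kron:
  assumes \<rho>: "\<rho> \<in> sqmat (a * p)" and \<rho>': "\<rho>' \<in> sqmat (q * b)"
    and l: "x < a" "c < p * q" "y < b" "x' < a" "c' < p * q" "y' < b"
  shows "o3 (p * q) b (kron \<rho> \<rho>') (x, c, y) (x', c', y')
    = o2 p \<rho> (x, c div q) (x', c' div q) * o2 b \<rho>' (c mod q, y) (c' mod q, y')"
proof -
  have e: "(x * (p * q) + c) * b + y = (x * p + c div q) * (q * b) + ((c mod q) * b + y)" for x c y
  proof -
    have "(x * (p * q) + c) * b + y = (x * (p * q) + (c div q * q + c mod q)) * b + y" by simp
    then show ?thesis by (simp only: algebra_simps)
  qed
  have "x * p + c div q < a * p" "x' * p + c' div q < a * p" "c mod q * b + y < q * b" "c' mod q * b + y' < q * b"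
    using l by (auto intro!: pair_less div_less_pair mod_less_pair)
  then show ?thesis unfolding o3_def o2_def fst_conv snd_conv e by (intro kron_index[OF \<rho> \<rho>'])
qed

text \<open>In the copies of the joint input Charlie's digits alternate between the two states;
  sorting them with \<open>splitL\<close> and \<open>splitR\<close> recovers the product of the two
  powers.\<close>

lemma o3_party_power_kron:
  assumes \<rho>: "\<rho> \<in> sqmat (a * p)" and \<rho>': "\<rho>' \<in> sqmat (q * b)"
  shows "\<lbrakk>x < a ^ n; c < (p * q) ^ n; y < b ^ n; x' < a ^ n; c' < (p * q) ^ n; y' < b ^ n\<rbrakk> \<Longrightarrow>
    o3 ((p * q) ^ n) (b ^ n) (party_power [a, p * q, b] (kron \<rho> \<rho>') n) (x, c, y) (x', c', y')
    = o2 (p ^ n) (party_power [a, p] \<rho> n) (x, splitL p q n c) (x', splitL p q n c')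
      * o2 (b ^ n) (party_power [q, b] \<rho>' n) (splitR p q n c, y) (splitR p q n c', y')"
proof (induction n arbitrary: x c y x' c' y')
  case 0
  then show ?case by (simp add: o3_def o2_def)
next
  case (Suc n)
  let ?C = "(p * q) ^ n"
  have d: "x div a ^ n < a" "c div ?C < p * q" "y div b ^ n < b" "x' div a ^ n < a" "c' div ?C < p * q" "y' div b ^ n < b"
    and m: "x mod a ^ n < a ^ n" "c mod ?C < ?C" "y mod b ^ n < b ^ n" "x' mod a ^ n < a ^ n" "c' mod ?C < ?C" "y' mod b ^ n < b ^ n"
    using Suc.prems by (auto intro: div_less_pair mod_less_pair)
  have sl: "splitL p q (Suc n) c div p ^ n = c div ?C div q" "splitL p q (Suc n) c mod p ^ n = splitL p q n (c mod ?C)"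
    "splitR p q (Suc n) c div q ^ n = c div ?C mod q" "splitR p q (Suc n) c mod q ^ n = splitR p q n (c mod ?C)"
    if "c mod ?C < ?C" for c
    using split_less[OF that] by (simp_all add: pair_div)
  have "o3 ((p * q) * ?C) (b * b ^ n) (party_power [a, p * q, b] (kron \<rho> \<rho>') (Suc n)) (x, c, y) (x', c', y')
    = o3 (p * q) b (kron \<rho> \<rho>') (x div a ^ n, c div ?C, y div b ^ n) (x' div a ^ n, c' div ?C, y' div b ^ n)
      * o3 ?C (b ^ n) (party_power [a, p * q, b] (kron \<rho> \<rho>') n) (x mod a ^ n, c mod ?C, y mod b ^ n) (x' mod a ^ n, c' mod ?C, y' mod b ^ n)"
    using Suc.prems o3_party_tensor[of "(x, c, y)" a "a ^ n" "p * q" ?C b "b ^ n" "(x', c', y')"] by simp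
  also have "... = o2 p \<rho> (x div a ^ n, c div ?C div q) (x' div a ^ n, c' div ?C div q)
      * o2 b \<rho>' (c div ?C mod q, y div b ^ n) (c' div ?C mod q, y' div b ^ n)
      * (o2 (p ^ n) (party_power [a, p] \<rho> n) (x mod a ^ n, splitL p q n (c mod ?C)) (x' mod a ^ n, splitL p q n (c' mod ?C))
      * o2 (b ^ n) (party_power [q, b] \<rho>' n) (splitR p q n (c mod ?C), y mod b ^ n) (splitR p q n (c' mod ?C), y' mod b ^ n))"
    unfolding o3_kron[OF \<rho> \<rho>' d] Suc.IH[OF m] ..
  also have "... = o2 (p ^ Suc n) (party_power [a, p] \<rho> (Suc n)) (x, splitL p q (Suc n) c) (x', splitL p q (Suc n) c')
      * o2 (b ^ Suc n) (party_power [q, b] \<rho>' (Suc n)) (splitR p q (Suc n) c, y) (splitR p q (Suc n) c', y')"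
  proof -
    have P: "(x, splitL p q (Suc n) c) \<in> ix2 (a ^ Suc n) (p ^ Suc n)" "(x', splitL p q (Suc n) c') \<in> ix2 (a ^ Suc n) (p ^ Suc n)"
      "(splitR p q (Suc n) c, y) \<in> ix2 (q ^ Suc n) (b ^ Suc n)" "(splitR p q (Suc n) c', y') \<in> ix2 (q ^ Suc n) (b ^ Suc n)"
      using Suc.prems split_less[of c p q "Suc n"] split_less[of c' p q "Suc n"] by blast+
    show ?thesis
      unfolding o2_party_power_Suc[OF P(1,2)] o2_party_power_Suc[OF P(3,4)] fst_conv snd_conv sl[OF m(2)] sl[OF m(5)] by (simp only: mult_ac)
  qed
  finally show ?case by simp
qed

lemma o2_party_power_ptranspose1:
  "\<lbrakk>x < a ^ n; y < b ^ n; x' < a ^ n; y' < b ^ n\<rbrakk> \<Longrightarrow>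
    o2 (b ^ n) (party_power [a, b] (ptranspose [a, b] 1 \<rho>) n) (x, y) (x', y') = o2 (b ^ n) (party_power [a, b] \<rho> n) (x, y') (x', y)"
proof (induction n arbitrary: x y x' y')
  case 0
  then show ?case by (simp add: o2_def)
next
  case (Suc n)
  then have "x div a ^ n < a" "y div b ^ n < b" "x' div a ^ n < a" "y' div b ^ n < b"
    "x mod a ^ n < a ^ n" "y mod b ^ n < b ^ n" "x' mod a ^ n < a ^ n" "y' mod b ^ n < b ^ n"
    by (auto intro: div_less_pair mod_less_pair)
  note l = this
  have P: "(u, v) \<in> ix2 (a ^ Suc n) (b ^ Suc n)" if "u \<in> {x, x'}" "v \<in> {y, y'}" for u v
    using Suc.prems that by blast
  show ?case
    unfolding o2_party_power_Suc[OF P P, OF insertI1 insertI1 insertI2[OF singletonI] insertI2[OF singletonI]]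
      o2_party_power_Suc[OF P P, OF insertI1 insertI2[OF singletonI] insertI2[OF singletonI] insertI1]
      fst_conv snd_conv o2_ptranspose1[OF l(1-4)] Suc.IH[OF l(5-8)] ..
qed

lemma o2_party_power_ptranspose0:
  "\<lbrakk>x < a ^ n; y < b ^ n; x' < a ^ n; y' < b ^ n\<rbrakk> \<Longrightarrow>
    o2 (b ^ n) (party_power [a, b] (ptranspose [a, b] 0 \<rho>) n) (x, y) (x', y') = o2 (b ^ n) (party_power [a, b] \<rho> n) (x', y) (x, y')"
proof (induction n arbitrary: x y x' y')
  case 0
  then show ?case by (simp add: o2_def)
next
  case (Suc n)
  then have "x div a ^ n < a" "y div b ^ n < b" "x' div a ^ n < a" "y' div b ^ n < b"
    "x mod a ^ n < a ^ n" "y mod b ^ n < b ^ n" "x' mod a ^ n < a ^ n" "y' mod b ^ n < b ^ n"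
    by (auto intro: div_less_pair mod_less_pair)
  note l = this
  have P: "(u, v) \<in> ix2 (a ^ Suc n) (b ^ Suc n)" if "u \<in> {x, x'}" "v \<in> {y, y'}" for u v
    using Suc.prems that by blast
  show ?case
    unfolding o2_party_power_Suc[OF P P, OF insertI1 insertI1 insertI2[OF singletonI] insertI2[OF singletonI]]
      o2_party_power_Suc[OF P P, OF insertI2[OF singletonI] insertI1 insertI1 insertI2[OF singletonI]]
      fst_conv snd_conv o2_ptranspose0[OF l(1-4)] Suc.IH[OF l(5-8)] ..
qed

lemma one_less_two: "(1::nat) < 2" and zero_less_two: "(0::nat) < 2" by simp_all

text \<open>Partial transposition fixes the diagonal and with it the trace; positivity is the PPT
  condition.\<close>

lemma ppt_density:
  assumes "ppt_state [a, b] p \<rho>" "p < 2" shows "density (a * b) \<rho>" "density (a * b) (ptranspose [a, b] p \<rho>)"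
proof -
  show d: "density (a * b) \<rho>" using assms by (simp add: ppt_state_def)
  have "p = 0 \<or> p = 1" using assms by auto
  then have "tr (ix2 a b) (o2 b (ptranspose [a, b] p \<rho>)) = tr (ix2 a b) (o2 b \<rho>)"
    unfolding tr_def by (intro sum.cong refl) (auto simp: o2_ptranspose0 o2_ptranspose1 simp del: One_nat_def)
  then show "density (a * b) (ptranspose [a, b] p \<rho>)"
    using d pos_o2 assms by (auto simp: density_o2 ppt_state_def psd_pos)
qed

lemma density_dim_pos: "density (a * b) \<rho> \<Longrightarrow> 0 < a \<and> 0 < b"
  by (auto simp: density_o2 tr_def intro!: Nat.gr0I)

text \<open>For each number of copies a repeater protocol is turned into a distillation protocol
  with exactly the same output, so achievability carries over with the same \<epsilon>,
  \<open>n\<close> and \<open>m\<close>, and monotonicity of the rate suffices.\<close>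

lemma key_repeater_rate_le:
  assumes \<rho>: "ppt_state [a, p] 1 \<rho>" and \<rho>': "ppt_state [q, b] 0 \<rho>'"
  shows "key_repeater_rate a (p * q) b (kron \<rho> \<rho>') \<le> distillable_key a p (ptranspose [a, p] 1 \<rho>)"
    and "key_repeater_rate a (p * q) b (kron \<rho> \<rho>') \<le> distillable_key q b (ptranspose [q, b] 0 \<rho>')"
proof -
  note d = ppt_density[OF \<rho> one_less_two] and d' = ppt_density[OF \<rho>' zero_less_two]
  have pos: "0 < a" "0 < p" "0 < q" "0 < b" using density_dim_pos[OF d(1)] density_dim_pos[OF d'(1)] by auto
  have c: "\<rho> \<in> sqmat (a * p)" "\<rho>' \<in> sqmat (q * b)" using d(1) d'(1) by (auto simp: density_fn)
  let ?R = "\<lambda>n. party_power [a, p] (ptranspose [a, p] 1 \<rho>) n" and ?R' = "\<lambda>n. party_power [q, b] (ptranspose [q, b] 0 \<rho>') n"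
    and ?W = "\<lambda>n. party_power [a, p * q, b] (kron \<rho> \<rho>') n"
  \<comment> \<open>Transposing Charlie's whole system keeps the product form: the factors are the
    powers of the two transposed states, both density operators.\<close>
  have W: "o3 ((p * q) ^ n) (b ^ n) (ptranspose [a ^ n, (p * q) ^ n, b ^ n] 1 (?W n)) (x, k, y) (x', k', y')
      = o2 (p ^ n) (?R n) (x, splitL p q n k) (x', splitL p q n k') * o2 (b ^ n) (?R' n) (splitR p q n k, y) (splitR p q n k', y')"
    if "x < a ^ n" "k < (p * q) ^ n" "y < b ^ n" "x' < a ^ n" "k' < (p * q) ^ n" "y' < b ^ n" for n x k y x' k' y'
    using that split_less[of k p q n] split_less[of k' p q n]
    by (simp only: o3_ptranspose1 o3_party_power_kron[OF c] o2_party_power_ptranspose1 o2_party_power_ptranspose0)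
  have Tc: "ptranspose [a ^ n, (p * q) ^ n, b ^ n] 1 (?W n) \<in> sqmat (a ^ n * (p * q) ^ n * b ^ n)" for n
    by (simp add: ptranspose_def mult.assoc)
  have pn: "0 < a ^ n" "0 < (p * q) ^ n" "0 < b ^ n" for n using pos by simp_all
  show "key_repeater_rate a (p * q) b (kron \<rho> \<rho>') \<le> distillable_key a p (ptranspose [a, p] 1 \<rho>)"
    unfolding key_repeater_rate_def distillable_key_def
  proof (rule asymptotic_rate_mono, elim exE conjE)
    fix \<epsilon> n m \<Lambda> a' c' b' \<gamma> assume l: "locc [a ^ n, (p * q) ^ n, b ^ n] [2 ^ m * a', c', 2 ^ m * b'] \<Lambda>"
      and \<gamma>: "private_state m a' b' \<gamma>"
      and n: "trace_norm (ptrace [2 ^ m * a', c', 2 ^ m * b'] 1 (\<Lambda> (?W n)) - \<gamma>) \<le> \<epsilon>"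
    let ?C = "(p * q) ^ n" and ?A = "a ^ n" and ?B = "b ^ n"
    from locc_merge_right[OF l pn] obtain \<Lambda>1 where l1: "locc [?A, ?C * ?B] [2 ^ m * a', 2 ^ m * b'] \<Lambda>1"
      and e1: "simulates \<Lambda>1 ?A ?C ?B \<Lambda> (2 ^ m * a') c' (2 ^ m * b')" by blast
    have l1': "locc ([?A, p ^ n][1 := ?C * ?B]) [2 ^ m * a', 2 ^ m * b'] \<Lambda>1" using l1 by simp
    \<comment> \<open>An index of Charlie and Bob together: \<open>f\<close> extracts Charlie's part
      of the first input, while \<open>g\<close> joins his part of the second with Bob's index to an
      index of the state to be prepared.\<close>
    have fg: "splitL p q n (i div ?B) < p ^ n \<and> splitR p q n (i div ?B) * ?B + i mod ?B < q ^ n * ?B" if "i < ?C * ?B" for i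
      using split_less[OF div_less_pair[OF that]] mod_less_pair[OF that] by (auto intro: pair_less)
    have s: "(\<Sum>i<?C * ?B. h (splitL p q n (i div ?B)) (splitR p q n (i div ?B) * ?B + i mod ?B)) = (\<Sum>u<p ^ n. \<Sum>j<q ^ n * ?B. h u j)"
      for h :: "nat \<Rightarrow> nat \<Rightarrow> complex"
    proof -
      have "(\<Sum>i<?C * ?B. h (splitL p q n (i div ?B)) (splitR p q n (i div ?B) * ?B + i mod ?B))
        = (\<Sum>k<?C. \<Sum>y<?B. h (splitL p q n k) (splitR p q n k * ?B + y))"
        unfolding sum_pair by (intro sum.cong refl) (simp add: pair_div)
      also have "... = (\<Sum>u<p ^ n. \<Sum>v<q ^ n. \<Sum>y<?B. h u (v * ?B + y))" by (rule sum_split)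
      finally show ?thesis by (simp only: sum_pair)
    qed
    have pre: "1 < length [?A, p ^ n]" "[?A, p ^ n] ! 1 = p ^ n" "0 < ?C * ?B"
      "prod_list (take 1 [?A, p ^ n]) = ?A" "prod_list (drop (Suc 1) [?A, p ^ n]) = 1"
      using pos by simp_all
    have XY: "o3 (?C * ?B) 1 (ptranspose [?A, ?C, ?B] 1 (?W n)) (x, i, z) (x', i', z')
        = o3 (p ^ n) 1 (?R n) (x, splitL p q n (i div ?B), z) (x', splitL p q n (i' div ?B), z')
          * ?R' n $$ (splitR p q n (i div ?B) * ?B + i mod ?B, splitR p q n (i' div ?B) * ?B + i' mod ?B)"
      if b: "x < ?A" "i < ?C * ?B" "z < 1" "x' < ?A" "i' < ?C * ?B" "z' < 1" for x i z x' i' z'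
    proof -
      have "o3 (?C * ?B) 1 (ptranspose [?A, ?C, ?B] 1 (?W n)) (x, i, z) (x', i', z')
        = o3 ?C ?B (ptranspose [?A, ?C, ?B] 1 (?W n)) (x, i div ?B, i mod ?B) (x', i' div ?B, i' mod ?B)"
        using b by (simp add: o3_def add_mult_distrib mult.assoc add.assoc div_mult_mod_eq)
      also have "... = o2 (p ^ n) (?R n) (x, splitL p q n (i div ?B)) (x', splitL p q n (i' div ?B))
          * o2 ?B (?R' n) (splitR p q n (i div ?B), i mod ?B) (splitR p q n (i' div ?B), i' mod ?B)"
        using b by (intro W) (auto intro: div_less_pair mod_less_pair)
      finally show ?thesis
        using b by (simp add: o3_def o2_def)
    qed
    have Xc: "?R n \<in> sqmat (?A * p ^ n * 1)"
      and Yc: "ptranspose [?A, ?C, ?B] 1 (?W n) \<in> sqmat (?A * (?C * ?B) * 1)"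
      using Tc[of n] party_power_carrier by (simp_all add: mult.assoc)
    from locc_attach[OF l1' pre(1-3) density_power[OF d'(2)] fg s pre(4,5) Xc Yc XY] obtain \<Lambda>2
      where l2: "locc [?A, p ^ n] [2 ^ m * a', 2 ^ m * b'] \<Lambda>2" and "\<Lambda>2 (?R n) = \<Lambda>1 (ptranspose [?A, ?C, ?B] 1 (?W n))" by blast
    note this(2)
    also have "... = ptrace [2 ^ m * a', c', 2 ^ m * b'] 1 (\<Lambda> (?W n))" using e1 party_power3_carrier unfolding simulates_def by blast
    finally show "\<exists>\<Lambda> a' b' \<gamma>. locc [?A, p ^ n] [2 ^ m * a', 2 ^ m * b'] \<Lambda> \<and> private_state m a' b' \<gamma> \<and> trace_norm (\<Lambda> (?R n) - \<gamma>) \<le> \<epsilon>"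
      using l2 \<gamma> n by (intro exI conjI) (assumption, assumption, simp only:)
  qed
  show "key_repeater_rate a (p * q) b (kron \<rho> \<rho>') \<le> distillable_key q b (ptranspose [q, b] 0 \<rho>')"
    unfolding key_repeater_rate_def distillable_key_def
  proof (rule asymptotic_rate_mono, elim exE conjE)
    fix \<epsilon> n m \<Lambda> a' c' b' \<gamma> assume l: "locc [a ^ n, (p * q) ^ n, b ^ n] [2 ^ m * a', c', 2 ^ m * b'] \<Lambda>"
      and \<gamma>: "private_state m a' b' \<gamma>"
      and n: "trace_norm (ptrace [2 ^ m * a', c', 2 ^ m * b'] 1 (\<Lambda> (?W n)) - \<gamma>) \<le> \<epsilon>"
    let ?C = "(p * q) ^ n" and ?A = "a ^ n" and ?B = "b ^ n"
    from locc_merge_left[OF l pn] obtain \<Lambda>1 where l1: "locc [?A * ?C, ?B] [2 ^ m * a', 2 ^ m * b'] \<Lambda>1"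
      and e1: "simulates \<Lambda>1 ?A ?C ?B \<Lambda> (2 ^ m * a') c' (2 ^ m * b')" by blast
    have l1': "locc ([q ^ n, ?B][0 := ?A * ?C]) [2 ^ m * a', 2 ^ m * b'] \<Lambda>1" using l1 by simp
    \<comment> \<open>With Alice as Charlie's partner the roles are exchanged: \<open>f\<close>
      keeps Charlie's part of the second input, and the power of the first transposed state is
      prepared on Alice's index and the rest of Charlie's.\<close>
    have fg: "splitR p q n (i mod ?C) < q ^ n \<and> (i div ?C) * p ^ n + splitL p q n (i mod ?C) < ?A * p ^ n" if "i < ?A * ?C" for i
      using split_less[OF mod_less_pair[OF that]] div_less_pair[OF that] by (auto intro: pair_less)
    have s: "(\<Sum>i<?A * ?C. h (splitR p q n (i mod ?C)) ((i div ?C) * p ^ n + splitL p q n (i mod ?C))) = (\<Sum>u<q ^ n. \<Sum>j<?A * p ^ n. h u j)"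
      for h :: "nat \<Rightarrow> nat \<Rightarrow> complex"
    proof -
      have "(\<Sum>i<?A * ?C. h (splitR p q n (i mod ?C)) ((i div ?C) * p ^ n + splitL p q n (i mod ?C)))
        = (\<Sum>x<?A. \<Sum>k<?C. h (splitR p q n k) (x * p ^ n + splitL p q n k))"
        unfolding sum_pair by (intro sum.cong refl) (simp add: pair_div)
      also have "... = (\<Sum>x<?A. \<Sum>u<p ^ n. \<Sum>v<q ^ n. h v (x * p ^ n + u))" by (intro sum.cong refl sum_split)
      also have "... = (\<Sum>j<?A * p ^ n. \<Sum>v<q ^ n. h v j)" by (simp only: sum_pair)
      also have "... = (\<Sum>u<q ^ n. \<Sum>j<?A * p ^ n. h u j)" by (rule sum.swap)
      finally show ?thesis .
    qed
    have pre: "0 < length [q ^ n, ?B]" "[q ^ n, ?B] ! 0 = q ^ n" "0 < ?A * ?C"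
      "prod_list (take 0 [q ^ n, ?B]) = 1" "prod_list (drop (Suc 0) [q ^ n, ?B]) = ?B"
      using pos by simp_all
    have XY: "o3 (?A * ?C) ?B (ptranspose [?A, ?C, ?B] 1 (?W n)) (x, i, z) (x', i', z')
        = o3 (q ^ n) ?B (?R' n) (x, splitR p q n (i mod ?C), z) (x', splitR p q n (i' mod ?C), z')
          * ?R n $$ ((i div ?C) * p ^ n + splitL p q n (i mod ?C), (i' div ?C) * p ^ n + splitL p q n (i' mod ?C))"
      if b: "x < 1" "i < ?A * ?C" "z < ?B" "x' < 1" "i' < ?A * ?C" "z' < ?B" for x i z x' i' z'
    proof -
      have "o3 (?A * ?C) ?B (ptranspose [?A, ?C, ?B] 1 (?W n)) (x, i, z) (x', i', z')
        = o3 ?C ?B (ptranspose [?A, ?C, ?B] 1 (?W n)) (i div ?C, i mod ?C, z) (i' div ?C, i' mod ?C, z')"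
        using b by (simp add: o3_def div_mult_mod_eq)
      also have "... = o2 (p ^ n) (?R n) (i div ?C, splitL p q n (i mod ?C)) (i' div ?C, splitL p q n (i' mod ?C))
          * o2 ?B (?R' n) (splitR p q n (i mod ?C), z) (splitR p q n (i' mod ?C), z')"
        using b by (intro W) (auto intro: div_less_pair mod_less_pair)
      finally show ?thesis
        using b by (simp add: o3_def o2_def mult.commute)
    qed
    have Xc: "?R' n \<in> sqmat (1 * q ^ n * ?B)"
      and Yc: "ptranspose [?A, ?C, ?B] 1 (?W n) \<in> sqmat (1 * (?A * ?C) * ?B)"
      using Tc[of n] party_power_carrier by simp_all
    from locc_attach[OF l1' pre(1-3) density_power[OF d(2)] fg s pre(4,5) Xc Yc XY] obtain \<Lambda>2
      where l2: "locc [q ^ n, ?B] [2 ^ m * a', 2 ^ m * b'] \<Lambda>2" and "\<Lambda>2 (?R' n) = \<Lambda>1 (ptranspose [?A, ?C, ?B] 1 (?W n))" by blast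
    note this(2)
    also have "... = ptrace [2 ^ m * a', c', 2 ^ m * b'] 1 (\<Lambda> (?W n))" using e1 party_power3_carrier unfolding simulates_def by blast
    finally show "\<exists>\<Lambda> a' b' \<gamma>. locc [q ^ n, ?B] [2 ^ m * a', 2 ^ m * b'] \<Lambda> \<and> private_state m a' b' \<gamma> \<and> trace_norm (\<Lambda> (?R' n) - \<gamma>) \<le> \<epsilon>"
      using l2 \<gamma> n by (intro exI conjI) (assumption, assumption, simp only:)
  qed
qed

theorem theorem13:
  fixes dA dCA dCB dB :: nat and \<rho> \<rho>' :: "complex mat"
  assumes "ppt_state [dA, dCA] 1 \<rho>" and "ppt_state [dCB, dB] 0 \<rho>'"
  shows "key_repeater_rate dA (dCA * dCB) dB (kron \<rho> \<rho>')
           \<le> min (distillable_key dA dCA (ptranspose [dA, dCA] 1 \<rho>))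
                 (distillable_key dCB dB (ptranspose [dCB, dB] 0 \<rho>'))
       \<and> min (distillable_key dA dCA (ptranspose [dA, dCA] 1 \<rho>))
             (distillable_key dCB dB (ptranspose [dCB, dB] 0 \<rho>'))
           \<le> Min {reg_rel_ent_entanglement dA dCA (ptranspose [dA, dCA] 1 \<rho>),
                  reg_rel_ent_entanglement dCB dB (ptranspose [dCB, dB] 0 \<rho>'),
                  squashed_entanglement dA dCA (ptranspose [dA, dCA] 1 \<rho>),
                  squashed_entanglement dCB dB (ptranspose [dCB, dB] 0 \<rho>')}"
  using key_repeater_rate_le[OF assms]
    distillable_key_le_reg_rel_ent_entanglement[OF ppt_density(2)[OF assms(1) one_less_two]]
    distillable_key_le_reg_rel_ent_entanglement[OF ppt_density(2)[OF assms(2) zero_less_two]]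
    distillable_key_le_squashed_entanglement[OF ppt_density(2)[OF assms(1) one_less_two]]
    distillable_key_le_squashed_entanglement[OF ppt_density(2)[OF assms(2) zero_less_two]]
  by (simp add: min.coboundedI1 min.coboundedI2 del: One_nat_def)

end
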